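(* Fix a categorical $\mathcal{S}\ell\lambda$-model (as in the context), with interpretation $[\![-]\!]$. Let $M, M'$ be terms with $\Gamma\vdash M:\sigma$ and $\Gamma\vdash M':\sigma$. If $M =_{\mathcal{S}\ell} M'$, then $[\![\Gamma\vdash M:\sigma]\!]=[\![\Gamma\vdash M':\sigma]\!]$.
   Context: $\mathcal{S}\ell\lambda$-calculus. Types: $\sigma,\tau ::= \iota \mid \sigma \multimap \tau$. There are three disjoint kinds of typed variables: ground variables $x^\iota, y^\iota, z^\iota,\dots$ (type $\iota$), higher-order variables $f^{\sigma\multimap\tau}, g,\dots$ (arrow types), and stable variables $\digamma^\sigma$ (any type). A basis is a finite list of variables; $\Gamma^\iota$ denotes a basis of ground variables only, $\Gamma^*$ a basis of stable variables only; $\Gamma,\Delta$ is concatenation. Typing rules: $\vdash \underline{0}:\iota$; $\vdash \mathtt{succ}:\iota\multimap\iota$; $\vdash \mathtt{pred}:\iota\multimap\iota$; from $\Gamma \vdash M:\iota$, $\Delta\vdash L:\iota$, $\Delta \vdash R:\iota$ with $\Gamma\cap\Delta=\emptyset$ derive $\Gamma,\Delta \vdash \ell\mathtt{if}\,M\,L\,R : \iota$; exchange of adjacent variables; $x^\iota \vdash x:\iota$; ground weakening ($\Gamma\vdash M:\tau$ gives $\Gamma,x^\iota\vdash M:\tau$); ground contraction ($\Gamma,x_1^\iota,x_2^\iota \vdash M:\tau$ gives $\Gamma,x^\iota\vdash M[x/x_1,x/x_2]:\tau$); $f^{\sigma\multimap\tau}\vdash f:\sigma\multimap\tau$; application: from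 $\Gamma\vdash M:\sigma\multimap\tau$, $\Delta\vdash N:\sigma$, $\Gamma\cap\Delta=\emptyset$ derive $\Gamma,\Delta\vdash MN:\tau$; abstraction: from $\Gamma, x^\sigma\vdash M:\tau$ (x a ground or higher-order variable) derive $\Gamma\vdash\lambda x^\sigma.M:\sigma\multimap\tau$; $\digamma^\sigma\vdash\digamma:\sigma$; stable contraction and stable weakening analogous to the ground ones; fixpoint: from $\Gamma^\iota,\Delta^*,\digamma^\sigma\vdash M:\sigma$ derive $\Gamma^\iota,\Delta^*\vdash \mu\digamma.M:\sigma$. Numerals $\underline{n}$ are $\mathtt{succ}(\cdots(\mathtt{succ}\,\underline{0}))$; terms are taken up to $\alpha$-equivalence and substitutions are capture-free. Reduction rules: $(\lambda f.M)N\leadsto M[N/f]$ ($f$ higher-order); $(\lambda z^\iota.M)\underline n\leadsto M[\underline n/z]$ (only numeral arguments); $\mu\digamma.M\leadsto M[\mu\digamma.M/\digamma]$; $\mathtt{pred}(\mathtt{succ}\,\underline n)\leadsto\underline n$; $\ell\mathtt{if}\,\underline0\,L\,R\leadsto L$; $\ell\mathtt{if}\,\underline{n+1}\,L\,R\leadsto R$. $\to_{\mathcal{S}\ell}$ is the contextual closure of $\leadsto$, and $=_{\mathcal{S}\ell}$ its reflexive, symmetric, transitive closure. Linear category: a symmetric monoidal closed category $(\mathcal{L},\otimes,\multimap,{\mathbf 1})$ with a symmetric monoidal comonad $(!,\delta,\varepsilon,q)$ (with $q_{A,B}: !A\otimes !B\to !(A\otimes B)$, $q_{\mathbf 1}:{\mathbf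 1}\to !{\mathbf 1}$; $q$ also denotes the iterated map $!A_1\otimes\cdots\otimes !A_k \to !(A_1\otimes\cdots\otimes A_k)$) such that every free coalgebra $(!A,\delta_A)$ carries monoidal natural transformations $d_A : !A\to !A\otimes !A$, $e_A: !A\to{\mathbf 1}$ forming a commutative comonoid and being coalgebra morphisms, and every coalgebra morphism between free coalgebras is a comonoid morphism. $\mathrm{cur}(-)$ denotes currying $\mathrm{Hom}(C\otimes A,B)\cong\mathrm{Hom}(C,A\multimap B)$, $\mathrm{eval}:(A\multimap B)\otimes A\to B$ the evaluation, $\gamma$ the symmetry; coherence isomorphisms such as ${\mathbf 1}\otimes A\cong A$ are left implicit. $\mathcal{S}\ell\lambda$-category: a linear category with (i) an object $N$ and morphisms $0:{\mathbf 1}\to N$, $succ, pred : N\to N$ with $pred\circ(n+1)=n$ for all numerals (numeral $0$ is $0$, numeral $n+1$ is $succ\circ n$); a morphism $p:N\to !N$ making $(N,p)$ a $!$-coalgebra; morphisms $w_N:N\to{\mathbf 1}$, $c_N:N\to N\otimes N$ forming a commutative comonoid such that $0$ and $succ$ are coalgebra morphisms and comonoid morphisms and $p$ is a comonoid morphism (w.r.t. $(d_N,e_N)$ on $!N$); (ii) $\mathcal{L}$ is cartesian (product $\times$, pairing $\langle-,-\rangle$) and there is $\ell if: N\otimes(N\times N)\to N$ with $\ell if\circ(0\otimes\langle f,g\rangle)=f$ and $\ell if\circ((n+1)\otimes\langle f,g\rangle)=g$ for all $f,g:{\mathbf 1}\to N$ and numerals $n$; (iii) for each object $B$ a morphism $fix_B: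 !(!B\multimap B)\to B$ with $fix_B = \mathrm{eval}\circ(\varepsilon_{!B\multimap B}\otimes(!fix_B\circ\delta_{!B\multimap B}))\circ d_{!B\multimap B}$. Categorical $\mathcal{S}\ell\lambda$-model: an $\mathcal{S}\ell\lambda$-category with $[\![\iota]\!]=N$, $[\![\sigma\multimap\tau]\!]=[\![\sigma]\!]\multimap[\![\tau]\!]$; $[\![\emptyset]\!]={\mathbf 1}$, $[\![x^\sigma,\Delta]\!]=[\![\sigma]\!]\otimes[\![\Delta]\!]$ for ground/higher-order $x$, $[\![\digamma^\sigma,\Delta]\!]=![\![\sigma]\!]\otimes[\![\Delta]\!]$. For ground $\Gamma^\iota$ of length $k$, $p_\Gamma=p\otimes\cdots\otimes p$ ($k$ times); for $\Delta^*=\digamma_1^{\sigma_1},\dots,\digamma_m^{\sigma_m}$, $\delta_\Delta=\delta_{[\![\sigma_1]\!]}\otimes\cdots\otimes\delta_{[\![\sigma_m]\!]}$. The interpretation of a judgment $\Gamma\vdash M:\sigma$ is a morphism $[\![\Gamma]\!]\to[\![\sigma]\!]$ defined by: $[\![\underline 0]\!]=0$, $[\![\mathtt{succ}]\!]=\mathrm{cur}(succ)$, $[\![\mathtt{pred}]\!]=\mathrm{cur}(pred)$, $[\![x^\iota\vdash x]\!]=\mathrm{id}_N$, $[\![f\vdash f]\!]=\mathrm{id}$, $[\![\digamma^\sigma\vdash\digamma]\!]=\varepsilon_{[\![\sigma]\!]}$; $[\![\Gamma^\iota,\Delta^*\vdash\mu\digamma.M]\!]=fix_{[\![\sigma]\!]}\circ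 !\mathrm{cur}([\![\Gamma^\iota,\Delta^*,\digamma^\sigma\vdash M]\!])\circ q\circ(p_\Gamma\otimes\delta_\Delta)$; $[\![\lambda x.M]\!]=\mathrm{cur}([\![\Gamma,x^\sigma\vdash M]\!])$; exchange is precomposition with $\mathrm{id}\otimes\gamma\otimes\mathrm{id}$; $[\![\Gamma,\Delta\vdash MN]\!]=\mathrm{eval}\circ([\![\Gamma\vdash M]\!]\otimes[\![\Delta\vdash N]\!])$; $[\![\Gamma,\Delta\vdash\ell\mathtt{if}\,M\,L\,R]\!]=\ell if\circ([\![\Gamma\vdash M]\!]\otimes\langle[\![\Delta\vdash L]\!],[\![\Delta\vdash R]\!]\rangle)$; ground contraction/weakening are precomposition with $\mathrm{id}\otimes c_N$ / $\mathrm{id}\otimes w_N$; stable contraction/weakening are precomposition with $\mathrm{id}\otimes d_{[\![\sigma]\!]}$ / $\mathrm{id}\otimes e_{[\![\sigma]\!]}$.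
   Formalization: The equations for ℓif are required for all f,g : A → N with A an arbitrary object, not only for f,g : 1 → N; with global elements only, the claim fails for open terms such as ℓif 0 x y and x. *)

theory Defs
  imports Main
begin

section \<open>Syntax\<close>

datatype ty = Iota | Lolli ty ty  (infixr "\<multimap>" 65)

text \<open>
  The three disjoint kinds of typed variables: ground, higher-order (whose type is an arrow by
  construction) and stable.
\<close>

datatype var =
    is_Gnd: Gnd nat
  | is_Ho: Ho nat ty ty
  | is_Stb: Stb nat ty

primrec vty :: "var \<Rightarrow> ty" where
  "vty (Gnd x) = Iota"
| "vty (Ho f \<sigma> \<tau>) = \<sigma> \<multimap> \<tau>"
| "vty (Stb F \<sigma>) = \<sigma>"

text \<open>
  Terms up to alpha-equivalence: free variables are named, bound variables are de Bruijn indices.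
  A \<^term>\<open>Lam \<sigma>\<close> binds a ground variable if \<open>\<sigma>\<close> is \<^term>\<open>Iota\<close> and a higher-order variable otherwise;
  \<^term>\<open>Mu \<sigma>\<close> binds a stable variable.
\<close>

datatype trm =
    Zero
  | Succ
  | Pred
  | FV var
  | BV nat
  | App trm trm
  | LIf trm trm trm
  | Lam ty trm
  | Mu ty trm

text \<open>\<open>bind 0 x M\<close> is the body of the abstraction of \<open>x\<close> in \<open>M\<close>.\<close>

primrec bind :: "nat \<Rightarrow> var \<Rightarrow> trm \<Rightarrow> trm" where
  "bind k x Zero = Zero"
| "bind k x Succ = Succ"
| "bind k x Pred = Pred"
| "bind k x (FV y) = (if y = x then BV k else FV y)"
| "bind k x (BV i) = BV (if i < k then i else Suc i)"
| "bind k x (App M N) = App (bind k x M) (bind k x N)"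
| "bind k x (LIf M L R) = LIf (bind k x M) (bind k x L) (bind k x R)"
| "bind k x (Lam \<sigma> M) = Lam \<sigma> (bind (Suc k) x M)"
| "bind k x (Mu \<sigma> M) = Mu \<sigma> (bind (Suc k) x M)"

abbreviation lam :: "var \<Rightarrow> trm \<Rightarrow> trm" where
  "lam x M \<equiv> Lam (vty x) (bind 0 x M)"

abbreviation mu :: "var \<Rightarrow> trm \<Rightarrow> trm" where
  "mu x M \<equiv> Mu (vty x) (bind 0 x M)"

primrec lift :: "nat \<Rightarrow> trm \<Rightarrow> trm" where
  "lift k Zero = Zero"
| "lift k Succ = Succ"
| "lift k Pred = Pred"
| "lift k (FV y) = FV y"
| "lift k (BV i) = BV (if i < k then i else Suc i)"
| "lift k (App M N) = App (lift k M) (lift k N)"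
| "lift k (LIf M L R) = LIf (lift k M) (lift k L) (lift k R)"
| "lift k (Lam \<sigma> M) = Lam \<sigma> (lift (Suc k) M)"
| "lift k (Mu \<sigma> M) = Mu \<sigma> (lift (Suc k) M)"

text \<open>\<open>inst 0 N B\<close> replaces the outermost bound variable of the body \<open>B\<close> by \<open>N\<close>.\<close>

primrec inst :: "nat \<Rightarrow> trm \<Rightarrow> trm \<Rightarrow> trm" where
  "inst k N Zero = Zero"
| "inst k N Succ = Succ"
| "inst k N Pred = Pred"
| "inst k N (FV y) = FV y"
| "inst k N (BV i) = (if i < k then BV i else if i = k then N else BV (i - 1))"
| "inst k N (App M M') = App (inst k N M) (inst k N M')"
| "inst k N (LIf M L R) = LIf (inst k N M) (inst k N L) (inst k N R)"
| "inst k N (Lam \<sigma> M) = Lam \<sigma> (inst (Suc k) (lift 0 N) M)"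
| "inst k N (Mu \<sigma> M) = Mu \<sigma> (inst (Suc k) (lift 0 N) M)"

text \<open>Capture-free substitution for a named variable, and its agreement with \<^const>\<open>inst\<close>.\<close>

primrec fsubst :: "var \<Rightarrow> trm \<Rightarrow> trm \<Rightarrow> trm" where
  "fsubst x N Zero = Zero"
| "fsubst x N Succ = Succ"
| "fsubst x N Pred = Pred"
| "fsubst x N (FV y) = (if y = x then N else FV y)"
| "fsubst x N (BV i) = BV i"
| "fsubst x N (App M M') = App (fsubst x N M) (fsubst x N M')"
| "fsubst x N (LIf M L R) = LIf (fsubst x N M) (fsubst x N L) (fsubst x N R)"
| "fsubst x N (Lam \<sigma> M) = Lam \<sigma> (fsubst x (lift 0 N) M)"
| "fsubst x N (Mu \<sigma> M) = Mu \<sigma> (fsubst x (lift 0 N) M)"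

lemma inst_bind: "inst k N (bind k x M) = fsubst x N M"
  by (induction M arbitrary: k N) auto

text \<open>Renaming of free variables; \<open>merge x1 x2 x M\<close> is \<open>M[x/x1, x/x2]\<close>.\<close>

primrec ren :: "(var \<Rightarrow> var) \<Rightarrow> trm \<Rightarrow> trm" where
  "ren r Zero = Zero"
| "ren r Succ = Succ"
| "ren r Pred = Pred"
| "ren r (FV y) = FV (r y)"
| "ren r (BV i) = BV i"
| "ren r (App M N) = App (ren r M) (ren r N)"
| "ren r (LIf M L R) = LIf (ren r M) (ren r L) (ren r R)"
| "ren r (Lam \<sigma> M) = Lam \<sigma> (ren r M)"
| "ren r (Mu \<sigma> M) = Mu \<sigma> (ren r M)"

abbreviation merge :: "var \<Rightarrow> var \<Rightarrow> var \<Rightarrow> trm \<Rightarrow> trm" where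
  "merge x1 x2 x M \<equiv> ren (id(x1 := x, x2 := x)) M"

primrec num :: "nat \<Rightarrow> trm" where
  "num 0 = Zero"
| "num (Suc n) = App Succ (num n)"


section \<open>Typing\<close>

text \<open>
  A basis is a list of pairwise distinct variables; distinctness is maintained by the freshness
  side conditions of weakening and contraction.
\<close>

inductive typing :: "var list \<Rightarrow> trm \<Rightarrow> ty \<Rightarrow> bool"  ("_ \<turnstile> _ : _" [50, 50, 50] 50) where
  t_zero: "[] \<turnstile> Zero : Iota"
| t_succ: "[] \<turnstile> Succ : Iota \<multimap> Iota"
| t_pred: "[] \<turnstile> Pred : Iota \<multimap> Iota"
| t_lif: "\<Gamma> \<turnstile> M : Iota \<Longrightarrow> \<Delta> \<turnstile> L : Iota \<Longrightarrow> \<Delta> \<turnstile> R : Iota \<Longrightarrow> set \<Gamma> \<inter> set \<Delta> = {}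
    \<Longrightarrow> \<Gamma> @ \<Delta> \<turnstile> LIf M L R : Iota"
| t_exch: "\<Gamma> @ x # y # \<Delta> \<turnstile> M : \<tau> \<Longrightarrow> \<Gamma> @ y # x # \<Delta> \<turnstile> M : \<tau>"
| t_gvar: "[Gnd x] \<turnstile> FV (Gnd x) : Iota"
| t_gweak: "\<Gamma> \<turnstile> M : \<tau> \<Longrightarrow> Gnd x \<notin> set \<Gamma> \<Longrightarrow> \<Gamma> @ [Gnd x] \<turnstile> M : \<tau>"
| t_gcontr: "\<Gamma> @ [Gnd x1, Gnd x2] \<turnstile> M : \<tau> \<Longrightarrow> Gnd x \<notin> set \<Gamma>
    \<Longrightarrow> \<Gamma> @ [Gnd x] \<turnstile> merge (Gnd x1) (Gnd x2) (Gnd x) M : \<tau>"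
| t_hvar: "[Ho f \<sigma> \<tau>] \<turnstile> FV (Ho f \<sigma> \<tau>) : \<sigma> \<multimap> \<tau>"
| t_app: "\<Gamma> \<turnstile> M : \<sigma> \<multimap> \<tau> \<Longrightarrow> \<Delta> \<turnstile> N : \<sigma> \<Longrightarrow> set \<Gamma> \<inter> set \<Delta> = {} \<Longrightarrow> \<Gamma> @ \<Delta> \<turnstile> App M N : \<tau>"
| t_lam: "\<Gamma> @ [x] \<turnstile> M : \<tau> \<Longrightarrow> \<not> is_Stb x \<Longrightarrow> \<Gamma> \<turnstile> lam x M : vty x \<multimap> \<tau>"
| t_svar: "[Stb F \<sigma>] \<turnstile> FV (Stb F \<sigma>) : \<sigma>"
| t_sweak: "\<Gamma> \<turnstile> M : \<tau> \<Longrightarrow> Stb F \<sigma> \<notin> set \<Gamma> \<Longrightarrow> \<Gamma> @ [Stb F \<sigma>] \<turnstile> M : \<tau>"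
| t_scontr: "\<Gamma> @ [Stb F1 \<sigma>, Stb F2 \<sigma>] \<turnstile> M : \<tau> \<Longrightarrow> Stb F \<sigma> \<notin> set \<Gamma>
    \<Longrightarrow> \<Gamma> @ [Stb F \<sigma>] \<turnstile> merge (Stb F1 \<sigma>) (Stb F2 \<sigma>) (Stb F \<sigma>) M : \<tau>"
| t_mu: "\<Gamma> @ \<Delta> @ [Stb F \<sigma>] \<turnstile> M : \<sigma> \<Longrightarrow> list_all is_Gnd \<Gamma> \<Longrightarrow> list_all is_Stb \<Delta>
    \<Longrightarrow> \<Gamma> @ \<Delta> \<turnstile> mu (Stb F \<sigma>) M : \<sigma>"

lemma typing_distinct: "\<Gamma> \<turnstile> M : \<sigma> \<Longrightarrow> distinct \<Gamma>"
  by (induction rule: typing.induct) auto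


section \<open>Reduction and conversion\<close>

inductive redex :: "trm \<Rightarrow> trm \<Rightarrow> bool" where
  r_beta: "redex (App (Lam (\<sigma> \<multimap> \<tau>) B) N) (inst 0 N B)"
| r_beta_num: "redex (App (Lam Iota B) (num n)) (inst 0 (num n) B)"
| r_mu: "redex (Mu \<sigma> B) (inst 0 (Mu \<sigma> B) B)"
| r_pred: "redex (App Pred (App Succ (num n))) (num n)"
| r_if_zero: "redex (LIf (num 0) L R) L"
| r_if_suc: "redex (LIf (num (Suc n)) L R) R"

lemma redex_named:
  "redex (App (lam (Ho f \<sigma> \<tau>) M) N) (fsubst (Ho f \<sigma> \<tau>) N M)"
  "redex (App (lam (Gnd z) M) (num n)) (fsubst (Gnd z) (num n) M)"
  "redex (mu (Stb F \<sigma>) M) (fsubst (Stb F \<sigma>) (mu (Stb F \<sigma>) M) M)"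
  by (metis inst_bind redex.intros vty.simps)+

inductive step :: "trm \<Rightarrow> trm \<Rightarrow> bool" where
  s_redex: "redex M M' \<Longrightarrow> step M M'"
| s_app1: "step M M' \<Longrightarrow> step (App M N) (App M' N)"
| s_app2: "step N N' \<Longrightarrow> step (App M N) (App M N')"
| s_if1: "step M M' \<Longrightarrow> step (LIf M L R) (LIf M' L R)"
| s_if2: "step L L' \<Longrightarrow> step (LIf M L R) (LIf M L' R)"
| s_if3: "step R R' \<Longrightarrow> step (LIf M L R) (LIf M L R')"
| s_lam: "step B B' \<Longrightarrow> step (Lam \<sigma> B) (Lam \<sigma> B')"
| s_mu: "step B B' \<Longrightarrow> step (Mu \<sigma> B) (Mu \<sigma> B')"

definition conv :: "trm \<Rightarrow> trm \<Rightarrow> bool"  (infix "=\<^sub>S\<^sub>l" 50) where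
  "M =\<^sub>S\<^sub>l M' \<longleftrightarrow> equivclp step M M'"


section \<open>Symmetric monoidal closed categories\<close>

text \<open>
  \<open>g \<cdot> f\<close> is \<open>g\<close> after \<open>f\<close>. Objects are tensored with \<open>\<otimes>\<close>, arrows with \<open>\<odot>\<close>. The structural isomorphisms come with their inverses:
  \<open>asc A B C : (A \<otimes> B) \<otimes> C \<rightarrow> A \<otimes> (B \<otimes> C)\<close>, \<open>lun A : I \<otimes> A \<rightarrow> A\<close>, \<open>run A : A \<otimes> I \<rightarrow> A\<close>.
  \<open>cur A B D\<close> curries an arrow \<open>A \<otimes> B \<rightarrow> D\<close> into \<open>A \<rightarrow> hom B D\<close>.
\<close>

record ('o, 'm) smcc =
  Obj :: "'o set"
  Hom :: "'o \<Rightarrow> 'o \<Rightarrow> 'm set"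
  idn :: "'o \<Rightarrow> 'm"
  comp :: "'m \<Rightarrow> 'm \<Rightarrow> 'm"  (infixr "\<cdot>\<index>" 55)
  tens :: "'o \<Rightarrow> 'o \<Rightarrow> 'o"  (infixr "\<otimes>\<index>" 70)
  tensm :: "'m \<Rightarrow> 'm \<Rightarrow> 'm"  (infixr "\<odot>\<index>" 70)
  unit :: "'o"  ("\<one>\<index>")
  asc :: "'o \<Rightarrow> 'o \<Rightarrow> 'o \<Rightarrow> 'm"
  asci :: "'o \<Rightarrow> 'o \<Rightarrow> 'o \<Rightarrow> 'm"
  lun :: "'o \<Rightarrow> 'm"
  luni :: "'o \<Rightarrow> 'm"
  run :: "'o \<Rightarrow> 'm"
  runi :: "'o \<Rightarrow> 'm"
  sym :: "'o \<Rightarrow> 'o \<Rightarrow> 'm"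
  hom :: "'o \<Rightarrow> 'o \<Rightarrow> 'o"
  cur :: "'o \<Rightarrow> 'o \<Rightarrow> 'o \<Rightarrow> 'm \<Rightarrow> 'm"
  eval :: "'o \<Rightarrow> 'o \<Rightarrow> 'm"

hide_const (open) unit sym comp

locale category =
  fixes C :: "('o, 'm, 'z) smcc_scheme" (structure)
  assumes Hom_obj: "f \<in> Hom C A B \<Longrightarrow> A \<in> Obj C \<and> B \<in> Obj C"
    and Hom_disjoint: "f \<in> Hom C A B \<Longrightarrow> f \<in> Hom C A' B' \<Longrightarrow> A = A' \<and> B = B'"
    and idn_hom: "A \<in> Obj C \<Longrightarrow> idn C A \<in> Hom C A A"
    and comp_hom: "f \<in> Hom C A B \<Longrightarrow> g \<in> Hom C B D \<Longrightarrow> g \<cdot> f \<in> Hom C A D"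
    and comp_idn: "f \<in> Hom C A B \<Longrightarrow> f \<cdot> idn C A = f"
    and idn_comp: "f \<in> Hom C A B \<Longrightarrow> idn C B \<cdot> f = f"
    and comp_assoc: "f \<in> Hom C A B \<Longrightarrow> g \<in> Hom C B D \<Longrightarrow> h \<in> Hom C D E
      \<Longrightarrow> (h \<cdot> g) \<cdot> f = h \<cdot> (g \<cdot> f)"

locale symmetric_monoidal_category = category +
  assumes unit_obj: "\<one> \<in> Obj C"
    and tens_obj: "A \<in> Obj C \<Longrightarrow> B \<in> Obj C \<Longrightarrow> A \<otimes> B \<in> Obj C"
    and tensm_hom: "f \<in> Hom C A A' \<Longrightarrow> g \<in> Hom C B B' \<Longrightarrow> f \<odot> g \<in> Hom C (A \<otimes> B) (A' \<otimes> B')"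
    and tensm_idn: "A \<in> Obj C \<Longrightarrow> B \<in> Obj C \<Longrightarrow> idn C A \<odot> idn C B = idn C (A \<otimes> B)"
    and tensm_comp: "f \<in> Hom C A A' \<Longrightarrow> f' \<in> Hom C A' A'' \<Longrightarrow> g \<in> Hom C B B' \<Longrightarrow> g' \<in> Hom C B' B''
      \<Longrightarrow> (f' \<cdot> f) \<odot> (g' \<cdot> g) = (f' \<odot> g') \<cdot> (f \<odot> g)"
    and asc_hom: "A \<in> Obj C \<Longrightarrow> B \<in> Obj C \<Longrightarrow> D \<in> Obj C
      \<Longrightarrow> asc C A B D \<in> Hom C ((A \<otimes> B) \<otimes> D) (A \<otimes> (B \<otimes> D))"
    and asci_hom: "A \<in> Obj C \<Longrightarrow> B \<in> Obj C \<Longrightarrow> D \<in> Obj C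
      \<Longrightarrow> asci C A B D \<in> Hom C (A \<otimes> (B \<otimes> D)) ((A \<otimes> B) \<otimes> D)"
    and asc_asci: "A \<in> Obj C \<Longrightarrow> B \<in> Obj C \<Longrightarrow> D \<in> Obj C
      \<Longrightarrow> asc C A B D \<cdot> asci C A B D = idn C (A \<otimes> (B \<otimes> D))"
    and asci_asc: "A \<in> Obj C \<Longrightarrow> B \<in> Obj C \<Longrightarrow> D \<in> Obj C
      \<Longrightarrow> asci C A B D \<cdot> asc C A B D = idn C ((A \<otimes> B) \<otimes> D)"
    and asc_natural: "f \<in> Hom C A A' \<Longrightarrow> g \<in> Hom C B B' \<Longrightarrow> h \<in> Hom C D D'
      \<Longrightarrow> asc C A' B' D' \<cdot> ((f \<odot> g) \<odot> h) = (f \<odot> (g \<odot> h)) \<cdot> asc C A B D"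
    and lun_hom: "A \<in> Obj C \<Longrightarrow> lun C A \<in> Hom C (\<one> \<otimes> A) A"
    and luni_hom: "A \<in> Obj C \<Longrightarrow> luni C A \<in> Hom C A (\<one> \<otimes> A)"
    and lun_luni: "A \<in> Obj C \<Longrightarrow> lun C A \<cdot> luni C A = idn C A"
    and luni_lun: "A \<in> Obj C \<Longrightarrow> luni C A \<cdot> lun C A = idn C (\<one> \<otimes> A)"
    and lun_natural: "f \<in> Hom C A B \<Longrightarrow> lun C B \<cdot> (idn C \<one> \<odot> f) = f \<cdot> lun C A"
    and run_hom: "A \<in> Obj C \<Longrightarrow> run C A \<in> Hom C (A \<otimes> \<one>) A"
    and runi_hom: "A \<in> Obj C \<Longrightarrow> runi C A \<in> Hom C A (A \<otimes> \<one>)"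
    and run_runi: "A \<in> Obj C \<Longrightarrow> run C A \<cdot> runi C A = idn C A"
    and runi_run: "A \<in> Obj C \<Longrightarrow> runi C A \<cdot> run C A = idn C (A \<otimes> \<one>)"
    and run_natural: "f \<in> Hom C A B \<Longrightarrow> run C B \<cdot> (f \<odot> idn C \<one>) = f \<cdot> run C A"
    and sym_hom: "A \<in> Obj C \<Longrightarrow> B \<in> Obj C \<Longrightarrow> smcc.sym C A B \<in> Hom C (A \<otimes> B) (B \<otimes> A)"
    and sym_sym: "A \<in> Obj C \<Longrightarrow> B \<in> Obj C \<Longrightarrow> smcc.sym C B A \<cdot> smcc.sym C A B = idn C (A \<otimes> B)"
    and sym_natural: "f \<in> Hom C A A' \<Longrightarrow> g \<in> Hom C B B'
      \<Longrightarrow> smcc.sym C A' B' \<cdot> (f \<odot> g) = (g \<odot> f) \<cdot> smcc.sym C A B"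
    and triangle: "A \<in> Obj C \<Longrightarrow> B \<in> Obj C
      \<Longrightarrow> (idn C A \<odot> lun C B) \<cdot> asc C A \<one> B = run C A \<odot> idn C B"
    and pentagon: "A \<in> Obj C \<Longrightarrow> B \<in> Obj C \<Longrightarrow> D \<in> Obj C \<Longrightarrow> E \<in> Obj C
      \<Longrightarrow> asc C A B (D \<otimes> E) \<cdot> asc C (A \<otimes> B) D E
        = (idn C A \<odot> asc C B D E) \<cdot> asc C A (B \<otimes> D) E \<cdot> (asc C A B D \<odot> idn C E)"
    and hexagon: "A \<in> Obj C \<Longrightarrow> B \<in> Obj C \<Longrightarrow> D \<in> Obj C
      \<Longrightarrow> asc C B D A \<cdot> smcc.sym C A (B \<otimes> D) \<cdot> asc C A B D
        = (idn C B \<odot> smcc.sym C A D) \<cdot> asc C B A D \<cdot> (smcc.sym C A B \<odot> idn C D)"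

locale symmetric_monoidal_closed_category = symmetric_monoidal_category +
  assumes hom_obj: "A \<in> Obj C \<Longrightarrow> B \<in> Obj C \<Longrightarrow> hom C A B \<in> Obj C"
    and eval_hom: "A \<in> Obj C \<Longrightarrow> B \<in> Obj C \<Longrightarrow> eval C A B \<in> Hom C (hom C A B \<otimes> A) B"
    and cur_hom: "A \<in> Obj C \<Longrightarrow> B \<in> Obj C \<Longrightarrow> f \<in> Hom C (A \<otimes> B) D \<Longrightarrow> cur C A B D f \<in> Hom C A (hom C B D)"
    and eval_cur: "A \<in> Obj C \<Longrightarrow> B \<in> Obj C \<Longrightarrow> f \<in> Hom C (A \<otimes> B) D
      \<Longrightarrow> eval C B D \<cdot> (cur C A B D f \<odot> idn C B) = f"
    and cur_eval: "B \<in> Obj C \<Longrightarrow> D \<in> Obj C \<Longrightarrow> g \<in> Hom C A (hom C B D)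
      \<Longrightarrow> cur C A B D (eval C B D \<cdot> (g \<odot> idn C B)) = g"

text \<open>The interchange \<open>(A \<otimes> B) \<otimes> (D \<otimes> E) \<rightarrow> (A \<otimes> D) \<otimes> (B \<otimes> E)\<close>.\<close>

definition mid :: "('o, 'm, 'z) smcc_scheme \<Rightarrow> 'o \<Rightarrow> 'o \<Rightarrow> 'o \<Rightarrow> 'o \<Rightarrow> 'm" where
  "mid C A B D E =
     asci C A D (B \<otimes>\<^bsub>C\<^esub> E)
     \<cdot>\<^bsub>C\<^esub> (idn C A \<odot>\<^bsub>C\<^esub> (asc C D B E \<cdot>\<^bsub>C\<^esub> (smcc.sym C B D \<odot>\<^bsub>C\<^esub> idn C E) \<cdot>\<^bsub>C\<^esub> asci C B D E))
     \<cdot>\<^bsub>C\<^esub> asc C A B (D \<otimes>\<^bsub>C\<^esub> E)"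

definition commutative_comonoid :: "('o, 'm, 'z) smcc_scheme \<Rightarrow> 'o \<Rightarrow> 'm \<Rightarrow> 'm \<Rightarrow> bool" where
  "commutative_comonoid C A c w \<longleftrightarrow>
     A \<in> Obj C \<and> c \<in> Hom C A (A \<otimes>\<^bsub>C\<^esub> A) \<and> w \<in> Hom C A \<one>\<^bsub>C\<^esub> \<and>
     asc C A A A \<cdot>\<^bsub>C\<^esub> (c \<odot>\<^bsub>C\<^esub> idn C A) \<cdot>\<^bsub>C\<^esub> c = (idn C A \<odot>\<^bsub>C\<^esub> c) \<cdot>\<^bsub>C\<^esub> c \<and>
     lun C A \<cdot>\<^bsub>C\<^esub> (w \<odot>\<^bsub>C\<^esub> idn C A) \<cdot>\<^bsub>C\<^esub> c = idn C A \<and>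
     run C A \<cdot>\<^bsub>C\<^esub> (idn C A \<odot>\<^bsub>C\<^esub> w) \<cdot>\<^bsub>C\<^esub> c = idn C A \<and>
     smcc.sym C A A \<cdot>\<^bsub>C\<^esub> c = c"

definition comonoid_morphism ::
  "('o, 'm, 'z) smcc_scheme \<Rightarrow> 'o \<Rightarrow> 'm \<Rightarrow> 'm \<Rightarrow> 'o \<Rightarrow> 'm \<Rightarrow> 'm \<Rightarrow> 'm \<Rightarrow> bool" where
  "comonoid_morphism C A c w B c' w' f \<longleftrightarrow>
     f \<in> Hom C A B \<and> c' \<cdot>\<^bsub>C\<^esub> f = (f \<odot>\<^bsub>C\<^esub> f) \<cdot>\<^bsub>C\<^esub> c \<and> w' \<cdot>\<^bsub>C\<^esub> f = w"


section \<open>Linear categories\<close>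

text \<open>\<open>q2 A B\<close> and \<open>q1\<close> are the components \<open>!A \<otimes> !B \<rightarrow> !(A \<otimes> B)\<close> and \<open>1 \<rightarrow> !1\<close> of \<open>q\<close>.\<close>

record ('o, 'm) lincat = "('o, 'm) smcc" +
  bang :: "'o \<Rightarrow> 'o"
  bangm :: "'m \<Rightarrow> 'm"
  dlt :: "'o \<Rightarrow> 'm"
  eps :: "'o \<Rightarrow> 'm"
  q2 :: "'o \<Rightarrow> 'o \<Rightarrow> 'm"
  q1 :: "'m"
  dup :: "'o \<Rightarrow> 'm"
  era :: "'o \<Rightarrow> 'm"

locale symmetric_monoidal_comonad = symmetric_monoidal_category C
  for C :: "('o, 'm, 'z) lincat_scheme" (structure) +
  assumes bang_obj: "A \<in> Obj C \<Longrightarrow> bang C A \<in> Obj C"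
    and bangm_hom: "f \<in> Hom C A B \<Longrightarrow> bangm C f \<in> Hom C (bang C A) (bang C B)"
    and bangm_idn: "A \<in> Obj C \<Longrightarrow> bangm C (idn C A) = idn C (bang C A)"
    and bangm_comp: "f \<in> Hom C A B \<Longrightarrow> g \<in> Hom C B D \<Longrightarrow> bangm C (g \<cdot> f) = bangm C g \<cdot> bangm C f"
    \<comment> \<open>comonad\<close>
    and dlt_hom: "A \<in> Obj C \<Longrightarrow> dlt C A \<in> Hom C (bang C A) (bang C (bang C A))"
    and dlt_natural: "f \<in> Hom C A B \<Longrightarrow> dlt C B \<cdot> bangm C f = bangm C (bangm C f) \<cdot> dlt C A"
    and eps_hom: "A \<in> Obj C \<Longrightarrow> eps C A \<in> Hom C (bang C A) A"
    and eps_natural: "f \<in> Hom C A B \<Longrightarrow> eps C B \<cdot> bangm C f = f \<cdot> eps C A"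
    and dlt_dlt: "A \<in> Obj C \<Longrightarrow> bangm C (dlt C A) \<cdot> dlt C A = dlt C (bang C A) \<cdot> dlt C A"
    and eps_dlt: "A \<in> Obj C \<Longrightarrow> eps C (bang C A) \<cdot> dlt C A = idn C (bang C A)"
    and bang_eps_dlt: "A \<in> Obj C \<Longrightarrow> bangm C (eps C A) \<cdot> dlt C A = idn C (bang C A)"
    \<comment> \<open>symmetric monoidal functor\<close>
    and q2_hom: "A \<in> Obj C \<Longrightarrow> B \<in> Obj C \<Longrightarrow> q2 C A B \<in> Hom C (bang C A \<otimes> bang C B) (bang C (A \<otimes> B))"
    and q1_hom: "q1 C \<in> Hom C \<one> (bang C \<one>)"
    and q2_natural: "f \<in> Hom C A A' \<Longrightarrow> g \<in> Hom C B B'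
      \<Longrightarrow> q2 C A' B' \<cdot> (bangm C f \<odot> bangm C g) = bangm C (f \<odot> g) \<cdot> q2 C A B"
    and q2_asc: "A \<in> Obj C \<Longrightarrow> B \<in> Obj C \<Longrightarrow> D \<in> Obj C
      \<Longrightarrow> bangm C (asc C A B D) \<cdot> q2 C (A \<otimes> B) D \<cdot> (q2 C A B \<odot> idn C (bang C D))
        = q2 C A (B \<otimes> D) \<cdot> (idn C (bang C A) \<odot> q2 C B D) \<cdot> asc C (bang C A) (bang C B) (bang C D)"
    and q2_lun: "A \<in> Obj C
      \<Longrightarrow> bangm C (lun C A) \<cdot> q2 C \<one> A \<cdot> (q1 C \<odot> idn C (bang C A)) = lun C (bang C A)"
    and q2_run: "A \<in> Obj C
      \<Longrightarrow> bangm C (run C A) \<cdot> q2 C A \<one> \<cdot> (idn C (bang C A) \<odot> q1 C) = run C (bang C A)"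
    and q2_sym: "A \<in> Obj C \<Longrightarrow> B \<in> Obj C
      \<Longrightarrow> bangm C (smcc.sym C A B) \<cdot> q2 C A B = q2 C B A \<cdot> smcc.sym C (bang C A) (bang C B)"
    \<comment> \<open>monoidality of comultiplication and counit\<close>
    and dlt_q2: "A \<in> Obj C \<Longrightarrow> B \<in> Obj C
      \<Longrightarrow> dlt C (A \<otimes> B) \<cdot> q2 C A B
        = bangm C (q2 C A B) \<cdot> q2 C (bang C A) (bang C B) \<cdot> (dlt C A \<odot> dlt C B)"
    and dlt_q1: "dlt C \<one> \<cdot> q1 C = bangm C (q1 C) \<cdot> q1 C"
    and eps_q2: "A \<in> Obj C \<Longrightarrow> B \<in> Obj C \<Longrightarrow> eps C (A \<otimes> B) \<cdot> q2 C A B = eps C A \<odot> eps C B"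
    and eps_q1: "eps C \<one> \<cdot> q1 C = idn C \<one>"

definition coalgebra :: "('o, 'm, 'z) lincat_scheme \<Rightarrow> 'o \<Rightarrow> 'm \<Rightarrow> bool" where
  "coalgebra C A h \<longleftrightarrow>
     A \<in> Obj C \<and> h \<in> Hom C A (bang C A) \<and>
     eps C A \<cdot>\<^bsub>C\<^esub> h = idn C A \<and> dlt C A \<cdot>\<^bsub>C\<^esub> h = bangm C h \<cdot>\<^bsub>C\<^esub> h"

definition coalgebra_morphism ::
  "('o, 'm, 'z) lincat_scheme \<Rightarrow> 'o \<Rightarrow> 'm \<Rightarrow> 'o \<Rightarrow> 'm \<Rightarrow> 'm \<Rightarrow> bool" where
  "coalgebra_morphism C A h B k f \<longleftrightarrow> f \<in> Hom C A B \<and> k \<cdot>\<^bsub>C\<^esub> f = bangm C f \<cdot>\<^bsub>C\<^esub> h"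

text \<open>
  The unit carries the coalgebra structure \<open>q1\<close>, and the tensor of coalgebras \<open>(A, h)\<close> and
  \<open>(B, k)\<close> the structure \<open>q2 A B \<cdot> (h \<odot> k)\<close>; the unit carries the comonoid structure
  \<open>(luni \<one>, idn \<one>)\<close>.
\<close>

locale linear_category =
  symmetric_monoidal_closed_category C + symmetric_monoidal_comonad C
  for C :: "('o, 'm, 'z) lincat_scheme" (structure) +
  assumes comonoid_bang: "A \<in> Obj C \<Longrightarrow> commutative_comonoid C (bang C A) (dup C A) (era C A)"
    and dup_natural: "f \<in> Hom C A B \<Longrightarrow> dup C B \<cdot> bangm C f = (bangm C f \<odot> bangm C f) \<cdot> dup C A"
    and era_natural: "f \<in> Hom C A B \<Longrightarrow> era C B \<cdot> bangm C f = era C A"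
    and dup_q2: "A \<in> Obj C \<Longrightarrow> B \<in> Obj C
      \<Longrightarrow> dup C (A \<otimes> B) \<cdot> q2 C A B
        = (q2 C A B \<odot> q2 C A B) \<cdot> mid C (bang C A) (bang C A) (bang C B) (bang C B) \<cdot> (dup C A \<odot> dup C B)"
    and dup_q1: "dup C \<one> \<cdot> q1 C = (q1 C \<odot> q1 C) \<cdot> luni C \<one>"
    and era_q2: "A \<in> Obj C \<Longrightarrow> B \<in> Obj C
      \<Longrightarrow> era C (A \<otimes> B) \<cdot> q2 C A B = lun C \<one> \<cdot> (era C A \<odot> era C B)"
    and era_q1: "era C \<one> \<cdot> q1 C = idn C \<one>"
    and dup_coalgebra: "A \<in> Obj C
      \<Longrightarrow> coalgebra_morphism C (bang C A) (dlt C A)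
            (bang C A \<otimes> bang C A) (q2 C (bang C A) (bang C A) \<cdot> (dlt C A \<odot> dlt C A)) (dup C A)"
    and era_coalgebra: "A \<in> Obj C
      \<Longrightarrow> coalgebra_morphism C (bang C A) (dlt C A) \<one> (q1 C) (era C A)"
    and free_coalgebra_comonoid: "A \<in> Obj C \<Longrightarrow> B \<in> Obj C
      \<Longrightarrow> coalgebra_morphism C (bang C A) (dlt C A) (bang C B) (dlt C B) f
      \<Longrightarrow> comonoid_morphism C (bang C A) (dup C A) (era C A) (bang C B) (dup C B) (era C B) f"


section \<open>The categorical models\<close>

record ('o, 'm) slcat = "('o, 'm) lincat" +
  nno :: "'o"
  zro :: "'m"
  suc :: "'m"
  prd :: "'m"
  pco :: "'m"
  wkn :: "'m"
  ctr :: "'m"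
  prod :: "'o \<Rightarrow> 'o \<Rightarrow> 'o"
  proj1 :: "'o \<Rightarrow> 'o \<Rightarrow> 'm"
  proj2 :: "'o \<Rightarrow> 'o \<Rightarrow> 'm"
  pair :: "'m \<Rightarrow> 'm \<Rightarrow> 'm"
  lif :: "'m"
  fixp :: "'o \<Rightarrow> 'm"

hide_const (open) prod

primrec numeral_arrow :: "('o, 'm, 'z) slcat_scheme \<Rightarrow> nat \<Rightarrow> 'm" where
  "numeral_arrow C 0 = zro C"
| "numeral_arrow C (Suc n) = suc C \<cdot>\<^bsub>C\<^esub> numeral_arrow C n"

locale cartesian_category = category C
  for C :: "('o, 'm, 'z) slcat_scheme" (structure) +
  assumes terminal: "\<exists>T \<in> Obj C. \<forall>A \<in> Obj C. \<exists>!f. f \<in> Hom C A T"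
    and prod_obj: "A \<in> Obj C \<Longrightarrow> B \<in> Obj C \<Longrightarrow> slcat.prod C A B \<in> Obj C"
    and proj1_hom: "A \<in> Obj C \<Longrightarrow> B \<in> Obj C \<Longrightarrow> proj1 C A B \<in> Hom C (slcat.prod C A B) A"
    and proj2_hom: "A \<in> Obj C \<Longrightarrow> B \<in> Obj C \<Longrightarrow> proj2 C A B \<in> Hom C (slcat.prod C A B) B"
    and pair_hom: "f \<in> Hom C D A \<Longrightarrow> g \<in> Hom C D B \<Longrightarrow> pair C f g \<in> Hom C D (slcat.prod C A B)"
    and proj1_pair: "f \<in> Hom C D A \<Longrightarrow> g \<in> Hom C D B \<Longrightarrow> proj1 C A B \<cdot> pair C f g = f"
    and proj2_pair: "f \<in> Hom C D A \<Longrightarrow> g \<in> Hom C D B \<Longrightarrow> proj2 C A B \<cdot> pair C f g = g"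
    and pair_unique: "A \<in> Obj C \<Longrightarrow> B \<in> Obj C \<Longrightarrow> h \<in> Hom C D (slcat.prod C A B)
      \<Longrightarrow> pair C (proj1 C A B \<cdot> h) (proj2 C A B \<cdot> h) = h"

text \<open>
  The equations for \<open>lif\<close> are required for generalized elements \<open>f, g : A \<rightarrow> N\<close>, not only for
  \<open>A = \<one>\<close>: the branches of a conditional may have free variables, and the equations for global
  elements alone do not validate the conditional reductions on open terms.
\<close>

locale Sl_category = linear_category C + cartesian_category C
  for C :: "('o, 'm, 'z) slcat_scheme" (structure) +
  assumes nno_obj: "nno C \<in> Obj C"
    and zro_hom: "zro C \<in> Hom C \<one> (nno C)"
    and suc_hom: "suc C \<in> Hom C (nno C) (nno C)"
    and prd_hom: "prd C \<in> Hom C (nno C) (nno C)"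
    and prd_suc: "prd C \<cdot> numeral_arrow C (Suc n) = numeral_arrow C n"
    and pco_coalgebra: "coalgebra C (nno C) (pco C)"
    and nno_comonoid: "commutative_comonoid C (nno C) (ctr C) (wkn C)"
    and zro_coalgebra: "coalgebra_morphism C \<one> (q1 C) (nno C) (pco C) (zro C)"
    and suc_coalgebra: "coalgebra_morphism C (nno C) (pco C) (nno C) (pco C) (suc C)"
    and zro_comonoid: "comonoid_morphism C \<one> (luni C \<one>) (idn C \<one>) (nno C) (ctr C) (wkn C) (zro C)"
    and suc_comonoid: "comonoid_morphism C (nno C) (ctr C) (wkn C) (nno C) (ctr C) (wkn C) (suc C)"
    and pco_comonoid: "comonoid_morphism C (nno C) (ctr C) (wkn C)
      (bang C (nno C)) (dup C (nno C)) (era C (nno C)) (pco C)"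
    and lif_hom: "lif C \<in> Hom C (nno C \<otimes> slcat.prod C (nno C) (nno C)) (nno C)"
    and lif_zero: "f \<in> Hom C A (nno C) \<Longrightarrow> g \<in> Hom C A (nno C)
      \<Longrightarrow> lif C \<cdot> (numeral_arrow C 0 \<odot> pair C f g) \<cdot> luni C A = f"
    and lif_suc: "f \<in> Hom C A (nno C) \<Longrightarrow> g \<in> Hom C A (nno C)
      \<Longrightarrow> lif C \<cdot> (numeral_arrow C (Suc n) \<odot> pair C f g) \<cdot> luni C A = g"
    and fixp_hom: "B \<in> Obj C \<Longrightarrow> fixp C B \<in> Hom C (bang C (hom C (bang C B) B)) B"
    and fixp_eq: "B \<in> Obj C
      \<Longrightarrow> fixp C B = eval C (bang C B) B
            \<cdot> (eps C (hom C (bang C B) B) \<odot> (bangm C (fixp C B) \<cdot> dlt C (hom C (bang C B) B)))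
            \<cdot> dup C (hom C (bang C B) B)"


section \<open>Interpretation\<close>

context
  fixes C :: "('o, 'm, 'z) slcat_scheme" (structure)
begin

primrec tyI :: "ty \<Rightarrow> 'o" where
  "tyI Iota = nno C"
| "tyI (\<sigma> \<multimap> \<tau>) = hom C (tyI \<sigma>) (tyI \<tau>)"

primrec varI :: "var \<Rightarrow> 'o" where
  "varI (Gnd x) = nno C"
| "varI (Ho f \<sigma> \<tau>) = hom C (tyI \<sigma>) (tyI \<tau>)"
| "varI (Stb F \<sigma>) = bang C (tyI \<sigma>)"

primrec tensl :: "'o list \<Rightarrow> 'o" where
  "tensl [] = \<one>"
| "tensl (A # As) = A \<otimes> tensl As"

primrec tensml :: "'m list \<Rightarrow> 'm" where
  "tensml [] = idn C \<one>"
| "tensml (f # fs) = f \<odot> tensml fs"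

definition basisI :: "var list \<Rightarrow> 'o" where
  "basisI \<Gamma> = tensl (map varI \<Gamma>)"

text \<open>
  As \<open>basisI\<close> nests to the right, the implicit coherence isomorphisms are made explicit:
  \<open>split As Bs : tensl (As @ Bs) \<rightarrow> tensl As \<otimes> tensl Bs\<close> and
  \<open>snoc As B : tensl As \<otimes> B \<rightarrow> tensl (As @ [B])\<close>. For \<open>g : tensl Bs \<rightarrow> tensl Ds\<close>,
  \<open>under As g : tensl (As @ Bs) \<rightarrow> tensl (As @ Ds)\<close> is \<open>g\<close> preceded by identities on \<open>As\<close>.
\<close>

primrec split :: "'o list \<Rightarrow> 'o list \<Rightarrow> 'm" where
  "split [] Bs = luni C (tensl Bs)"
| "split (A # As) Bs = asci C A (tensl As) (tensl Bs) \<cdot> (idn C A \<odot> split As Bs)"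

primrec snoc :: "'o list \<Rightarrow> 'o \<Rightarrow> 'm" where
  "snoc [] B = runi C B \<cdot> lun C B"
| "snoc (A # As) B = (idn C A \<odot> snoc As B) \<cdot> asc C A (tensl As) B"

primrec under :: "'o list \<Rightarrow> 'm \<Rightarrow> 'm" where
  "under [] g = g"
| "under (A # As) g = idn C A \<odot> under As g"

text \<open>
  For an arrow \<open>w : A \<rightarrow> \<one>\<close>, resp. \<open>c : A \<rightarrow> A \<otimes> A\<close>, \<open>drop1 w : tensl [A] \<rightarrow> tensl []\<close> and
  \<open>copy1 A c : tensl [A] \<rightarrow> tensl [A, A]\<close> are that arrow up to coherence.
\<close>

definition drop1 :: "'m \<Rightarrow> 'm" where
  "drop1 w = lun C \<one> \<cdot> (w \<odot> idn C \<one>)"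

definition copy1 :: "'o \<Rightarrow> 'm \<Rightarrow> 'm" where
  "copy1 A c = asc C A A \<one> \<cdot> (c \<odot> idn C \<one>)"

text \<open>\<open>swap A B D : A \<otimes> (B \<otimes> D) \<rightarrow> B \<otimes> (A \<otimes> D)\<close>.\<close>

definition swap :: "'o \<Rightarrow> 'o \<Rightarrow> 'o \<Rightarrow> 'm" where
  "swap A B D = asc C B A D \<cdot> (smcc.sym C A B \<odot> idn C D) \<cdot> asci C A B D"

text \<open>The iterated \<open>q : !A\<^sub>1 \<otimes> \<dots> \<otimes> !A\<^sub>k \<rightarrow> !(A\<^sub>1 \<otimes> \<dots> \<otimes> A\<^sub>k)\<close>.\<close>

primrec ql :: "'o list \<Rightarrow> 'm" where
  "ql [] = q1 C"
| "ql (A # As) = q2 C A (tensl As) \<cdot> (idn C (bang C A) \<odot> ql As)"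

text \<open>The coalgebra structure on a ground or stable variable (unused on higher-order ones).\<close>

primrec coalgI :: "var \<Rightarrow> 'm" where
  "coalgI (Gnd x) = pco C"
| "coalgI (Ho f \<sigma> \<tau>) = undefined"
| "coalgI (Stb F \<sigma>) = dlt C (tyI \<sigma>)"

text \<open>
  \<open>sem \<Gamma> M \<sigma> f\<close>: the arrow \<open>f\<close> is the interpretation of \<open>\<Gamma> \<turnstile> M : \<sigma>\<close> computed along some
  derivation of that judgment. The rules are those of \<^const>\<open>typing\<close>.
\<close>

inductive sem :: "var list \<Rightarrow> trm \<Rightarrow> ty \<Rightarrow> 'm \<Rightarrow> bool" where
  i_zero: "sem [] Zero Iota (zro C)"
| i_succ: "sem [] Succ (Iota \<multimap> Iota) (cur C \<one> (nno C) (nno C) (suc C \<cdot> lun C (nno C)))"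
| i_pred: "sem [] Pred (Iota \<multimap> Iota) (cur C \<one> (nno C) (nno C) (prd C \<cdot> lun C (nno C)))"
| i_lif: "sem \<Gamma> M Iota m \<Longrightarrow> sem \<Delta> L Iota l \<Longrightarrow> sem \<Delta> R Iota r \<Longrightarrow> set \<Gamma> \<inter> set \<Delta> = {}
    \<Longrightarrow> sem (\<Gamma> @ \<Delta>) (LIf M L R) Iota
          (lif C \<cdot> (m \<odot> pair C l r) \<cdot> split (map varI \<Gamma>) (map varI \<Delta>))"
| i_exch: "sem (\<Gamma> @ x # y # \<Delta>) M \<tau> f
    \<Longrightarrow> sem (\<Gamma> @ y # x # \<Delta>) M \<tau> (f \<cdot> under (map varI \<Gamma>) (swap (varI y) (varI x) (basisI \<Delta>)))"
| i_gvar: "sem [Gnd x] (FV (Gnd x)) Iota (run C (nno C))"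
| i_gweak: "sem \<Gamma> M \<tau> f \<Longrightarrow> Gnd x \<notin> set \<Gamma>
    \<Longrightarrow> sem (\<Gamma> @ [Gnd x]) M \<tau> (f \<cdot> under (map varI \<Gamma>) (drop1 (wkn C)))"
| i_gcontr: "sem (\<Gamma> @ [Gnd x1, Gnd x2]) M \<tau> f \<Longrightarrow> Gnd x \<notin> set \<Gamma>
    \<Longrightarrow> sem (\<Gamma> @ [Gnd x]) (merge (Gnd x1) (Gnd x2) (Gnd x) M) \<tau>
          (f \<cdot> under (map varI \<Gamma>) (copy1 (nno C) (ctr C)))"
| i_hvar: "sem [Ho f \<sigma> \<tau>] (FV (Ho f \<sigma> \<tau>)) (\<sigma> \<multimap> \<tau>) (run C (tyI (\<sigma> \<multimap> \<tau>)))"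
| i_app: "sem \<Gamma> M (\<sigma> \<multimap> \<tau>) f \<Longrightarrow> sem \<Delta> N \<sigma> g \<Longrightarrow> set \<Gamma> \<inter> set \<Delta> = {}
    \<Longrightarrow> sem (\<Gamma> @ \<Delta>) (App M N) \<tau>
          (eval C (tyI \<sigma>) (tyI \<tau>) \<cdot> (f \<odot> g) \<cdot> split (map varI \<Gamma>) (map varI \<Delta>))"
| i_lam: "sem (\<Gamma> @ [x]) M \<tau> f \<Longrightarrow> \<not> is_Stb x
    \<Longrightarrow> sem \<Gamma> (lam x M) (vty x \<multimap> \<tau>)
          (cur C (basisI \<Gamma>) (varI x) (tyI \<tau>) (f \<cdot> snoc (map varI \<Gamma>) (varI x)))"
| i_svar: "sem [Stb F \<sigma>] (FV (Stb F \<sigma>)) \<sigma> (eps C (tyI \<sigma>) \<cdot> run C (bang C (tyI \<sigma>)))"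
| i_sweak: "sem \<Gamma> M \<tau> f \<Longrightarrow> Stb F \<sigma> \<notin> set \<Gamma>
    \<Longrightarrow> sem (\<Gamma> @ [Stb F \<sigma>]) M \<tau> (f \<cdot> under (map varI \<Gamma>) (drop1 (era C (tyI \<sigma>))))"
| i_scontr: "sem (\<Gamma> @ [Stb F1 \<sigma>, Stb F2 \<sigma>]) M \<tau> f \<Longrightarrow> Stb F \<sigma> \<notin> set \<Gamma>
    \<Longrightarrow> sem (\<Gamma> @ [Stb F \<sigma>]) (merge (Stb F1 \<sigma>) (Stb F2 \<sigma>) (Stb F \<sigma>) M) \<tau>
          (f \<cdot> under (map varI \<Gamma>) (copy1 (bang C (tyI \<sigma>)) (dup C (tyI \<sigma>))))"
| i_mu: "sem (\<Gamma> @ \<Delta> @ [Stb F \<sigma>]) M \<sigma> f \<Longrightarrow> list_all is_Gnd \<Gamma> \<Longrightarrow> list_all is_Stb \<Delta>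
    \<Longrightarrow> sem (\<Gamma> @ \<Delta>) (mu (Stb F \<sigma>) M) \<sigma>
          (fixp C (tyI \<sigma>)
           \<cdot> bangm C (cur C (basisI (\<Gamma> @ \<Delta>)) (bang C (tyI \<sigma>)) (tyI \<sigma>)
                (f \<cdot> snoc (map varI (\<Gamma> @ \<Delta>)) (bang C (tyI \<sigma>))))
           \<cdot> ql (map varI (\<Gamma> @ \<Delta>))
           \<cdot> tensml (map coalgI (\<Gamma> @ \<Delta>)))"

lemma sem_typing: "sem \<Gamma> M \<sigma> f \<Longrightarrow> \<Gamma> \<turnstile> M : \<sigma>"
  by (induction rule: sem.induct) (blast intro: typing.intros)+

lemma typing_sem: "\<Gamma> \<turnstile> M : \<sigma> \<Longrightarrow> \<exists>f. sem \<Gamma> M \<sigma> f"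
proof (induction rule: typing.induct)
qed (blast intro: sem.intros)+

end

text \<open>Interpretations are arrows \<open>basisI \<Gamma> \<rightarrow> tyI \<sigma>\<close>.\<close>

context Sl_category
begin

lemmas homs =
  idn_hom unit_obj tens_obj tensm_hom asc_hom asci_hom lun_hom luni_hom run_hom runi_hom
  sym_hom hom_obj eval_hom cur_hom bang_obj bangm_hom dlt_hom eps_hom q2_hom q1_hom
  prod_obj proj1_hom proj2_hom pair_hom nno_obj zro_hom suc_hom prd_hom lif_hom fixp_hom

lemma nno_homs:
  "pco C \<in> Hom C (nno C) (bang C (nno C))"
  "wkn C \<in> Hom C (nno C) \<one>"
  "ctr C \<in> Hom C (nno C) (nno C \<otimes> nno C)"
  using pco_coalgebra nno_comonoid by (auto simp: coalgebra_def commutative_comonoid_def)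

lemma bang_comonoid_homs:
  assumes "A \<in> Obj C"
  shows "era C A \<in> Hom C (bang C A) \<one>"
    and "dup C A \<in> Hom C (bang C A) (bang C A \<otimes> bang C A)"
  using comonoid_bang[OF assms] by (auto simp: commutative_comonoid_def)

lemma tyI_obj: "tyI C \<sigma> \<in> Obj C"
  by (induction \<sigma>) (auto intro: homs)

lemma varI_obj: "varI C x \<in> Obj C"
  by (cases x) (auto intro: homs tyI_obj)

lemma tensl_obj: "set As \<subseteq> Obj C \<Longrightarrow> tensl C As \<in> Obj C"
  by (induction As) (auto intro: homs)

lemma vars_obj: "set (map (varI C) \<Gamma>) \<subseteq> Obj C"
  by (auto intro: varI_obj)

lemma basisI_obj: "basisI C \<Gamma> \<in> Obj C"
  unfolding basisI_def by (intro tensl_obj vars_obj)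

lemma varI_vty: "\<not> is_Stb x \<Longrightarrow> varI C x = tyI C (vty x)"
  by (cases x) auto

lemma split_hom:
  "set As \<subseteq> Obj C \<Longrightarrow> set Bs \<subseteq> Obj C
   \<Longrightarrow> split C As Bs \<in> Hom C (tensl C (As @ Bs)) (tensl C As \<otimes> tensl C Bs)"
proof (induction As)
  case Nil
  then show ?case by (auto intro: homs tensl_obj)
next
  case (Cons A As)
  then have "split C As Bs \<in> Hom C (tensl C (As @ Bs)) (tensl C As \<otimes> tensl C Bs)" by simp
  with Cons.prems show ?case
    by (auto intro!: comp_hom[OF tensm_hom] intro: homs tensl_obj)
qed

lemma snoc_hom:
  "set As \<subseteq> Obj C \<Longrightarrow> B \<in> Obj C \<Longrightarrow> snoc C As B \<in> Hom C (tensl C As \<otimes> B) (tensl C (As @ [B]))"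
proof (induction As)
  case Nil
  then show ?case by (auto intro: comp_hom[OF lun_hom] homs)
next
  case (Cons A As)
  then show ?case
    by (auto intro!: comp_hom[OF asc_hom] intro: homs tensl_obj)
qed

lemma under_hom:
  "set As \<subseteq> Obj C \<Longrightarrow> g \<in> Hom C (tensl C Bs) (tensl C Ds)
   \<Longrightarrow> under C As g \<in> Hom C (tensl C (As @ Bs)) (tensl C (As @ Ds))"
  by (induction As) (auto intro: homs)

lemma drop1_hom: "w \<in> Hom C A \<one> \<Longrightarrow> drop1 C w \<in> Hom C (tensl C [A]) (tensl C [])"
  unfolding drop1_def by (auto intro!: comp_hom[OF tensm_hom] intro: homs)

lemma copy1_hom: "c \<in> Hom C A (A \<otimes> A) \<Longrightarrow> copy1 C A c \<in> Hom C (tensl C [A]) (tensl C [A, A])"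
  using Hom_obj[of c A "A \<otimes> A"]
  unfolding copy1_def by (auto intro!: comp_hom[OF tensm_hom] intro: homs)

lemma swap_hom:
  "A \<in> Obj C \<Longrightarrow> B \<in> Obj C \<Longrightarrow> D \<in> Obj C \<Longrightarrow> swap C A B D \<in> Hom C (A \<otimes> (B \<otimes> D)) (B \<otimes> (A \<otimes> D))"
  unfolding swap_def by (rule comp_hom[OF comp_hom[OF asci_hom tensm_hom]]) (auto intro: homs)

lemma ql_hom:
  "set As \<subseteq> Obj C \<Longrightarrow> ql C As \<in> Hom C (tensl C (map (bang C) As)) (bang C (tensl C As))"
proof (induction As)
  case Nil
  then show ?case by (auto intro: homs)
next
  case (Cons A As)
  then show ?case
    by (auto intro!: comp_hom[OF tensm_hom] intro: homs tensl_obj)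
qed

lemma coalgI_hom:
  "\<not> is_Ho x \<Longrightarrow> coalgI C x \<in> Hom C (varI C x) (bang C (varI C x))"
  by (cases x) (auto intro: homs nno_homs tyI_obj)

lemma tensml_coalgI_hom:
  "\<forall>x \<in> set \<Gamma>. \<not> is_Ho x
   \<Longrightarrow> tensml C (map (coalgI C) \<Gamma>) \<in> Hom C (basisI C \<Gamma>) (tensl C (map (bang C) (map (varI C) \<Gamma>)))"
  unfolding basisI_def by (induction \<Gamma>) (auto intro: homs coalgI_hom)

lemma under_basis:
  assumes "f \<in> Hom C (basisI C (\<Gamma> @ \<Delta>)) T"
    and "g \<in> Hom C (tensl C Bs) (tensl C (map (varI C) \<Delta>))" and "Bs = map (varI C) \<Delta>'"
  shows "f \<cdot> under C (map (varI C) \<Gamma>) g \<in> Hom C (basisI C (\<Gamma> @ \<Delta>')) T"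
  using assms under_hom[OF vars_obj, of g Bs "map (varI C) \<Delta>" \<Gamma>] comp_hom
  by (auto simp: basisI_def)

lemma split_basis:
  assumes "f \<in> Hom C (basisI C \<Gamma>) A" "g \<in> Hom C (basisI C \<Delta>) B" "h \<in> Hom C (A \<otimes> B) D"
  shows "h \<cdot> (f \<odot> g) \<cdot> split C (map (varI C) \<Gamma>) (map (varI C) \<Delta>) \<in> Hom C (basisI C (\<Gamma> @ \<Delta>)) D"
  using assms split_hom[OF vars_obj vars_obj, of \<Gamma> \<Delta>]
  by (auto simp: basisI_def intro!: comp_hom[OF comp_hom[OF _ tensm_hom]])

lemma snoc_basis:
  assumes "f \<in> Hom C (basisI C (\<Gamma> @ [x])) D"
  shows "cur C (basisI C \<Gamma>) (varI C x) D (f \<cdot> snoc C (map (varI C) \<Gamma>) (varI C x))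
    \<in> Hom C (basisI C \<Gamma>) (hom C (varI C x) D)"
  using assms snoc_hom[OF vars_obj varI_obj, of \<Gamma> x]
  by (auto simp: basisI_def intro!: cur_hom comp_hom varI_obj tensl_obj)

theorem sem_hom: "sem C \<Gamma> M \<sigma> f \<Longrightarrow> f \<in> Hom C (basisI C \<Gamma>) (tyI C \<sigma>)"
proof (induction rule: sem.induct)
  case i_zero
  then show ?case by (auto simp: basisI_def intro: homs)
next
  case i_succ
  then show ?case by (auto simp: basisI_def intro!: cur_hom comp_hom[OF lun_hom] intro: homs)
next
  case i_pred
  then show ?case by (auto simp: basisI_def intro!: cur_hom comp_hom[OF lun_hom] intro: homs)
next
  case (i_lif \<Gamma> M m \<Delta> L l R r)
  then show ?case by (auto intro!: split_basis intro: homs)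
next
  case (i_exch \<Gamma> x y \<Delta> M \<tau> f)
  show ?case
    by (rule under_basis[OF i_exch.IH, where Bs = "map (varI C) (y # x # \<Delta>)"])
      (use swap_hom[OF varI_obj varI_obj basisI_obj] in \<open>auto simp: basisI_def\<close>)
next
  case (i_gvar x)
  then show ?case by (auto simp: basisI_def intro: homs)
next
  case (i_gweak \<Gamma> M \<tau> f x)
  then have "f \<in> Hom C (basisI C (\<Gamma> @ [])) (tyI C \<tau>)" by simp
  then show ?case
    by (rule under_basis[where Bs = "[nno C]"]) (use drop1_hom[OF nno_homs(2)] in simp_all)
next
  case (i_gcontr \<Gamma> x1 x2 M \<tau> f x)
  show ?case
    by (rule under_basis[OF i_gcontr.IH, where Bs = "[nno C]"])
      (use copy1_hom[OF nno_homs(3)] in auto)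
next
  case (i_hvar f \<sigma> \<tau>)
  then show ?case by (auto simp: basisI_def intro: homs tyI_obj)
next
  case (i_app \<Gamma> M \<sigma> \<tau> f \<Delta> N g)
  then show ?case by (auto intro!: split_basis intro: homs tyI_obj)
next
  case (i_lam \<Gamma> x M \<tau> f)
  then show ?case using snoc_basis[of f \<Gamma> x] by (simp add: varI_vty)
next
  case (i_svar F \<sigma>)
  then show ?case by (auto simp: basisI_def intro!: comp_hom[OF run_hom] intro: homs tyI_obj)
next
  case (i_sweak \<Gamma> M \<tau> f F \<sigma>)
  then have "f \<in> Hom C (basisI C (\<Gamma> @ [])) (tyI C \<tau>)" by simp
  then show ?case
    by (rule under_basis[where Bs = "[bang C (tyI C \<sigma>)]"])
      (use drop1_hom[OF bang_comonoid_homs(1)[OF tyI_obj]] in simp_all)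
next
  case (i_scontr \<Gamma> F1 \<sigma> F2 M \<tau> f F)
  show ?case
    by (rule under_basis[OF i_scontr.IH, where Bs = "[bang C (tyI C \<sigma>)]"])
      (use copy1_hom[OF bang_comonoid_homs(2)[OF tyI_obj]] in auto)
next
  case (i_mu \<Gamma> \<Delta> F \<sigma> M f)
  have "f \<in> Hom C (basisI C ((\<Gamma> @ \<Delta>) @ [Stb F \<sigma>])) (tyI C \<sigma>)"
    using i_mu.IH by simp
  from snoc_basis[OF this]
  have cur: "cur C (basisI C (\<Gamma> @ \<Delta>)) (bang C (tyI C \<sigma>)) (tyI C \<sigma>)
        (f \<cdot> snoc C (map (varI C) (\<Gamma> @ \<Delta>)) (bang C (tyI C \<sigma>)))
      \<in> Hom C (basisI C (\<Gamma> @ \<Delta>)) (hom C (bang C (tyI C \<sigma>)) (tyI C \<sigma>))" by simp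
  have coalg: "\<forall>x \<in> set (\<Gamma> @ \<Delta>). \<not> is_Ho x"
    using i_mu.hyps by (auto simp: list_all_iff is_Gnd_def is_Stb_def)
  have ql: "ql C (map (varI C) (\<Gamma> @ \<Delta>))
      \<in> Hom C (tensl C (map (bang C) (map (varI C) (\<Gamma> @ \<Delta>)))) (bang C (basisI C (\<Gamma> @ \<Delta>)))"
    using ql_hom[OF vars_obj] unfolding basisI_def .
  show ?case
    by (rule comp_hom[OF comp_hom[OF comp_hom[OF tensml_coalgI_hom[OF coalg] ql]
          bangm_hom[OF cur]] fixp_hom[OF tyI_obj]])
qed

end

end

theory Submission
  imports Defs "HOL-Library.Confluence"
begin

text \<open>
  Reduction is confluent on raw terms, so convertible terms have a common reduct, and it suffices
  that interpretations are unique and preserved by reduction. Neither is visible on \<open>sem\<close>, whose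
  structural rules may be used anywhere. The interpretation \<open>isem\<close> is therefore directed by the
  syntax: the immediate subterms share the ground and stable variables of the context, and a
  structural arrow \<open>str\<close>, built from copying, discarding and symmetries in a strictification
  of the model, distributes them. Everything rests on one coherence law: substituting along
  comonoid morphisms commutes with structural arrows. Hence \<open>isem\<close> admits the structural rules
  (so it contains \<open>sem\<close>) and simultaneous substitution, where variables, linear arguments,
  numerals and fixpoints are all instances: the interpretations of numerals and
  promotions are morphisms of coalgebras and of comonoids. The rest is naturality of currying and the
  equations of \<open>lif\<close> and \<open>fixp\<close>.
\<close>

section \<open>Confluence of reduction on raw terms\<close>

text \<open>Even the case of two equal terms is a coherence theorem, because one judgment has many
  derivations that contract, weaken and exchange at different places. The arrow does not depend on
  these choices because higher-order variables are linear: the free variables of the subterms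
  dictate where each of them goes, while a ground or stable variable can be offered to every
  subterm, as it can be discarded there. Copyable variables put two separate demands on a
  substituted arrow. To meet contraction and weakening it must respect the comonoids; to pass under
  \<open>Mu\<close>, which promotes its body along the coalgebra structure of the context, it must
  respect the coalgebras. An arbitrary argument need not satisfy either demand, but only linear
  variables are ever replaced by one. Arrows of the strictification carry their lists of objects, as
  a tensor product does not determine the list of its factors.\<close>

lemma lift_lift: "i < Suc k \<Longrightarrow> lift i (lift k M) = lift (Suc k) (lift i M)"
  by (induction M arbitrary: i k) auto

lemma lift_inst: "j < Suc i \<Longrightarrow> lift i (inst j N M) = inst j (lift i N) (lift (Suc i) M)"
  by (induction M arbitrary: i j N) (auto simp: lift_lift)

text \<open>Companion of \<open>lift_inst\<close> for lifting at or below the substituted index,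
  which is thereby shifted by one.\<close>

lemma lift_inst_lt: "i < Suc j \<Longrightarrow> lift i (inst j N M) = inst (Suc j) (lift i N) (lift i M)"
  by (induction M arbitrary: i j N) (auto simp: lift_lift)

lemma inst_lift: "inst k N (lift k M) = M"
  by (induction M arbitrary: k N) auto

text \<open>The substitution lemma for de Bruijn indices. It identifies the substitution instance of
  a contractum with the contractum of the substitution instance, for beta redexes and unfoldings
  alike.\<close>

lemma inst_inst:
  "i < Suc j \<Longrightarrow> inst i (inst j V U) (inst (Suc j) (lift i V) M) = inst j V (inst i U M)"
  by (induction M arbitrary: i j U V) (auto simp: inst_lift lift_lift lift_inst_lt)

lemma lift_num [simp]: "lift k (num n) = num n"
  by (induction n) auto

lemma inst_num [simp]: "inst k N (num n) = num n"
  by (induction n) auto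

text \<open>The rules that inspect a numeral have no premise for it, because a numeral reduces only
  to itself. The conditional rules spell out \<open>Zero\<close> and \<open>App Succ (num n)\<close>
  so that they match on constructors, and they put no premise on the discarded branch.\<close>

inductive par :: "trm \<Rightarrow> trm \<Rightarrow> bool" where
  p_zero: "par Zero Zero"
| p_succ: "par Succ Succ"
| p_pred: "par Pred Pred"
| p_fv: "par (FV x) (FV x)"
| p_bv: "par (BV i) (BV i)"
| p_app: "par M M' \<Longrightarrow> par N N' \<Longrightarrow> par (App M N) (App M' N')"
| p_lif: "par M M' \<Longrightarrow> par L L' \<Longrightarrow> par R R' \<Longrightarrow> par (LIf M L R) (LIf M' L' R')"
| p_lam: "par B B' \<Longrightarrow> par (Lam \<sigma> B) (Lam \<sigma> B')"
| p_mu: "par B B' \<Longrightarrow> par (Mu \<sigma> B) (Mu \<sigma> B')"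
| p_beta: "par B B' \<Longrightarrow> par N N' \<Longrightarrow> par (App (Lam (\<sigma> \<multimap> \<tau>) B) N) (inst 0 N' B')"
| p_beta_num: "par B B' \<Longrightarrow> par (App (Lam Iota B) (num n)) (inst 0 (num n) B')"
| p_unfold: "par B B' \<Longrightarrow> par (Mu \<sigma> B) (inst 0 (Mu \<sigma> B') B')"
| p_pred_suc: "par (App Pred (App Succ (num n))) (num n)"
| p_if_zero: "par L L' \<Longrightarrow> par (LIf Zero L R) L'"
| p_if_suc: "par R R' \<Longrightarrow> par (LIf (App Succ (num n)) L R) R'"

lemma par_refl: "par M M"
  by (induction M) (auto intro: par.intros)

inductive_cases par_atomE:
  "par Zero M" "par Succ M" "par Pred M" "par (FV x) M" "par (BV i) M" "par (Lam \<sigma> B) M"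

text \<open>No redex has the form \<open>Zero\<close> or \<open>App Succ N\<close>, so only the
  congruence rules apply. Being a numeral is therefore stable under reduction, which makes the
  value-restricted beta rule compatible with the other rules.\<close>

lemma par_num: "par (num n) M \<Longrightarrow> M = num n"
proof (induction n arbitrary: M)
  case 0
  then show ?case by (auto elim: par_atomE)
next
  case (Suc n)
  from Suc.prems have "par (App Succ (num n)) M" by simp
  then show ?case
    by cases (auto elim: par_atomE dest: Suc.IH)
qed

lemma par_lift: "par M M' \<Longrightarrow> par (lift k M) (lift k M')"
proof (induction arbitrary: k rule: par.induct)
  case (p_beta B B' N N' \<sigma> \<tau>)
  then show ?case
    using par.p_beta[of "lift (Suc k) B" "lift (Suc k) B'" "lift k N" "lift k N'"]
    by (simp add: lift_inst)
next
  case (p_beta_num B B' n)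
  then show ?case
    using par.p_beta_num[of "lift (Suc k) B" "lift (Suc k) B'" n] by (simp add: lift_inst)
next
  case (p_unfold B B' \<sigma>)
  then show ?case
    using par.p_unfold[of "lift (Suc k) B" "lift (Suc k) B'" \<sigma>] by (simp add: lift_inst)
qed (auto intro: par.intros)

text \<open>Contracted redexes are handled by \<open>inst_inst\<close>; redexes that demand a
  numeral survive because substitution does not change numerals.\<close>

lemma par_inst: "par M M' \<Longrightarrow> par N N' \<Longrightarrow> par (inst k N M) (inst k N' M')"
proof (induction arbitrary: k N N' rule: par.induct)
  case (p_lam B B' \<sigma>)
  then show ?case by (simp add: par.p_lam par_lift)
next
  case (p_mu B B' \<sigma>)
  then show ?case by (simp add: par.p_mu par_lift)
next
  case (p_beta B B' P P' \<sigma> \<tau>)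
  have "par (inst (Suc k) (lift 0 N) B) (inst (Suc k) (lift 0 N') B')" "par (inst k N P) (inst k N' P')"
    using p_beta by (auto intro: par_lift)
  from par.p_beta[OF this] show ?case by (simp flip: inst_inst)
next
  case (p_beta_num B B' n)
  have "par (inst (Suc k) (lift 0 N) B) (inst (Suc k) (lift 0 N') B')"
    using p_beta_num by (auto intro: par_lift)
  from par.p_beta_num[OF this, of n] show ?case by (simp flip: inst_inst)
next
  case (p_unfold B B' \<sigma>)
  have "par (inst (Suc k) (lift 0 N) B) (inst (Suc k) (lift 0 N') B')"
    using p_unfold by (auto intro: par_lift)
  from par.p_unfold[OF this, of \<sigma>] show ?case by (simp flip: inst_inst)
qed (auto intro: par.intros)

text \<open>Takahashi's complete development.\<close>

fun dev :: "trm \<Rightarrow> trm" where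
  "dev (App M N) =
    (case M of
       Lam \<rho> B \<Rightarrow>
         (case \<rho> of
            Iota \<Rightarrow> if N \<in> range num then inst 0 N (dev B) else App (Lam \<rho> (dev B)) (dev N)
          | _ \<Rightarrow> inst 0 (dev N) (dev B))
     | Pred \<Rightarrow>
         (case N of
            App N1 N2 \<Rightarrow> if N1 = Succ \<and> N2 \<in> range num then N2 else App Pred (dev N)
          | _ \<Rightarrow> App Pred (dev N))
     | _ \<Rightarrow> App (dev M) (dev N))"
| "dev (LIf M L R) =
    (if M = Zero then dev L
     else if M \<in> range (\<lambda>n. App Succ (num n)) then dev R
     else LIf (dev M) (dev L) (dev R))"
| "dev (Lam \<sigma> B) = Lam \<sigma> (dev B)"
| "dev (Mu \<sigma> B) = inst 0 (Mu \<sigma> (dev B)) (dev B)"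
| "dev M = M"

lemma dev_num [simp]: "dev (num n) = num n"
  by (induction n) auto

text \<open>A redex of \<open>M\<close> is either contracted in the given reduct or still present
  there: \<open>par\<close> sends \<open>Lam\<close> to \<open>Lam\<close>, \<open>Pred\<close> to
  \<open>Pred\<close> and a numeral to itself. In both cases the complete development can catch up
  in one parallel step.\<close>

lemma par_dev: "par M N \<Longrightarrow> par N (dev M)"
proof (induction rule: par.induct)
  case (p_app M M' N N')
  show ?case
  proof (cases M)
    case (Lam \<rho> B)
    then obtain B' where B': "M' = Lam \<rho> B'" using p_app.hyps(1) by (auto elim: par_atomE)
    with Lam p_app.IH(1) have B: "par B' (dev B)" by (auto elim: par_atomE)
    show ?thesis
    proof (cases \<rho>)
      case Iota
      show ?thesis
      proof (cases "N \<in> range num")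
        \<comment> \<open>The argument is a numeral, so it is unchanged in the reduct and the redex
          can still be contracted there.\<close>
        case True
        then obtain n where "N = num n" by auto
        moreover from this p_app.hyps(2) have "N' = num n" by (simp add: par_num)
        ultimately show ?thesis using Lam B' B Iota by (auto intro: par.intros)
      next
        case False
        then show ?thesis using Lam B' B Iota p_app.IH by (auto intro: par.intros)
      qed
    next
      case (Lolli \<sigma> \<tau>)
      then show ?thesis using Lam B' B p_app.IH by (auto intro: par.intros)
    qed
  next
    case Pred
    then have M': "M' = Pred" using p_app.hyps(1) by (auto elim: par_atomE)
    show ?thesis
    proof (cases "N \<in> range (\<lambda>n. App Succ (num n))")
      case True
      then obtain n where n: "N = num (Suc n)" by auto
      with p_app.hyps(2) have "N' = num (Suc n)" by (metis par_num)
      with n M' Pred show ?thesis by (auto intro: par.intros)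
    next
      case False
      then have "dev (App M N) = App Pred (dev N)" using Pred by (auto split: trm.split)
      with M' p_app.IH show ?thesis by (auto intro: par.intros)
    qed
  qed (use p_app in \<open>auto intro: par.intros\<close>)
next
  case (p_lif M M' L L' R R')
  consider "M = Zero" | n where "M = App Succ (num n)" | "M \<noteq> Zero" "M \<notin> range (\<lambda>n. App Succ (num n))"
    by blast
  then show ?case
  proof cases
    case 1
    then show ?thesis using p_lif by (auto intro: par.intros elim: par_atomE)
  next
    case 2
    then have "M' = App Succ (num n)" using p_lif.hyps(1) par_num[of "Suc n"] by simp
    then show ?thesis using p_lif 2 by (auto intro: par.intros)
  next
    case 3
    then show ?thesis using p_lif by (auto intro: par.intros)
  qed
next
  case (p_beta B B' N N' \<sigma> \<tau>)
  then show ?case by (auto intro: par_inst)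
next
  case (p_beta_num B B' n)
  then show ?case by (auto intro: par_inst par_refl)
next
  case (p_unfold B B' \<sigma>)
  then show ?case by (auto intro!: par_inst intro: par.intros)
qed (auto intro: par.intros par_refl)

text \<open>By \<open>par_dev\<close> any two parallel reducts of a term meet in its complete
  development, which is more than strong confluence asks for.\<close>

lemma confluentp_par: "confluentp par"
  by (rule strong_confluentp_imp_confluentp)
    (auto intro!: strong_confluentpI intro: par_dev)

section \<open>Parallel reduction against single steps\<close>

lemma step_par: "step M N \<Longrightarrow> par M N"
proof (induction rule: step.induct)
  case (s_redex M M')
  then show ?case by cases (auto intro: par.intros par_refl)
qed (auto intro: par.intros par_refl)

lemma steps_cong:
  "step\<^sup>*\<^sup>* M M' \<Longrightarrow> step\<^sup>*\<^sup>* (App M N) (App M' N)"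
  "step\<^sup>*\<^sup>* N N' \<Longrightarrow> step\<^sup>*\<^sup>* (App M N) (App M N')"
  "step\<^sup>*\<^sup>* M M' \<Longrightarrow> step\<^sup>*\<^sup>* (LIf M L R) (LIf M' L R)"
  "step\<^sup>*\<^sup>* L L' \<Longrightarrow> step\<^sup>*\<^sup>* (LIf M L R) (LIf M L' R)"
  "step\<^sup>*\<^sup>* R R' \<Longrightarrow> step\<^sup>*\<^sup>* (LIf M L R) (LIf M L R')"
  "step\<^sup>*\<^sup>* B B' \<Longrightarrow> step\<^sup>*\<^sup>* (Lam \<sigma> B) (Lam \<sigma> B')"
  "step\<^sup>*\<^sup>* B B' \<Longrightarrow> step\<^sup>*\<^sup>* (Mu \<sigma> B) (Mu \<sigma> B')"
  by (induction rule: rtranclp_induct; blast intro: step.intros rtranclp.rtrancl_into_rtrancl)+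

lemma redex_steps: "step\<^sup>*\<^sup>* M M' \<Longrightarrow> redex M' N \<Longrightarrow> step\<^sup>*\<^sup>* M N"
  by (meson rtranclp.rtrancl_into_rtrancl s_redex)

lemma par_steps: "par M N \<Longrightarrow> step\<^sup>*\<^sup>* M N"
proof (induction rule: par.induct)
  case (p_app M M' N N')
  then show ?case by (meson steps_cong rtranclp_trans)
next
  case (p_lif M M' L L' R R')
  then show ?case by (meson steps_cong rtranclp_trans)
next
  case (p_beta B B' N N' \<sigma> \<tau>)
  then show ?case by (meson steps_cong rtranclp_trans redex_steps r_beta)
next
  case (p_beta_num B B' n)
  then show ?case by (meson steps_cong redex_steps r_beta_num)
next
  case (p_unfold B B' \<sigma>)
  then show ?case by (meson steps_cong redex_steps r_mu)
next
  case (p_pred_suc n)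
  then show ?case by (meson redex.intros s_redex r_into_rtranclp)
next
  case (p_if_zero L L' R)
  then show ?case using r_if_zero[of L R] by (metis num.simps(1) s_redex converse_rtranclp_into_rtranclp)
next
  case (p_if_suc R R' n L)
  then show ?case using r_if_suc[of n L R] by (metis num.simps(2) s_redex converse_rtranclp_into_rtranclp)
qed (auto intro: steps_cong)

text \<open>A single step is a parallel step and a parallel step is a sequence of single steps, so
  both relations have the same reflexive transitive closure.\<close>

lemma confluentp_step: "confluentp step"
proof -
  have "par\<^sup>*\<^sup>* = step\<^sup>*\<^sup>*"
  proof (rule antisym)
    show "par\<^sup>*\<^sup>* \<le> step\<^sup>*\<^sup>*"
      using rtranclp_mono[of par "step\<^sup>*\<^sup>*"] par_steps by (simp add: le_fun_def)
    show "step\<^sup>*\<^sup>* \<le> par\<^sup>*\<^sup>*"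
      using rtranclp_mono[of step par] step_par by (simp add: le_fun_def)
  qed
  then show ?thesis
    using confluentpD[OF confluentp_par] by (auto intro!: confluentpI)
qed

lemma conv_joinable: "M =\<^sub>S\<^sub>l N \<Longrightarrow> \<exists>P. step\<^sup>*\<^sup>* M P \<and> step\<^sup>*\<^sup>* N P"
  using semiconfluentp_equivclp[OF confluentp_imp_semiconfluentp[OF confluentp_step]]
  by (auto simp: conv_def rtranclp_conversep)

section \<open>Strict symmetric monoidal categories with copyable wires\<close>

text \<open>Objects are lists, so the associativity and unit laws of the tensor are plain equations;
  \<open>ok\<close> singles out the lists of genuine objects. Composition and tensor are total
  functions, hence the typing hypotheses in the laws. Only one hexagon is assumed, as the other one
  is its inverse.\<close>

locale strict_smc =
  fixes ok :: "'o list \<Rightarrow> bool"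
    and ar :: "'a \<Rightarrow> bool"
    and dm cd :: "'a \<Rightarrow> 'o list"
    and Id :: "'o list \<Rightarrow> 'a"
    and cmp :: "'a \<Rightarrow> 'a \<Rightarrow> 'a"  (infixr "\<circ>\<^sub>s" 55)
    and tns :: "'a \<Rightarrow> 'a \<Rightarrow> 'a"  (infixr "\<boxtimes>" 60)
    and sg :: "'o list \<Rightarrow> 'o list \<Rightarrow> 'a"
  assumes ok_Nil [simp]: "ok []"
    and ok_append [simp]: "ok (As @ Bs) \<longleftrightarrow> ok As \<and> ok Bs"
    and ok_dm [simp]: "ar f \<Longrightarrow> ok (dm f)"
    and ok_cd [simp]: "ar f \<Longrightarrow> ok (cd f)"
    and dm_Id [simp]: "dm (Id As) = As" and cd_Id [simp]: "cd (Id As) = As"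
    and dm_cmp [simp]: "dm (g \<circ>\<^sub>s f) = dm f" and cd_cmp [simp]: "cd (g \<circ>\<^sub>s f) = cd g"
    and dm_tns [simp]: "dm (f \<boxtimes> g) = dm f @ dm g" and cd_tns [simp]: "cd (f \<boxtimes> g) = cd f @ cd g"
    and dm_sg [simp]: "dm (sg As Bs) = As @ Bs" and cd_sg [simp]: "cd (sg As Bs) = Bs @ As"
    and ar_Id [simp]: "ok As \<Longrightarrow> ar (Id As)"
    and ar_cmp [simp]: "ar f \<Longrightarrow> ar g \<Longrightarrow> dm g = cd f \<Longrightarrow> ar (g \<circ>\<^sub>s f)"
    and ar_tns [simp]: "ar f \<Longrightarrow> ar g \<Longrightarrow> ar (f \<boxtimes> g)"
    and ar_sg [simp]: "ok As \<Longrightarrow> ok Bs \<Longrightarrow> ar (sg As Bs)"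
    and Id_cmp [simp]: "ar f \<Longrightarrow> cd f = As \<Longrightarrow> Id As \<circ>\<^sub>s f = f"
    and cmp_Id [simp]: "ar f \<Longrightarrow> dm f = As \<Longrightarrow> f \<circ>\<^sub>s Id As = f"
    and cmp_assoc: "ar f \<Longrightarrow> ar g \<Longrightarrow> ar h \<Longrightarrow> dm g = cd f \<Longrightarrow> dm h = cd g
      \<Longrightarrow> (h \<circ>\<^sub>s g) \<circ>\<^sub>s f = h \<circ>\<^sub>s (g \<circ>\<^sub>s f)"
    and tns_Id [simp]: "ok As \<Longrightarrow> ok Bs \<Longrightarrow> Id As \<boxtimes> Id Bs = Id (As @ Bs)"
    and interchange: "ar f \<Longrightarrow> ar f' \<Longrightarrow> ar g \<Longrightarrow> ar g' \<Longrightarrow> dm f' = cd f \<Longrightarrow> dm g' = cd g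
      \<Longrightarrow> (f' \<boxtimes> g') \<circ>\<^sub>s (f \<boxtimes> g) = (f' \<circ>\<^sub>s f) \<boxtimes> (g' \<circ>\<^sub>s g)"
    and tns_assoc: "ar f \<Longrightarrow> ar g \<Longrightarrow> ar h \<Longrightarrow> (f \<boxtimes> g) \<boxtimes> h = f \<boxtimes> (g \<boxtimes> h)"
    and Id_Nil_tns [simp]: "ar f \<Longrightarrow> Id [] \<boxtimes> f = f"
    and tns_Id_Nil [simp]: "ar f \<Longrightarrow> f \<boxtimes> Id [] = f"
    and sg_natural: "ar f \<Longrightarrow> ar g \<Longrightarrow> sg (cd f) (cd g) \<circ>\<^sub>s (f \<boxtimes> g) = (g \<boxtimes> f) \<circ>\<^sub>s sg (dm f) (dm g)"
    and sg_sg: "ok As \<Longrightarrow> ok Bs \<Longrightarrow> sg Bs As \<circ>\<^sub>s sg As Bs = Id (As @ Bs)"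
    and sg_append: "ok As \<Longrightarrow> ok Bs \<Longrightarrow> ok Ds
      \<Longrightarrow> sg As (Bs @ Ds) = (Id Bs \<boxtimes> sg As Ds) \<circ>\<^sub>s (sg As Bs \<boxtimes> Id Ds)"
begin

text \<open>The hexagon at two empty lists makes this symmetry idempotent, and an invertible
  idempotent is an identity.\<close>

lemma sg_Nil_right: assumes "ok As" shows "sg As [] = Id As"
proof -
  let ?s = "sg As []" and ?t = "sg [] As"
  have idem: "?s = ?s \<circ>\<^sub>s ?s" using sg_append[of As "[]" "[]"] assms by simp
  have ts: "?t \<circ>\<^sub>s ?s = Id As" using sg_sg[of As "[]"] assms by simp
  have "Id As = ?t \<circ>\<^sub>s (?s \<circ>\<^sub>s ?s)" using ts idem by simp
  also have "\<dots> = (?t \<circ>\<^sub>s ?s) \<circ>\<^sub>s ?s" using assms by (simp add: cmp_assoc)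
  also have "\<dots> = ?s" using ts assms by simp
  finally show ?thesis by simp
qed

lemma sg_Nil_left: assumes "ok As" shows "sg [] As = Id As"
  using sg_sg[of "[]" As] assms by (simp add: sg_Nil_right)

text \<open>The composite on the right is inverse to \<open>sg Ds (As @ Bs)\<close>, by the assumed
  hexagon, and inverses are unique.\<close>

lemma sg_append_left:
  assumes "ok As" "ok Bs" "ok Ds"
  shows "sg (As @ Bs) Ds = (sg As Ds \<boxtimes> Id Bs) \<circ>\<^sub>s (Id As \<boxtimes> sg Bs Ds)"
proof -
  let ?l = "(sg As Ds \<boxtimes> Id Bs) \<circ>\<^sub>s (Id As \<boxtimes> sg Bs Ds)"
  let ?r = "sg Ds (As @ Bs)"
  have r: "?r = (Id As \<boxtimes> sg Ds Bs) \<circ>\<^sub>s (sg Ds As \<boxtimes> Id Bs)" using assms by (simp add: sg_append)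
  have "?l \<circ>\<^sub>s ?r = (sg As Ds \<boxtimes> Id Bs) \<circ>\<^sub>s ((Id As \<boxtimes> sg Bs Ds) \<circ>\<^sub>s (Id As \<boxtimes> sg Ds Bs)) \<circ>\<^sub>s (sg Ds As \<boxtimes> Id Bs)"
    unfolding r using assms by (simp add: cmp_assoc)
  also have "(Id As \<boxtimes> sg Bs Ds) \<circ>\<^sub>s (Id As \<boxtimes> sg Ds Bs) = Id (As @ Ds @ Bs)"
    using assms by (simp add: interchange sg_sg)
  also have "(sg As Ds \<boxtimes> Id Bs) \<circ>\<^sub>s Id (As @ Ds @ Bs) \<circ>\<^sub>s (sg Ds As \<boxtimes> Id Bs) = Id (Ds @ As @ Bs)"
    using assms by (simp add: interchange sg_sg)
  finally have l: "?l \<circ>\<^sub>s ?r = Id (Ds @ As @ Bs)" .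
  have "?l = ?l \<circ>\<^sub>s (?r \<circ>\<^sub>s sg (As @ Bs) Ds)" using assms by (simp add: sg_sg)
  also have "\<dots> = (?l \<circ>\<^sub>s ?r) \<circ>\<^sub>s sg (As @ Bs) Ds" using assms by (simp add: cmp_assoc)
  also have "\<dots> = sg (As @ Bs) Ds" unfolding l using assms by simp
  finally show ?thesis by simp
qed

lemma tns_factor_left: "ar f \<Longrightarrow> ar g \<Longrightarrow> f \<boxtimes> g = (f \<boxtimes> Id (cd g)) \<circ>\<^sub>s (Id (dm f) \<boxtimes> g)"
  by (simp add: interchange)

lemma tns_factor_right: "ar f \<Longrightarrow> ar g \<Longrightarrow> f \<boxtimes> g = (Id (cd f) \<boxtimes> g) \<circ>\<^sub>s (f \<boxtimes> Id (dm g))"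
  by (simp add: interchange)

lemma tns_cmp_Id: "ar f \<Longrightarrow> ar g \<Longrightarrow> dm g = cd f \<Longrightarrow> ok As
  \<Longrightarrow> (g \<circ>\<^sub>s f) \<boxtimes> Id As = (g \<boxtimes> Id As) \<circ>\<^sub>s (f \<boxtimes> Id As)"
  by (simp add: interchange)

lemma Id_tns_cmp: "ar f \<Longrightarrow> ar g \<Longrightarrow> dm g = cd f \<Longrightarrow> ok As
  \<Longrightarrow> Id As \<boxtimes> (g \<circ>\<^sub>s f) = (Id As \<boxtimes> g) \<circ>\<^sub>s (Id As \<boxtimes> f)"
  by (simp add: interchange)

end

text \<open>
  Labels \<open>v\<close> stand for variables: those with \<open>lin v\<close> are used exactly once, the others carry a
  commutative comonoid \<open>(dp v, er v)\<close>.
\<close>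

locale wires = strict_smc ok ar dm cd Id cmp tns sg
  for ok :: "'o list \<Rightarrow> bool" and ar :: "'a \<Rightarrow> bool" and dm cd Id
    and cmp (infixr "\<circ>\<^sub>s" 55) and tns (infixr "\<boxtimes>" 60) and sg +
  fixes ob :: "'v \<Rightarrow> 'o" and lin :: "'v \<Rightarrow> bool" and dp er :: "'v \<Rightarrow> 'a"
  assumes ok_ob [simp]: "ok (map ob \<Gamma>)"
    and ar_dp [simp]: "\<not> lin v \<Longrightarrow> ar (dp v)"
    and dm_dp [simp]: "\<not> lin v \<Longrightarrow> dm (dp v) = [ob v]"
    and cd_dp [simp]: "\<not> lin v \<Longrightarrow> cd (dp v) = [ob v, ob v]"
    and ar_er [simp]: "\<not> lin v \<Longrightarrow> ar (er v)"
    and dm_er [simp]: "\<not> lin v \<Longrightarrow> dm (er v) = [ob v]"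
    and cd_er [simp]: "\<not> lin v \<Longrightarrow> cd (er v) = []"
    and dp_coassoc: "\<not> lin v \<Longrightarrow> (dp v \<boxtimes> Id [ob v]) \<circ>\<^sub>s dp v = (Id [ob v] \<boxtimes> dp v) \<circ>\<^sub>s dp v"
    and er_dp: "\<not> lin v \<Longrightarrow> (er v \<boxtimes> Id [ob v]) \<circ>\<^sub>s dp v = Id [ob v]"
    and sg_dp: "\<not> lin v \<Longrightarrow> sg [ob v] [ob v] \<circ>\<^sub>s dp v = dp v"
begin

abbreviation W :: "'v list \<Rightarrow> 'o list" where "W \<Gamma> \<equiv> map ob \<Gamma>"
abbreviation J :: "'v list \<Rightarrow> 'a" where "J \<Gamma> \<equiv> Id (map ob \<Gamma>)"

lemma ok_single [simp]: "ok [ob v]" "ok [ob v, ob u]"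
  using ok_ob[of "[v]"] ok_ob[of "[v, u]"] by simp_all

lemma ok_Cons [simp]: "ok (ob v # As) \<longleftrightarrow> ok As"
  using ok_append[of "[ob v]" As] by simp

lemma tns_J [simp]:
  "Id [ob v] \<boxtimes> J \<Gamma> = J (v # \<Gamma>)" "J \<Gamma> \<boxtimes> J \<Delta> = J (\<Gamma> @ \<Delta>)"
  "Id [ob v, ob u] \<boxtimes> J \<Gamma> = J (v # u # \<Gamma>)"
  using tns_Id[of "[ob v]" "W \<Gamma>"] tns_Id[of "W \<Gamma>" "W \<Delta>"] tns_Id[of "[ob v, ob u]" "W \<Gamma>"] by simp_all

definition rm :: "'v \<Rightarrow> 'v list \<Rightarrow> 'v list" where
  "rm y \<Gamma> = (if lin y then removeAll y \<Gamma> else \<Gamma>)"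

text \<open>\<open>pull \<Gamma> y : \<Gamma> \<rightarrow> y # rm y \<Gamma>\<close> moves \<open>y\<close> to the front, leaving a copy behind if \<open>y\<close> is not linear.\<close>

primrec pull :: "'v list \<Rightarrow> 'v \<Rightarrow> 'a" where
  "pull [] y = undefined"
| "pull (x # \<Gamma>) y =
    (if x = y then (if lin y then J (y # \<Gamma>) else dp y \<boxtimes> J \<Gamma>)
     else (sg [ob x] [ob y] \<boxtimes> J (rm y \<Gamma>)) \<circ>\<^sub>s (Id [ob x] \<boxtimes> pull \<Gamma> y))"

primrec erase :: "'v list \<Rightarrow> 'a" where
  "erase [] = Id []"
| "erase (x # \<Gamma>) = er x \<boxtimes> erase \<Gamma>"

text \<open>
  \<open>str \<Gamma> ys : \<Gamma> \<rightarrow> ys\<close> is the structural arrow that permutes, copies and discards the variables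
  of \<open>\<Gamma>\<close> as prescribed by the list \<open>ys\<close>.
\<close>

primrec str :: "'v list \<Rightarrow> 'v list \<Rightarrow> 'a" where
  "str \<Gamma> [] = erase \<Gamma>"
| "str \<Gamma> (y # ys) = (Id [ob y] \<boxtimes> str (rm y \<Gamma>) ys) \<circ>\<^sub>s pull \<Gamma> y"

text \<open>Phrased with occurrence counts, so that the order of \<open>ys\<close> is irrelevant and
  the linear variables of an appended list are those of its two parts. The list \<open>ys\<close>
  may repeat or omit copyable variables, whereas \<open>\<Gamma>\<close> has to be distinct.\<close>

definition valid :: "'v list \<Rightarrow> 'v list \<Rightarrow> bool" where
  "valid \<Gamma> ys \<longleftrightarrow> distinct \<Gamma> \<and> set ys \<subseteq> set \<Gamma> \<and> (\<forall>x \<in> set \<Gamma>. lin x \<longrightarrow> count_list ys x = 1)"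

lemma valid_Nil: "valid \<Gamma> [] \<longleftrightarrow> distinct \<Gamma> \<and> (\<forall>x \<in> set \<Gamma>. \<not> lin x)"
  by (auto simp: valid_def)

lemma valid_Cons: "valid \<Gamma> (y # ys) \<longleftrightarrow> distinct \<Gamma> \<and> y \<in> set \<Gamma> \<and> valid (rm y \<Gamma>) ys"
  by (auto simp: valid_def rm_def distinct_removeAll count_list_0_iff)

lemma valid_distinct: "valid \<Gamma> ys \<Longrightarrow> distinct \<Gamma>"
  by (simp add: valid_def)

lemma count_list_distinct: "distinct xs \<Longrightarrow> count_list xs x = (if x \<in> set xs then 1 else 0)"
  by (induction xs) auto

lemma valid_self: "distinct \<Gamma> \<Longrightarrow> valid \<Gamma> \<Gamma>"
  by (simp add: valid_def count_list_distinct)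

lemma distinct_rm: "distinct \<Gamma> \<Longrightarrow> distinct (rm y \<Gamma>)"
  by (simp add: rm_def distinct_removeAll)

lemma rm_Cons: "x \<noteq> y \<Longrightarrow> rm y (x # \<Gamma>) = x # rm y \<Gamma>"
  by (simp add: rm_def)

lemma rm_Cons_self: "distinct (y # \<Gamma>) \<Longrightarrow> rm y (y # \<Gamma>) = (if lin y then \<Gamma> else y # \<Gamma>)"
  by (simp add: rm_def)

lemma rm_rm: "rm x (rm y \<Gamma>) = rm y (rm x \<Gamma>)"
  by (auto simp: rm_def removeAll_filter_not_eq conj_commute)

lemma in_rm: "x \<in> set (rm y \<Gamma>) \<longleftrightarrow> x \<in> set \<Gamma> \<and> (x = y \<longrightarrow> \<not> lin y)"
  by (auto simp: rm_def)

section \<open>Extraction of one variable from a context\<close>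

lemma pull_arr:
  assumes "distinct \<Gamma>" "y \<in> set \<Gamma>"
  shows "ar (pull \<Gamma> y) \<and> dm (pull \<Gamma> y) = W \<Gamma> \<and> cd (pull \<Gamma> y) = ob y # W (rm y \<Gamma>)"
  using assms by (induction \<Gamma>) (auto simp: rm_Cons rm_def)

lemma pull_arr' [simp]:
  assumes "distinct \<Gamma>" "y \<in> set \<Gamma>"
  shows "ar (pull \<Gamma> y)" "dm (pull \<Gamma> y) = W \<Gamma>" "cd (pull \<Gamma> y) = ob y # W (rm y \<Gamma>)"
  using pull_arr[OF assms] by auto

lemma erase_arr:
  assumes "\<forall>x \<in> set \<Gamma>. \<not> lin x"
  shows "ar (erase \<Gamma>) \<and> dm (erase \<Gamma>) = W \<Gamma> \<and> cd (erase \<Gamma>) = []"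
  using assms by (induction \<Gamma>) auto

lemma str_arr:
  "valid \<Gamma> ys \<Longrightarrow> ar (str \<Gamma> ys) \<and> dm (str \<Gamma> ys) = W \<Gamma> \<and> cd (str \<Gamma> ys) = W ys"
proof (induction ys arbitrary: \<Gamma>)
  case Nil
  then show ?case using erase_arr by (auto simp: valid_Nil)
next
  case (Cons y ys)
  then have "valid (rm y \<Gamma>) ys" "distinct \<Gamma>" "y \<in> set \<Gamma>" by (auto simp: valid_Cons)
  with Cons.IH[of "rm y \<Gamma>"] show ?case by simp
qed

lemma str_arr' [simp]:
  assumes "valid \<Gamma> ys"
  shows "ar (str \<Gamma> ys)" "dm (str \<Gamma> ys) = W \<Gamma>" "cd (str \<Gamma> ys) = W ys"
  using str_arr[OF assms] by auto

lemma sg_er: "\<not> lin y \<Longrightarrow> (er y \<boxtimes> Id [ob x]) \<circ>\<^sub>s sg [ob x] [ob y] = Id [ob x] \<boxtimes> er y"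
  using sg_natural[of "Id [ob x]" "er y"] by (simp add: sg_Nil_right)

text \<open>At the position of \<open>y\<close> this is the counit law; the wires in front of it are
  crossed by naturality of the symmetry.\<close>

lemma er_pull:
  assumes "distinct \<Gamma>" "y \<in> set \<Gamma>" "\<not> lin y"
  shows "(er y \<boxtimes> J \<Gamma>) \<circ>\<^sub>s pull \<Gamma> y = J \<Gamma>"
  using assms
proof (induction \<Gamma>)
  case (Cons x \<Gamma>)
  show ?case
  proof (cases "x = y")
    case True
    have "(er y \<boxtimes> J (y # \<Gamma>)) \<circ>\<^sub>s (dp y \<boxtimes> J \<Gamma>) = ((er y \<boxtimes> Id [ob y]) \<boxtimes> J \<Gamma>) \<circ>\<^sub>s (dp y \<boxtimes> J \<Gamma>)"
      using Cons.prems by (simp add: tns_assoc)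
    also have "\<dots> = ((er y \<boxtimes> Id [ob y]) \<circ>\<^sub>s dp y) \<boxtimes> J \<Gamma>"
      using Cons.prems by (simp add: interchange)
    finally show ?thesis using Cons.prems True by (simp add: er_dp)
  next
    case False
    with Cons.prems have y: "y \<in> set \<Gamma>" "distinct \<Gamma>" and rm: "rm y \<Gamma> = \<Gamma>" by (auto simp: rm_def)
    have "(er y \<boxtimes> J (x # \<Gamma>)) \<circ>\<^sub>s pull (x # \<Gamma>) y
      = ((er y \<boxtimes> Id [ob x]) \<boxtimes> J \<Gamma>) \<circ>\<^sub>s (sg [ob x] [ob y] \<boxtimes> J \<Gamma>) \<circ>\<^sub>s (Id [ob x] \<boxtimes> pull \<Gamma> y)"
      using Cons.prems False y by (simp add: tns_assoc rm)
    also have "\<dots> = ((Id [ob x] \<boxtimes> er y) \<boxtimes> J \<Gamma>) \<circ>\<^sub>s (Id [ob x] \<boxtimes> pull \<Gamma> y)"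
      using Cons.prems y by (simp flip: cmp_assoc add: interchange sg_er rm)
    also have "\<dots> = Id [ob x] \<boxtimes> ((er y \<boxtimes> J \<Gamma>) \<circ>\<^sub>s pull \<Gamma> y)"
      using Cons.prems y by (simp add: tns_assoc interchange rm)
    finally show ?thesis using Cons y by simp
  qed
qed simp

text \<open>Two extractions in a row. The case \<open>x = z\<close> is allowed for a copyable
  variable, since \<open>rm x \<Gamma>\<close> still contains it.\<close>

abbreviation pull2 :: "'v list \<Rightarrow> 'v \<Rightarrow> 'v \<Rightarrow> 'a" where
  "pull2 \<Gamma> x z \<equiv> (Id [ob x] \<boxtimes> pull (rm x \<Gamma>) z) \<circ>\<^sub>s pull \<Gamma> x"

text \<open>By the hexagon, the head wire crosses the two extracted wires one after the other or
  both at once.\<close>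

lemma pull2_Cons:
  assumes "distinct (u # \<Gamma>)" "x \<in> set \<Gamma>" "z \<in> set (rm x \<Gamma>)"
  shows "pull2 (u # \<Gamma>) x z = (sg [ob u] [ob x, ob z] \<boxtimes> J (rm z (rm x \<Gamma>))) \<circ>\<^sub>s (Id [ob u] \<boxtimes> pull2 \<Gamma> x z)"
proof -
  let ?G = "rm z (rm x \<Gamma>)"
  have ne: "u \<noteq> x" "u \<noteq> z" using assms by (auto simp: in_rm)
  have d: "distinct \<Gamma>" "distinct (rm x \<Gamma>)" "distinct (u # rm x \<Gamma>)" "z \<in> set (u # rm x \<Gamma>)"
    using assms by (auto simp: distinct_rm in_rm)
  have "pull2 (u # \<Gamma>) x z =
    (Id [ob x] \<boxtimes> ((sg [ob u] [ob z] \<boxtimes> J ?G) \<circ>\<^sub>s (Id [ob u] \<boxtimes> pull (rm x \<Gamma>) z)))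
    \<circ>\<^sub>s (sg [ob u] [ob x] \<boxtimes> J (rm x \<Gamma>)) \<circ>\<^sub>s (Id [ob u] \<boxtimes> pull \<Gamma> x)"
    using ne by (simp add: rm_Cons)
  also have "\<dots> = (Id [ob x] \<boxtimes> sg [ob u] [ob z] \<boxtimes> J ?G)
    \<circ>\<^sub>s ((Id [ob x, ob u] \<boxtimes> pull (rm x \<Gamma>) z) \<circ>\<^sub>s (sg [ob u] [ob x] \<boxtimes> J (rm x \<Gamma>))) \<circ>\<^sub>s (Id [ob u] \<boxtimes> pull \<Gamma> x)"
    using assms d by (simp add: Id_tns_cmp cmp_assoc tns_assoc[symmetric])
  also have "(Id [ob x, ob u] \<boxtimes> pull (rm x \<Gamma>) z) \<circ>\<^sub>s (sg [ob u] [ob x] \<boxtimes> J (rm x \<Gamma>))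
    = (sg [ob u] [ob x] \<boxtimes> Id (ob z # W ?G)) \<circ>\<^sub>s (Id [ob u, ob x] \<boxtimes> pull (rm x \<Gamma>) z)"
    using assms d by (simp add: interchange)
  also have "(Id [ob x] \<boxtimes> sg [ob u] [ob z] \<boxtimes> J ?G)
      \<circ>\<^sub>s ((sg [ob u] [ob x] \<boxtimes> Id (ob z # W ?G)) \<circ>\<^sub>s (Id [ob u, ob x] \<boxtimes> pull (rm x \<Gamma>) z)) \<circ>\<^sub>s (Id [ob u] \<boxtimes> pull \<Gamma> x)
    = (((Id [ob x] \<boxtimes> sg [ob u] [ob z]) \<boxtimes> J ?G) \<circ>\<^sub>s ((sg [ob u] [ob x] \<boxtimes> Id [ob z]) \<boxtimes> J ?G))
      \<circ>\<^sub>s ((Id [ob u] \<boxtimes> Id [ob x] \<boxtimes> pull (rm x \<Gamma>) z) \<circ>\<^sub>s (Id [ob u] \<boxtimes> pull \<Gamma> x))"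
    using assms d by (simp add: cmp_assoc tns_assoc tns_assoc[symmetric, of "Id [ob u]" "Id [ob x]"])
  also have "\<dots> = (sg [ob u] [ob x, ob z] \<boxtimes> J ?G) \<circ>\<^sub>s (Id [ob u] \<boxtimes> pull2 \<Gamma> x z)"
    using assms d sg_append[of "[ob u]" "[ob x]" "[ob z]"] by (simp add: interchange)
  finally show ?thesis .
qed

text \<open>At the position of \<open>y\<close> this is coassociativity. A wire \<open>x\<close> in
  front of it crosses both copies at once, by naturality of the symmetry, which is the form that
  \<open>pull2_Cons\<close> provides.\<close>

lemma dp_pull:
  assumes "distinct \<Gamma>" "y \<in> set \<Gamma>" "\<not> lin y"
  shows "(dp y \<boxtimes> J \<Gamma>) \<circ>\<^sub>s pull \<Gamma> y = pull2 \<Gamma> y y"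
  using assms
proof (induction \<Gamma>)
  case (Cons x \<Gamma>)
  show ?case
  proof (cases "x = y")
    case True
    have "(dp y \<boxtimes> J (y # \<Gamma>)) \<circ>\<^sub>s (dp y \<boxtimes> J \<Gamma>) = ((dp y \<boxtimes> Id [ob y]) \<boxtimes> J \<Gamma>) \<circ>\<^sub>s (dp y \<boxtimes> J \<Gamma>)"
      using Cons.prems by (simp add: tns_assoc)
    also have "\<dots> = ((dp y \<boxtimes> Id [ob y]) \<circ>\<^sub>s dp y) \<boxtimes> J \<Gamma>"
      using Cons.prems by (simp add: interchange)
    also have "\<dots> = (Id [ob y] \<boxtimes> dp y \<boxtimes> J \<Gamma>) \<circ>\<^sub>s (dp y \<boxtimes> J \<Gamma>)"
      using Cons.prems by (simp add: dp_coassoc interchange flip: tns_assoc)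
    finally show ?thesis using Cons.prems True by (simp add: rm_def)
  next
    case False
    with Cons.prems have y: "y \<in> set \<Gamma>" "distinct \<Gamma>" and rm: "rm y \<Gamma> = \<Gamma>" by (auto simp: rm_def)
    have nat: "(dp y \<boxtimes> Id [ob x]) \<circ>\<^sub>s sg [ob x] [ob y] = sg [ob x] [ob y, ob y] \<circ>\<^sub>s (Id [ob x] \<boxtimes> dp y)"
      using sg_natural[of "Id [ob x]" "dp y"] Cons.prems by simp
    have "(dp y \<boxtimes> J (x # \<Gamma>)) \<circ>\<^sub>s pull (x # \<Gamma>) y
      = ((dp y \<boxtimes> Id [ob x]) \<boxtimes> J \<Gamma>) \<circ>\<^sub>s (sg [ob x] [ob y] \<boxtimes> J \<Gamma>) \<circ>\<^sub>s (Id [ob x] \<boxtimes> pull \<Gamma> y)"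
      using Cons.prems False y by (simp add: tns_assoc rm)
    also have "\<dots> = ((sg [ob x] [ob y, ob y] \<circ>\<^sub>s (Id [ob x] \<boxtimes> dp y)) \<boxtimes> J \<Gamma>) \<circ>\<^sub>s (Id [ob x] \<boxtimes> pull \<Gamma> y)"
      using Cons.prems y by (simp flip: cmp_assoc add: interchange nat rm)
    also have "\<dots> = (sg [ob x] [ob y, ob y] \<boxtimes> J \<Gamma>) \<circ>\<^sub>s (Id [ob x] \<boxtimes> ((dp y \<boxtimes> J \<Gamma>) \<circ>\<^sub>s pull \<Gamma> y))"
      using Cons.prems y by (simp add: tns_cmp_Id Id_tns_cmp cmp_assoc tns_assoc rm)
    also have "\<dots> = pull2 (x # \<Gamma>) y y"
      using pull2_Cons[of x \<Gamma> y y] Cons.prems y by (simp add: Cons.IH rm del: pull.simps)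
    finally show ?thesis .
  qed
qed simp

text \<open>For \<open>x = z\<close> this is cocommutativity, after both extractions have been
  rewritten to a copy by \<open>dp_pull\<close>. For distinct variables it is naturality of the
  symmetry, with real content only where one of them stands at the head.\<close>

lemma pull_swap:
  assumes "distinct \<Gamma>" "x \<in> set \<Gamma>" "z \<in> set (rm x \<Gamma>)"
  shows "(sg [ob x] [ob z] \<boxtimes> J (rm x (rm z \<Gamma>))) \<circ>\<^sub>s pull2 \<Gamma> x z = pull2 \<Gamma> z x"
proof (cases "x = z")
  case True
  with assms have nl: "\<not> lin x" by (auto simp: in_rm)
  then have rm: "rm x \<Gamma> = \<Gamma>" by (simp add: rm_def)
  have "(sg [ob x] [ob x] \<boxtimes> J \<Gamma>) \<circ>\<^sub>s (dp x \<boxtimes> J \<Gamma>) \<circ>\<^sub>s pull \<Gamma> x = (dp x \<boxtimes> J \<Gamma>) \<circ>\<^sub>s pull \<Gamma> x"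
    using assms nl rm by (simp flip: cmp_assoc add: interchange sg_dp)
  with True rm assms nl show ?thesis by (simp add: dp_pull)
next
  case ne: False
  \<comment> \<open>A linear \<open>x\<close> is left in place. A copyable one is first duplicated,
    and naturality of the symmetry at \<open>dp x\<close> together with the second hexagon lets
    \<open>z\<close> cross both copies.\<close>
  have head: "(sg [ob x] [ob z] \<boxtimes> J (rm x (rm z (x # \<Gamma>)))) \<circ>\<^sub>s pull2 (x # \<Gamma>) x z = pull2 (x # \<Gamma>) z x"
    if "distinct (x # \<Gamma>)" "z \<in> set \<Gamma>" "x \<noteq> z" for x z \<Gamma>
  proof (cases "lin x")
    case True
    then have "rm x (x # \<Gamma>) = \<Gamma>" "rm x (x # rm z \<Gamma>) = rm z \<Gamma>"
      using that by (auto simp: rm_def)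
    then show ?thesis using that True by (simp add: rm_Cons in_rm)
  next
    case False
    then have rm: "rm x \<Gamma> = \<Gamma>" for \<Gamma> by (simp add: rm_def)
    let ?G = "rm z \<Gamma>"
    have dist: "distinct \<Gamma>" using that by simp
    have "(sg [ob x] [ob z] \<boxtimes> J (x # ?G)) \<circ>\<^sub>s (Id [ob x] \<boxtimes> ((sg [ob x] [ob z] \<boxtimes> J ?G) \<circ>\<^sub>s (Id [ob x] \<boxtimes> pull \<Gamma> z))) \<circ>\<^sub>s (dp x \<boxtimes> J \<Gamma>)
      = (((sg [ob x] [ob z] \<boxtimes> Id [ob x]) \<boxtimes> J ?G) \<circ>\<^sub>s ((Id [ob x] \<boxtimes> sg [ob x] [ob z]) \<boxtimes> J ?G))
        \<circ>\<^sub>s (Id [ob x, ob x] \<boxtimes> pull \<Gamma> z) \<circ>\<^sub>s (dp x \<boxtimes> J \<Gamma>)"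
      using that False by (simp add: Id_tns_cmp cmp_assoc tns_assoc) (simp add: dist that flip: tns_assoc)
    also have "\<dots> = (sg [ob x, ob x] [ob z] \<boxtimes> J ?G) \<circ>\<^sub>s (dp x \<boxtimes> pull \<Gamma> z)"
      using that False sg_append_left[of "[ob x]" "[ob x]" "[ob z]"] by (simp add: interchange)
    also have "\<dots> = ((sg [ob x, ob x] [ob z] \<circ>\<^sub>s (dp x \<boxtimes> Id [ob z])) \<boxtimes> J ?G) \<circ>\<^sub>s (Id [ob x] \<boxtimes> pull \<Gamma> z)"
      using that False by (simp add: tns_cmp_Id cmp_assoc tns_assoc interchange)
    also have "sg [ob x, ob x] [ob z] \<circ>\<^sub>s (dp x \<boxtimes> Id [ob z]) = (Id [ob z] \<boxtimes> dp x) \<circ>\<^sub>s sg [ob x] [ob z]"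
      using sg_natural[of "dp x" "Id [ob z]"] False by simp
    also have "(((Id [ob z] \<boxtimes> dp x) \<circ>\<^sub>s sg [ob x] [ob z]) \<boxtimes> J ?G) \<circ>\<^sub>s (Id [ob x] \<boxtimes> pull \<Gamma> z)
       = (Id [ob z] \<boxtimes> (dp x \<boxtimes> J ?G)) \<circ>\<^sub>s (sg [ob x] [ob z] \<boxtimes> J ?G) \<circ>\<^sub>s (Id [ob x] \<boxtimes> pull \<Gamma> z)"
      using that False by (simp add: tns_cmp_Id cmp_assoc tns_assoc)
    finally show ?thesis using that False by (simp add: rm_Cons rm)
  qed
  show ?thesis using assms ne
  proof (induction \<Gamma>)
    case (Cons u \<Gamma>)
    consider "u = x" | "u = z" | "u \<noteq> x" "u \<noteq> z" by blast
    then show ?case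
    proof cases
      case 1
      with Cons.prems show ?thesis using head[of x \<Gamma> z] by (auto simp: in_rm)
    next
      \<comment> \<open>The mirror image of \<open>head\<close>, with the roles of \<open>x\<close>
        and \<open>z\<close> exchanged; the remaining symmetry is cancelled by its inverse.\<close>
      case 2
      with Cons.prems have zx: "distinct (z # \<Gamma>)" "x \<in> set \<Gamma>" "z \<noteq> x" by auto
      let ?G = "rm x (rm z (z # \<Gamma>))"
      have d: "distinct (rm z (z # \<Gamma>))" "x \<in> set (rm z (z # \<Gamma>))" "distinct (z # \<Gamma>)"
         "z \<in> set (rm x (z # \<Gamma>))" "x \<in> set (z # \<Gamma>)" "z \<in> set (z # \<Gamma>)" "distinct (rm x (z # \<Gamma>))"
        using zx by (auto simp: in_rm intro: distinct_rm simp del: distinct.simps)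
      have "(sg [ob x] [ob z] \<boxtimes> J ?G) \<circ>\<^sub>s pull2 (z # \<Gamma>) x z
        = (sg [ob x] [ob z] \<boxtimes> J ?G) \<circ>\<^sub>s (sg [ob z] [ob x] \<boxtimes> J ?G) \<circ>\<^sub>s pull2 (z # \<Gamma>) z x"
        using head[OF zx] by (simp add: rm_rm del: pull.simps)
      also have "\<dots> = pull2 (z # \<Gamma>) z x"
        using d by (simp flip: cmp_assoc add: interchange sg_sg del: pull.simps)
      finally show ?thesis using 2 by (simp del: pull.simps)
    next
      case 3
      with Cons.prems have p: "x \<in> set \<Gamma>" "z \<in> set \<Gamma>" "z \<in> set (rm x \<Gamma>)" "x \<in> set (rm z \<Gamma>)" "distinct \<Gamma>"
        "distinct (rm x \<Gamma>)" "distinct (rm z \<Gamma>)" "distinct (u # \<Gamma>)"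
        by (auto simp: in_rm intro: distinct_rm)
      let ?G = "rm x (rm z \<Gamma>)"
      have nat: "(sg [ob x] [ob z] \<boxtimes> Id [ob u]) \<circ>\<^sub>s sg [ob u] [ob x, ob z]
          = sg [ob u] [ob z, ob x] \<circ>\<^sub>s (Id [ob u] \<boxtimes> sg [ob x] [ob z])"
        using sg_natural[of "Id [ob u]" "sg [ob x] [ob z]"] by simp
      have "(sg [ob x] [ob z] \<boxtimes> J (u # ?G)) \<circ>\<^sub>s pull2 (u # \<Gamma>) x z
        = ((sg [ob x] [ob z] \<boxtimes> Id [ob u]) \<boxtimes> J ?G) \<circ>\<^sub>s (sg [ob u] [ob x, ob z] \<boxtimes> J ?G) \<circ>\<^sub>s (Id [ob u] \<boxtimes> pull2 \<Gamma> x z)"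
        using p by (simp add: pull2_Cons tns_assoc rm_rm[of z] del: pull.simps)
      also have "\<dots> = ((sg [ob u] [ob z, ob x] \<circ>\<^sub>s (Id [ob u] \<boxtimes> sg [ob x] [ob z])) \<boxtimes> J ?G) \<circ>\<^sub>s (Id [ob u] \<boxtimes> pull2 \<Gamma> x z)"
        using p by (simp flip: cmp_assoc nat add: interchange rm_rm[of z])
      also have "\<dots> = (sg [ob u] [ob z, ob x] \<boxtimes> J ?G) \<circ>\<^sub>s (Id [ob u] \<boxtimes> ((sg [ob x] [ob z] \<boxtimes> J ?G) \<circ>\<^sub>s pull2 \<Gamma> x z))"
        using p by (simp add: tns_cmp_Id Id_tns_cmp cmp_assoc tns_assoc rm_rm[of z])
      also have "\<dots> = pull2 (u # \<Gamma>) z x"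
        using p 3 Cons by (simp add: pull2_Cons rm_rm[of z] del: pull.simps)
      finally show ?thesis using 3 by (simp add: rm_Cons del: pull.simps)
    qed
  qed simp
qed

section \<open>Permuting the outputs of a structural arrow\<close>

lemma valid_perm: "(\<And>x. count_list ys x = count_list zs x) \<Longrightarrow> valid \<Gamma> ys \<Longrightarrow> valid \<Gamma> zs"
  by (metis (no_types, lifting) count_list_0_iff subset_iff valid_def)

lemma tns_scalar: "ar f \<Longrightarrow> cd f = [] \<Longrightarrow> ar h \<Longrightarrow> dm h = As \<Longrightarrow> h \<circ>\<^sub>s (f \<boxtimes> Id As) = f \<boxtimes> h"
  using tns_factor_right[of f h] by simp

lemma valid_drop: "valid \<Gamma> (us @ ws) \<Longrightarrow> \<forall>x \<in> set us. \<not> lin x \<Longrightarrow> valid \<Gamma> ws"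
  and valid_dup: "valid \<Gamma> (us @ ws) \<Longrightarrow> \<forall>x \<in> set us. \<not> lin x \<Longrightarrow> valid \<Gamma> (us @ us @ ws)"
proof -
  assume *: "valid \<Gamma> (us @ ws)" "\<forall>x \<in> set us. \<not> lin x"
  then have "count_list us x = 0" if "lin x" for x
    using that by (auto simp: count_list_0_iff)
  with * show "valid \<Gamma> ws" "valid \<Gamma> (us @ us @ ws)" by (auto simp: valid_def)
qed

text \<open>\<open>str\<close> peels off the prefix \<open>vs\<close> wire by wire, so an equation
  about the later outputs may be applied behind it. The premises range over all
  \<open>\<Delta>\<close> because the context left after the prefix depends on the linear variables
  that it consumed.\<close>

lemma str_prefix:
  assumes "valid \<Gamma> (vs @ us)" "ar X" "dm X = W us" "ar Y" "dm Y = W us'" "cd Y = cd X"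
    and "\<And>\<Delta>. valid \<Delta> us \<Longrightarrow> valid \<Delta> us'"
    and eq: "\<And>\<Delta>. valid \<Delta> us \<Longrightarrow> X \<circ>\<^sub>s str \<Delta> us = Y \<circ>\<^sub>s str \<Delta> us'"
  shows "(J vs \<boxtimes> X) \<circ>\<^sub>s str \<Gamma> (vs @ us) = (J vs \<boxtimes> Y) \<circ>\<^sub>s str \<Gamma> (vs @ us')"
  using assms(1)
proof (induction vs arbitrary: \<Gamma>)
  case Nil
  then show ?case using assms by simp
next
  case (Cons v vs)
  have valid_app: "valid \<Delta> (vs @ us')" if "valid \<Delta> (vs @ us)" for \<Delta>
    using that
  proof (induction vs arbitrary: \<Delta>)
    case Nil
    then show ?case using assms(7) by simp
  qed (auto simp: valid_Cons)
  from Cons.prems have v: "valid (rm v \<Gamma>) (vs @ us)" "distinct \<Gamma>" "v \<in> set \<Gamma>"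
    by (auto simp: valid_Cons)
  note v' = valid_app[OF v(1)]
  have step: "(J (v # vs) \<boxtimes> Z) \<circ>\<^sub>s str \<Gamma> (v # vs @ ws)
      = (Id [ob v] \<boxtimes> ((J vs \<boxtimes> Z) \<circ>\<^sub>s str (rm v \<Gamma>) (vs @ ws))) \<circ>\<^sub>s pull \<Gamma> v"
    if "ar Z" "dm Z = W ws" "valid (rm v \<Gamma>) (vs @ ws)" for Z ws
  proof -
    have "J (v # vs) \<boxtimes> Z = Id [ob v] \<boxtimes> J vs \<boxtimes> Z" using that by (simp flip: tns_assoc)
    then show ?thesis using that v by (simp add: Id_tns_cmp cmp_assoc)
  qed
  show ?case
    using step[of X us] step[of Y us'] assms v v' Cons.IH[OF v(1)] by simp
qed

text \<open>\<open>pull_swap\<close> exchanges the two extractions, and interchange moves the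
  symmetry past the structural arrow for the remaining outputs.\<close>

lemma str_swap:
  assumes "valid \<Gamma> (x # z # C)"
  shows "(sg [ob x] [ob z] \<boxtimes> J C) \<circ>\<^sub>s str \<Gamma> (x # z # C) = str \<Gamma> (z # x # C)"
proof -
  let ?G = "rm x (rm z \<Gamma>)"
  have G: "rm z (rm x \<Gamma>) = ?G" by (rule rm_rm)
  from assms have v: "distinct \<Gamma>" "x \<in> set \<Gamma>" "z \<in> set (rm x \<Gamma>)" "valid ?G C" "distinct (rm x \<Gamma>)"
    by (auto simp: valid_Cons G)
  then have w: "z \<in> set \<Gamma>" "x \<in> set (rm z \<Gamma>)" "distinct (rm z \<Gamma>)" by (auto simp: in_rm distinct_rm)
  have "(sg [ob x] [ob z] \<boxtimes> J C) \<circ>\<^sub>s str \<Gamma> (x # z # C)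
    = (sg [ob x] [ob z] \<boxtimes> J C) \<circ>\<^sub>s (Id [ob x, ob z] \<boxtimes> str ?G C) \<circ>\<^sub>s pull2 \<Gamma> x z"
    using v by (simp add: Id_tns_cmp cmp_assoc G flip: tns_assoc)
  also have "\<dots> = (Id [ob z, ob x] \<boxtimes> str ?G C) \<circ>\<^sub>s (sg [ob x] [ob z] \<boxtimes> J ?G) \<circ>\<^sub>s pull2 \<Gamma> x z"
    using v by (simp flip: cmp_assoc add: interchange G)
  also have "\<dots> = str \<Gamma> (z # x # C)"
    using v w by (simp add: pull_swap Id_tns_cmp cmp_assoc flip: tns_assoc)
  finally show ?thesis .
qed

lemma str_swap_block1:
  assumes "valid \<Gamma> (x # Zs @ C)"
  shows "(sg [ob x] (W Zs) \<boxtimes> J C) \<circ>\<^sub>s str \<Gamma> (x # Zs @ C) = str \<Gamma> (Zs @ x # C)"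
  using assms
proof (induction Zs arbitrary: \<Gamma>)
  case Nil
  then show ?case by (simp add: sg_Nil_right del: str.simps)
next
  case (Cons z Zs)
  have v: "valid \<Gamma> (z # x # Zs @ C)" "valid \<Gamma> (z # Zs @ x # C)"
    by (rule valid_perm[OF _ Cons.prems]; simp)+
  have "sg [ob x] (W (z # Zs)) = (Id [ob z] \<boxtimes> sg [ob x] (W Zs)) \<circ>\<^sub>s (sg [ob x] [ob z] \<boxtimes> J Zs)"
    using sg_append[of "[ob x]" "[ob z]" "W Zs"] by simp
  then have "(sg [ob x] (W (z # Zs)) \<boxtimes> J C) \<circ>\<^sub>s str \<Gamma> (x # z # Zs @ C)
    = (J [z] \<boxtimes> (sg [ob x] (W Zs) \<boxtimes> J C)) \<circ>\<^sub>s (sg [ob x] [ob z] \<boxtimes> J (Zs @ C)) \<circ>\<^sub>s str \<Gamma> (x # z # Zs @ C)"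
    using Cons.prems by (simp add: tns_cmp_Id cmp_assoc tns_assoc del: str.simps flip: map_append)
  also have "\<dots> = (J [z] \<boxtimes> (sg [ob x] (W Zs) \<boxtimes> J C)) \<circ>\<^sub>s str \<Gamma> ([z] @ x # Zs @ C)"
    using str_swap[of \<Gamma> x z "Zs @ C"] Cons.prems by (simp del: str.simps)
  also have "\<dots> = (J [z] \<boxtimes> J (Zs @ x # C)) \<circ>\<^sub>s str \<Gamma> ([z] @ Zs @ x # C)"
  proof (rule str_prefix)
    show "valid \<Delta> (Zs @ x # C)" if "valid \<Delta> (x # Zs @ C)" for \<Delta>
      by (rule valid_perm[OF _ that]) simp
    then show "(sg [ob x] (W Zs) \<boxtimes> J C) \<circ>\<^sub>s str \<Delta> (x # Zs @ C) = J (Zs @ x # C) \<circ>\<^sub>s str \<Delta> (Zs @ x # C)"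
      if "valid \<Delta> (x # Zs @ C)" for \<Delta>
      using Cons.IH[OF that] that by (simp del: str.simps)
  qed (use v in \<open>auto simp del: str.simps\<close>)
  finally show ?case using v by (simp del: str.simps)
qed

text \<open>The two hexagons build a block symmetry from symmetries of single wires, each of which
  is absorbed by \<open>str_swap_block1\<close>, behind a prefix where necessary.\<close>

lemma str_swap_block:
  assumes "valid \<Gamma> (Xs @ Zs @ C)"
  shows "(sg (W Xs) (W Zs) \<boxtimes> J C) \<circ>\<^sub>s str \<Gamma> (Xs @ Zs @ C) = str \<Gamma> (Zs @ Xs @ C)"
  using assms
proof (induction Xs arbitrary: \<Gamma> C)
  case Nil
  then show ?case by (simp add: sg_Nil_left del: str.simps)
next
  case (Cons x Xs)
  have v: "valid \<Gamma> ([x] @ Zs @ Xs @ C)" "valid \<Gamma> (Zs @ x # Xs @ C)"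
    by (rule valid_perm[OF _ Cons.prems]; simp)+
  have "sg (W (x # Xs)) (W Zs) = (sg [ob x] (W Zs) \<boxtimes> J Xs) \<circ>\<^sub>s (Id [ob x] \<boxtimes> sg (W Xs) (W Zs))"
    using sg_append_left[of "[ob x]" "W Xs" "W Zs"] by simp
  then have "(sg (W (x # Xs)) (W Zs) \<boxtimes> J C) \<circ>\<^sub>s str \<Gamma> (x # Xs @ Zs @ C)
    = (sg [ob x] (W Zs) \<boxtimes> J (Xs @ C)) \<circ>\<^sub>s (J [x] \<boxtimes> (sg (W Xs) (W Zs) \<boxtimes> J C)) \<circ>\<^sub>s str \<Gamma> ([x] @ Xs @ Zs @ C)"
    using Cons.prems by (simp add: tns_cmp_Id cmp_assoc tns_assoc del: str.simps flip: map_append)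
  also have "(J [x] \<boxtimes> (sg (W Xs) (W Zs) \<boxtimes> J C)) \<circ>\<^sub>s str \<Gamma> ([x] @ Xs @ Zs @ C)
    = (J [x] \<boxtimes> J (Zs @ Xs @ C)) \<circ>\<^sub>s str \<Gamma> ([x] @ Zs @ Xs @ C)"
  proof (rule str_prefix)
    show "valid \<Delta> (Zs @ Xs @ C)" if "valid \<Delta> (Xs @ Zs @ C)" for \<Delta>
      by (rule valid_perm[OF _ that]) simp
    then show "(sg (W Xs) (W Zs) \<boxtimes> J C) \<circ>\<^sub>s str \<Delta> (Xs @ Zs @ C) = J (Zs @ Xs @ C) \<circ>\<^sub>s str \<Delta> (Zs @ Xs @ C)"
      if "valid \<Delta> (Xs @ Zs @ C)" for \<Delta>
      using Cons.IH[OF that] that by (simp del: str.simps)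
  qed (use Cons.prems in \<open>auto simp del: str.simps\<close>)
  also have "(sg [ob x] (W Zs) \<boxtimes> J (Xs @ C)) \<circ>\<^sub>s \<dots> = str \<Gamma> (Zs @ x # Xs @ C)"
    using str_swap_block1[of \<Gamma> x Zs "Xs @ C"] v by (simp del: str.simps)
  finally show ?case by (simp del: str.simps)
qed

section \<open>Simultaneous substitution along structural arrows\<close>

primrec gs :: "('v \<Rightarrow> 'a) \<Rightarrow> 'v list \<Rightarrow> 'a" where
  "gs g [] = Id []"
| "gs g (z # zs) = g z \<boxtimes> gs g zs"

abbreviation cc :: "('v \<Rightarrow> 'v list) \<Rightarrow> 'v list \<Rightarrow> 'v list" where
  "cc G zs \<equiv> concat (map G zs)"

text \<open>
  An arrow \<open>g z : G z \<rightarrow> z\<close> may be substituted for \<open>z\<close>; if \<open>z\<close> is not linear, \<open>g z\<close> must commute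
  with copying and discarding, where \<open>\<Gamma>\<close> supplies the inputs of all copies.
\<close>

definition sb :: "('v \<Rightarrow> 'v list) \<Rightarrow> ('v \<Rightarrow> 'a) \<Rightarrow> 'v \<Rightarrow> bool" where
  "sb G g z \<longleftrightarrow> ar (g z) \<and> dm (g z) = W (G z) \<and> cd (g z) = [ob z] \<and>
     (\<not> lin z \<longrightarrow> (\<forall>x \<in> set (G z). \<not> lin x) \<and>
       (\<forall>\<Gamma> C. valid \<Gamma> (G z @ C) \<longrightarrow>
          ((er z \<circ>\<^sub>s g z) \<boxtimes> J C) \<circ>\<^sub>s str \<Gamma> (G z @ C) = str \<Gamma> C \<and>
          ((dp z \<circ>\<^sub>s g z) \<boxtimes> J C) \<circ>\<^sub>s str \<Gamma> (G z @ C) = (g z \<boxtimes> g z \<boxtimes> J C) \<circ>\<^sub>s str \<Gamma> (G z @ G z @ C)))"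

lemma sb_arr: "sb G g z \<Longrightarrow> ar (g z)" "sb G g z \<Longrightarrow> dm (g z) = W (G z)" "sb G g z \<Longrightarrow> cd (g z) = [ob z]"
  by (auto simp: sb_def)

lemma sb_er: "sb G g z \<Longrightarrow> \<not> lin z \<Longrightarrow> valid \<Gamma> (G z @ C)
    \<Longrightarrow> ((er z \<circ>\<^sub>s g z) \<boxtimes> J C) \<circ>\<^sub>s str \<Gamma> (G z @ C) = str \<Gamma> C"
  and sb_dp: "sb G g z \<Longrightarrow> \<not> lin z \<Longrightarrow> valid \<Gamma> (G z @ C)
    \<Longrightarrow> ((dp z \<circ>\<^sub>s g z) \<boxtimes> J C) \<circ>\<^sub>s str \<Gamma> (G z @ C) = (g z \<boxtimes> g z \<boxtimes> J C) \<circ>\<^sub>s str \<Gamma> (G z @ G z @ C)"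
  by (simp_all add: sb_def)

lemma sb_nonlin: "sb G g z \<Longrightarrow> \<not> lin z \<Longrightarrow> \<forall>x \<in> set (G z). \<not> lin x"
  by (simp add: sb_def)

lemma gs_arr: "\<forall>z \<in> set zs. sb G g z \<Longrightarrow> ar (gs g zs) \<and> dm (gs g zs) = W (cc G zs) \<and> cd (gs g zs) = W zs"
  by (induction zs) (auto simp: sb_arr)

lemma gs_append: "\<forall>z \<in> set (ys @ zs). sb G g z \<Longrightarrow> gs g (ys @ zs) = gs g ys \<boxtimes> gs g zs"
proof (induction ys)
  case Nil
  then show ?case using gs_arr by simp
next
  case (Cons y ys)
  then show ?case using gs_arr[of ys G g] gs_arr[of zs G g] by (auto simp: tns_assoc sb_arr)
qed

text \<open>The sum runs over a fixed set \<open>S\<close> instead of the list, so that the counts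
  for two lists over the same variables can be compared term by term.\<close>

lemma count_list_concat:
  assumes "finite S" "set zs \<subseteq> S"
  shows "count_list (cc G zs) x = (\<Sum>z\<in>S. count_list zs z * count_list (G z) x)"
  using assms(2)
proof (induction zs)
  case (Cons z zs)
  have "(\<Sum>y\<in>S. count_list (z # zs) y * count_list (G y) x)
    = (\<Sum>y\<in>S. (if y = z then count_list (G z) x else 0) + count_list zs y * count_list (G y) x)"
    by (rule sum.cong) auto
  also have "\<dots> = count_list (G z) x + (\<Sum>y\<in>S. count_list zs y * count_list (G y) x)"
    using Cons.prems assms(1) by (simp add: sum.distrib)
  finally show ?case using Cons by simp
qed simp

text \<open>Only linear variables are counted, and these come from linear \<open>z\<close> alone.
  Such a \<open>z\<close> occurs once in \<open>zs\<close> and once in \<open>\<Theta>\<close>, so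
  both concatenations contain the same linear variables equally often.\<close>

lemma valid_cc:
  assumes "\<And>z x. z \<in> set \<Theta> \<Longrightarrow> x \<in> set (G z) \<Longrightarrow> lin x \<Longrightarrow> lin z"
    and zs: "valid \<Theta> zs" and "valid \<Gamma> (cc G \<Theta> @ ws)"
  shows "valid \<Gamma> (cc G zs @ ws)"
proof -
  have d: "distinct \<Theta>" "set zs \<subseteq> set \<Theta>" using zs by (auto simp: valid_def)
  have "count_list (cc G zs) x = count_list (cc G \<Theta>) x" if "lin x" for x
  proof -
    have c: "count_list zs z * count_list (G z) x = count_list \<Theta> z * count_list (G z) x" if "z \<in> set \<Theta>" for z
    proof (cases "x \<in> set (G z)")
      case True
      with \<open>lin x\<close> assms(1) that have "lin z" by blast
      then show ?thesis using zs that by (simp add: valid_def count_list_distinct)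
    qed simp
    then show ?thesis
      using d by (subst (1 2) count_list_concat[of "set \<Theta>"]) (auto intro: sum.cong c)
  qed
  with assms(3) d show ?thesis by (auto simp: valid_def)
qed

lemma valid_cc_sb:
  assumes "\<forall>z \<in> set \<Theta>. sb G g z" "valid \<Theta> zs" "valid \<Gamma> (cc G \<Theta> @ ws)"
  shows "valid \<Gamma> (cc G zs @ ws)"
  by (rule valid_cc[OF _ assms(2,3)]) (use assms(1) in \<open>auto simp: sb_def\<close>)

text \<open>Each \<open>g z\<close> is removed together with its eraser by \<open>sb_er\<close>,
  with all later inputs as the spectators \<open>C\<close> of that law.\<close>

lemma subst_erase:
  assumes "\<forall>z \<in> set \<Theta>. sb G g z" "\<forall>z \<in> set \<Theta>. \<not> lin z" "valid \<Gamma> (cc G \<Theta> @ ws)"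
  shows "((erase \<Theta> \<circ>\<^sub>s gs g \<Theta>) \<boxtimes> J ws) \<circ>\<^sub>s str \<Gamma> (cc G \<Theta> @ ws) = str \<Gamma> ws"
  using assms
proof (induction \<Theta>)
  case Nil
  then show ?case by (simp del: str.simps)
next
  case (Cons z \<Theta>)
  let ?f = "(erase \<Theta> \<circ>\<^sub>s gs g \<Theta>) \<boxtimes> J ws" and ?C = "cc G \<Theta> @ ws"
  have a: "ar (gs g \<Theta>)" "dm (gs g \<Theta>) = W (cc G \<Theta>)" "cd (gs g \<Theta>) = W \<Theta>"
    "ar (erase \<Theta>)" "dm (erase \<Theta>) = W \<Theta>" "cd (erase \<Theta>) = []" "\<not> lin z" "sb G g z"
    using gs_arr[of \<Theta> G g] erase_arr[of \<Theta>] Cons.prems by auto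
  note z = sb_arr[OF \<open>sb G g z\<close>]
  have er: "((er z \<circ>\<^sub>s g z) \<boxtimes> J ?C) \<circ>\<^sub>s str \<Gamma> (G z @ ?C) = str \<Gamma> ?C"
    using sb_er[OF \<open>sb G g z\<close>, of \<Gamma> ?C] a Cons.prems by simp
  have v: "valid \<Gamma> ?C"
    using valid_drop[of \<Gamma> "G z" ?C] Cons.prems sb_nonlin[OF \<open>sb G g z\<close>] a by simp
  have "?f \<circ>\<^sub>s ((er z \<circ>\<^sub>s g z) \<boxtimes> J ?C) = (er z \<circ>\<^sub>s g z) \<boxtimes> ?f"
    by (rule tns_scalar) (use a z in simp_all)
  then have "((erase (z # \<Theta>) \<circ>\<^sub>s gs g (z # \<Theta>)) \<boxtimes> J ws) \<circ>\<^sub>s str \<Gamma> (G z @ ?C)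
    = ?f \<circ>\<^sub>s ((er z \<circ>\<^sub>s g z) \<boxtimes> J ?C) \<circ>\<^sub>s str \<Gamma> (G z @ ?C)"
    using Cons.prems a z
    by (simp flip: cmp_assoc map_append add: interchange tns_assoc del: str.simps)
  also have "\<dots> = str \<Gamma> ws"
    unfolding er using Cons v by simp
  finally show ?case by (simp del: str.simps)
qed

text \<open>If \<open>z\<close> is the head, this is the copying law in \<open>sb\<close>, or
  trivial for a linear \<open>z\<close>. A different head \<open>x\<close> is crossed by naturality:
  the symmetry of the two wires becomes the symmetry of the blocks \<open>G x\<close> and
  \<open>G z\<close>, which \<open>str\<close> absorbs.\<close>

lemma subst_pull:
  assumes "\<forall>z \<in> set \<Theta>. sb G g z" "distinct \<Theta>" "z \<in> set \<Theta>" "valid \<Gamma> (cc G \<Theta> @ ws)"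
  shows "((pull \<Theta> z \<circ>\<^sub>s gs g \<Theta>) \<boxtimes> J ws) \<circ>\<^sub>s str \<Gamma> (cc G \<Theta> @ ws)
    = (gs g (z # rm z \<Theta>) \<boxtimes> J ws) \<circ>\<^sub>s str \<Gamma> (cc G (z # rm z \<Theta>) @ ws)"
  using assms
proof (induction \<Theta> arbitrary: \<Gamma>)
  case (Cons x \<Theta>)
  let ?C = "cc G \<Theta> @ ws"
  have gsT: "ar (gs g \<Theta>)" "dm (gs g \<Theta>) = W (cc G \<Theta>)" "cd (gs g \<Theta>) = W \<Theta>"
    using gs_arr[of \<Theta> G g] Cons.prems by auto
  have sx: "sb G g x" using Cons.prems by simp
  note x = sb_arr[OF sx]
  show ?case
  proof (cases "x = z")
    case True
    show ?thesis
    proof (cases "lin z")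
      case True
      then have "rm z (x # \<Theta>) = \<Theta>" using Cons.prems \<open>x = z\<close> by (simp add: rm_Cons_self)
      then show ?thesis using \<open>x = z\<close> True gsT x by (simp del: str.simps)
    next
      case False
      have dp: "((dp z \<circ>\<^sub>s g z) \<boxtimes> J ?C) \<circ>\<^sub>s str \<Gamma> (G z @ ?C) = (g z \<boxtimes> g z \<boxtimes> J ?C) \<circ>\<^sub>s str \<Gamma> (G z @ G z @ ?C)"
        using sb_dp[OF sx, of \<Gamma> ?C] True False Cons.prems by simp
      have v: "valid \<Gamma> (G z @ G z @ ?C)"
        using valid_dup[of \<Gamma> "G z" ?C] Cons.prems sb_nonlin[OF sx] True False by simp
      have "((pull (x # \<Theta>) z \<circ>\<^sub>s gs g (x # \<Theta>)) \<boxtimes> J ws) \<circ>\<^sub>s str \<Gamma> (G z @ ?C)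
        = (Id [ob z, ob z] \<boxtimes> gs g \<Theta> \<boxtimes> J ws) \<circ>\<^sub>s ((dp z \<circ>\<^sub>s g z) \<boxtimes> J ?C) \<circ>\<^sub>s str \<Gamma> (G z @ ?C)"
        using True False Cons.prems gsT x
        by (simp flip: cmp_assoc map_append add: interchange tns_assoc del: str.simps)
      also have "\<dots> = (g z \<boxtimes> g z \<boxtimes> gs g \<Theta> \<boxtimes> J ws) \<circ>\<^sub>s str \<Gamma> (G z @ G z @ ?C)"
      proof -
        have "(Id [ob z, ob z] \<boxtimes> gs g \<Theta> \<boxtimes> J ws) \<circ>\<^sub>s ((g z \<boxtimes> g z) \<boxtimes> J ?C) = (g z \<boxtimes> g z) \<boxtimes> gs g \<Theta> \<boxtimes> J ws"
          using True gsT x by (simp add: interchange)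
        then have "(Id [ob z, ob z] \<boxtimes> gs g \<Theta> \<boxtimes> J ws) \<circ>\<^sub>s (g z \<boxtimes> g z \<boxtimes> J ?C) = g z \<boxtimes> g z \<boxtimes> gs g \<Theta> \<boxtimes> J ws"
          using True gsT x by (simp add: tns_assoc)
        then show ?thesis
          unfolding dp using True gsT x v by (simp flip: cmp_assoc map_append del: str.simps)
      qed
      finally show ?thesis using True False Cons.prems gsT x
        by (simp add: rm_def tns_assoc del: str.simps)
    qed
  next
    case False
    with Cons.prems have z: "z \<in> set \<Theta>" "distinct \<Theta>" "sb G g z" by auto
    note za = sb_arr[OF z(3)]
    let ?R = "rm z \<Theta>" and ?D = "cc G (rm z \<Theta>) @ ws"
    have gsR: "ar (gs g ?R)" "dm (gs g ?R) = W (cc G ?R)" "cd (gs g ?R) = W ?R"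
      using gs_arr[of ?R G g] Cons.prems by (auto simp: in_rm)
    have vR: "valid \<Theta> (z # ?R)" using z by (auto simp: valid_Cons intro!: valid_self distinct_rm)
    have v: "valid \<Gamma> (G x @ G z @ ?D)"
    proof -
      have "valid (x # \<Theta>) (x # z # ?R)"
        using vR Cons.prems False by (auto simp: valid_def count_list_0_iff in_rm)
      from valid_cc_sb[OF _ this] Cons.prems show ?thesis by fastforce
    qed
    have v2: "valid \<Gamma> (G z @ G x @ ?D)" by (rule valid_perm[OF _ v]) simp
    have "pull (x # \<Theta>) z \<circ>\<^sub>s gs g (x # \<Theta>)
      = (sg [ob x] [ob z] \<boxtimes> J ?R) \<circ>\<^sub>s (g x \<boxtimes> J (z # ?R)) \<circ>\<^sub>s (J (G x) \<boxtimes> (pull \<Theta> z \<circ>\<^sub>s gs g \<Theta>))"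
      using False z Cons.prems gsT x by (simp add: cmp_assoc interchange)
    then have "((pull (x # \<Theta>) z \<circ>\<^sub>s gs g (x # \<Theta>)) \<boxtimes> J ws) \<circ>\<^sub>s str \<Gamma> (G x @ ?C)
      = (sg [ob x] [ob z] \<boxtimes> J (?R @ ws)) \<circ>\<^sub>s (g x \<boxtimes> J (z # ?R @ ws))
         \<circ>\<^sub>s (J (G x) \<boxtimes> ((pull \<Theta> z \<circ>\<^sub>s gs g \<Theta>) \<boxtimes> J ws)) \<circ>\<^sub>s str \<Gamma> (G x @ ?C)"
      using False z Cons.prems gsT x
      by (simp add: tns_cmp_Id cmp_assoc tns_assoc del: str.simps pull.simps gs.simps flip: map_append)
    \<comment> \<open>The induction hypothesis is used behind the prefix \<open>G x\<close>, in
      whatever context that prefix leaves; this is why \<open>\<Gamma>\<close> is arbitrary in the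
      induction.\<close>
    also have "(J (G x) \<boxtimes> ((pull \<Theta> z \<circ>\<^sub>s gs g \<Theta>) \<boxtimes> J ws)) \<circ>\<^sub>s str \<Gamma> (G x @ ?C)
      = (J (G x) \<boxtimes> (gs g (z # ?R) \<boxtimes> J ws)) \<circ>\<^sub>s str \<Gamma> (G x @ cc G (z # ?R) @ ws)"
    proof (rule str_prefix)
      show "valid \<Delta> (cc G (z # ?R) @ ws)" if "valid \<Delta> ?C" for \<Delta>
        using valid_cc_sb[OF _ vR that, of g] Cons.prems by simp
    qed (use Cons gsT gsR z za in \<open>auto simp del: str.simps\<close>)
    also have "(sg [ob x] [ob z] \<boxtimes> J (?R @ ws)) \<circ>\<^sub>s (g x \<boxtimes> J (z # ?R @ ws)) \<circ>\<^sub>s \<dots>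
      = ((sg [ob x] [ob z] \<circ>\<^sub>s (g x \<boxtimes> g z)) \<boxtimes> gs g ?R \<boxtimes> J ws) \<circ>\<^sub>s str \<Gamma> (G x @ G z @ ?D)"
      using v z za x gsR
    proof -
      have "(sg [ob x] [ob z] \<boxtimes> J (?R @ ws)) \<circ>\<^sub>s (g x \<boxtimes> J (z # ?R @ ws)) \<circ>\<^sub>s (J (G x) \<boxtimes> (gs g (z # ?R) \<boxtimes> J ws))
        = (sg [ob x] [ob z] \<boxtimes> J (?R @ ws)) \<circ>\<^sub>s ((g x \<boxtimes> g z) \<boxtimes> (gs g ?R \<boxtimes> J ws))"
        using z za x gsR by (simp add: interchange tns_assoc)
      also have "\<dots> = (sg [ob x] [ob z] \<circ>\<^sub>s (g x \<boxtimes> g z)) \<boxtimes> gs g ?R \<boxtimes> J ws"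
        using z za x gsR by (simp add: interchange)
      finally show ?thesis
        using v z za x gsR by (simp flip: cmp_assoc map_append del: str.simps)
    qed
    \<comment> \<open>Naturality trades the symmetry on outputs for one on input blocks, ready for
      \<open>str_swap_block\<close>.\<close>
    also have "sg [ob x] [ob z] \<circ>\<^sub>s (g x \<boxtimes> g z) = (g z \<boxtimes> g x) \<circ>\<^sub>s sg (W (G x)) (W (G z))"
      using sg_natural[of "g x" "g z"] x za by simp
    also have "(\<dots> \<boxtimes> gs g ?R \<boxtimes> J ws) \<circ>\<^sub>s str \<Gamma> (G x @ G z @ ?D)
      = ((g z \<boxtimes> g x) \<boxtimes> gs g ?R \<boxtimes> J ws) \<circ>\<^sub>s (sg (W (G x)) (W (G z)) \<boxtimes> J ?D) \<circ>\<^sub>s str \<Gamma> (G x @ G z @ ?D)"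
      using v z za x gsR
      by (simp flip: cmp_assoc map_append add: interchange del: str.simps)
    also have "\<dots> = (gs g (z # rm z (x # \<Theta>)) \<boxtimes> J ws) \<circ>\<^sub>s str \<Gamma> (cc G (z # rm z (x # \<Theta>)) @ ws)"
      unfolding str_swap_block[OF v] using v2 z za x gsR False
      by (simp add: rm_Cons tns_assoc del: str.simps)
    finally show ?thesis by (simp del: str.simps pull.simps)
  qed
qed simp

text \<open>One extraction at a time: \<open>subst_pull\<close> moves the substitution past it, and
  the rest follows behind the prefix \<open>G z\<close>. The spectator wires \<open>ws\<close> make
  the law usable on one factor of a tensor, as in \<open>str_str2\<close>.\<close>

lemma subst_str_ws:
  assumes "\<forall>z \<in> set \<Theta>. sb G g z" "valid \<Theta> zs" "valid \<Gamma> (cc G \<Theta> @ ws)"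
  shows "((str \<Theta> zs \<circ>\<^sub>s gs g \<Theta>) \<boxtimes> J ws) \<circ>\<^sub>s str \<Gamma> (cc G \<Theta> @ ws)
    = (gs g zs \<boxtimes> J ws) \<circ>\<^sub>s str \<Gamma> (cc G zs @ ws)"
  using assms
proof (induction zs arbitrary: \<Theta> \<Gamma>)
  case Nil
  then have "valid \<Gamma> ws" using valid_cc_sb[of \<Theta> G g "[]" \<Gamma> ws] by simp
  then show ?case using Nil subst_erase[of \<Theta> G g \<Gamma> ws] by (simp add: valid_Nil)
next
  case (Cons z zs)
  let ?R = "rm z \<Theta>"
  from Cons.prems have z: "distinct \<Theta>" "z \<in> set \<Theta>" "valid ?R zs" "sb G g z" "\<forall>y \<in> set ?R. sb G g y"
    by (auto simp: valid_Cons in_rm)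
  have gsT: "ar (gs g \<Theta>)" "dm (gs g \<Theta>) = W (cc G \<Theta>)" "cd (gs g \<Theta>) = W \<Theta>"
    and gsR: "ar (gs g ?R)" "dm (gs g ?R) = W (cc G ?R)" "cd (gs g ?R) = W ?R"
    and gsz: "ar (gs g zs)" "dm (gs g zs) = W (cc G zs)" "cd (gs g zs) = W zs"
    using gs_arr[of \<Theta> G g] gs_arr[of ?R G g] gs_arr[of zs G g] Cons.prems
    by (auto simp: in_rm valid_def)
  note za = sb_arr[OF z(4)]
  have vR: "valid \<Theta> (z # ?R)" using z by (auto simp: valid_Cons intro!: valid_self distinct_rm)
  have v: "valid \<Gamma> (G z @ cc G ?R @ ws)" using valid_cc_sb[OF _ vR, where g = g] Cons.prems by simp
  have v2: "valid \<Gamma> (G z @ cc G zs @ ws)" using valid_cc_sb[OF _ Cons.prems(2), where g = g] Cons.prems by simp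
  have "((str \<Theta> (z # zs) \<circ>\<^sub>s gs g \<Theta>) \<boxtimes> J ws) \<circ>\<^sub>s str \<Gamma> (cc G \<Theta> @ ws)
    = (Id [ob z] \<boxtimes> str ?R zs \<boxtimes> J ws) \<circ>\<^sub>s ((pull \<Theta> z \<circ>\<^sub>s gs g \<Theta>) \<boxtimes> J ws) \<circ>\<^sub>s str \<Gamma> (cc G \<Theta> @ ws)"
    unfolding str.simps using Cons.prems z gsT
    by (simp add: cmp_assoc tns_cmp_Id tns_assoc del: str.simps flip: map_append)
  also have "\<dots> = (Id [ob z] \<boxtimes> str ?R zs \<boxtimes> J ws) \<circ>\<^sub>s (gs g (z # ?R) \<boxtimes> J ws) \<circ>\<^sub>s str \<Gamma> (cc G (z # ?R) @ ws)"
    using subst_pull[of \<Theta> G g z \<Gamma> ws] Cons.prems z by simp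
  also have "\<dots> = (g z \<boxtimes> J (zs @ ws)) \<circ>\<^sub>s (J (G z) \<boxtimes> ((str ?R zs \<circ>\<^sub>s gs g ?R) \<boxtimes> J ws)) \<circ>\<^sub>s str \<Gamma> (G z @ cc G ?R @ ws)"
    using v z gsR za
    by (simp flip: cmp_assoc map_append add: interchange tns_assoc del: str.simps)
  also have "(J (G z) \<boxtimes> ((str ?R zs \<circ>\<^sub>s gs g ?R) \<boxtimes> J ws)) \<circ>\<^sub>s str \<Gamma> (G z @ cc G ?R @ ws)
    = (J (G z) \<boxtimes> (gs g zs \<boxtimes> J ws)) \<circ>\<^sub>s str \<Gamma> (G z @ cc G zs @ ws)"
  proof (rule str_prefix)
    show "valid \<Delta> (cc G zs @ ws)" if "valid \<Delta> (cc G ?R @ ws)" for \<Delta>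
      using valid_cc_sb[OF z(5,3) that] .
  qed (use Cons.IH[OF z(5,3)] v gsR gsz z in \<open>auto simp del: str.simps\<close>)
  also have "(g z \<boxtimes> J (zs @ ws)) \<circ>\<^sub>s \<dots> = (gs g (z # zs) \<boxtimes> J ws) \<circ>\<^sub>s str \<Gamma> (cc G (z # zs) @ ws)"
    using v2 z gsz za
    by (simp flip: cmp_assoc map_append add: interchange tns_assoc del: str.simps)
  finally show ?case .
qed

lemma subst_str:
  assumes "\<forall>z \<in> set \<Theta>. sb G g z" "valid \<Theta> zs" "valid \<Gamma> (cc G \<Theta>)"
  shows "str \<Theta> zs \<circ>\<^sub>s gs g \<Theta> \<circ>\<^sub>s str \<Gamma> (cc G \<Theta>) = gs g zs \<circ>\<^sub>s str \<Gamma> (cc G zs)"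
proof -
  have "set zs \<subseteq> set \<Theta>" using assms by (simp add: valid_def)
  then show ?thesis
  using subst_str_ws[of \<Theta> G g zs \<Gamma> "[]"] assms gs_arr[of \<Theta> G g] gs_arr[of zs G g]
  by (auto simp: subset_iff cmp_assoc)
qed

text \<open>\<open>er_pull\<close> and \<open>dp_pull\<close> say that the identity commutes with
  discarding and copying. Renamings and the composition of structural arrows thereby become
  instances of substitution.\<close>

lemma sb_ident: "sb (\<lambda>z. [z]) (\<lambda>z. Id [ob z]) z"
proof -
  have "(er z \<boxtimes> J C) \<circ>\<^sub>s str \<Gamma> (z # C) = str \<Gamma> C"
    "(dp z \<boxtimes> J C) \<circ>\<^sub>s str \<Gamma> (z # C) = str \<Gamma> (z # z # C)"
    if "valid \<Gamma> (z # C)" "\<not> lin z" for \<Gamma> C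
  proof -
    from that have v: "valid \<Gamma> C" "distinct \<Gamma>" "z \<in> set \<Gamma>" and rm: "rm z \<Gamma> = \<Gamma>"
      by (auto simp: valid_Cons rm_def)
    have "(er z \<boxtimes> J C) \<circ>\<^sub>s str \<Gamma> (z # C) = str \<Gamma> C \<circ>\<^sub>s (er z \<boxtimes> J \<Gamma>) \<circ>\<^sub>s pull \<Gamma> z"
      using v that by (simp flip: cmp_assoc add: interchange rm tns_scalar)
    then show "(er z \<boxtimes> J C) \<circ>\<^sub>s str \<Gamma> (z # C) = str \<Gamma> C"
      using v that by (simp add: er_pull)
    have "(dp z \<boxtimes> J C) \<circ>\<^sub>s str \<Gamma> (z # C) = (Id [ob z, ob z] \<boxtimes> str \<Gamma> C) \<circ>\<^sub>s (dp z \<boxtimes> J \<Gamma>) \<circ>\<^sub>s pull \<Gamma> z"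
      using v that by (simp flip: cmp_assoc add: interchange rm)
    also have "\<dots> = str \<Gamma> (z # z # C)"
      using v that by (simp add: dp_pull rm Id_tns_cmp cmp_assoc flip: tns_assoc)
    finally show "(dp z \<boxtimes> J C) \<circ>\<^sub>s str \<Gamma> (z # C) = str \<Gamma> (z # z # C)" .
  qed
  moreover have "valid \<Gamma> (z # z # C)" if "valid \<Gamma> (z # C)" "\<not> lin z" for \<Gamma> C
    using that by (auto simp: valid_def)
  ultimately show ?thesis by (simp add: sb_def del: str.simps)
qed

section \<open>Composition and tensor of structural arrows\<close>

lemma gs_ident: "gs (\<lambda>z. Id [ob z]) zs = J zs"
  by (induction zs) auto

text \<open>Substituting every variable for itself in \<open>subst_str_ws\<close> yields the
  composition law of structural arrows.\<close>

lemma str_str_ws: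
  assumes "valid \<Delta> zs" "valid \<Gamma> (\<Delta> @ ws)"
  shows "(str \<Delta> zs \<boxtimes> J ws) \<circ>\<^sub>s str \<Gamma> (\<Delta> @ ws) = str \<Gamma> (zs @ ws)"
proof -
  have "valid \<Gamma> (zs @ ws)"
    using valid_cc_sb[of \<Delta> "\<lambda>z. [z]" _ zs \<Gamma> ws] assms sb_ident by auto
  then show ?thesis
    using subst_str_ws[of \<Delta> "\<lambda>z. [z]" "\<lambda>z. Id [ob z]" zs \<Gamma> ws] assms
    by (simp add: sb_ident gs_ident)
qed

lemma valid_trans: "valid \<Delta> zs \<Longrightarrow> valid \<Gamma> (\<Delta> @ ws) \<Longrightarrow> valid \<Gamma> (zs @ ws)"
  using valid_cc_sb[of \<Delta> "\<lambda>z. [z]" _ zs \<Gamma> ws] sb_ident by auto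

lemma valid_trans2: "valid \<Delta>1 zs1 \<Longrightarrow> valid \<Delta>2 zs2 \<Longrightarrow> valid \<Gamma> (\<Delta>1 @ \<Delta>2) \<Longrightarrow> valid \<Gamma> (zs1 @ zs2)"
proof -
  assume *: "valid \<Delta>1 zs1" "valid \<Delta>2 zs2" "valid \<Gamma> (\<Delta>1 @ \<Delta>2)"
  have "valid \<Gamma> (\<Delta>2 @ zs1)" by (rule valid_perm[OF _ valid_trans[OF *(1,3)]]) simp
  from valid_trans[OF *(2) this] show ?thesis by (rule valid_perm[rotated]) simp
qed

lemma str_str: "valid \<Delta> zs \<Longrightarrow> valid \<Gamma> \<Delta> \<Longrightarrow> str \<Delta> zs \<circ>\<^sub>s str \<Gamma> \<Delta> = str \<Gamma> zs"
  using str_str_ws[of \<Delta> zs \<Gamma> "[]"] by simp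

text \<open>The right factor is composed behind the prefix \<open>\<Delta>1\<close>, then the left
  one with \<open>zs2\<close> as spectators.\<close>

lemma str_str2:
  assumes "valid \<Delta>1 zs1" "valid \<Delta>2 zs2" "valid \<Gamma> (\<Delta>1 @ \<Delta>2)"
  shows "(str \<Delta>1 zs1 \<boxtimes> str \<Delta>2 zs2) \<circ>\<^sub>s str \<Gamma> (\<Delta>1 @ \<Delta>2) = str \<Gamma> (zs1 @ zs2)"
proof -
  have v: "valid \<Gamma> (\<Delta>1 @ zs2)"
  proof -
    have "valid \<Gamma> (\<Delta>2 @ \<Delta>1)" by (rule valid_perm[OF _ assms(3)]) simp
    from valid_trans[OF assms(2) this] show ?thesis by (rule valid_perm[rotated]) simp
  qed
  have "(J \<Delta>1 \<boxtimes> str \<Delta>2 zs2) \<circ>\<^sub>s str \<Gamma> (\<Delta>1 @ \<Delta>2) = (J \<Delta>1 \<boxtimes> J zs2) \<circ>\<^sub>s str \<Gamma> (\<Delta>1 @ zs2)"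
  proof (rule str_prefix)
    show *: "valid \<Delta> zs2" if "valid \<Delta> \<Delta>2" for \<Delta>
      using valid_trans[of \<Delta>2 zs2 \<Delta> "[]"] assms that by simp
    show "str \<Delta>2 zs2 \<circ>\<^sub>s str \<Delta> \<Delta>2 = J zs2 \<circ>\<^sub>s str \<Delta> zs2" if "valid \<Delta> \<Delta>2" for \<Delta>
      using *[OF that] str_str[OF assms(2) that] by simp
  qed (use assms in auto)
  then have "(str \<Delta>1 zs1 \<boxtimes> str \<Delta>2 zs2) \<circ>\<^sub>s str \<Gamma> (\<Delta>1 @ \<Delta>2) = (str \<Delta>1 zs1 \<boxtimes> J zs2) \<circ>\<^sub>s str \<Gamma> (\<Delta>1 @ zs2)"
    using assms v by (simp add: tns_factor_left[of "str \<Delta>1 zs1" "str \<Delta>2 zs2"] cmp_assoc)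
  also have "\<dots> = str \<Gamma> (zs1 @ zs2)" by (rule str_str_ws[OF assms(1) v])
  finally show ?thesis .
qed

lemma str_weaken_Cons:
  assumes "\<not> lin x" "x \<notin> set \<Gamma>" "valid \<Gamma> ys"
  shows "str (x # \<Gamma>) ys = er x \<boxtimes> str \<Gamma> ys"
  using assms
proof (induction ys arbitrary: \<Gamma>)
  case (Cons y ys)
  let ?R = "rm y \<Gamma>"
  from Cons.prems have v: "distinct \<Gamma>" "y \<in> set \<Gamma>" "valid ?R ys" "x \<noteq> y" by (auto simp: valid_Cons)
  have nat: "(Id [ob y] \<boxtimes> er x) \<circ>\<^sub>s sg [ob x] [ob y] = er x \<boxtimes> Id [ob y]"
    using sg_natural[of "er x" "Id [ob y]"] Cons.prems by (simp add: sg_Nil_left)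
  have "str (x # \<Gamma>) (y # ys)
    = ((Id [ob y] \<boxtimes> er x) \<boxtimes> str ?R ys) \<circ>\<^sub>s (sg [ob x] [ob y] \<boxtimes> J ?R) \<circ>\<^sub>s (Id [ob x] \<boxtimes> pull \<Gamma> y)"
    using v Cons.prems Cons.IH[of ?R] by (auto simp: rm_Cons in_rm tns_assoc)
  also have "\<dots> = ((er x \<boxtimes> Id [ob y]) \<boxtimes> str ?R ys) \<circ>\<^sub>s (Id [ob x] \<boxtimes> pull \<Gamma> y)"
    using v Cons.prems by (simp flip: cmp_assoc nat add: interchange)
  also have "\<dots> = er x \<boxtimes> str \<Gamma> (y # ys)"
    using v Cons.prems by (simp add: interchange tns_assoc)
  finally show ?case .
qed simp

text \<open>A copyable head is copied once and its leftover is erased by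
  \<open>str_weaken_Cons\<close>, so a counit law closes the induction.\<close>

lemma str_self: "distinct \<Gamma> \<Longrightarrow> str \<Gamma> \<Gamma> = J \<Gamma>"
proof (induction \<Gamma>)
  case (Cons x \<Gamma>)
  show ?case
  proof (cases "lin x")
    case True
    then show ?thesis using Cons by (simp add: rm_Cons_self)
  next
    case False
    then have "str (x # \<Gamma>) (x # \<Gamma>) = (Id [ob x] \<boxtimes> er x \<boxtimes> J \<Gamma>) \<circ>\<^sub>s (dp x \<boxtimes> J \<Gamma>)"
      using Cons by (simp add: rm_def str_weaken_Cons valid_self)
    also have "\<dots> = ((Id [ob x] \<boxtimes> er x) \<circ>\<^sub>s dp x) \<boxtimes> J \<Gamma>"
      using False by (simp add: interchange flip: tns_assoc)
    \<comment> \<open>Cocommutativity turns the counit law on the right into the one on the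
      left.\<close>
    also have "(Id [ob x] \<boxtimes> er x) \<circ>\<^sub>s dp x = (Id [ob x] \<boxtimes> er x) \<circ>\<^sub>s sg [ob x] [ob x] \<circ>\<^sub>s dp x"
      using False by (simp add: sg_dp)
    also have "\<dots> = (er x \<boxtimes> Id [ob x]) \<circ>\<^sub>s dp x"
      using False sg_natural[of "er x" "Id [ob x]"] by (simp flip: cmp_assoc add: sg_Nil_left)
    finally show ?thesis using False by (simp add: er_dp)
  qed
qed simp

text \<open>The structural arrow from \<open>\<Gamma>1 @ \<Gamma>2\<close> to itself is the
  identity, so precomposing with it in \<open>str_str2\<close> changes nothing.\<close>

lemma str_split:
  assumes "valid \<Gamma>1 ys1" "valid \<Gamma>2 ys2" "set \<Gamma>1 \<inter> set \<Gamma>2 = {}"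
  shows "str (\<Gamma>1 @ \<Gamma>2) (ys1 @ ys2) = str \<Gamma>1 ys1 \<boxtimes> str \<Gamma>2 ys2"
proof -
  have "distinct (\<Gamma>1 @ \<Gamma>2)" using assms by (auto simp: valid_def)
  then show ?thesis
    using str_str2[OF assms(1,2) valid_self] str_self assms by (simp del: map_append flip: tns_J(2))
qed

lemma valid_append_split:
  assumes "valid \<Gamma>1 ys1" "valid \<Gamma>2 ys2" "set \<Gamma>1 \<inter> set \<Gamma>2 = {}"
  shows "valid (\<Gamma>1 @ \<Gamma>2) (ys1 @ ys2)"
  using assms by (intro valid_trans2[OF assms(1,2) valid_self]) (auto simp: valid_def)

section \<open>Exchange, contraction and weakening as structural arrows\<close>

lemma str_exchange:
  assumes "distinct (\<Gamma> @ y # x # \<Delta>)"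
  shows "str (\<Gamma> @ y # x # \<Delta>) (\<Gamma> @ x # y # \<Delta>) = J \<Gamma> \<boxtimes> sg [ob y] [ob x] \<boxtimes> J \<Delta>"
proof -
  have "valid [y, x] [y, x]" using assms by (intro valid_self) simp
  then have 1: "str [y, x] [x, y] = sg [ob y] [ob x]"
    using str_swap[of "[y, x]" y x "[]"] assms by (simp add: str_self del: str.simps)
  have v: "valid [y, x] [x, y]" by (rule valid_perm[OF _ \<open>valid [y, x] [y, x]\<close>]) simp
  have d: "valid \<Gamma> \<Gamma>" "valid \<Delta> \<Delta>" using assms by (auto intro: valid_self)
  have "str (\<Gamma> @ [y, x] @ \<Delta>) (\<Gamma> @ [x, y] @ \<Delta>) = str \<Gamma> \<Gamma> \<boxtimes> str ([y, x] @ \<Delta>) ([x, y] @ \<Delta>)"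
    using assms d v by (intro str_split valid_append_split) auto
  also have "\<dots> = str \<Gamma> \<Gamma> \<boxtimes> str [y, x] [x, y] \<boxtimes> str \<Delta> \<Delta>"
    using assms d v by (subst str_split) auto
  finally show ?thesis using assms 1 by (simp add: str_self del: str.simps)
qed

lemma str_contract_single: "\<not> lin x \<Longrightarrow> str [x] [x, x] = dp x"
  using str_self[of "[x]"] by (simp add: rm_def)

lemma valid_contract: "distinct (\<Gamma> @ [x]) \<Longrightarrow> \<not> lin x \<Longrightarrow> valid (\<Gamma> @ [x]) (\<Gamma> @ [x, x])"
  by (rule valid_append_split) (auto simp: valid_self, simp add: valid_def)

lemma str_contract:
  assumes "distinct (\<Gamma> @ [x])" "\<not> lin x"
  shows "str (\<Gamma> @ [x]) (\<Gamma> @ [x, x]) = J \<Gamma> \<boxtimes> dp x"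
proof -
  have "valid [x] [x, x]" using assms by (simp add: valid_def)
  with assms show ?thesis
    by (subst str_split) (auto simp: valid_self str_self str_contract_single simp del: str.simps)
qed

lemma valid_weaken: "distinct (\<Gamma> @ [x]) \<Longrightarrow> \<not> lin x \<Longrightarrow> valid (\<Gamma> @ [x]) \<Gamma>"
  using valid_append_split[of \<Gamma> \<Gamma> "[x]" "[]"] by (auto simp: valid_self valid_Nil)

lemma str_weaken:
  assumes "distinct (\<Gamma> @ [x])" "\<not> lin x"
  shows "str (\<Gamma> @ [x]) \<Gamma> = J \<Gamma> \<boxtimes> er x"
  using assms str_split[of \<Gamma> \<Gamma> "[x]" "[]"] by (auto simp: valid_self valid_Nil str_self)

text \<open>The comonoid of a context built up one variable at a time: the second copy of
  \<open>x\<close> has to cross the first copy of \<open>\<Gamma>\<close>. This is the crossing that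
  \<open>mid\<close> performs in the law for \<open>dup\<close> on a tensor.\<close>

lemma str_dup_Cons:
  assumes "distinct (x # \<Gamma>)" "\<forall>y \<in> set (x # \<Gamma>). \<not> lin y"
  shows "str (x # \<Gamma>) ((x # \<Gamma>) @ x # \<Gamma>) = (Id [ob x] \<boxtimes> sg [ob x] (W \<Gamma>) \<boxtimes> J \<Gamma>) \<circ>\<^sub>s (dp x \<boxtimes> str \<Gamma> (\<Gamma> @ \<Gamma>))"
proof -
  have v: "valid [x] [x, x]" "valid \<Gamma> (\<Gamma> @ \<Gamma>)" using assms by (auto simp: valid_def)
  have v2: "valid (x # \<Gamma>) ([x] @ x # \<Gamma> @ \<Gamma>)" "valid (x # \<Gamma>) ([x] @ \<Gamma> @ x # \<Gamma>)"
    using assms by (auto simp: valid_def)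
  have "dp x \<boxtimes> str \<Gamma> (\<Gamma> @ \<Gamma>) = str (x # \<Gamma>) ([x] @ x # \<Gamma> @ \<Gamma>)"
    using str_split[OF v] assms by (simp add: str_contract_single del: str.simps)
  moreover have "(J [x] \<boxtimes> (sg [ob x] (W \<Gamma>) \<boxtimes> J \<Gamma>)) \<circ>\<^sub>s str (x # \<Gamma>) ([x] @ x # \<Gamma> @ \<Gamma>)
    = (J [x] \<boxtimes> J (\<Gamma> @ x # \<Gamma>)) \<circ>\<^sub>s str (x # \<Gamma>) ([x] @ \<Gamma> @ x # \<Gamma>)"
  proof (rule str_prefix)
    show *: "valid \<Delta> (\<Gamma> @ x # \<Gamma>)" if "valid \<Delta> (x # \<Gamma> @ \<Gamma>)" for \<Delta>
      by (rule valid_perm[OF _ that]) simp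
    show "(sg [ob x] (W \<Gamma>) \<boxtimes> J \<Gamma>) \<circ>\<^sub>s str \<Delta> (x # \<Gamma> @ \<Gamma>) = J (\<Gamma> @ x # \<Gamma>) \<circ>\<^sub>s str \<Delta> (\<Gamma> @ x # \<Gamma>)"
      if "valid \<Delta> (x # \<Gamma> @ \<Gamma>)" for \<Delta>
      using str_swap_block1[OF that] *[OF that] by (simp del: str.simps)
  qed (use v2 in \<open>auto simp del: str.simps\<close>)
  ultimately show ?thesis using v2 by (simp del: str.simps)
qed

text \<open>It suffices to test copying and discarding in the context \<open>G z\<close> itself;
  \<open>str_str_ws\<close> transports both equations to any surrounding context.\<close>

lemma sbI:
  assumes "ar (g z)" "dm (g z) = W (G z)" "cd (g z) = [ob z]" "distinct (G z)"
    and "\<not> lin z \<Longrightarrow> \<forall>x \<in> set (G z). \<not> lin x"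
    and "\<not> lin z \<Longrightarrow> er z \<circ>\<^sub>s g z = str (G z) []"
    and "\<not> lin z \<Longrightarrow> dp z \<circ>\<^sub>s g z = (g z \<boxtimes> g z) \<circ>\<^sub>s str (G z) (G z @ G z)"
  shows "sb G g z"
proof -
  have "((er z \<circ>\<^sub>s g z) \<boxtimes> J C) \<circ>\<^sub>s str \<Gamma> (G z @ C) = str \<Gamma> C \<and>
    ((dp z \<circ>\<^sub>s g z) \<boxtimes> J C) \<circ>\<^sub>s str \<Gamma> (G z @ C) = (g z \<boxtimes> g z \<boxtimes> J C) \<circ>\<^sub>s str \<Gamma> (G z @ G z @ C)"
    if "\<not> lin z" "valid \<Gamma> (G z @ C)" for \<Gamma> C
  proof -
    have v: "valid (G z) []" "valid (G z) (G z @ G z)" using assms that by (auto simp: valid_def)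
    then show ?thesis
      using that assms str_str_ws[OF v(1) that(2)] str_str_ws[OF v(2) that(2)]
      by (simp add: tns_cmp_Id cmp_assoc tns_assoc del: str.simps)
  qed
  then show ?thesis using assms by (simp add: sb_def)
qed

text \<open>An induction principle over the generators of structural arrows between copyable
  contexts. The predicate sees the variables and not merely their objects, because the coalgebra
  structure of a context is attached to its variables.\<close>

lemma str_closed:
  assumes Id: "\<And>\<Gamma>. \<forall>x \<in> set \<Gamma>. \<not> lin x \<Longrightarrow> P \<Gamma> (J \<Gamma>) \<Gamma>"
    and cmp: "\<And>\<Gamma> f \<Delta> g \<Theta>. P \<Gamma> f \<Delta> \<Longrightarrow> P \<Delta> g \<Theta> \<Longrightarrow> P \<Gamma> (g \<circ>\<^sub>s f) \<Theta>"
    and tns: "\<And>\<Gamma> f \<Delta> \<Gamma>' g \<Delta>'. P \<Gamma> f \<Delta> \<Longrightarrow> P \<Gamma>' g \<Delta>' \<Longrightarrow> P (\<Gamma> @ \<Gamma>') (f \<boxtimes> g) (\<Delta> @ \<Delta>')"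
    and dp: "\<And>x. \<not> lin x \<Longrightarrow> P [x] (dp x) [x, x]"
    and er: "\<And>x. \<not> lin x \<Longrightarrow> P [x] (er x) []"
    and sg: "\<And>x y. \<not> lin x \<Longrightarrow> \<not> lin y \<Longrightarrow> P [x, y] (sg [ob x] [ob y]) [y, x]"
    and nl: "\<forall>x \<in> set \<Gamma>. \<not> lin x" and v: "valid \<Gamma> ys"
  shows "P \<Gamma> (str \<Gamma> ys) ys"
proof -
  have rm: "rm y \<Gamma> = \<Gamma>" if "\<forall>x \<in> set \<Gamma>. \<not> lin x" for y \<Gamma>
    using that by (auto simp: rm_def)
  have pull: "P \<Gamma> (pull \<Gamma> y) (y # \<Gamma>)" if "\<forall>x \<in> set \<Gamma>. \<not> lin x" "distinct \<Gamma>" "y \<in> set \<Gamma>" for \<Gamma> y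
    using that
  proof (induction \<Gamma>)
    case (Cons x \<Gamma>)
    show ?case
    proof (cases "x = y")
      case True
      then show ?thesis using tns[OF dp Id, of y \<Gamma>] Cons.prems by auto
    next
      case False
      have "P ([x] @ \<Gamma>) (J [x] \<boxtimes> pull \<Gamma> y) ([x] @ y # \<Gamma>)"
        using Cons False by (intro tns Id) auto
      moreover have "P ([x, y] @ \<Gamma>) (sg [ob x] [ob y] \<boxtimes> J \<Gamma>) ([y, x] @ \<Gamma>)"
        using Cons.prems False by (intro tns sg Id) auto
      ultimately show ?thesis
        using False cmp[of "x # \<Gamma>" _ "x # y # \<Gamma>"] rm[of \<Gamma> y] Cons.prems by auto
    qed
  qed simp
  have erase: "P \<Gamma> (erase \<Gamma>) []" using nl
  proof (induction \<Gamma>)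
    case Nil
    then show ?case using Id[of "[]"] by simp
  next
    case (Cons x \<Gamma>)
    then show ?case using tns[OF er, of x \<Gamma> "erase \<Gamma>" "[]"] by simp
  qed
  show ?thesis using v
  proof (induction ys)
    case Nil
    then show ?case using erase by simp
  next
    case (Cons y ys)
    then have y: "valid \<Gamma> ys" "distinct \<Gamma>" "y \<in> set \<Gamma>" using rm[OF nl] by (auto simp: valid_Cons)
    have "P ([y] @ \<Gamma>) (J [y] \<boxtimes> str \<Gamma> ys) ([y] @ ys)"
      using y nl Cons.IH by (intro tns Id) auto
    with cmp[OF pull[OF nl y(2,3)]] show ?case using rm[OF nl] by simp
  qed
qed

end

section \<open>Strictification\<close>

context category
begin

text \<open>The model gives its arrows through hom-sets. As these are disjoint, every arrow has a
  unique source and target, and typing conditions become equations for the simplifier.\<close>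

definition src :: "'m \<Rightarrow> 'o" where "src f = (THE A. \<exists>B. f \<in> Hom C A B)"
definition trg :: "'m \<Rightarrow> 'o" where "trg f = (THE B. \<exists>A. f \<in> Hom C A B)"
definition arr :: "'m \<Rightarrow> bool" where "arr f \<longleftrightarrow> f \<in> Hom C (src f) (trg f)"

lemma Hom_iff: "f \<in> Hom C A B \<longleftrightarrow> arr f \<and> src f = A \<and> trg f = B"
proof
  assume f: "f \<in> Hom C A B"
  then have "src f = A" "trg f = B"
    unfolding src_def trg_def by (auto intro!: the_equality dest: Hom_disjoint[OF f])
  with f show "arr f \<and> src f = A \<and> trg f = B" by (simp add: arr_def)
qed (auto simp: arr_def)

lemma arr_obj [simp]: "arr f \<Longrightarrow> src f \<in> Obj C" "arr f \<Longrightarrow> trg f \<in> Obj C"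
  using Hom_obj by (auto simp: arr_def)

lemma idn_arr [simp]:
  "A \<in> Obj C \<Longrightarrow> arr (idn C A)" "A \<in> Obj C \<Longrightarrow> src (idn C A) = A" "A \<in> Obj C \<Longrightarrow> trg (idn C A) = A"
  using idn_hom Hom_iff by auto

lemma comp_arr [simp]:
  assumes "arr f" "arr g" "src g = trg f"
  shows "arr (g \<cdot> f)" "src (g \<cdot> f) = src f" "trg (g \<cdot> f) = trg g"
  using comp_hom[of f "src f" "trg f" g "trg g"] assms by (auto simp: Hom_iff)

lemma idn_simps [simp]:
  "arr f \<Longrightarrow> src f = A \<Longrightarrow> f \<cdot> idn C A = f"
  "arr f \<Longrightarrow> trg f = A \<Longrightarrow> idn C A \<cdot> f = f"
  by (auto intro: comp_idn idn_comp simp: Hom_iff)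

lemma assoc: "arr f \<Longrightarrow> arr g \<Longrightarrow> arr h \<Longrightarrow> src g = trg f \<Longrightarrow> src h = trg g
  \<Longrightarrow> (h \<cdot> g) \<cdot> f = h \<cdot> g \<cdot> f"
  by (rule comp_assoc) (auto simp: Hom_iff)

lemma comp_reassoc: "g \<cdot> f = k \<Longrightarrow> arr f \<Longrightarrow> arr g \<Longrightarrow> src g = trg f \<Longrightarrow> arr h \<Longrightarrow> trg h = src f
  \<Longrightarrow> g \<cdot> f \<cdot> h = k \<cdot> h"
  by (metis assoc)

lemma iso_cancel_left:
  "i' \<cdot> i = idn C A \<Longrightarrow> arr i \<Longrightarrow> arr i' \<Longrightarrow> src i = A \<Longrightarrow> src i' = trg i
   \<Longrightarrow> arr f \<Longrightarrow> arr g \<Longrightarrow> trg f = A \<Longrightarrow> trg g = A \<Longrightarrow> i \<cdot> f = i \<cdot> g \<Longrightarrow> f = g"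
  by (metis assoc idn_simps(2))

lemma iso_cancel_right:
  "i \<cdot> i' = idn C A \<Longrightarrow> arr i \<Longrightarrow> arr i' \<Longrightarrow> trg i = A \<Longrightarrow> src i = trg i'
   \<Longrightarrow> arr f \<Longrightarrow> arr g \<Longrightarrow> src f = A \<Longrightarrow> src g = A \<Longrightarrow> f \<cdot> i = g \<cdot> i \<Longrightarrow> f = g"
  by (metis assoc idn_simps(1))

end

context symmetric_monoidal_category
begin

declare unit_obj [simp] tens_obj [simp]

lemma tensm_arr [simp]:
  assumes "arr f" "arr g"
  shows "arr (f \<odot> g)" "src (f \<odot> g) = src f \<otimes> src g" "trg (f \<odot> g) = trg f \<otimes> trg g"
  using tensm_hom[of f "src f" "trg f" g "src g" "trg g"] assms by (auto simp: Hom_iff)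

lemma struct_arr [simp]:
  "A \<in> Obj C \<Longrightarrow> B \<in> Obj C \<Longrightarrow> D \<in> Obj C \<Longrightarrow> arr (asc C A B D)"
  "A \<in> Obj C \<Longrightarrow> B \<in> Obj C \<Longrightarrow> D \<in> Obj C \<Longrightarrow> src (asc C A B D) = (A \<otimes> B) \<otimes> D"
  "A \<in> Obj C \<Longrightarrow> B \<in> Obj C \<Longrightarrow> D \<in> Obj C \<Longrightarrow> trg (asc C A B D) = A \<otimes> B \<otimes> D"
  "A \<in> Obj C \<Longrightarrow> B \<in> Obj C \<Longrightarrow> D \<in> Obj C \<Longrightarrow> arr (asci C A B D)"
  "A \<in> Obj C \<Longrightarrow> B \<in> Obj C \<Longrightarrow> D \<in> Obj C \<Longrightarrow> trg (asci C A B D) = (A \<otimes> B) \<otimes> D"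
  "A \<in> Obj C \<Longrightarrow> B \<in> Obj C \<Longrightarrow> D \<in> Obj C \<Longrightarrow> src (asci C A B D) = A \<otimes> B \<otimes> D"
  "A \<in> Obj C \<Longrightarrow> arr (lun C A)" "A \<in> Obj C \<Longrightarrow> src (lun C A) = \<one> \<otimes> A" "A \<in> Obj C \<Longrightarrow> trg (lun C A) = A"
  "A \<in> Obj C \<Longrightarrow> arr (luni C A)" "A \<in> Obj C \<Longrightarrow> trg (luni C A) = \<one> \<otimes> A" "A \<in> Obj C \<Longrightarrow> src (luni C A) = A"
  "A \<in> Obj C \<Longrightarrow> arr (run C A)" "A \<in> Obj C \<Longrightarrow> src (run C A) = A \<otimes> \<one>" "A \<in> Obj C \<Longrightarrow> trg (run C A) = A"
  "A \<in> Obj C \<Longrightarrow> arr (runi C A)" "A \<in> Obj C \<Longrightarrow> trg (runi C A) = A \<otimes> \<one>" "A \<in> Obj C \<Longrightarrow> src (runi C A) = A"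
  "A \<in> Obj C \<Longrightarrow> B \<in> Obj C \<Longrightarrow> arr (smcc.sym C A B)"
  "A \<in> Obj C \<Longrightarrow> B \<in> Obj C \<Longrightarrow> src (smcc.sym C A B) = A \<otimes> B"
  "A \<in> Obj C \<Longrightarrow> B \<in> Obj C \<Longrightarrow> trg (smcc.sym C A B) = B \<otimes> A"
  using asc_hom asci_hom lun_hom luni_hom run_hom runi_hom sym_hom by (auto simp: Hom_iff)

lemma struct_iso [simp]:
  "A \<in> Obj C \<Longrightarrow> B \<in> Obj C \<Longrightarrow> D \<in> Obj C \<Longrightarrow> asc C A B D \<cdot> asci C A B D = idn C (A \<otimes> B \<otimes> D)"
  "A \<in> Obj C \<Longrightarrow> B \<in> Obj C \<Longrightarrow> D \<in> Obj C \<Longrightarrow> asci C A B D \<cdot> asc C A B D = idn C ((A \<otimes> B) \<otimes> D)"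
  "A \<in> Obj C \<Longrightarrow> lun C A \<cdot> luni C A = idn C A" "A \<in> Obj C \<Longrightarrow> luni C A \<cdot> lun C A = idn C (\<one> \<otimes> A)"
  "A \<in> Obj C \<Longrightarrow> run C A \<cdot> runi C A = idn C A" "A \<in> Obj C \<Longrightarrow> runi C A \<cdot> run C A = idn C (A \<otimes> \<one>)"
  "A \<in> Obj C \<Longrightarrow> B \<in> Obj C \<Longrightarrow> smcc.sym C B A \<cdot> smcc.sym C A B = idn C (A \<otimes> B)"
  by (simp_all add: asc_asci asci_asc lun_luni luni_lun run_runi runi_run sym_sym)

lemma struct_iso_comp [simp]:
  "A \<in> Obj C \<Longrightarrow> B \<in> Obj C \<Longrightarrow> D \<in> Obj C \<Longrightarrow> arr f \<Longrightarrow> trg f = A \<otimes> B \<otimes> D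
    \<Longrightarrow> asc C A B D \<cdot> asci C A B D \<cdot> f = f"
  "A \<in> Obj C \<Longrightarrow> B \<in> Obj C \<Longrightarrow> D \<in> Obj C \<Longrightarrow> arr f \<Longrightarrow> trg f = (A \<otimes> B) \<otimes> D
    \<Longrightarrow> asci C A B D \<cdot> asc C A B D \<cdot> f = f"
  "A \<in> Obj C \<Longrightarrow> arr f \<Longrightarrow> trg f = A \<Longrightarrow> lun C A \<cdot> luni C A \<cdot> f = f"
  "A \<in> Obj C \<Longrightarrow> arr f \<Longrightarrow> trg f = \<one> \<otimes> A \<Longrightarrow> luni C A \<cdot> lun C A \<cdot> f = f"
  "A \<in> Obj C \<Longrightarrow> arr f \<Longrightarrow> trg f = A \<Longrightarrow> run C A \<cdot> runi C A \<cdot> f = f"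
  "A \<in> Obj C \<Longrightarrow> arr f \<Longrightarrow> trg f = A \<otimes> \<one> \<Longrightarrow> runi C A \<cdot> run C A \<cdot> f = f"
  by (simp_all flip: assoc)

lemma tensm_idn' [simp]: "A \<in> Obj C \<Longrightarrow> B \<in> Obj C \<Longrightarrow> idn C A \<odot> idn C B = idn C (A \<otimes> B)"
  by (rule tensm_idn)

lemma tensm_merge: "arr f \<Longrightarrow> arr f' \<Longrightarrow> arr g \<Longrightarrow> arr g' \<Longrightarrow> src f' = trg f \<Longrightarrow> src g' = trg g
  \<Longrightarrow> (f' \<odot> g') \<cdot> (f \<odot> g) = (f' \<cdot> f) \<odot> (g' \<cdot> g)"
  by (rule tensm_comp[symmetric]) (auto simp: Hom_iff)

lemma tensm_merge_comp: "arr f \<Longrightarrow> arr f' \<Longrightarrow> arr g \<Longrightarrow> arr g' \<Longrightarrow> src f' = trg f \<Longrightarrow> src g' = trg g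
  \<Longrightarrow> arr h \<Longrightarrow> trg h = src f \<otimes> src g
  \<Longrightarrow> (f' \<odot> g') \<cdot> (f \<odot> g) \<cdot> h = ((f' \<cdot> f) \<odot> (g' \<cdot> g)) \<cdot> h"
  by (simp add: tensm_merge flip: assoc)

lemma asc_nat: "arr f \<Longrightarrow> arr g \<Longrightarrow> arr h \<Longrightarrow> trg f = A \<Longrightarrow> trg g = B \<Longrightarrow> trg h = D
  \<Longrightarrow> asc C A B D \<cdot> ((f \<odot> g) \<odot> h) = (f \<odot> (g \<odot> h)) \<cdot> asc C (src f) (src g) (src h)"
  by (rule asc_natural) (auto simp: Hom_iff)

lemma asci_nat:
  assumes "arr f" "arr g" "arr h" "trg f = A" "trg g = B" "trg h = D"
  shows "asci C A B D \<cdot> (f \<odot> (g \<odot> h)) = ((f \<odot> g) \<odot> h) \<cdot> asci C (src f) (src g) (src h)"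
proof -
  have o: "A \<in> Obj C" "B \<in> Obj C" "D \<in> Obj C" using assms by auto
  have "asci C A B D \<cdot> (f \<odot> (g \<odot> h))
    = asci C A B D \<cdot> ((f \<odot> (g \<odot> h)) \<cdot> asc C (src f) (src g) (src h)) \<cdot> asci C (src f) (src g) (src h)"
    using assms o by (simp add: assoc)
  also have "\<dots> = asci C A B D \<cdot> (asc C A B D \<cdot> ((f \<odot> g) \<odot> h)) \<cdot> asci C (src f) (src g) (src h)"
    using assms by (simp add: asc_nat)
  also have "\<dots> = ((f \<odot> g) \<odot> h) \<cdot> asci C (src f) (src g) (src h)"
    using assms o by (simp add: assoc)
  finally show ?thesis .
qed

lemma lun_nat: "arr f \<Longrightarrow> trg f = A \<Longrightarrow> lun C A \<cdot> (idn C \<one> \<odot> f) = f \<cdot> lun C (src f)"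
  by (rule lun_natural) (auto simp: Hom_iff)

lemma luni_nat: "arr f \<Longrightarrow> trg f = A \<Longrightarrow> luni C A \<cdot> f = (idn C \<one> \<odot> f) \<cdot> luni C (src f)"
  by (rule iso_cancel_left[of "luni C A" "lun C A" "\<one> \<otimes> A"])
    (auto simp: comp_reassoc[OF lun_nat] assoc)

lemma run_nat: "arr f \<Longrightarrow> trg f = A \<Longrightarrow> run C A \<cdot> (f \<odot> idn C \<one>) = f \<cdot> run C (src f)"
  by (rule run_natural) (auto simp: Hom_iff)

lemma runi_nat: "arr f \<Longrightarrow> trg f = A \<Longrightarrow> runi C A \<cdot> f = (f \<odot> idn C \<one>) \<cdot> runi C (src f)"
  by (rule iso_cancel_left[of "runi C A" "run C A" "A \<otimes> \<one>"])
    (auto simp: comp_reassoc[OF run_nat] assoc)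

lemma sym_nat: "arr f \<Longrightarrow> arr g \<Longrightarrow> trg f = A \<Longrightarrow> trg g = B
  \<Longrightarrow> smcc.sym C A B \<cdot> (f \<odot> g) = (g \<odot> f) \<cdot> smcc.sym C (src f) (src g)"
  by (rule sym_natural) (auto simp: Hom_iff)

section \<open>Unit coherence from triangle and pentagon\<close>

lemma tensm_unit_faithful:
  assumes "arr f" "arr g" "src f = src g" "trg f = trg g"
  shows "idn C \<one> \<odot> f = idn C \<one> \<odot> g \<Longrightarrow> f = g" and "f \<odot> idn C \<one> = g \<odot> idn C \<one> \<Longrightarrow> f = g"
proof -
  assume "idn C \<one> \<odot> f = idn C \<one> \<odot> g"
  then have "f \<cdot> lun C (src f) = g \<cdot> lun C (src f)"
    using lun_nat[of f "trg f"] lun_nat[of g "trg f"] assms by simp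
  then show "f = g"
    by (rule iso_cancel_right[of "lun C (src f)" "luni C (src f)", rotated -1]) (use assms in auto)
next
  assume "f \<odot> idn C \<one> = g \<odot> idn C \<one>"
  then have "f \<cdot> run C (src f) = g \<cdot> run C (src f)"
    using run_nat[of f "trg f"] run_nat[of g "trg f"] assms by simp
  then show "f = g"
    by (rule iso_cancel_right[of "run C (src f)" "runi C (src f)", rotated -1]) (use assms in auto)
qed

text \<open>Kelly's argument: tensoring with the unit is faithful, so the equation may be checked
  under \<open>idn C \<one>\<close> and after an isomorphism of associators, where pentagon and
  triangle apply.\<close>

lemma lun_asc:
  assumes [simp]: "A \<in> Obj C" "B \<in> Obj C"
  shows "lun C (A \<otimes> B) \<cdot> asc C \<one> A B = lun C A \<odot> idn C B"
proof (rule tensm_unit_faithful(1))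
  let ?i = "asc C \<one> (\<one> \<otimes> A) B \<cdot> (asc C \<one> \<one> A \<odot> idn C B)"
  let ?j = "(asci C \<one> \<one> A \<odot> idn C B) \<cdot> asci C \<one> (\<one> \<otimes> A) B"
  show "idn C \<one> \<odot> (lun C (A \<otimes> B) \<cdot> asc C \<one> A B) = idn C \<one> \<odot> (lun C A \<odot> idn C B)"
  proof (rule iso_cancel_right[of ?i ?j])
    show "?i \<cdot> ?j = idn C (\<one> \<otimes> (\<one> \<otimes> A) \<otimes> B)"
      by (simp add: assoc) (simp add: tensm_merge_comp)
    have "(idn C \<one> \<odot> (lun C (A \<otimes> B) \<cdot> asc C \<one> A B)) \<cdot> ?i
      = (idn C \<one> \<odot> lun C (A \<otimes> B)) \<cdot> (idn C \<one> \<odot> asc C \<one> A B) \<cdot> ?i"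
      by (simp add: tensm_merge_comp)
    also have "\<dots> = (idn C \<one> \<odot> lun C (A \<otimes> B)) \<cdot> asc C \<one> \<one> (A \<otimes> B) \<cdot> asc C (\<one> \<otimes> \<one>) A B"
      by (simp add: pentagon)
    also have "\<dots> = (run C \<one> \<odot> idn C (A \<otimes> B)) \<cdot> asc C (\<one> \<otimes> \<one>) A B"
      by (subst comp_reassoc[OF triangle]) auto
    also have "\<dots> = asc C \<one> A B \<cdot> ((run C \<one> \<odot> idn C A) \<odot> idn C B)"
      by (simp add: asc_nat)
    also have "\<dots> = asc C \<one> A B \<cdot> ((idn C \<one> \<odot> lun C A) \<odot> idn C B) \<cdot> (asc C \<one> \<one> A \<odot> idn C B)"
      by (simp add: tensm_merge triangle)
    also have "\<dots> = (idn C \<one> \<odot> (lun C A \<odot> idn C B)) \<cdot> ?i"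
      by (subst comp_reassoc[OF asc_nat]) (auto simp: assoc)
    finally show "(idn C \<one> \<odot> (lun C (A \<otimes> B) \<cdot> asc C \<one> A B)) \<cdot> ?i = (idn C \<one> \<odot> (lun C A \<odot> idn C B)) \<cdot> ?i" .
  qed simp_all
qed simp_all

text \<open>The same argument on the other side, checked after tensoring with the unit on the right
  and composing with an associator.\<close>

lemma run_asc:
  assumes [simp]: "A \<in> Obj C" "B \<in> Obj C"
  shows "(idn C A \<odot> run C B) \<cdot> asc C A B \<one> = run C (A \<otimes> B)"
proof (rule tensm_unit_faithful(2))
  show "((idn C A \<odot> run C B) \<cdot> asc C A B \<one>) \<odot> idn C \<one> = run C (A \<otimes> B) \<odot> idn C \<one>"
  proof (rule iso_cancel_left[of "asci C A B \<one>" "asc C A B \<one>"])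
    have "asc C A B \<one> \<cdot> (((idn C A \<odot> run C B) \<cdot> asc C A B \<one>) \<odot> idn C \<one>)
      = asc C A B \<one> \<cdot> ((idn C A \<odot> run C B) \<odot> idn C \<one>) \<cdot> (asc C A B \<one> \<odot> idn C \<one>)"
      by (simp add: tensm_merge)
    also have "\<dots> = (idn C A \<odot> (run C B \<odot> idn C \<one>)) \<cdot> asc C A (B \<otimes> \<one>) \<one> \<cdot> (asc C A B \<one> \<odot> idn C \<one>)"
      by (subst comp_reassoc[OF asc_nat]) (auto simp: assoc)
    also have "\<dots> = (idn C A \<odot> (idn C B \<odot> lun C \<one>)) \<cdot> (idn C A \<odot> asc C B \<one> \<one>) \<cdot> asc C A (B \<otimes> \<one>) \<one> \<cdot> (asc C A B \<one> \<odot> idn C \<one>)"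
      by (simp add: tensm_merge_comp triangle)
    also have "\<dots> = (idn C A \<odot> (idn C B \<odot> lun C \<one>)) \<cdot> asc C A B (\<one> \<otimes> \<one>) \<cdot> asc C (A \<otimes> B) \<one> \<one>"
      by (simp add: pentagon)
    also have "\<dots> = asc C A B \<one> \<cdot> ((idn C A \<odot> idn C B) \<odot> lun C \<one>) \<cdot> asc C (A \<otimes> B) \<one> \<one>"
      using comp_reassoc[OF asc_nat[of "idn C A" "idn C B" "lun C \<one>" A B \<one>], of "asc C (A \<otimes> B) \<one> \<one>"]
      by (simp add: assoc)
    also have "\<dots> = asc C A B \<one> \<cdot> (run C (A \<otimes> B) \<odot> idn C \<one>)"
      by (simp add: triangle)
    finally show "asc C A B \<one> \<cdot> (((idn C A \<odot> run C B) \<cdot> asc C A B \<one>) \<odot> idn C \<one>)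
      = asc C A B \<one> \<cdot> (run C (A \<otimes> B) \<odot> idn C \<one>)" .
  qed simp_all
qed simp_all

text \<open>Naturality of \<open>lun\<close> at itself gives \<open>lun C (\<one> \<otimes> \<one>)
  = idn C \<one> \<odot> lun C \<one>\<close>. Then \<open>lun_asc\<close> and the triangle agree
  after tensoring with the unit, which is faithful.\<close>

lemma lun_unit: "lun C \<one> = run C \<one>"
proof (rule tensm_unit_faithful(2))
  have "lun C \<one> \<cdot> lun C (\<one> \<otimes> \<one>) = lun C \<one> \<cdot> (idn C \<one> \<odot> lun C \<one>)"
    by (simp add: lun_nat)
  then have "lun C (\<one> \<otimes> \<one>) = idn C \<one> \<odot> lun C \<one>"
    by (rule iso_cancel_left[of "luni C \<one>" "lun C \<one>" "\<one> \<otimes> \<one>", rotated -1]) simp_all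
  then show "lun C \<one> \<odot> idn C \<one> = run C \<one> \<odot> idn C \<one>"
    using lun_asc[of \<one> \<one>] triangle[of \<one> \<one>] by simp
qed simp_all

lemma luni_unit: "luni C \<one> = runi C \<one>"
proof -
  have "luni C \<one> = luni C \<one> \<cdot> run C \<one> \<cdot> runi C \<one>" by simp
  also have "\<dots> = runi C \<one>" by (simp flip: lun_unit)
  finally show ?thesis .
qed

lemma asc_luni: "A \<in> Obj C \<Longrightarrow> B \<in> Obj C \<Longrightarrow> asc C \<one> A B \<cdot> (luni C A \<odot> idn C B) = luni C (A \<otimes> B)"
  by (rule iso_cancel_left[of "luni C (A \<otimes> B)" "lun C (A \<otimes> B)" "\<one> \<otimes> A \<otimes> B"])
    (auto simp: comp_reassoc[OF lun_asc] tensm_merge)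

lemma asci_runi:
  assumes [simp]: "A \<in> Obj C" "B \<in> Obj C"
  shows "asci C A B \<one> \<cdot> (idn C A \<odot> runi C B) = runi C (A \<otimes> B)"
proof (rule iso_cancel_left[of "runi C (A \<otimes> B)" "run C (A \<otimes> B)" "(A \<otimes> B) \<otimes> \<one>"])
  have "run C (A \<otimes> B) \<cdot> asci C A B \<one> \<cdot> (idn C A \<odot> runi C B)
    = ((idn C A \<odot> run C B) \<cdot> asc C A B \<one>) \<cdot> asci C A B \<one> \<cdot> (idn C A \<odot> runi C B)"
    by (subst run_asc) simp_all
  also have "\<dots> = run C (A \<otimes> B) \<cdot> runi C (A \<otimes> B)"
    by (simp add: assoc) (simp add: tensm_merge)
  finally show "run C (A \<otimes> B) \<cdot> asci C A B \<one> \<cdot> (idn C A \<odot> runi C B) = run C (A \<otimes> B) \<cdot> runi C (A \<otimes> B)" .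
qed simp_all

lemma asc_runi: "A \<in> Obj C \<Longrightarrow> B \<in> Obj C \<Longrightarrow> asc C A B \<one> \<cdot> runi C (A \<otimes> B) = idn C A \<odot> runi C B"
  by (simp flip: asci_runi)

lemma triangle_runi: "A \<in> Obj C \<Longrightarrow> B \<in> Obj C \<Longrightarrow> (idn C A \<odot> lun C B) \<cdot> asc C A \<one> B \<cdot> (runi C A \<odot> idn C B) = idn C (A \<otimes> B)"
  by (subst comp_reassoc[OF triangle]) (auto simp: tensm_merge)

end

context Sl_category
begin

section \<open>Splitting and joining tensor products of lists\<close>

abbreviation T :: "'o list \<Rightarrow> 'o" where "T \<equiv> tensl C"
abbreviation okl :: "'o list \<Rightarrow> bool" where "okl As \<equiv> set As \<subseteq> Obj C"

declare hom_obj [simp] bang_obj [simp] nno_obj [simp] prod_obj [simp]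
declare tensl_obj [simp]

abbreviation sp :: "'o list \<Rightarrow> 'o list \<Rightarrow> 'm" where "sp \<equiv> split C"

text \<open>The inverse of \<open>split\<close>. Conjugation with the two turns the tensor of the
  model into a strictly associative operation on lists.\<close>

primrec jn :: "'o list \<Rightarrow> 'o list \<Rightarrow> 'm" where
  "jn [] Bs = lun C (T Bs)"
| "jn (A # As) Bs = (idn C A \<odot> jn As Bs) \<cdot> asc C A (T As) (T Bs)"

lemma split_arr [simp]:
  assumes "okl As" "okl Bs"
  shows "arr (sp As Bs)" "src (sp As Bs) = T (As @ Bs)" "trg (sp As Bs) = T As \<otimes> T Bs"
  using split_hom[OF assms] by (auto simp: Hom_iff)

lemma jn_arr' : "okl As \<Longrightarrow> okl Bs \<Longrightarrow> arr (jn As Bs) \<and> src (jn As Bs) = T As \<otimes> T Bs \<and> trg (jn As Bs) = T (As @ Bs)"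
  by (induction As) auto

lemma jn_arr [simp]:
  assumes "okl As" "okl Bs"
  shows "arr (jn As Bs)" "src (jn As Bs) = T As \<otimes> T Bs" "trg (jn As Bs) = T (As @ Bs)"
  using jn_arr'[OF assms] by auto

lemma split_jn [simp]: "okl As \<Longrightarrow> okl Bs \<Longrightarrow> sp As Bs \<cdot> jn As Bs = idn C (T As \<otimes> T Bs)"
  by (induction As) (auto simp: assoc tensm_merge_comp)

lemma jn_split [simp]: "okl As \<Longrightarrow> okl Bs \<Longrightarrow> jn As Bs \<cdot> sp As Bs = idn C (T (As @ Bs))"
  by (induction As) (auto simp: assoc tensm_merge)

lemma split_jn_comp [simp]:
  "okl As \<Longrightarrow> okl Bs \<Longrightarrow> arr f \<Longrightarrow> trg f = T As \<otimes> T Bs \<Longrightarrow> sp As Bs \<cdot> jn As Bs \<cdot> f = f"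
  "okl As \<Longrightarrow> okl Bs \<Longrightarrow> arr f \<Longrightarrow> trg f = T (As @ Bs) \<Longrightarrow> jn As Bs \<cdot> sp As Bs \<cdot> f = f"
  by (simp_all flip: assoc)

lemma split_Nil: "okl As \<Longrightarrow> sp As [] = runi C (T As)"
  by (induction As) (auto simp: luni_unit asci_runi)

lemma jn_Nil: "okl As \<Longrightarrow> jn As [] = run C (T As)"
  by (induction As) (auto simp: lun_unit run_asc)

text \<open>Splitting off three blocks in either order differs by one associator. The induction
  peels off a single object, where the pentagon rebrackets.\<close>

lemma split_asc:
  "okl As \<Longrightarrow> okl Bs \<Longrightarrow> okl Ds \<Longrightarrow>
    asc C (T As) (T Bs) (T Ds) \<cdot> (sp As Bs \<odot> idn C (T Ds)) \<cdot> sp (As @ Bs) Ds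
    = (idn C (T As) \<odot> sp Bs Ds) \<cdot> sp As (Bs @ Ds)"
proof (induction As)
  case Nil
  then show ?case
    by (simp add: luni_nat[of "sp Bs Ds"])
      (subst comp_reassoc[OF asc_luni], auto simp: luni_nat)
next
  case (Cons x As)
  then have [simp]: "x \<in> Obj C" "okl As" "okl Bs" "okl Ds" by auto
  let ?A = "T As" and ?B = "T Bs" and ?D = "T Ds"
  \<comment> \<open>The pentagon, solved for inverse associators on the left.\<close>
  have pent: "asc C (x \<otimes> ?A) ?B ?D \<cdot> (asci C x ?A ?B \<odot> idn C ?D) \<cdot> asci C x (?A \<otimes> ?B) ?D
     = asci C x ?A (?B \<otimes> ?D) \<cdot> (idn C x \<odot> asc C ?A ?B ?D)"
  proof (rule iso_cancel_left[of "asci C x ?A (?B \<otimes> ?D)" "asc C x ?A (?B \<otimes> ?D)"])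
    show "asc C x ?A (?B \<otimes> ?D) \<cdot> asc C (x \<otimes> ?A) ?B ?D \<cdot> (asci C x ?A ?B \<odot> idn C ?D) \<cdot> asci C x (?A \<otimes> ?B) ?D
      = asc C x ?A (?B \<otimes> ?D) \<cdot> asci C x ?A (?B \<otimes> ?D) \<cdot> (idn C x \<odot> asc C ?A ?B ?D)"
      by (subst comp_reassoc[OF pentagon]) (auto simp: assoc tensm_merge_comp)
  qed simp_all
  have "asc C (x \<otimes> ?A) ?B ?D \<cdot> (sp (x # As) Bs \<odot> idn C ?D) \<cdot> sp ((x # As) @ Bs) Ds
    = asc C (x \<otimes> ?A) ?B ?D \<cdot> (asci C x ?A ?B \<odot> idn C ?D) \<cdot> (((idn C x \<odot> sp As Bs) \<odot> idn C ?D)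
       \<cdot> asci C x (T (As @ Bs)) ?D) \<cdot> (idn C x \<odot> sp (As @ Bs) Ds)"
    by (simp add: assoc tensm_merge_comp)
  also have "((idn C x \<odot> sp As Bs) \<odot> idn C ?D) \<cdot> asci C x (T (As @ Bs)) ?D
    = asci C x (?A \<otimes> ?B) ?D \<cdot> (idn C x \<odot> (sp As Bs \<odot> idn C ?D))"
    by (simp add: asci_nat)
  also have "asc C (x \<otimes> ?A) ?B ?D \<cdot> (asci C x ?A ?B \<odot> idn C ?D) \<cdot> (asci C x (?A \<otimes> ?B) ?D \<cdot> (idn C x \<odot> (sp As Bs \<odot> idn C ?D))) \<cdot> (idn C x \<odot> sp (As @ Bs) Ds)
    = (asc C (x \<otimes> ?A) ?B ?D \<cdot> (asci C x ?A ?B \<odot> idn C ?D) \<cdot> asci C x (?A \<otimes> ?B) ?D) \<cdot> (idn C x \<odot> ((sp As Bs \<odot> idn C ?D) \<cdot> sp (As @ Bs) Ds))"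
    by (simp add: assoc tensm_merge)
  also have "\<dots> = asci C x ?A (?B \<otimes> ?D) \<cdot> (idn C x \<odot> (asc C ?A ?B ?D \<cdot> (sp As Bs \<odot> idn C ?D) \<cdot> sp (As @ Bs) Ds))"
    unfolding pent by (simp add: assoc tensm_merge)
  also have "\<dots> = asci C x ?A (?B \<otimes> ?D) \<cdot> (idn C x \<odot> (idn C ?A \<odot> sp Bs Ds)) \<cdot> (idn C x \<odot> sp As (Bs @ Ds))"
    using Cons by (simp add: tensm_merge)
  also have "\<dots> = (idn C (T (x # As)) \<odot> sp Bs Ds) \<cdot> sp (x # As) (Bs @ Ds)"
    by (subst comp_reassoc[OF asci_nat]) (auto simp: assoc)
  finally show ?case by simp
qed

text \<open>Obtained from \<open>split_asc\<close> by composing with the joins, which invert the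
  splittings.\<close>

lemma jn_asc:
  assumes [simp]: "okl As" "okl Bs" "okl Ds"
  shows "jn As (Bs @ Ds) \<cdot> (idn C (T As) \<odot> jn Bs Ds) \<cdot> asc C (T As) (T Bs) (T Ds)
    = jn (As @ Bs) Ds \<cdot> (jn As Bs \<odot> idn C (T Ds))"
proof -
  let ?X = "(sp As Bs \<odot> idn C (T Ds)) \<cdot> sp (As @ Bs) Ds"
  let ?X' = "jn (As @ Bs) Ds \<cdot> (jn As Bs \<odot> idn C (T Ds))"
  have X: "?X \<cdot> ?X' = idn C ((T As \<otimes> T Bs) \<otimes> T Ds)"
    by (simp add: assoc tensm_merge)
  have "jn As (Bs @ Ds) \<cdot> (idn C (T As) \<odot> jn Bs Ds) \<cdot> asc C (T As) (T Bs) (T Ds)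
    = jn As (Bs @ Ds) \<cdot> (idn C (T As) \<odot> jn Bs Ds) \<cdot> (asc C (T As) (T Bs) (T Ds) \<cdot> ?X) \<cdot> ?X'"
    using X by (simp add: assoc)
  also have "\<dots> = ?X'"
    unfolding split_asc[OF assms] by (simp add: assoc) (simp add: tensm_merge_comp)
  finally show ?thesis .
qed

text \<open>An arrow \<open>As \<rightarrow> Bs\<close> of the strictification is a triple \<open>(As, m, Bs)\<close> with \<open>m : T As \<rightarrow> T Bs\<close>.\<close>

definition ar :: "'o list \<times> 'm \<times> 'o list \<Rightarrow> bool" where
  "ar f \<longleftrightarrow> okl (fst f) \<and> okl (snd (snd f)) \<and> arr (fst (snd f))
     \<and> src (fst (snd f)) = T (fst f) \<and> trg (fst (snd f)) = T (snd (snd f))"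

abbreviation dm :: "'o list \<times> 'm \<times> 'o list \<Rightarrow> 'o list" where "dm f \<equiv> fst f"
abbreviation cd :: "'o list \<times> 'm \<times> 'o list \<Rightarrow> 'o list" where "cd f \<equiv> snd (snd f)"
abbreviation mor :: "'o list \<times> 'm \<times> 'o list \<Rightarrow> 'm" where "mor f \<equiv> fst (snd f)"

definition Ids :: "'o list \<Rightarrow> 'o list \<times> 'm \<times> 'o list" where
  "Ids As = (As, idn C (T As), As)"

definition cmps :: "'o list \<times> 'm \<times> 'o list \<Rightarrow> 'o list \<times> 'm \<times> 'o list \<Rightarrow> 'o list \<times> 'm \<times> 'o list"
    (infixr "\<circ>\<^sub>s" 55) where
  "g \<circ>\<^sub>s f = (dm f, mor g \<cdot> mor f, cd g)"

definition tnss :: "'o list \<times> 'm \<times> 'o list \<Rightarrow> 'o list \<times> 'm \<times> 'o list \<Rightarrow> 'o list \<times> 'm \<times> 'o list"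
    (infixr "\<boxtimes>" 60) where
  "f \<boxtimes> g = (dm f @ dm g, jn (cd f) (cd g) \<cdot> (mor f \<odot> mor g) \<cdot> sp (dm f) (dm g), cd f @ cd g)"

definition sgs :: "'o list \<Rightarrow> 'o list \<Rightarrow> 'o list \<times> 'm \<times> 'o list" where
  "sgs As Bs = (As @ Bs, jn Bs As \<cdot> smcc.sym C (T As) (T Bs) \<cdot> sp As Bs, Bs @ As)"

lemmas strict_defs = Ids_def cmps_def tnss_def sgs_def ar_def

lemma tnss_assoc:
  assumes "ar f" "ar g" "ar h"
  shows "(f \<boxtimes> g) \<boxtimes> h = f \<boxtimes> (g \<boxtimes> h)"
proof -
  obtain As f0 As' Bs g0 Bs' Ds h0 Ds' where fgh: "f = (As, f0, As')" "g = (Bs, g0, Bs')" "h = (Ds, h0, Ds')"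
    by (metis prod.collapse)
  have o [simp]: "okl As" "okl As'" "okl Bs" "okl Bs'" "okl Ds" "okl Ds'" "arr f0" "arr g0" "arr h0"
    "src f0 = T As" "src g0 = T Bs" "src h0 = T Ds" "trg f0 = T As'" "trg g0 = T Bs'" "trg h0 = T Ds'"
    using assms by (auto simp: fgh ar_def)
  have "mor ((f \<boxtimes> g) \<boxtimes> h) = (jn (As' @ Bs') Ds' \<cdot> (jn As' Bs' \<odot> idn C (T Ds')))
      \<cdot> ((f0 \<odot> g0) \<odot> h0) \<cdot> (sp As Bs \<odot> idn C (T Ds)) \<cdot> sp (As @ Bs) Ds"
    by (simp add: fgh tnss_def assoc tensm_merge_comp)
  also have "\<dots> = jn As' (Bs' @ Ds') \<cdot> (idn C (T As') \<odot> jn Bs' Ds') \<cdot> (asc C (T As') (T Bs') (T Ds')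
      \<cdot> ((f0 \<odot> g0) \<odot> h0)) \<cdot> (sp As Bs \<odot> idn C (T Ds)) \<cdot> sp (As @ Bs) Ds"
    by (simp add: assoc flip: jn_asc)
  also have "\<dots> = jn As' (Bs' @ Ds') \<cdot> (idn C (T As') \<odot> jn Bs' Ds') \<cdot> (f0 \<odot> (g0 \<odot> h0))
      \<cdot> asc C (T As) (T Bs) (T Ds) \<cdot> (sp As Bs \<odot> idn C (T Ds)) \<cdot> sp (As @ Bs) Ds"
    by (simp add: asc_nat) (simp add: assoc)
  also have "\<dots> = mor (f \<boxtimes> (g \<boxtimes> h))"
    unfolding split_asc[OF o(1,3,5)] by (simp add: fgh tnss_def assoc tensm_merge_comp)
  finally show ?thesis by (simp add: tnss_def)
qed

text \<open>The hexagon of the model, conjugated by splittings and joins and combined with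
  naturality of the symmetry.\<close>

lemma sgs_append:
  assumes [simp]: "okl As" "okl Bs" "okl Ds"
  shows "sgs As (Bs @ Ds) = (Ids Bs \<boxtimes> sgs As Ds) \<circ>\<^sub>s (sgs As Bs \<boxtimes> Ids Ds)"
proof -
  let ?A = "T As" and ?B = "T Bs" and ?D = "T Ds"
  \<comment> \<open>The join after the first crossing and the splitting before the second cancel up
    to a single associator.\<close>
  have mid: "(idn C ?B \<odot> sp As Ds) \<cdot> sp Bs (As @ Ds) \<cdot> jn (Bs @ As) Ds \<cdot> (jn Bs As \<odot> idn C ?D) = asc C ?B ?A ?D"
    by (subst jn_asc[symmetric]) (auto simp: tensm_merge_comp)
  have "mor ((Ids Bs \<boxtimes> sgs As Ds) \<circ>\<^sub>s (sgs As Bs \<boxtimes> Ids Ds))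
    = jn Bs (Ds @ As) \<cdot> (idn C ?B \<odot> jn Ds As) \<cdot> (idn C ?B \<odot> smcc.sym C ?A ?D)
      \<cdot> ((idn C ?B \<odot> sp As Ds) \<cdot> sp Bs (As @ Ds) \<cdot> jn (Bs @ As) Ds \<cdot> (jn Bs As \<odot> idn C ?D))
      \<cdot> (smcc.sym C ?A ?B \<odot> idn C ?D) \<cdot> (sp As Bs \<odot> idn C ?D) \<cdot> sp (As @ Bs) Ds"
    by (simp add: strict_defs) (simp add: assoc, simp add: tensm_merge_comp)
  also have "\<dots> = jn Bs (Ds @ As) \<cdot> (idn C ?B \<odot> jn Ds As) \<cdot> ((idn C ?B \<odot> smcc.sym C ?A ?D)
      \<cdot> asc C ?B ?A ?D \<cdot> (smcc.sym C ?A ?B \<odot> idn C ?D)) \<cdot> (sp As Bs \<odot> idn C ?D) \<cdot> sp (As @ Bs) Ds"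
    unfolding mid by (simp add: assoc)
  also have "\<dots> = jn Bs (Ds @ As) \<cdot> (idn C ?B \<odot> jn Ds As) \<cdot> (asc C ?B ?D ?A \<cdot> smcc.sym C ?A (?B \<otimes> ?D) \<cdot> asc C ?A ?B ?D)
      \<cdot> (sp As Bs \<odot> idn C ?D) \<cdot> sp (As @ Bs) Ds"
    by (simp add: hexagon)
  also have "\<dots> = (jn Bs (Ds @ As) \<cdot> (idn C ?B \<odot> jn Ds As) \<cdot> asc C ?B ?D ?A) \<cdot> smcc.sym C ?A (?B \<otimes> ?D)
      \<cdot> asc C ?A ?B ?D \<cdot> (sp As Bs \<odot> idn C ?D) \<cdot> sp (As @ Bs) Ds"
    by (simp add: assoc)
  also have "\<dots> = jn (Bs @ Ds) As \<cdot> (jn Bs Ds \<odot> idn C ?A) \<cdot> (smcc.sym C ?A (?B \<otimes> ?D) \<cdot> (idn C ?A \<odot> sp Bs Ds)) \<cdot> sp As (Bs @ Ds)"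
    unfolding split_asc[OF assms] jn_asc[OF assms(2,3,1)] by (simp add: assoc)
  also have "\<dots> = jn (Bs @ Ds) As \<cdot> smcc.sym C ?A (T (Bs @ Ds)) \<cdot> sp As (Bs @ Ds)"
    by (simp add: sym_nat) (simp add: assoc tensm_merge_comp)
  finally show ?thesis by (simp add: strict_defs)
qed

sublocale strict_smc okl ar "\<lambda>f. dm f" "\<lambda>f. cd f" Ids "(\<circ>\<^sub>s)" "(\<boxtimes>)" sgs
proof
  fix As Bs assume [simp]: "okl As" "okl Bs"
  show "Ids As \<boxtimes> Ids Bs = Ids (As @ Bs)" by (simp add: strict_defs)
  show "sgs Bs As \<circ>\<^sub>s sgs As Bs = Ids (As @ Bs)"
    by (simp add: strict_defs assoc) (simp add: sym_sym flip: assoc)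
next
  fix f f' g g' assume *: "ar f" "ar f'" "ar g" "ar g'" "dm f' = cd f" "dm g' = cd g"
  then show "(f' \<boxtimes> g') \<circ>\<^sub>s (f \<boxtimes> g) = (f' \<circ>\<^sub>s f) \<boxtimes> (g' \<circ>\<^sub>s g)"
    by (simp add: strict_defs assoc tensm_merge_comp)
next
  fix f g assume "ar f" "ar g"
  then show "sgs (cd f) (cd g) \<circ>\<^sub>s (f \<boxtimes> g) = (g \<boxtimes> f) \<circ>\<^sub>s sgs (dm f) (dm g)"
    by (simp add: strict_defs assoc) (subst comp_reassoc[OF sym_nat], auto simp: assoc)
next
  fix f assume "ar f"
  then show "Ids [] \<boxtimes> f = f"
    by (cases f) (auto simp: strict_defs comp_reassoc[OF lun_nat] assoc)
next
  fix f assume "ar f"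
  then show "f \<boxtimes> Ids [] = f"
    by (cases f) (auto simp: strict_defs comp_reassoc[OF run_nat] assoc split_Nil jn_Nil)
qed (auto simp: assoc tnss_assoc sgs_append, auto simp: strict_defs assoc)

end

context Sl_category
begin

text \<open>A singleton list denotes \<open>A \<otimes> \<one>\<close> and not \<open>A\<close>;
  this trailing unit is the source of the many \<open>run\<close> and \<open>runi\<close> below. The
  equation is the triangle in inverted form.\<close>

lemma split_single: "A \<in> Obj C \<Longrightarrow> okl Ds \<Longrightarrow> sp [A] Ds = runi C A \<odot> idn C (T Ds)"
proof -
  assume [simp]: "A \<in> Obj C" "okl Ds"
  show ?thesis
  proof (rule iso_cancel_left[of "asci C A \<one> (T Ds) \<cdot> (idn C A \<odot> luni C (T Ds))" "(idn C A \<odot> lun C (T Ds)) \<cdot> asc C A \<one> (T Ds)"])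
    show "((idn C A \<odot> lun C (T Ds)) \<cdot> asc C A \<one> (T Ds)) \<cdot> sp [A] Ds
      = ((idn C A \<odot> lun C (T Ds)) \<cdot> asc C A \<one> (T Ds)) \<cdot> (runi C A \<odot> idn C (T Ds))"
      by (simp add: assoc triangle_runi) (simp add: tensm_merge)
  qed (simp_all add: assoc, simp_all add: tensm_merge_comp)
qed

lemma jn_single: "A \<in> Obj C \<Longrightarrow> okl Ds \<Longrightarrow> jn [A] Ds = run C A \<odot> idn C (T Ds)"
  by (simp add: triangle)

lemmas jn_split_simps = jn.simps split.simps

section \<open>Arrows of the model as strict arrows\<close>

lemma mor_Ids [simp]: "mor (Ids As) = idn C (T As)"
  by (simp add: Ids_def)

lemma mor_cmps [simp]: "mor (g \<circ>\<^sub>s f) = mor g \<cdot> mor f"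
  by (simp add: cmps_def)

lemma ar_simps [simp]:
  assumes "ar f"
  shows "arr (mor f)" "src (mor f) = T (dm f)" "trg (mor f) = T (cd f)" "okl (dm f)" "okl (cd f)"
  using assms unfolding ar_def by blast+

lemma arrow_eqI: "dm f = dm g \<Longrightarrow> mor f = mor g \<Longrightarrow> cd f = cd g \<Longrightarrow> f = g"
  by (auto intro: prod_eqI)

lemma mor_Ids_tns: "A \<in> Obj C \<Longrightarrow> ar g \<Longrightarrow> mor (Ids [A] \<boxtimes> g) = idn C A \<odot> mor g"
  by (simp add: tnss_def split_single jn_single tensm_merge del: jn_split_simps)

lemma mor_Ids_under:
  "okl As \<Longrightarrow> ar g \<Longrightarrow> mor (Ids As \<boxtimes> g) = under C As (mor g)"
proof (induction As)
  case Nil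
  then show ?case by simp
next
  case (Cons A As)
  have "Ids (A # As) \<boxtimes> g = Ids [A] \<boxtimes> (Ids As \<boxtimes> g)"
    using Cons.prems tns_Id[of "[A]" As] by (simp del: tns_Id flip: tnss_assoc)
  then show ?case using Cons by (simp add: mor_Ids_tns)
qed

text \<open>\<open>runi\<close> adds the trailing unit that the codomain \<open>[B]\<close>
  requires. Being invertible, it loses no information, and \<open>mk_run\<close> undoes it.\<close>

definition mk :: "'o list \<Rightarrow> 'm \<Rightarrow> 'o \<Rightarrow> 'o list \<times> 'm \<times> 'o list" where
  "mk As f B = (As, runi C B \<cdot> f, [B])"

lemma mk_proj [simp]: "dm (mk As f B) = As" "cd (mk As f B) = [B]" "mor (mk As f B) = runi C B \<cdot> f"
  by (simp_all add: mk_def)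

lemma ar_mk [simp]: "okl As \<Longrightarrow> arr f \<Longrightarrow> src f = T As \<Longrightarrow> trg f = B \<Longrightarrow> ar (mk As f B)"
  by (auto simp: mk_def ar_def)

lemma mk_run: "ar f \<Longrightarrow> cd f = [B] \<Longrightarrow> mk (dm f) (run C B \<cdot> mor f) B = f"
  using ar_simps(5)[of f] by (intro arrow_eqI) simp_all

lemma mk_cmp: "ar k \<Longrightarrow> cd k = As \<Longrightarrow> arr f \<Longrightarrow> src f = T As \<Longrightarrow> trg f = B \<Longrightarrow> mk As f B \<circ>\<^sub>s k = mk (dm k) (f \<cdot> mor k) B"
  by (intro arrow_eqI) (auto simp: assoc)

lemma mor_mk_tns:
  assumes [simp]: "okl As" "okl Bs" "arr f" "arr g" "src f = T As" "src g = T Bs" "trg f = A" "trg g = B"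
  shows "mor (mk As f A \<boxtimes> mk Bs g B) = (idn C A \<odot> runi C B) \<cdot> (f \<odot> g) \<cdot> sp As Bs"
proof -
  have [simp]: "A \<in> Obj C" "B \<in> Obj C"
    using arr_obj(2)[OF assms(3)] arr_obj(2)[OF assms(4)] by simp_all
  show ?thesis
    by (simp add: tnss_def jn_single tensm_merge tensm_merge_comp del: jn_split_simps)
qed

lemma mor_mk_tns_Ids:
  assumes "ar f" "dm f = [A]" "okl Ds"
  shows "mor (f \<boxtimes> Ids Ds) = jn (cd f) Ds \<cdot> ((mor f \<cdot> runi C A) \<odot> idn C (T Ds))"
proof -
  have [simp]: "A \<in> Obj C" using ar_simps(4)[OF assms(1)] assms by simp
  show ?thesis using assms
    by (simp add: tnss_def split_single tensm_merge del: jn_split_simps)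
qed

lemma snoc_alt: "okl As \<Longrightarrow> B \<in> Obj C \<Longrightarrow> snoc C As B = jn As [B] \<cdot> (idn C (T As) \<odot> runi C B)"
proof (induction As)
  case Nil
  then show ?case by (simp add: lun_nat)
next
  case (Cons A As)
  then show ?case
    by (simp add: assoc flip: tensm_idn) (simp add: asc_nat assoc tensm_merge_comp del: tensm_idn' flip: tensm_idn)
qed

lemma swap_arr [simp]:
  assumes "A \<in> Obj C" "B \<in> Obj C" "D \<in> Obj C"
  shows "arr (swap C A B D)" "src (swap C A B D) = A \<otimes> B \<otimes> D" "trg (swap C A B D) = B \<otimes> A \<otimes> D"
  using swap_hom[OF assms] by (auto simp: Hom_iff)

text \<open>The trailing units of both wires cancel by naturality, and what remains is the arrow
  \<open>swap\<close> by which \<open>sem\<close> interprets exchange.\<close>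

lemma sgs_single_Ids:
  assumes [simp]: "A \<in> Obj C" "B \<in> Obj C" "okl Ds"
  shows "mor (sgs [A] [B] \<boxtimes> Ids Ds) = swap C A B (T Ds)"
proof -
  let ?D = "idn C (T Ds)"
  have "mor (sgs [A] [B]) = (run C B \<odot> idn C (A \<otimes> \<one>)) \<cdot> smcc.sym C (A \<otimes> \<one>) (B \<otimes> \<one>) \<cdot> (runi C A \<odot> idn C (B \<otimes> \<one>))"
    by (simp add: sgs_def split_single jn_single del: jn_split_simps)
  also have "\<dots> = (run C B \<odot> idn C (A \<otimes> \<one>)) \<cdot> (idn C (B \<otimes> \<one>) \<odot> runi C A) \<cdot> smcc.sym C A (B \<otimes> \<one>)"
    by (simp add: sym_nat)
  also have "\<dots> = (idn C B \<odot> runi C A) \<cdot> (run C B \<odot> idn C A) \<cdot> smcc.sym C A (B \<otimes> \<one>)"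
    by (simp add: tensm_merge_comp)
  also have "\<dots> = (idn C B \<odot> runi C A) \<cdot> smcc.sym C A B \<cdot> (idn C A \<odot> run C B)"
    by (simp add: sym_nat)
  finally have sg: "mor (sgs [A] [B]) = (idn C B \<odot> runi C A) \<cdot> smcc.sym C A B \<cdot> (idn C A \<odot> run C B)" .
  have "mor (sgs [A] [B] \<boxtimes> Ids Ds) = jn [B, A] Ds \<cdot> (mor (sgs [A] [B]) \<odot> ?D) \<cdot> sp [A, B] Ds"
    by (simp add: tnss_def sgs_def)
  also have "\<dots> = ((idn C B \<odot> (run C A \<odot> ?D)) \<cdot> asc C B (A \<otimes> \<one>) (T Ds))
    \<cdot> (((idn C B \<odot> runi C A) \<odot> ?D) \<cdot> (smcc.sym C A B \<odot> ?D) \<cdot> ((idn C A \<odot> run C B) \<odot> ?D))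
    \<cdot> asci C A (B \<otimes> \<one>) (T Ds) \<cdot> (idn C A \<odot> (runi C B \<odot> ?D))"
    unfolding sg using jn_single[of A Ds] split_single[of B Ds] by (simp add: tensm_merge)
  also have "\<dots> = (idn C B \<odot> (run C A \<odot> ?D)) \<cdot> (asc C B (A \<otimes> \<one>) (T Ds) \<cdot> ((idn C B \<odot> runi C A) \<odot> ?D))
    \<cdot> (smcc.sym C A B \<odot> ?D) \<cdot> (((idn C A \<odot> run C B) \<odot> ?D) \<cdot> asci C A (B \<otimes> \<one>) (T Ds)) \<cdot> (idn C A \<odot> (runi C B \<odot> ?D))"
    by (simp add: assoc)
  also have "\<dots> = (idn C B \<odot> (run C A \<odot> ?D)) \<cdot> ((idn C B \<odot> (runi C A \<odot> ?D)) \<cdot> asc C B A (T Ds))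
    \<cdot> (smcc.sym C A B \<odot> ?D) \<cdot> (asci C A B (T Ds) \<cdot> (idn C A \<odot> (run C B \<odot> ?D))) \<cdot> (idn C A \<odot> (runi C B \<odot> ?D))"
    using asc_nat[of "idn C B" "runi C A" ?D] asci_nat[of "idn C A" "run C B" ?D] by simp
  also have "\<dots> = asc C B A (T Ds) \<cdot> (smcc.sym C A B \<odot> ?D) \<cdot> asci C A B (T Ds)"
    by (simp add: assoc) (simp add: tensm_merge tensm_merge_comp)
  finally show ?thesis by (simp add: swap_def)
qed

lemma mor_sgs_single: "A \<in> Obj C \<Longrightarrow> B \<in> Obj C \<Longrightarrow> mor (sgs [A] [B]) = swap C A B \<one>"
  using sgs_single_Ids[of A B "[]"] by simp

lemma drop1_alt: "arr w \<Longrightarrow> src w = A \<Longrightarrow> trg w = \<one> \<Longrightarrow> drop1 C w = w \<cdot> run C A"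
  by (auto simp: drop1_def lun_unit run_nat)

lemma copy1_alt: "arr c \<Longrightarrow> src c = A \<Longrightarrow> trg c = A \<otimes> A \<Longrightarrow> A \<in> Obj C \<Longrightarrow> copy1 C A c = (idn C A \<odot> runi C A) \<cdot> c \<cdot> run C A"
proof -
  assume [simp]: "arr c" "src c = A" "trg c = A \<otimes> A" "A \<in> Obj C"
  have "(idn C A \<odot> runi C A) \<cdot> c \<cdot> run C A = asc C A A \<one> \<cdot> (runi C (A \<otimes> A) \<cdot> c) \<cdot> run C A"
    by (simp add: assoc comp_reassoc[OF asc_runi])
  also have "\<dots> = copy1 C A c" unfolding copy1_def by (simp add: runi_nat) (simp add: assoc)
  finally show ?thesis by simp
qed

section \<open>Ground and stable variables as copyable wires\<close>

definition dpo :: "'o \<Rightarrow> 'm \<Rightarrow> 'o list \<times> 'm \<times> 'o list" where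
  "dpo A c = ([A], copy1 C A c, [A, A])"

definition ero :: "'o \<Rightarrow> 'm \<Rightarrow> 'o list \<times> 'm \<times> 'o list" where
  "ero A w = ([A], drop1 C w, [])"

lemma dpo_proj [simp]: "dm (dpo A c) = [A]" "cd (dpo A c) = [A, A]" "mor (dpo A c) = copy1 C A c"
  by (simp_all add: dpo_def)

lemma ero_proj [simp]: "dm (ero A w) = [A]" "cd (ero A w) = []" "mor (ero A w) = drop1 C w"
  by (simp_all add: ero_def)

lemma comonoid_arr:
  assumes "commutative_comonoid C A c w"
  shows "A \<in> Obj C" "arr c" "src c = A" "trg c = A \<otimes> A" "arr w" "src w = A" "trg w = \<one>"
  using assms by (auto simp: commutative_comonoid_def Hom_iff)

lemma copy_arr [simp]:
  assumes "commutative_comonoid C A c w"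
  shows "ar (dpo A c)" "ar (ero A w)"
  using comonoid_arr[OF assms] by (auto simp: ar_def dpo_def ero_def copy1_def drop1_def)

lemma mor_dpo_Ids:
  assumes [simp]: "arr c" "src c = A" "trg c = A \<otimes> A" "A \<in> Obj C" "okl Ds"
  shows "mor (dpo A c \<boxtimes> Ids Ds) = asc C A A (T Ds) \<cdot> (c \<odot> idn C (T Ds))"
proof -
  let ?D = "idn C (T Ds)"
  have a: "ar (dpo A c)" by (simp add: ar_def copy1_def)
  have "mor (dpo A c \<boxtimes> Ids Ds) = jn [A, A] Ds \<cdot> (((idn C A \<odot> runi C A) \<cdot> c) \<odot> ?D)"
    using mor_mk_tns_Ids[OF a, of A Ds] by (simp add: copy1_alt assoc del: jn_split_simps)
  also have "\<dots> = (idn C A \<odot> (run C A \<odot> ?D)) \<cdot> (asc C A (A \<otimes> \<one>) (T Ds) \<cdot> ((idn C A \<odot> runi C A) \<odot> ?D)) \<cdot> (c \<odot> ?D)"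
    using jn_single[of A Ds] by (simp add: assoc tensm_merge)
  also have "\<dots> = asc C A A (T Ds) \<cdot> (c \<odot> ?D)"
    by (simp add: asc_nat) (simp add: assoc tensm_merge_comp tensm_merge)
  finally show ?thesis .
qed

lemma mor_ero_Ids:
  assumes [simp]: "arr w" "src w = A" "trg w = \<one>" "A \<in> Obj C" "okl Ds"
  shows "mor (ero A w \<boxtimes> Ids Ds) = lun C (T Ds) \<cdot> (w \<odot> idn C (T Ds))"
proof -
  have a: "ar (ero A w)" by (simp add: ar_def drop1_def)
  show ?thesis
    using mor_mk_tns_Ids[OF a, of A Ds] by (simp add: drop1_alt assoc)
qed

text \<open>Each law is the one of the model tensored with the identity of the unit, once naturality
  has moved the associators aside; for coassociativity the pentagon rebrackets the rest.\<close>

lemma strict_comonoid: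
  assumes cc: "commutative_comonoid C A c w"
  shows "(dpo A c \<boxtimes> Ids [A]) \<circ>\<^sub>s dpo A c = (Ids [A] \<boxtimes> dpo A c) \<circ>\<^sub>s dpo A c"
    and "(ero A w \<boxtimes> Ids [A]) \<circ>\<^sub>s dpo A c = Ids [A]"
    and "sgs [A] [A] \<circ>\<^sub>s dpo A c = dpo A c"
proof -
  note [simp] = comonoid_arr[OF cc] copy_arr[OF cc]
  have ax: "asc C A A A \<cdot> (c \<odot> idn C A) \<cdot> c = (idn C A \<odot> c) \<cdot> c" "lun C A \<cdot> (w \<odot> idn C A) \<cdot> c = idn C A"
    "smcc.sym C A A \<cdot> c = c"
    using cc by (simp_all add: commutative_comonoid_def)
  show "(dpo A c \<boxtimes> Ids [A]) \<circ>\<^sub>s dpo A c = (Ids [A] \<boxtimes> dpo A c) \<circ>\<^sub>s dpo A c"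
  proof (rule arrow_eqI)
    have "mor ((dpo A c \<boxtimes> Ids [A]) \<circ>\<^sub>s dpo A c)
      = asc C A A (A \<otimes> \<one>) \<cdot> ((c \<odot> (idn C A \<odot> idn C \<one>)) \<cdot> asc C A A \<one>) \<cdot> (c \<odot> idn C \<one>)"
      by (simp add: mor_dpo_Ids copy1_def assoc)
    also have "\<dots> = asc C A A (A \<otimes> \<one>) \<cdot> (asc C (A \<otimes> A) A \<one> \<cdot> ((c \<odot> idn C A) \<odot> idn C \<one>)) \<cdot> (c \<odot> idn C \<one>)"
      using asc_nat[of c "idn C A" "idn C \<one>"] by simp
    also have "\<dots> = (asc C A A (A \<otimes> \<one>) \<cdot> asc C (A \<otimes> A) A \<one>) \<cdot> (((c \<odot> idn C A) \<cdot> c) \<odot> idn C \<one>)"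
      by (simp add: assoc tensm_merge)
    also have "\<dots> = (idn C A \<odot> asc C A A \<one>) \<cdot> asc C A (A \<otimes> A) \<one> \<cdot> ((asc C A A A \<cdot> (c \<odot> idn C A) \<cdot> c) \<odot> idn C \<one>)"
      by (simp add: pentagon) (simp add: assoc tensm_merge)
    also have "\<dots> = (idn C A \<odot> asc C A A \<one>) \<cdot> (asc C A (A \<otimes> A) \<one> \<cdot> ((idn C A \<odot> c) \<odot> idn C \<one>)) \<cdot> (c \<odot> idn C \<one>)"
      unfolding ax by (simp add: assoc tensm_merge)
    also have "\<dots> = mor ((Ids [A] \<boxtimes> dpo A c) \<circ>\<^sub>s dpo A c)"
      by (simp add: asc_nat) (simp add: mor_Ids_tns copy1_def assoc tensm_merge_comp)
    finally show "mor ((dpo A c \<boxtimes> Ids [A]) \<circ>\<^sub>s dpo A c) = mor ((Ids [A] \<boxtimes> dpo A c) \<circ>\<^sub>s dpo A c)" .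
  qed simp_all
  show "(ero A w \<boxtimes> Ids [A]) \<circ>\<^sub>s dpo A c = Ids [A]"
  proof (rule arrow_eqI)
    have "mor ((ero A w \<boxtimes> Ids [A]) \<circ>\<^sub>s dpo A c)
      = lun C (A \<otimes> \<one>) \<cdot> ((w \<odot> (idn C A \<odot> idn C \<one>)) \<cdot> asc C A A \<one>) \<cdot> (c \<odot> idn C \<one>)"
      by (simp add: mor_ero_Ids copy1_def assoc)
    also have "\<dots> = lun C (A \<otimes> \<one>) \<cdot> (asc C \<one> A \<one> \<cdot> ((w \<odot> idn C A) \<odot> idn C \<one>)) \<cdot> (c \<odot> idn C \<one>)"
      using asc_nat[of w "idn C A" "idn C \<one>"] by simp
    also have "\<dots> = (lun C (A \<otimes> \<one>) \<cdot> asc C \<one> A \<one>) \<cdot> ((w \<odot> idn C A) \<odot> idn C \<one>) \<cdot> (c \<odot> idn C \<one>)"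
      by (simp add: assoc)
    also have "\<dots> = idn C (A \<otimes> \<one>)"
      by (simp add: lun_asc tensm_merge ax)
    finally show "mor ((ero A w \<boxtimes> Ids [A]) \<circ>\<^sub>s dpo A c) = mor (Ids [A])" by simp
  qed simp_all
  show "sgs [A] [A] \<circ>\<^sub>s dpo A c = dpo A c"
    by (rule arrow_eqI) (simp_all add: mor_sgs_single, simp add: swap_def copy1_def assoc, simp add: tensm_merge_comp tensm_merge ax)
qed

text \<open>Higher-order variables are the linear ones, as \<open>lin\<close> is instantiated with
  \<open>is_Ho\<close>; in valid contexts their undefined values are never reached.\<close>

primrec dpv :: "var \<Rightarrow> 'o list \<times> 'm \<times> 'o list" where
  "dpv (Gnd x) = dpo (nno C) (ctr C)"
| "dpv (Ho f \<sigma> \<tau>) = undefined"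
| "dpv (Stb F \<sigma>) = dpo (bang C (tyI C \<sigma>)) (dup C (tyI C \<sigma>))"

primrec erv :: "var \<Rightarrow> 'o list \<times> 'm \<times> 'o list" where
  "erv (Gnd x) = ero (nno C) (wkn C)"
| "erv (Ho f \<sigma> \<tau>) = undefined"
| "erv (Stb F \<sigma>) = ero (bang C (tyI C \<sigma>)) (era C (tyI C \<sigma>))"

declare tyI_obj [simp] varI_obj [simp]

lemma comonoid_var:
  assumes "\<not> is_Ho x"
  obtains c w where "commutative_comonoid C (varI C x) c w" "dpv x = dpo (varI C x) c" "erv x = ero (varI C x) w"
  using assms nno_comonoid comonoid_bang[OF tyI_obj] by (cases x) auto

sublocale wires okl ar "\<lambda>f. dm f" "\<lambda>f. cd f" Ids "(\<circ>\<^sub>s)" "(\<boxtimes>)" sgs "varI C" is_Ho dpv erv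
proof
  fix x assume "\<not> is_Ho x"
  then obtain c w where x: "commutative_comonoid C (varI C x) c w" "dpv x = dpo (varI C x) c" "erv x = ero (varI C x) w"
    by (rule comonoid_var)
  then show "ar (dpv x)" "dm (dpv x) = [varI C x]" "cd (dpv x) = [varI C x, varI C x]"
    "ar (erv x)" "dm (erv x) = [varI C x]" "cd (erv x) = []" by simp_all
  show "(dpv x \<boxtimes> Ids [varI C x]) \<circ>\<^sub>s dpv x = (Ids [varI C x] \<boxtimes> dpv x) \<circ>\<^sub>s dpv x"
    "(erv x \<boxtimes> Ids [varI C x]) \<circ>\<^sub>s dpv x = Ids [varI C x]"
    "sgs [varI C x] [varI C x] \<circ>\<^sub>s dpv x = dpv x"
    using strict_comonoid[OF x(1)] by (simp_all add: x)
qed (use varI_obj in auto)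

end

section \<open>Closed structure, numerals, and promotion\<close>

context Sl_category
begin

section \<open>Application and abstraction\<close>

lemma V_obj [simp]: "varI C ` S \<subseteq> Obj C"
  by auto

lemma eval_arr [simp]:
  assumes "A \<in> Obj C" "B \<in> Obj C"
  shows "arr (eval C A B)" "src (eval C A B) = hom C A B \<otimes> A" "trg (eval C A B) = B"
  using eval_hom[OF assms] by (auto simp: Hom_iff)

lemma cur_arr [simp]:
  assumes "A \<in> Obj C" "B \<in> Obj C" "arr f" "src f = A \<otimes> B" "trg f = D"
  shows "arr (cur C A B D f)" "src (cur C A B D f) = A" "trg (cur C A B D f) = hom C B D"
  using cur_hom[of A B f D] assms by (auto simp: Hom_iff)

lemma eval_cur': "A \<in> Obj C \<Longrightarrow> B \<in> Obj C \<Longrightarrow> arr f \<Longrightarrow> src f = A \<otimes> B \<Longrightarrow> trg f = D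
   \<Longrightarrow> eval C B D \<cdot> (cur C A B D f \<odot> idn C B) = f"
  by (rule eval_cur) (auto simp: Hom_iff)

text \<open>Both sides have the same uncurried form, and \<open>cur_eval\<close> says that this form
  determines the arrow.\<close>

lemma cur_natural:
  assumes [simp]: "arr k" "trg k = A" "B \<in> Obj C" "arr f" "src f = A \<otimes> B" "trg f = D"
  shows "cur C A B D f \<cdot> k = cur C (src k) B D (f \<cdot> (k \<odot> idn C B))"
proof -
  have [simp]: "A \<in> Obj C" "D \<in> Obj C" using arr_obj(2)[OF assms(1)] arr_obj(2)[OF assms(4)] by simp_all
  have "cur C A B D f \<cdot> k \<in> Hom C (src k) (hom C B D)" by (simp add: Hom_iff)
  from cur_eval[OF _ _ this]
  have "cur C A B D f \<cdot> k = cur C (src k) B D (eval C B D \<cdot> ((cur C A B D f \<cdot> k) \<odot> idn C B))" by simp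
  also have "eval C B D \<cdot> ((cur C A B D f \<cdot> k) \<odot> idn C B) = (eval C B D \<cdot> (cur C A B D f \<odot> idn C B)) \<cdot> (k \<odot> idn C B)"
    by (simp add: assoc tensm_merge)
  finally show ?thesis by (simp add: eval_cur')
qed

definition evs :: "'o \<Rightarrow> 'o \<Rightarrow> 'o list \<times> 'm \<times> 'o list" where
  "evs A B = mk [hom C A B, A] (eval C A B \<cdot> (idn C (hom C A B) \<odot> run C A)) B"

text \<open>The abstracted wire is the last one, as in the typing rule. \<open>snoc\<close> and
  \<open>run\<close> hide the trailing units from \<open>cur\<close>, so that the result agrees with
  the arrow chosen by \<open>sem\<close>.\<close>

definition crs :: "'o list \<Rightarrow> 'o \<Rightarrow> 'o \<Rightarrow> 'o list \<times> 'm \<times> 'o list \<Rightarrow> 'o list \<times> 'm \<times> 'o list" where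
  "crs As A B f = mk As (cur C (T As) A B (run C B \<cdot> mor f \<cdot> snoc C As A)) (hom C A B)"

lemma evs_arr [simp]:
  assumes "A \<in> Obj C" "B \<in> Obj C"
  shows "ar (evs A B)" "dm (evs A B) = [hom C A B, A]" "cd (evs A B) = [B]"
  using assms by (auto simp: evs_def)

lemma snoc_arr [simp]:
  assumes "okl As" "B \<in> Obj C"
  shows "arr (snoc C As B)" "src (snoc C As B) = T As \<otimes> B" "trg (snoc C As B) = T (As @ [B])"
  using snoc_hom[OF assms] by (auto simp: Hom_iff)

lemma ar_body [simp]:
  assumes "ar f" "dm f = As @ [A]" "cd f = [B]"
  shows "arr (run C B \<cdot> mor f \<cdot> snoc C As A)" "src (run C B \<cdot> mor f \<cdot> snoc C As A) = T As \<otimes> A"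
    "trg (run C B \<cdot> mor f \<cdot> snoc C As A) = B" "okl As" "A \<in> Obj C" "B \<in> Obj C"
  using ar_simps[OF assms(1)] assms by auto

lemma crs_arr [simp]:
  assumes "ar f" "dm f = As @ [A]" "cd f = [B]"
  shows "ar (crs As A B f)"
  using ar_body[OF assms] by (simp add: crs_def)

lemma crs_proj [simp]: "dm (crs As A B f) = As" "cd (crs As A B f) = [hom C A B]"
  by (simp_all add: crs_def)

lemma evs_mk:
  assumes [simp]: "okl As" "okl Bs" "arr f" "arr g" "src f = T As" "src g = T Bs" "trg f = hom C A B" "trg g = A"
    "A \<in> Obj C" "B \<in> Obj C"
  shows "evs A B \<circ>\<^sub>s (mk As f (hom C A B) \<boxtimes> mk Bs g A) = mk (As @ Bs) (eval C A B \<cdot> (f \<odot> g) \<cdot> sp As Bs) B"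
  by (rule arrow_eqI) (simp_all add: evs_def mor_mk_tns assoc tensm_merge_comp)

lemma Ids_single: "A \<in> Obj C \<Longrightarrow> Ids [A] = mk [A] (run C A) A"
  by (rule arrow_eqI) (simp_all add: Ids_def)

lemma evs_crs:
  assumes f: "ar f" "dm f = As @ [A]" "cd f = [B]"
  shows "evs A B \<circ>\<^sub>s (crs As A B f \<boxtimes> Ids [A]) = f"
proof (rule arrow_eqI)
  note [simp] = ar_body[OF f]
  let ?b = "run C B \<cdot> mor f \<cdot> snoc C As A"
  have "evs A B \<circ>\<^sub>s (crs As A B f \<boxtimes> Ids [A]) = mk (As @ [A]) (eval C A B \<cdot> (cur C (T As) A B ?b \<odot> run C A) \<cdot> sp As [A]) B"
    by (simp add: crs_def Ids_single evs_mk)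
  also have "cur C (T As) A B ?b \<odot> run C A = (cur C (T As) A B ?b \<odot> idn C A) \<cdot> (idn C (T As) \<odot> run C A)"
    by (simp add: tensm_merge)
  also have "eval C A B \<cdot> (\<dots>) \<cdot> sp As [A] = (eval C A B \<cdot> (cur C (T As) A B ?b \<odot> idn C A)) \<cdot> (idn C (T As) \<odot> run C A) \<cdot> sp As [A]"
    by (simp add: assoc)
  also have "\<dots> = run C B \<cdot> mor f"
    using f by (simp only: eval_cur' ar_body[OF f] tensl_obj) (simp add: snoc_alt assoc tensm_merge_comp)
  finally show "mor (evs A B \<circ>\<^sub>s (crs As A B f \<boxtimes> Ids [A])) = mor f"
    using f by simp
qed (use f ar_body[OF f] in simp_all)

lemma crs_cmp:
  assumes f: "ar f" "dm f = cd k @ [A]" "cd f = [B]" and k: "ar k"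
  shows "crs (cd k) A B f \<circ>\<^sub>s k = crs (dm k) A B (f \<circ>\<^sub>s (k \<boxtimes> Ids [A]))"
proof (rule arrow_eqI)
  note [simp] = ar_body[OF f] ar_simps[OF k]
  have "(run C B \<cdot> mor f \<cdot> snoc C (cd k) A) \<cdot> (mor k \<odot> idn C A)
    = run C B \<cdot> mor (f \<circ>\<^sub>s (k \<boxtimes> Ids [A])) \<cdot> snoc C (dm k) A"
    using f by (simp add: snoc_alt tnss_def assoc tensm_merge tensm_merge_comp)
  then show "mor (crs (cd k) A B f \<circ>\<^sub>s k) = mor (crs (dm k) A B (f \<circ>\<^sub>s (k \<boxtimes> Ids [A])))"
    using f k by (simp add: crs_def assoc cur_natural)
qed simp_all

section \<open>Numerals and conditionals\<close>

lemma pair_arr [simp]: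
  assumes "arr f" "arr g" "src f = src g"
  shows "arr (pair C f g)" "src (pair C f g) = src f" "trg (pair C f g) = slcat.prod C (trg f) (trg g)"
  using pair_hom[of f "src f" "trg f" g "trg g"] assms by (auto simp: Hom_iff)

lemma pair_comp:
  assumes "arr f" "arr g" "src f = src g" "arr h" "trg h = src f"
  shows "pair C f g \<cdot> h = pair C (f \<cdot> h) (g \<cdot> h)"
proof -
  let ?A = "trg f" and ?B = "trg g"
  have h: "f \<in> Hom C (src f) ?A" "g \<in> Hom C (src f) ?B" using assms by (auto simp: Hom_iff)
  have p: "proj1 C ?A ?B \<in> Hom C (slcat.prod C ?A ?B) ?A" "proj2 C ?A ?B \<in> Hom C (slcat.prod C ?A ?B) ?B"
    using assms by (auto intro: proj1_hom proj2_hom)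
  have "pair C f g \<cdot> h \<in> Hom C (src h) (slcat.prod C ?A ?B)" using assms by (auto simp: Hom_iff)
  from pair_unique[OF _ _ this]
  have "pair C f g \<cdot> h = pair C (proj1 C ?A ?B \<cdot> pair C f g \<cdot> h) (proj2 C ?A ?B \<cdot> pair C f g \<cdot> h)"
    using assms by simp
  also have "proj1 C ?A ?B \<cdot> pair C f g \<cdot> h = f \<cdot> h"
    by (rule comp_reassoc[OF proj1_pair[OF h]]) (use assms p in \<open>auto simp: Hom_iff\<close>)
  also have "proj2 C ?A ?B \<cdot> pair C f g \<cdot> h = g \<cdot> h"
    by (rule comp_reassoc[OF proj2_pair[OF h]]) (use assms p in \<open>auto simp: Hom_iff\<close>)
  finally show ?thesis .
qed

abbreviation N :: "'o" where "N \<equiv> nno C"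

lemma nno_arr [simp]:
  "arr (zro C)" "src (zro C) = \<one>" "trg (zro C) = N" "arr (suc C)" "src (suc C) = N" "trg (suc C) = N"
  "arr (prd C)" "src (prd C) = N" "trg (prd C) = N"
  "arr (lif C)" "src (lif C) = N \<otimes> slcat.prod C N N" "trg (lif C) = N"
  using zro_hom suc_hom prd_hom lif_hom by (auto simp: Hom_iff)

lemma numeral_arr' : "arr (numeral_arrow C n) \<and> src (numeral_arrow C n) = \<one> \<and> trg (numeral_arrow C n) = N"
  by (induction n) auto

lemma numeral_arr [simp]: "arr (numeral_arrow C n)" "src (numeral_arrow C n) = \<one>" "trg (numeral_arrow C n) = N"
  using numeral_arr' by auto

definition nm :: "nat \<Rightarrow> 'o list \<times> 'm \<times> 'o list" where "nm n = mk [] (numeral_arrow C n) N"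
definition sucs :: "'o list \<times> 'm \<times> 'o list" where "sucs = mk [N] (suc C \<cdot> run C N) N"
definition prds :: "'o list \<times> 'm \<times> 'o list" where "prds = mk [N] (prd C \<cdot> run C N) N"

lemma nm_arr [simp]: "ar (nm n)" "dm (nm n) = []" "cd (nm n) = [N]"
  "ar sucs" "dm sucs = [N]" "cd sucs = [N]" "ar prds" "dm prds = [N]" "cd prds = [N]"
  by (simp_all add: nm_def sucs_def prds_def)

lemma sucs_nm: "sucs \<circ>\<^sub>s nm n = nm (Suc n)"
  by (rule arrow_eqI) (simp_all, simp_all add: sucs_def nm_def assoc)

lemma prds_nm: "prds \<circ>\<^sub>s nm (Suc n) = nm n"
  by (rule arrow_eqI) (simp_all, simp_all add: prds_def nm_def assoc, simp flip: numeral_arrow.simps add: prd_suc)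

text \<open>The branches share their inputs through the cartesian product, which is no tensor of
  wires. The conditional is therefore an operation on three arrows instead of composition with a
  fixed strict arrow.\<close>

definition cond :: "'o list \<times> 'm \<times> 'o list \<Rightarrow> 'o list \<times> 'm \<times> 'o list \<Rightarrow> 'o list \<times> 'm \<times> 'o list \<Rightarrow> 'o list \<times> 'm \<times> 'o list" where
  "cond m l r = mk (dm m @ dm l) (lif C \<cdot> ((run C N \<cdot> mor m) \<odot> pair C (run C N \<cdot> mor l) (run C N \<cdot> mor r)) \<cdot> sp (dm m) (dm l)) N"

lemma cond_proj [simp]: "dm (cond m l r) = dm m @ dm l" "cd (cond m l r) = [N]"
  by (simp_all add: cond_def)

lemma cond_arr [simp]:
  assumes "ar m" "ar l" "ar r" "dm l = dm r" "cd m = [N]" "cd l = [N]" "cd r = [N]"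
  shows "ar (cond m l r)"
  using ar_simps[OF assms(1)] ar_simps[OF assms(2)] ar_simps[OF assms(3)] assms by (simp add: cond_def)

lemma cond_cmp:
  assumes "ar m" "ar l" "ar r" "dm l = dm r" "cd m = [N]" "cd l = [N]" "cd r = [N]"
    "ar a" "ar b" "cd a = dm m" "cd b = dm r"
  shows "cond (m \<circ>\<^sub>s a) (l \<circ>\<^sub>s b) (r \<circ>\<^sub>s b) = cond m l r \<circ>\<^sub>s (a \<boxtimes> b)"
proof (rule arrow_eqI)
  note [simp] = ar_simps[OF assms(1)] ar_simps[OF assms(2)] ar_simps[OF assms(3)]
    ar_simps[OF assms(8)] ar_simps[OF assms(9)]
  have "pair C (run C N \<cdot> mor l \<cdot> mor b) (run C N \<cdot> mor r \<cdot> mor b)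
    = pair C (run C N \<cdot> mor l) (run C N \<cdot> mor r) \<cdot> mor b"
    using assms by (simp add: pair_comp assoc)
  then show "mor (cond (m \<circ>\<^sub>s a) (l \<circ>\<^sub>s b) (r \<circ>\<^sub>s b)) = mor (cond m l r \<circ>\<^sub>s (a \<boxtimes> b))"
    using assms by (simp add: cond_def tnss_def assoc tensm_merge_comp)
qed (use assms in simp_all)

text \<open>The branches are generalized elements with source \<open>T (dm r)\<close>, to which
  \<open>lif_zero\<close> and \<open>lif_suc\<close> apply.\<close>

lemma cond_nm:
  assumes "ar l" "ar r" "dm l = dm r" "cd l = [N]" "cd r = [N]"
  shows "cond (nm 0) l r = l" and "cond (nm (Suc n)) l r = r"
proof -
  note [simp] = ar_simps[OF assms(1)] ar_simps[OF assms(2)]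
  have h: "run C N \<cdot> mor l \<in> Hom C (T (dm r)) N" "run C N \<cdot> mor r \<in> Hom C (T (dm r)) N"
    using assms by (simp_all add: Hom_iff)
  show "cond (nm 0) l r = l"
    using assms lif_zero[OF h] mk_run[OF assms(1,4)]
    by (intro arrow_eqI) (simp_all add: cond_def nm_def)
  show "cond (nm (Suc n)) l r = r"
    using assms lif_suc[OF h] mk_run[OF assms(2,5)]
    by (intro arrow_eqI) (simp_all add: cond_def nm_def)
qed

section \<open>The exponential and the coalgebra structure of contexts\<close>

abbreviation B :: "'m \<Rightarrow> 'm" where "B \<equiv> bangm C"

lemma bang_arr [simp]:
  assumes "arr f"
  shows "arr (B f)" "src (B f) = bang C (src f)" "trg (B f) = bang C (trg f)"
  using bangm_hom[of f "src f" "trg f"] assms by (auto simp: Hom_iff)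

lemma exp_arr [simp]:
  assumes "A \<in> Obj C"
  shows "arr (dlt C A)" "src (dlt C A) = bang C A" "trg (dlt C A) = bang C (bang C A)"
    "arr (eps C A)" "src (eps C A) = bang C A" "trg (eps C A) = A"
    "arr (dup C A)" "src (dup C A) = bang C A" "trg (dup C A) = bang C A \<otimes> bang C A"
    "arr (era C A)" "src (era C A) = bang C A" "trg (era C A) = \<one>"
    "arr (fixp C A)" "src (fixp C A) = bang C (hom C (bang C A) A)" "trg (fixp C A) = A"
  using dlt_hom[OF assms] eps_hom[OF assms] bang_comonoid_homs[OF assms] fixp_hom[OF assms]
  by (auto simp: Hom_iff)

lemma q_arr [simp]:
  "arr (q1 C)" "src (q1 C) = \<one>" "trg (q1 C) = bang C \<one>"
  "A \<in> Obj C \<Longrightarrow> D \<in> Obj C \<Longrightarrow> arr (q2 C A D)"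
  "A \<in> Obj C \<Longrightarrow> D \<in> Obj C \<Longrightarrow> src (q2 C A D) = bang C A \<otimes> bang C D"
  "A \<in> Obj C \<Longrightarrow> D \<in> Obj C \<Longrightarrow> trg (q2 C A D) = bang C (A \<otimes> D)"
  using q1_hom q2_hom by (auto simp: Hom_iff)

lemma bang_idn [simp]: "A \<in> Obj C \<Longrightarrow> B (idn C A) = idn C (bang C A)"
  by (rule bangm_idn)

lemma bang_comp: "arr f \<Longrightarrow> arr g \<Longrightarrow> src g = trg f \<Longrightarrow> B g \<cdot> B f = B (g \<cdot> f)"
  by (rule bangm_comp[symmetric]) (auto simp: Hom_iff)

lemma bang_comp_comp: "arr f \<Longrightarrow> arr g \<Longrightarrow> src g = trg f \<Longrightarrow> arr h \<Longrightarrow> trg h = bang C (src f)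
  \<Longrightarrow> B g \<cdot> B f \<cdot> h = B (g \<cdot> f) \<cdot> h"
  by (simp add: bang_comp flip: assoc)

lemma q2_nat: "arr f \<Longrightarrow> arr g \<Longrightarrow> trg f = A \<Longrightarrow> trg g = D
  \<Longrightarrow> q2 C A D \<cdot> (B f \<odot> B g) = B (f \<odot> g) \<cdot> q2 C (src f) (src g)"
  by (rule q2_natural) (auto simp: Hom_iff)

lemma dlt_nat: "arr f \<Longrightarrow> trg f = A \<Longrightarrow> dlt C A \<cdot> B f = B (B f) \<cdot> dlt C (src f)"
  and eps_nat: "arr f \<Longrightarrow> trg f = A \<Longrightarrow> eps C A \<cdot> B f = f \<cdot> eps C (src f)"
  and dup_nat: "arr f \<Longrightarrow> trg f = A \<Longrightarrow> dup C A \<cdot> B f = (B f \<odot> B f) \<cdot> dup C (src f)"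
  and era_nat: "arr f \<Longrightarrow> trg f = A \<Longrightarrow> era C A \<cdot> B f = era C (src f)"
  by (rule dlt_natural eps_natural dup_natural era_natural; auto simp: Hom_iff)+

text \<open>\<open>zro\<close> and \<open>suc\<close> are morphisms of coalgebras and of comonoids,
  and numerals are their composites.\<close>

lemma numeral_laws:
  "pco C \<cdot> numeral_arrow C n = B (numeral_arrow C n) \<cdot> q1 C"
  "ctr C \<cdot> numeral_arrow C n = (numeral_arrow C n \<odot> numeral_arrow C n) \<cdot> luni C \<one>"
  "wkn C \<cdot> numeral_arrow C n = idn C \<one>"
proof -
  have [simp]: "arr (pco C)" "src (pco C) = N" "trg (pco C) = bang C N" "arr (ctr C)" "src (ctr C) = N"
    "trg (ctr C) = N \<otimes> N" "arr (wkn C)" "src (wkn C) = N" "trg (wkn C) = \<one>"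
    using nno_homs by (auto simp: Hom_iff)
  have z: "pco C \<cdot> zro C = B (zro C) \<cdot> q1 C" "ctr C \<cdot> zro C = (zro C \<odot> zro C) \<cdot> luni C \<one>" "wkn C \<cdot> zro C = idn C \<one>"
    using zro_coalgebra zro_comonoid by (auto simp: coalgebra_morphism_def comonoid_morphism_def)
  have s: "pco C \<cdot> suc C = B (suc C) \<cdot> pco C" "ctr C \<cdot> suc C = (suc C \<odot> suc C) \<cdot> ctr C" "wkn C \<cdot> suc C = wkn C"
    using suc_coalgebra suc_comonoid by (auto simp: coalgebra_morphism_def comonoid_morphism_def)
  show "pco C \<cdot> numeral_arrow C n = B (numeral_arrow C n) \<cdot> q1 C"
  proof (induction n)
    case (Suc n)
    then show ?case by (simp add: comp_reassoc[OF s(1)] assoc bang_comp_comp)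
  qed (simp add: z)
  show "ctr C \<cdot> numeral_arrow C n = (numeral_arrow C n \<odot> numeral_arrow C n) \<cdot> luni C \<one>"
  proof (induction n)
    case (Suc n)
    then show ?case by (simp add: comp_reassoc[OF s(2)] assoc tensm_merge_comp)
  qed (simp add: z)
  show "wkn C \<cdot> numeral_arrow C n = idn C \<one>"
    by (induction n) (simp_all add: z comp_reassoc[OF s(3)])
qed

abbreviation co :: "var \<Rightarrow> 'm" where "co \<equiv> coalgI C"
abbreviation V :: "var \<Rightarrow> 'o" where "V \<equiv> varI C"

lemma co_arr [simp]:
  assumes "\<not> is_Ho x"
  shows "arr (co x)" "src (co x) = V x" "trg (co x) = bang C (V x)"
  using coalgI_hom[OF assms] by (auto simp: Hom_iff)

lemma co_coalgebra:
  assumes "\<not> is_Ho x"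
  shows "eps C (V x) \<cdot> co x = idn C (V x)" "dlt C (V x) \<cdot> co x = B (co x) \<cdot> co x"
  using assms pco_coalgebra by (cases x; auto simp: coalgebra_def eps_dlt dlt_dlt)+

text \<open>
  On \<open>N\<close> the comonoid is a retract of that of \<open>!N\<close>, which makes \<open>ctr\<close> and \<open>wkn\<close> coalgebra morphisms.
\<close>

lemma nno_coalgebra_comonoid:
  "B (ctr C) \<cdot> pco C = q2 C N N \<cdot> (pco C \<odot> pco C) \<cdot> ctr C"
  "B (wkn C) \<cdot> pco C = q1 C \<cdot> wkn C"
proof -
  let ?p = "pco C" and ?e = "eps C N" and ?d = "dup C N"
  have [simp]: "arr ?p" "src ?p = N" "trg ?p = bang C N" "arr (ctr C)" "src (ctr C) = N"
    "trg (ctr C) = N \<otimes> N" "arr (wkn C)" "src (wkn C) = N" "trg (wkn C) = \<one>"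
    using nno_homs by (auto simp: Hom_iff)
  have p: "?e \<cdot> ?p = idn C N" "dlt C N \<cdot> ?p = B ?p \<cdot> ?p"
    using pco_coalgebra by (auto simp: coalgebra_def)
  have dp: "?d \<cdot> ?p = (?p \<odot> ?p) \<cdot> ctr C" and ep: "era C N \<cdot> ?p = wkn C"
    using pco_comonoid by (auto simp: comonoid_morphism_def)
  have d: "q2 C (bang C N) (bang C N) \<cdot> (dlt C N \<odot> dlt C N) \<cdot> ?d = B ?d \<cdot> dlt C N"
    using dup_coalgebra[of N] by (simp add: coalgebra_morphism_def assoc)
  have e: "q1 C \<cdot> era C N = B (era C N) \<cdot> dlt C N"
    using era_coalgebra[of N] by (simp add: coalgebra_morphism_def)
  \<comment> \<open>\<open>eps\<close> is a retraction of \<open>pco\<close>, so the copying of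
    \<open>N\<close> can be computed inside \<open>!N\<close>, where \<open>dup\<close> is known to
    be a coalgebra morphism.\<close>
  have c: "ctr C = (?e \<odot> ?e) \<cdot> ?d \<cdot> ?p"
    unfolding dp by (simp add: tensm_merge_comp p)
  have "B (ctr C) \<cdot> ?p = B (?e \<odot> ?e) \<cdot> B ?d \<cdot> B ?p \<cdot> ?p"
    unfolding c by (simp add: bang_comp_comp assoc bang_comp)
  also have "\<dots> = B (?e \<odot> ?e) \<cdot> (q2 C (bang C N) (bang C N) \<cdot> (dlt C N \<odot> dlt C N) \<cdot> ?d) \<cdot> ?p"
    unfolding d by (simp add: assoc flip: p)
  also have "\<dots> = (q2 C N N \<cdot> (B ?e \<odot> B ?e)) \<cdot> (dlt C N \<odot> dlt C N) \<cdot> ?d \<cdot> ?p"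
    by (simp add: q2_nat) (simp add: assoc)
  also have "\<dots> = q2 C N N \<cdot> ?d \<cdot> ?p"
    by (simp add: assoc tensm_merge_comp bang_eps_dlt)
  finally show "B (ctr C) \<cdot> ?p = q2 C N N \<cdot> (?p \<odot> ?p) \<cdot> ctr C"
    by (simp add: dp)
  have "B (wkn C) \<cdot> ?p = B (era C N) \<cdot> B ?p \<cdot> ?p"
    by (simp add: bang_comp_comp flip: ep)
  also have "\<dots> = (q1 C \<cdot> era C N) \<cdot> ?p"
    unfolding e by (simp add: assoc flip: p)
  also have "\<dots> = q1 C \<cdot> wkn C"
    by (simp add: assoc ep)
  finally show "B (wkn C) \<cdot> ?p = q1 C \<cdot> wkn C" .
qed

text \<open>Gathers, for either kind of copyable variable, that its comonoid maps are coalgebra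
  morphisms and that its coalgebra structure is a comonoid morphism. For \<open>N\<close> the latter
  is an axiom; for \<open>!A\<close> it is the axiom on free coalgebras, applied to
  \<open>dlt\<close>.\<close>

lemma coalg_var:
  assumes "\<not> is_Ho x"
  obtains c w where "commutative_comonoid C (V x) c w" "dpv x = dpo (V x) c" "erv x = ero (V x) w"
    "B c \<cdot> co x = q2 C (V x) (V x) \<cdot> (co x \<odot> co x) \<cdot> c" "B w \<cdot> co x = q1 C \<cdot> w"
    "dup C (V x) \<cdot> co x = (co x \<odot> co x) \<cdot> c" "era C (V x) \<cdot> co x = w"
proof (cases x)
  case (Gnd y)
  then show ?thesis
    using that[of "ctr C" "wkn C"] nno_comonoid nno_coalgebra_comonoid pco_comonoid
    by (simp add: comonoid_morphism_def)
next
  case (Ho f \<sigma> \<tau>)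
  with assms show ?thesis by simp
next
  case (Stb F \<sigma>)
  let ?A = "tyI C \<sigma>"
  have "comonoid_morphism C (bang C ?A) (dup C ?A) (era C ?A) (bang C (bang C ?A)) (dup C (bang C ?A)) (era C (bang C ?A)) (dlt C ?A)"
    \<comment> \<open>\<open>dlt\<close> is a morphism of free coalgebras by the coassociativity of
      the comonad.\<close>
    by (rule free_coalgebra_comonoid) (auto simp: coalgebra_morphism_def Hom_iff dlt_dlt)
  then show ?thesis
    using that[of "dup C ?A" "era C ?A"] comonoid_bang[of ?A] dup_coalgebra[of ?A] era_coalgebra[of ?A] Stb
    by (auto simp: comonoid_morphism_def coalgebra_morphism_def assoc)
qed

text \<open>The tensor of the coalgebras of the variables of \<open>\<Gamma>\<close>; \<open>cm\<close> below is the notion of coalgebra morphism.\<close>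

definition kap :: "var list \<Rightarrow> 'm" where
  "kap \<Gamma> = ql C (map (varI C) \<Gamma>) \<cdot> tensml C (map (coalgI C) \<Gamma>)"

abbreviation nl :: "var list \<Rightarrow> bool" where "nl \<Gamma> \<equiv> \<forall>x \<in> set \<Gamma>. \<not> is_Ho x"

lemma kap_hom: "nl \<Gamma> \<Longrightarrow> kap \<Gamma> \<in> Hom C (T (W \<Gamma>)) (bang C (T (W \<Gamma>)))"
  unfolding kap_def
  using comp_hom[OF tensml_coalgI_hom ql_hom[OF vars_obj]] by (simp add: basisI_def)

lemma kap_arr [simp]:
  assumes "nl \<Gamma>"
  shows "arr (kap \<Gamma>)" "src (kap \<Gamma>) = T (W \<Gamma>)" "trg (kap \<Gamma>) = bang C (T (W \<Gamma>))"
  using kap_hom[OF assms] by (auto simp: Hom_iff)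

lemma kap_Nil [simp]: "kap [] = q1 C"
  by (simp add: kap_def)

lemma kap_Cons [simp]:
  assumes "nl (x # \<Gamma>)"
  shows "kap (x # \<Gamma>) = q2 C (V x) (T (W \<Gamma>)) \<cdot> (co x \<odot> kap \<Gamma>)"
proof -
  have "\<forall>x \<in> set \<Gamma>. \<not> is_Ho x" using assms by simp
  from tensml_coalgI_hom[OF this] ql_hom[OF vars_obj, of \<Gamma>]
  have [simp]: "arr (tensml C (map co \<Gamma>))" "src (tensml C (map co \<Gamma>)) = T (W \<Gamma>)"
    "trg (tensml C (map co \<Gamma>)) = T (map (bang C) (W \<Gamma>))"
    "arr (ql C (W \<Gamma>))" "src (ql C (W \<Gamma>)) = T (map (bang C) (W \<Gamma>))" "trg (ql C (W \<Gamma>)) = bang C (T (W \<Gamma>))"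
    by (auto simp: Hom_iff basisI_def)
  show ?thesis using assms by (simp add: kap_def assoc tensm_merge)
qed

text \<open>The unit and the tensor of coalgebras are again coalgebras, because counit and
  comultiplication are monoidal with respect to \<open>q1\<close> and \<open>q2\<close>.\<close>

lemma kap_coalgebra:
  assumes "nl \<Gamma>"
  shows "eps C (T (W \<Gamma>)) \<cdot> kap \<Gamma> = idn C (T (W \<Gamma>)) \<and> dlt C (T (W \<Gamma>)) \<cdot> kap \<Gamma> = B (kap \<Gamma>) \<cdot> kap \<Gamma>"
  using assms
proof (induction \<Gamma>)
  case Nil
  then show ?case by (simp add: eps_q1 dlt_q1)
next
  case (Cons x \<Gamma>)
  let ?A = "V x" and ?G = "T (W \<Gamma>)" and ?k = "co x" and ?K = "kap \<Gamma>"
  have nl: "\<not> is_Ho x" "nl \<Gamma>" using Cons.prems by auto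
  note k = co_coalgebra[OF nl(1)] and K = conjunct1[OF Cons.IH[OF nl(2)]] conjunct2[OF Cons.IH[OF nl(2)]]
  have "eps C (?A \<otimes> ?G) \<cdot> q2 C ?A ?G \<cdot> (?k \<odot> ?K) = (eps C ?A \<odot> eps C ?G) \<cdot> (?k \<odot> ?K)"
    using nl by (intro comp_reassoc[OF eps_q2]) auto
  moreover have "dlt C (?A \<otimes> ?G) \<cdot> q2 C ?A ?G \<cdot> (?k \<odot> ?K)
    = (B (q2 C ?A ?G) \<cdot> q2 C (bang C ?A) (bang C ?G) \<cdot> (dlt C ?A \<odot> dlt C ?G)) \<cdot> (?k \<odot> ?K)"
    using nl by (intro comp_reassoc[OF dlt_q2]) auto
  moreover have "\<dots> = B (q2 C ?A ?G) \<cdot> (q2 C (bang C ?A) (bang C ?G) \<cdot> (B ?k \<odot> B ?K)) \<cdot> (?k \<odot> ?K)"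
    using nl by (simp add: assoc tensm_merge k K)
  moreover have "\<dots> = B (q2 C ?A ?G \<cdot> (?k \<odot> ?K)) \<cdot> q2 C ?A ?G \<cdot> (?k \<odot> ?K)"
    using nl by (simp add: q2_nat) (simp add: assoc bang_comp_comp)
  ultimately show ?case using nl by (simp add: tensm_merge k K)
qed

text \<open>The iterated \<open>q\<close> is bracketed to the right. Compatibility of
  \<open>q2\<close> with the associators rebrackets it along a splitting, and \<open>q2_lun\<close>
  handles the empty block.\<close>

lemma kap_split:
  assumes "nl \<Gamma>" "nl \<Delta>"
  shows "B (sp (W \<Gamma>) (W \<Delta>)) \<cdot> kap (\<Gamma> @ \<Delta>) = q2 C (T (W \<Gamma>)) (T (W \<Delta>)) \<cdot> (kap \<Gamma> \<odot> kap \<Delta>) \<cdot> sp (W \<Gamma>) (W \<Delta>)"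
  using assms(1)
proof (induction \<Gamma>)
  case Nil
  let ?D = "T (W \<Delta>)" and ?k = "kap \<Delta>"
  have "B (luni C ?D) \<cdot> ?k = B (luni C ?D) \<cdot> (lun C (bang C ?D) \<cdot> luni C (bang C ?D)) \<cdot> ?k"
    using assms(2) by simp
  also have "\<dots> = B (luni C ?D) \<cdot> lun C (bang C ?D) \<cdot> (luni C (bang C ?D) \<cdot> ?k)"
    using assms(2) by (simp add: assoc)
  also have "luni C (bang C ?D) \<cdot> ?k = (idn C \<one> \<odot> ?k) \<cdot> luni C ?D"
    using assms(2) by (simp add: luni_nat)
  also have "lun C (bang C ?D) \<cdot> (idn C \<one> \<odot> ?k) \<cdot> luni C ?D
    = (B (lun C ?D) \<cdot> q2 C \<one> ?D \<cdot> (q1 C \<odot> idn C (bang C ?D))) \<cdot> (idn C \<one> \<odot> ?k) \<cdot> luni C ?D"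
    by (simp add: q2_lun)
  also have "B (luni C ?D) \<cdot> \<dots> = q2 C \<one> ?D \<cdot> (q1 C \<odot> ?k) \<cdot> luni C ?D"
    using assms(2) by (simp add: assoc bang_comp_comp tensm_merge_comp)
  finally show ?case by simp
next
  case (Cons x \<Gamma>)
  let ?A = "V x" and ?G = "T (W \<Gamma>)" and ?D = "T (W \<Delta>)" and ?s = "sp (W \<Gamma>) (W \<Delta>)"
  have nl: "\<not> is_Ho x" "nl \<Gamma>" "nl \<Delta>" "nl (\<Gamma> @ \<Delta>)" "nl (x # \<Gamma> @ \<Delta>)" using Cons.prems assms(2) by auto
  \<comment> \<open>The law \<open>q2_asc\<close>, solved for the inverse associators.\<close>
  have q: "B (asci C ?A ?G ?D) \<cdot> q2 C ?A (?G \<otimes> ?D) \<cdot> (idn C (bang C ?A) \<odot> q2 C ?G ?D)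
    = q2 C (?A \<otimes> ?G) ?D \<cdot> (q2 C ?A ?G \<odot> idn C (bang C ?D)) \<cdot> asci C (bang C ?A) (bang C ?G) (bang C ?D)"
  proof -
    have "q2 C ?A (?G \<otimes> ?D) \<cdot> (idn C (bang C ?A) \<odot> q2 C ?G ?D)
      = (q2 C ?A (?G \<otimes> ?D) \<cdot> (idn C (bang C ?A) \<odot> q2 C ?G ?D) \<cdot> asc C (bang C ?A) (bang C ?G) (bang C ?D)) \<cdot> asci C (bang C ?A) (bang C ?G) (bang C ?D)"
      by (simp add: assoc)
    also have "\<dots> = B (asc C ?A ?G ?D) \<cdot> q2 C (?A \<otimes> ?G) ?D \<cdot> (q2 C ?A ?G \<odot> idn C (bang C ?D)) \<cdot> asci C (bang C ?A) (bang C ?G) (bang C ?D)"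
      by (simp flip: q2_asc) (simp add: assoc)
    finally show ?thesis by (simp add: bang_comp_comp)
  qed
  have "B (sp (W (x # \<Gamma>)) (W \<Delta>)) \<cdot> kap ((x # \<Gamma>) @ \<Delta>)
    = B (asci C ?A ?G ?D) \<cdot> (B (idn C ?A \<odot> ?s) \<cdot> q2 C ?A (T (W (\<Gamma> @ \<Delta>)))) \<cdot> (co x \<odot> kap (\<Gamma> @ \<Delta>))"
    using nl by (simp add: assoc bang_comp_comp)
  also have "B (idn C ?A \<odot> ?s) \<cdot> q2 C ?A (T (W (\<Gamma> @ \<Delta>))) = q2 C ?A (?G \<otimes> ?D) \<cdot> (idn C (bang C ?A) \<odot> B ?s)"
    using q2_nat[of "idn C ?A" ?s ?A "?G \<otimes> ?D"] by simp
  also have "B (asci C ?A ?G ?D) \<cdot> (\<dots>) \<cdot> (co x \<odot> kap (\<Gamma> @ \<Delta>))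
    = B (asci C ?A ?G ?D) \<cdot> q2 C ?A (?G \<otimes> ?D) \<cdot> (co x \<odot> (B ?s \<cdot> kap (\<Gamma> @ \<Delta>)))"
    using nl by (simp add: assoc tensm_merge)
  also have "\<dots> = (B (asci C ?A ?G ?D) \<cdot> q2 C ?A (?G \<otimes> ?D) \<cdot> (idn C (bang C ?A) \<odot> q2 C ?G ?D))
      \<cdot> (co x \<odot> (kap \<Gamma> \<odot> kap \<Delta>)) \<cdot> (idn C ?A \<odot> ?s)"
    using nl Cons.IH by (simp add: assoc tensm_merge)
  also have "\<dots> = q2 C (?A \<otimes> ?G) ?D \<cdot> (q2 C ?A ?G \<odot> idn C (bang C ?D)) \<cdot> (asci C (bang C ?A) (bang C ?G) (bang C ?D)
      \<cdot> (co x \<odot> (kap \<Gamma> \<odot> kap \<Delta>))) \<cdot> (idn C ?A \<odot> ?s)"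
    unfolding q using nl by (simp add: assoc)
  also have "\<dots> = q2 C (?A \<otimes> ?G) ?D \<cdot> (kap (x # \<Gamma>) \<odot> kap \<Delta>) \<cdot> sp (W (x # \<Gamma>)) (W \<Delta>)"
    using nl by (simp add: asci_nat) (simp add: assoc tensm_merge_comp)
  finally show ?case by simp
qed

lemma kap_append:
  assumes "nl \<Gamma>" "nl \<Delta>"
  shows "kap (\<Gamma> @ \<Delta>) = B (jn (W \<Gamma>) (W \<Delta>)) \<cdot> q2 C (T (W \<Gamma>)) (T (W \<Delta>)) \<cdot> (kap \<Gamma> \<odot> kap \<Delta>) \<cdot> sp (W \<Gamma>) (W \<Delta>)"
proof -
  have "nl (\<Gamma> @ \<Delta>)" using assms by auto
  then have "kap (\<Gamma> @ \<Delta>) = B (jn (W \<Gamma>) (W \<Delta>)) \<cdot> B (sp (W \<Gamma>) (W \<Delta>)) \<cdot> kap (\<Gamma> @ \<Delta>)"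
    by (simp add: bang_comp_comp)
  then show ?thesis unfolding kap_split[OF assms] .
qed

definition cm :: "var list \<Rightarrow> 'o list \<times> 'm \<times> 'o list \<Rightarrow> var list \<Rightarrow> bool" where
  "cm \<Gamma> f \<Delta> \<longleftrightarrow> nl \<Gamma> \<and> nl \<Delta> \<and> ar f \<and> dm f = W \<Gamma> \<and> cd f = W \<Delta> \<and> B (mor f) \<cdot> kap \<Gamma> = kap \<Delta> \<cdot> mor f"

lemma cm_Ids: "nl \<Gamma> \<Longrightarrow> cm \<Gamma> (J \<Gamma>) \<Gamma>"
  by (simp add: cm_def)

lemma cm_cmp: "cm \<Gamma> f \<Delta> \<Longrightarrow> cm \<Delta> g \<Theta> \<Longrightarrow> cm \<Gamma> (g \<circ>\<^sub>s f) \<Theta>"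
proof -
  assume *: "cm \<Gamma> f \<Delta>" "cm \<Delta> g \<Theta>"
  then have f: "nl \<Gamma>" "nl \<Delta>" "ar f" "dm f = W \<Gamma>" "cd f = W \<Delta>" "B (mor f) \<cdot> kap \<Gamma> = kap \<Delta> \<cdot> mor f"
    and g: "nl \<Theta>" "ar g" "dm g = W \<Delta>" "cd g = W \<Theta>" "B (mor g) \<cdot> kap \<Delta> = kap \<Theta> \<cdot> mor g"
    by (auto simp: cm_def)
  have "B (mor g \<cdot> mor f) \<cdot> kap \<Gamma> = B (mor g) \<cdot> B (mor f) \<cdot> kap \<Gamma>"
    using f(1-5) g(1-4) by (simp add: bang_comp_comp)
  also have "\<dots> = (B (mor g) \<cdot> kap \<Delta>) \<cdot> mor f"
    unfolding f(6) using f(1-5) g(1-4) by (simp add: assoc)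
  also have "\<dots> = kap \<Theta> \<cdot> mor g \<cdot> mor f"
    unfolding g(5) using f(1-5) g(1-4) by (simp add: assoc)
  finally show ?thesis using f g by (simp add: cm_def)
qed

text \<open>Naturality of \<open>q2\<close>, after \<open>kap_append\<close> and
  \<open>kap_split\<close> have divided both contexts into their blocks.\<close>

lemma cm_tns:
  assumes "cm \<Gamma> f \<Delta>" "cm \<Gamma>' g \<Delta>'"
  shows "cm (\<Gamma> @ \<Gamma>') (f \<boxtimes> g) (\<Delta> @ \<Delta>')"
proof -
  have f: "nl \<Gamma>" "nl \<Delta>" "ar f" "dm f = W \<Gamma>" "cd f = W \<Delta>" "B (mor f) \<cdot> kap \<Gamma> = kap \<Delta> \<cdot> mor f"
    and g: "nl \<Gamma>'" "nl \<Delta>'" "ar g" "dm g = W \<Gamma>'" "cd g = W \<Delta>'" "B (mor g) \<cdot> kap \<Gamma>' = kap \<Delta>' \<cdot> mor g"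
    using assms by (auto simp: cm_def)
  let ?j = "jn (W \<Delta>) (W \<Delta>')" and ?s = "sp (W \<Gamma>) (W \<Gamma>')"
  have "kap (\<Delta> @ \<Delta>') \<cdot> mor (f \<boxtimes> g) = B ?j \<cdot> q2 C (T (W \<Delta>)) (T (W \<Delta>')) \<cdot> ((kap \<Delta> \<cdot> mor f) \<odot> (kap \<Delta>' \<cdot> mor g)) \<cdot> ?s"
    using f(1-5) g(1-5) by (simp add: kap_append tnss_def assoc tensm_merge_comp)
  also have "\<dots> = B ?j \<cdot> (q2 C (T (W \<Delta>)) (T (W \<Delta>')) \<cdot> (B (mor f) \<odot> B (mor g))) \<cdot> (kap \<Gamma> \<odot> kap \<Gamma>') \<cdot> ?s"
    unfolding f(6)[symmetric] g(6)[symmetric] using f(1-5) g(1-5) by (simp add: assoc tensm_merge_comp)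
  also have "\<dots> = B ?j \<cdot> B (mor f \<odot> mor g) \<cdot> q2 C (T (W \<Gamma>)) (T (W \<Gamma>')) \<cdot> (kap \<Gamma> \<odot> kap \<Gamma>') \<cdot> ?s"
    using f(1-5) g(1-5) by (simp add: q2_nat) (simp add: assoc)
  also have "\<dots> = B ?j \<cdot> B (mor f \<odot> mor g) \<cdot> B ?s \<cdot> kap (\<Gamma> @ \<Gamma>')"
    using kap_split[OF f(1) g(1)] by simp
  also have "\<dots> = B (mor (f \<boxtimes> g)) \<cdot> kap (\<Gamma> @ \<Gamma>')"
  proof -
    have "nl (\<Gamma> @ \<Gamma>')" using f(1) g(1) by auto
    then show ?thesis using f(1-5) g(1-5) by (simp add: tnss_def bang_comp_comp)
  qed
  finally show ?thesis using f(1-5) g(1-5) by (auto simp: cm_def)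
qed

lemma cm_sgs:
  assumes "nl \<Gamma>" "nl \<Delta>"
  shows "cm (\<Gamma> @ \<Delta>) (sgs (W \<Gamma>) (W \<Delta>)) (\<Delta> @ \<Gamma>)"
proof -
  let ?G = "T (W \<Gamma>)" and ?D = "T (W \<Delta>)"
  let ?j = "jn (W \<Delta>) (W \<Gamma>)" and ?s = "sp (W \<Gamma>) (W \<Delta>)"
  have nl: "nl (\<Gamma> @ \<Delta>)" using assms by auto
  have "kap (\<Delta> @ \<Gamma>) \<cdot> mor (sgs (W \<Gamma>) (W \<Delta>)) = B ?j \<cdot> q2 C ?D ?G \<cdot> ((kap \<Delta> \<odot> kap \<Gamma>) \<cdot> smcc.sym C ?G ?D) \<cdot> ?s"
    using assms by (simp add: kap_append sgs_def assoc)
  also have "(kap \<Delta> \<odot> kap \<Gamma>) \<cdot> smcc.sym C ?G ?D = smcc.sym C (bang C ?G) (bang C ?D) \<cdot> (kap \<Gamma> \<odot> kap \<Delta>)"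
    using assms by (simp add: sym_nat)
  also have "B ?j \<cdot> q2 C ?D ?G \<cdot> (\<dots>) \<cdot> ?s = B ?j \<cdot> (q2 C ?D ?G \<cdot> smcc.sym C (bang C ?G) (bang C ?D)) \<cdot> (kap \<Gamma> \<odot> kap \<Delta>) \<cdot> ?s"
    using assms by (simp add: assoc)
  also have "\<dots> = B ?j \<cdot> B (smcc.sym C ?G ?D) \<cdot> q2 C ?G ?D \<cdot> (kap \<Gamma> \<odot> kap \<Delta>) \<cdot> ?s"
    using assms by (simp flip: q2_sym) (simp add: assoc)
  also have "\<dots> = B ?j \<cdot> B (smcc.sym C ?G ?D) \<cdot> B ?s \<cdot> kap (\<Gamma> @ \<Delta>)"
    using kap_split[OF assms] by simp
  also have "\<dots> = B (mor (sgs (W \<Gamma>) (W \<Delta>))) \<cdot> kap (\<Gamma> @ \<Delta>)"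
    using nl by (simp add: sgs_def bang_comp_comp)
  finally show ?thesis using assms by (auto simp: cm_def)
qed

text \<open>By \<open>q2_run\<close>, the factor \<open>q1\<close> contributed by the empty rest is
  a unit isomorphism, so \<open>kap\<close> of one variable is its own coalgebra structure up to the
  trailing unit.\<close>

lemma kap_single:
  assumes "\<not> is_Ho x"
  shows "kap [x] = B (runi C (V x)) \<cdot> co x \<cdot> run C (V x)"
proof -
  let ?A = "V x"
  have "q2 C ?A \<one> \<cdot> (idn C (bang C ?A) \<odot> q1 C) = B (runi C ?A) \<cdot> B (run C ?A) \<cdot> q2 C ?A \<one> \<cdot> (idn C (bang C ?A) \<odot> q1 C)"
    by (simp add: bang_comp_comp)
  also have "\<dots> = B (runi C ?A) \<cdot> run C (bang C ?A)"
    by (simp add: q2_run)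
  finally have q: "q2 C ?A \<one> \<cdot> (idn C (bang C ?A) \<odot> q1 C) = B (runi C ?A) \<cdot> run C (bang C ?A)" .
  have "kap [x] = (q2 C ?A \<one> \<cdot> (idn C (bang C ?A) \<odot> q1 C)) \<cdot> (co x \<odot> idn C \<one>)"
    using assms by (simp add: assoc tensm_merge)
  then show ?thesis unfolding q using assms by (simp add: assoc run_nat)
qed

lemma cm_dpv:
  assumes "\<not> is_Ho x"
  shows "cm [x] (dpv x) [x, x]"
proof -
  obtain c w where cw: "commutative_comonoid C (V x) c w" "dpv x = dpo (V x) c"
    "B c \<cdot> co x = q2 C (V x) (V x) \<cdot> (co x \<odot> co x) \<cdot> c"
    using coalg_var[OF assms] by metis
  let ?A = "V x" and ?k = "co x"
  note [simp] = comonoid_arr[OF cw(1)] assms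
  have "kap [x, x] \<cdot> copy1 C ?A c = q2 C ?A (?A \<otimes> \<one>) \<cdot> (idn C (bang C ?A) \<odot> q2 C ?A \<one>)
      \<cdot> ((?k \<odot> (?k \<odot> q1 C)) \<cdot> asc C ?A ?A \<one>) \<cdot> (c \<odot> idn C \<one>)"
    by (simp add: copy1_def assoc tensm_merge_comp)
  also have "(?k \<odot> (?k \<odot> q1 C)) \<cdot> asc C ?A ?A \<one> = asc C (bang C ?A) (bang C ?A) (bang C \<one>) \<cdot> ((?k \<odot> ?k) \<odot> q1 C)"
    by (simp add: asc_nat)
  also have "q2 C ?A (?A \<otimes> \<one>) \<cdot> (idn C (bang C ?A) \<odot> q2 C ?A \<one>) \<cdot> (\<dots>) \<cdot> (c \<odot> idn C \<one>)
    = (q2 C ?A (?A \<otimes> \<one>) \<cdot> (idn C (bang C ?A) \<odot> q2 C ?A \<one>) \<cdot> asc C (bang C ?A) (bang C ?A) (bang C \<one>)) \<cdot> ((?k \<odot> ?k) \<odot> q1 C) \<cdot> (c \<odot> idn C \<one>)"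
    by (simp add: assoc)
  also have "\<dots> = B (asc C ?A ?A \<one>) \<cdot> q2 C (?A \<otimes> ?A) \<one> \<cdot> ((q2 C ?A ?A \<cdot> (?k \<odot> ?k) \<cdot> c) \<odot> q1 C)"
    by (simp flip: q2_asc) (simp add: assoc tensm_merge_comp tensm_merge)
  also have "\<dots> = B (asc C ?A ?A \<one>) \<cdot> (q2 C (?A \<otimes> ?A) \<one> \<cdot> (B c \<odot> B (idn C \<one>))) \<cdot> (?k \<odot> q1 C)"
    unfolding cw(3)[symmetric] by (simp add: assoc tensm_merge)
  also have "\<dots> = B (copy1 C ?A c) \<cdot> kap [x]"
    by (simp add: q2_nat del: bang_idn) (simp add: copy1_def assoc bang_comp_comp)
  finally show ?thesis using cw(1,2) by (simp add: cm_def del: kap_Cons)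
qed

lemma cm_erv:
  assumes "\<not> is_Ho x"
  shows "cm [x] (erv x) []"
proof -
  obtain c w where cw: "commutative_comonoid C (V x) c w" "erv x = ero (V x) w" "B w \<cdot> co x = q1 C \<cdot> w"
    using coalg_var[OF assms] by metis
  note [simp] = comonoid_arr[OF cw(1)] assms
  have "B (w \<cdot> run C (V x)) \<cdot> B (runi C (V x)) \<cdot> co x \<cdot> run C (V x) = (B w \<cdot> co x) \<cdot> run C (V x)"
    by (simp add: bang_comp_comp assoc)
  also have "\<dots> = q1 C \<cdot> w \<cdot> run C (V x)"
    unfolding cw(3) by (simp add: assoc)
  finally show ?thesis using cw(1,2) by (simp add: cm_def drop1_alt kap_single del: kap_Cons)
qed

text \<open>All generators are coalgebra morphisms, so \<open>str_closed\<close> applies. This is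
  what moves structural arrows under the promotion in a fixpoint.\<close>

lemma cm_str:
  assumes "nl \<Gamma>" "valid \<Gamma> ys"
  shows "cm \<Gamma> (str \<Gamma> ys) ys"
proof (rule str_closed[where P = cm])
  fix x y assume "\<not> is_Ho x" "\<not> is_Ho y"
  then show "cm [x, y] (sgs [V x] [V y]) [y, x]" using cm_sgs[of "[x]" "[y]"] by simp
qed (use assms in \<open>auto intro: cm_Ids cm_cmp cm_tns cm_dpv cm_erv\<close>)

end

context Sl_category
begin

section \<open>Promotion\<close>

lemma mor_dpo_mk:
  assumes "commutative_comonoid C A c w" "arr h" "trg h = A"
  shows "copy1 C A c \<cdot> runi C A \<cdot> h = (idn C A \<odot> runi C A) \<cdot> c \<cdot> h" "drop1 C w \<cdot> runi C A \<cdot> h = w \<cdot> h"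
  using comonoid_arr[OF assms(1)] assms(2,3) by (simp_all add: copy1_alt drop1_alt assoc)

text \<open>Promotion as in linear logic, along the coalgebra \<open>kap \<Gamma>\<close> of the
  context. The interpretation of a fixpoint is \<open>fixp\<close> after the promotion of the
  curried body.\<close>

definition prom :: "var list \<Rightarrow> 'o list \<times> 'm \<times> 'o list \<Rightarrow> 'o \<Rightarrow> 'o list \<times> 'm \<times> 'o list" where
  "prom \<Gamma> f A = mk (W \<Gamma>) (B (run C A \<cdot> mor f) \<cdot> kap \<Gamma>) (bang C A)"

lemma prom_proj [simp]: "dm (prom \<Gamma> f A) = W \<Gamma>" "cd (prom \<Gamma> f A) = [bang C A]"
  by (simp_all add: prom_def)

lemma run_mor [simp]:
  assumes "ar f" "cd f = [A]"
  shows "arr (run C A \<cdot> mor f)" "src (run C A \<cdot> mor f) = T (dm f)" "trg (run C A \<cdot> mor f) = A" "A \<in> Obj C"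
  using ar_simps[OF assms(1)] assms(2) by auto

lemma prom_arr [simp]:
  assumes "nl \<Gamma>" "ar f" "dm f = W \<Gamma>" "cd f = [A]"
  shows "ar (prom \<Gamma> f A)"
  using assms run_mor[OF assms(2,4)] by (simp add: prom_def)

text \<open>Promotion is natural only in coalgebra morphisms \<open>k\<close>, since the equation in
  \<open>cm\<close> is needed to exchange \<open>k\<close> with \<open>kap\<close>.\<close>

lemma prom_cmp:
  assumes "cm \<Gamma>' k \<Gamma>" "ar f" "dm f = W \<Gamma>" "cd f = [A]"
  shows "prom \<Gamma> f A \<circ>\<^sub>s k = prom \<Gamma>' (f \<circ>\<^sub>s k) A"
proof (rule arrow_eqI)
  have k: "nl \<Gamma>'" "nl \<Gamma>" "ar k" "dm k = W \<Gamma>'" "cd k = W \<Gamma>" "B (mor k) \<cdot> kap \<Gamma>' = kap \<Gamma> \<cdot> mor k"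
    using assms by (auto simp: cm_def)
  note f [simp] = run_mor[OF assms(2,4)]
  have "B (run C A \<cdot> mor (f \<circ>\<^sub>s k)) = B (run C A \<cdot> mor f) \<cdot> B (mor k)"
    using assms(2-4) k(1-5) by (simp add: bang_comp assoc)
  then show "mor (prom \<Gamma> f A \<circ>\<^sub>s k) = mor (prom \<Gamma>' (f \<circ>\<^sub>s k) A)"
    using assms(2-4) k by (simp add: prom_def assoc)
qed (use assms in \<open>simp_all add: cm_def\<close>)

definition epss :: "'o \<Rightarrow> 'o list \<times> 'm \<times> 'o list" where
  "epss A = mk [bang C A] (eps C A \<cdot> run C (bang C A)) A"

lemma epss_arr [simp]: "A \<in> Obj C \<Longrightarrow> ar (epss A)" "dm (epss A) = [bang C A]" "cd (epss A) = [A]"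
  by (simp_all add: epss_def)

text \<open>Naturality of the counit \<open>eps\<close>, followed by the counit law of the coalgebra
  \<open>kap \<Gamma>\<close>.\<close>

lemma epss_prom:
  assumes "nl \<Gamma>" "ar f" "dm f = W \<Gamma>" "cd f = [A]"
  shows "epss A \<circ>\<^sub>s prom \<Gamma> f A = f"
proof (rule arrow_eqI)
  note f [simp] = run_mor[OF assms(2,4)]
  have "eps C A \<cdot> B (run C A \<cdot> mor f) \<cdot> kap \<Gamma> = ((run C A \<cdot> mor f) \<cdot> eps C (T (W \<Gamma>))) \<cdot> kap \<Gamma>"
    using assms by (intro comp_reassoc) (auto simp: eps_nat)
  also have "\<dots> = run C A \<cdot> mor f"
    using assms kap_coalgebra[OF assms(1)] by (simp add: assoc)
  finally have e: "eps C A \<cdot> B (run C A \<cdot> mor f) \<cdot> kap \<Gamma> = run C A \<cdot> mor f" .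
  have "mor (epss A \<circ>\<^sub>s prom \<Gamma> f A) = runi C A \<cdot> eps C A \<cdot> B (run C A \<cdot> mor f) \<cdot> kap \<Gamma>"
    using assms by (simp add: epss_def prom_def assoc)
  then show "mor (epss A \<circ>\<^sub>s prom \<Gamma> f A) = mor f"
    unfolding e using assms by simp
qed (use assms in simp_all)

text \<open>Naturality of \<open>dlt\<close> and the coalgebra law of \<open>kap\<close> turn
  digging after a promotion into a promotion of the promotion. This makes promotions coalgebra
  morphisms and also drives the unfolding of fixpoints.\<close>

lemma bang_prom:
  assumes "nl \<Gamma>" "arr g" "src g = T (W \<Gamma>)"
  shows "dlt C (trg g) \<cdot> B g \<cdot> kap \<Gamma> = B (B g \<cdot> kap \<Gamma>) \<cdot> kap \<Gamma>"
proof -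
  have "dlt C (trg g) \<cdot> B g \<cdot> kap \<Gamma> = (B (B g) \<cdot> dlt C (T (W \<Gamma>))) \<cdot> kap \<Gamma>"
    using assms by (intro comp_reassoc) (auto simp: dlt_nat)
  also have "\<dots> = B (B g) \<cdot> B (kap \<Gamma>) \<cdot> kap \<Gamma>"
    using assms kap_coalgebra[OF assms(1)] by (simp add: assoc)
  finally show ?thesis using assms by (simp add: bang_comp_comp)
qed

lemma cm_prom:
  assumes "nl \<Gamma>" "ar f" "dm f = W \<Gamma>" "cd f = [tyI C \<sigma>]"
  shows "cm \<Gamma> (prom \<Gamma> f (tyI C \<sigma>)) [Stb F \<sigma>]"
proof -
  let ?A = "tyI C \<sigma>" and ?g = "run C (tyI C \<sigma>) \<cdot> mor f"
  note f [simp] = run_mor[OF assms(2,4)]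
  have "kap [Stb F \<sigma>] \<cdot> runi C (bang C ?A) \<cdot> B ?g \<cdot> kap \<Gamma> = B (runi C (bang C ?A)) \<cdot> dlt C (trg ?g) \<cdot> B ?g \<cdot> kap \<Gamma>"
    using assms by (simp add: kap_single assoc del: kap_Cons)
  also have "\<dots> = B (runi C (bang C ?A) \<cdot> B ?g \<cdot> kap \<Gamma>) \<cdot> kap \<Gamma>"
    using assms by (subst bang_prom) (auto simp: bang_comp_comp)
  finally show ?thesis
    using assms by (simp add: cm_def prom_def del: kap_Cons)
qed

lemma cm_nm: "cm [] (nm n) [Gnd z]"
proof -
  have p: "arr (pco C)" "src (pco C) = N" "trg (pco C) = bang C N"
    using nno_homs by (auto simp: Hom_iff)
  have "kap [Gnd z] \<cdot> runi C N \<cdot> numeral_arrow C n = B (runi C N) \<cdot> pco C \<cdot> numeral_arrow C n"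
    by (simp add: kap_single assoc p del: kap_Cons)
  also have "\<dots> = B (runi C N \<cdot> numeral_arrow C n) \<cdot> q1 C"
    by (simp add: numeral_laws bang_comp_comp)
  finally show ?thesis by (simp add: cm_def nm_def del: kap_Cons)
qed

lemma nm_comonoid: "dpv (Gnd z) \<circ>\<^sub>s nm n = nm n \<boxtimes> nm n" "erv (Gnd z) \<circ>\<^sub>s nm n = Ids []"
  by (rule arrow_eqI; simp add: nm_def mor_mk_tns mor_dpo_mk[OF nno_comonoid] numeral_laws)+

text \<open>The interchange \<open>mid\<close> as moving one wire past a block.\<close>

lemma split_sgs_block:
  assumes [simp]: "A \<in> Obj C" "okl Gs"
  shows "sp Gs (A # Gs) \<cdot> mor (sgs [A] Gs \<boxtimes> Ids Gs)
    = asc C (T Gs) A (T Gs) \<cdot> (smcc.sym C A (T Gs) \<odot> idn C (T Gs)) \<cdot> asci C A (T Gs) (T Gs) \<cdot> (idn C A \<odot> sp Gs Gs)"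
    (is "?l = ?r")
proof (rule iso_cancel_left)
  let ?G = "T Gs"
  let ?i = "idn C ?G \<odot> (runi C A \<odot> idn C ?G)"
  show "(idn C ?G \<odot> (run C A \<odot> idn C ?G)) \<cdot> ?i = idn C (?G \<otimes> A \<otimes> ?G)"
    by (simp add: tensm_merge)
  have "?i \<cdot> ?l = ((idn C ?G \<odot> sp [A] Gs) \<cdot> sp Gs ([A] @ Gs)) \<cdot> mor (sgs [A] Gs \<boxtimes> Ids Gs)"
    using split_single[of A Gs] by (simp add: assoc del: jn_split_simps)
  also have "\<dots> = asc C ?G (A \<otimes> \<one>) ?G \<cdot> (sp Gs [A] \<odot> idn C ?G) \<cdot> sp (Gs @ [A]) Gs \<cdot> mor (sgs [A] Gs \<boxtimes> Ids Gs)"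
    by (subst split_asc[symmetric]) (simp_all add: assoc del: jn_split_simps)
  also have "\<dots> = asc C ?G (A \<otimes> \<one>) ?G \<cdot> ((smcc.sym C (A \<otimes> \<one>) ?G \<cdot> sp [A] Gs) \<odot> idn C ?G) \<cdot> sp ([A] @ Gs) Gs"
    by (simp add: tnss_def sgs_def assoc tensm_merge_comp del: jn_split_simps)
  also have "smcc.sym C (A \<otimes> \<one>) ?G \<cdot> sp [A] Gs = (idn C ?G \<odot> runi C A) \<cdot> smcc.sym C A ?G"
    by (simp add: split_single sym_nat del: jn_split_simps)
  also have "asc C ?G (A \<otimes> \<one>) ?G \<cdot> ((\<dots>) \<odot> idn C ?G) \<cdot> sp ([A] @ Gs) Gs
    = (asc C ?G (A \<otimes> \<one>) ?G \<cdot> ((idn C ?G \<odot> runi C A) \<odot> idn C ?G)) \<cdot> (smcc.sym C A ?G \<odot> idn C ?G) \<cdot> sp ([A] @ Gs) Gs"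
    by (simp add: assoc tensm_merge_comp del: jn_split_simps)
  also have "\<dots> = ?i \<cdot> ?r"
    by (simp add: asc_nat) (simp add: assoc)
  finally show "?i \<cdot> ?l = ?i \<cdot> ?r" .
qed simp_all

lemma mid_natural:
  assumes "arr f" "arr g" "arr h" "arr k"
  shows "mid C (trg f) (trg g) (trg h) (trg k) \<cdot> ((f \<odot> g) \<odot> (h \<odot> k))
    = ((f \<odot> h) \<odot> (g \<odot> k)) \<cdot> mid C (src f) (src g) (src h) (src k)"
proof -
  note [simp] = assms
  have sw: "(asc C (trg h) (trg g) (trg k) \<cdot> (smcc.sym C (trg g) (trg h) \<odot> idn C (trg k)) \<cdot> asci C (trg g) (trg h) (trg k)) \<cdot> (g \<odot> (h \<odot> k))
    = (h \<odot> (g \<odot> k)) \<cdot> asc C (src h) (src g) (src k) \<cdot> (smcc.sym C (src g) (src h) \<odot> idn C (src k)) \<cdot> asci C (src g) (src h) (src k)"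
  proof -
    have "(asc C (trg h) (trg g) (trg k) \<cdot> (smcc.sym C (trg g) (trg h) \<odot> idn C (trg k)) \<cdot> asci C (trg g) (trg h) (trg k)) \<cdot> (g \<odot> (h \<odot> k))
      = asc C (trg h) (trg g) (trg k) \<cdot> ((smcc.sym C (trg g) (trg h) \<cdot> (g \<odot> h)) \<odot> k) \<cdot> asci C (src g) (src h) (src k)"
      by (simp add: assoc asci_nat tensm_merge_comp)
    also have "\<dots> = (asc C (trg h) (trg g) (trg k) \<cdot> ((h \<odot> g) \<odot> k)) \<cdot> (smcc.sym C (src g) (src h) \<odot> idn C (src k)) \<cdot> asci C (src g) (src h) (src k)"
      by (simp add: sym_nat) (simp add: assoc tensm_merge_comp)
    finally show ?thesis by (simp add: asc_nat) (simp add: assoc)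
  qed
  let ?s = "\<lambda>A A' D. asc C A' A D \<cdot> (smcc.sym C A A' \<odot> idn C D) \<cdot> asci C A A' D"
  have "mid C (trg f) (trg g) (trg h) (trg k) \<cdot> ((f \<odot> g) \<odot> (h \<odot> k))
    = asci C (trg f) (trg h) (trg g \<otimes> trg k) \<cdot> (f \<odot> (?s (trg g) (trg h) (trg k) \<cdot> (g \<odot> (h \<odot> k)))) \<cdot> asc C (src f) (src g) (src h \<otimes> src k)"
    by (simp add: mid_def assoc asc_nat tensm_merge_comp)
  also have "\<dots> = (asci C (trg f) (trg h) (trg g \<otimes> trg k) \<cdot> (f \<odot> (h \<odot> (g \<odot> k)))) \<cdot> (idn C (src f) \<odot> ?s (src g) (src h) (src k)) \<cdot> asc C (src f) (src g) (src h \<otimes> src k)"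
    unfolding sw by (simp add: assoc tensm_merge_comp)
  finally show ?thesis by (simp add: asci_nat) (simp add: mid_def assoc)
qed

lemma mid_arr [simp]:
  assumes [simp]: "A \<in> Obj C" "A' \<in> Obj C" "D \<in> Obj C" "D' \<in> Obj C"
  shows "arr (mid C A A' D D')" "src (mid C A A' D D') = (A \<otimes> A') \<otimes> (D \<otimes> D')"
    "trg (mid C A A' D D') = (A \<otimes> D) \<otimes> (A' \<otimes> D')"
  by (simp_all add: mid_def)

text \<open>\<open>kap\<close> is a comonoid morphism, where the comonoid of a context is its
  structural arrow to two copies of itself. In the induction the interchange \<open>mid\<close> from
  \<open>dup_q2\<close> is matched, through \<open>split_sgs_block\<close>, with the crossing in
  \<open>str_dup_Cons\<close>.\<close>

lemma dup_kap:
  assumes "nl \<Gamma>" "distinct \<Gamma>"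
  shows "dup C (T (W \<Gamma>)) \<cdot> kap \<Gamma> = (kap \<Gamma> \<odot> kap \<Gamma>) \<cdot> sp (W \<Gamma>) (W \<Gamma>) \<cdot> mor (str \<Gamma> (\<Gamma> @ \<Gamma>))"
  using assms
proof (induction \<Gamma>)
  case Nil
  then show ?case by (simp add: dup_q1)
next
  case (Cons x \<Gamma>)
  have nl: "\<not> is_Ho x" "nl \<Gamma>" "distinct \<Gamma>" using Cons.prems by auto
  obtain c w where cw: "commutative_comonoid C (V x) c w" "dpv x = dpo (V x) c"
    "dup C (V x) \<cdot> co x = (co x \<odot> co x) \<cdot> c"
    using coalg_var[OF nl(1)] by metis
  note [simp] = comonoid_arr[OF cw(1)] nl
  let ?A = "V x" and ?G = "T (W \<Gamma>)" and ?k = "co x" and ?K = "kap \<Gamma>" and ?s = "str \<Gamma> (\<Gamma> @ \<Gamma>)"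
  let ?sp = "sp (W \<Gamma>) (W \<Gamma>)"
  let ?kap = "q2 C ?A ?G \<cdot> (?k \<odot> ?K)"
  have "valid \<Gamma> (\<Gamma> @ \<Gamma>)" using nl by (auto simp: valid_def)
  note s = str_arr[OF this]
  have ms [simp]: "arr (mor ?s)" "src (mor ?s) = ?G" "trg (mor ?s) = T (W \<Gamma> @ W \<Gamma>)"
    using ar_simps(1-3)[of ?s] s by simp_all
  have "mor (dpv x \<boxtimes> ?s) = mor ((dpo ?A c \<boxtimes> Ids (W (\<Gamma> @ \<Gamma>))) \<circ>\<^sub>s (Ids [?A] \<boxtimes> ?s))"
    using s cw copy_arr[OF cw(1)] tns_factor_left[of "dpo ?A c" ?s] by simp
  also have "\<dots> = asc C ?A ?A (T (W \<Gamma> @ W \<Gamma>)) \<cdot> (c \<odot> mor ?s)"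
    using s by (simp add: mor_dpo_Ids mor_Ids_tns assoc tensm_merge)
  finally have dp: "mor (dpv x \<boxtimes> ?s) = asc C ?A ?A (T (W \<Gamma> @ W \<Gamma>)) \<cdot> (c \<odot> mor ?s)" .
  have "ar (sgs [?A] (W \<Gamma>) \<boxtimes> Ids (W \<Gamma>))" by simp
  note sg [simp] = ar_simps(1-3)[OF this, simplified]
  have str: "sp (W (x # \<Gamma>)) (W (x # \<Gamma>)) \<cdot> mor (str (x # \<Gamma>) ((x # \<Gamma>) @ x # \<Gamma>)) = mid C ?A ?A ?G ?G \<cdot> (c \<odot> (?sp \<cdot> mor ?s))"
  proof -
    have "sp (W (x # \<Gamma>)) (W (x # \<Gamma>)) \<cdot> mor (str (x # \<Gamma>) ((x # \<Gamma>) @ x # \<Gamma>))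
      = asci C ?A ?G (?A \<otimes> ?G) \<cdot> (idn C ?A \<odot> (sp (W \<Gamma>) (?A # W \<Gamma>) \<cdot> mor (sgs [?A] (W \<Gamma>) \<boxtimes> Ids (W \<Gamma>)))) \<cdot> mor (dpv x \<boxtimes> ?s)"
      unfolding str_dup_Cons[OF Cons.prems(2,1)]
      using dp by (simp add: mor_Ids_tns assoc tensm_merge_comp)
    also have "\<dots> = asci C ?A ?G (?A \<otimes> ?G) \<cdot> (idn C ?A \<odot> (asc C ?G ?A ?G \<cdot> (smcc.sym C ?A ?G \<odot> idn C ?G) \<cdot> asci C ?A ?G ?G))
      \<cdot> ((idn C ?A \<odot> (idn C ?A \<odot> ?sp)) \<cdot> asc C ?A ?A (T (W \<Gamma> @ W \<Gamma>))) \<cdot> (c \<odot> mor ?s)"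
      unfolding dp by (subst split_sgs_block) (auto simp: assoc tensm_merge_comp)
    also have "(idn C ?A \<odot> (idn C ?A \<odot> ?sp)) \<cdot> asc C ?A ?A (T (W \<Gamma> @ W \<Gamma>)) = asc C ?A ?A (?G \<otimes> ?G) \<cdot> ((idn C ?A \<odot> idn C ?A) \<odot> ?sp)"
      using asc_nat[of "idn C ?A" "idn C ?A" ?sp ?A ?A "?G \<otimes> ?G"] by simp
    also have "asci C ?A ?G (?A \<otimes> ?G) \<cdot> (idn C ?A \<odot> (asc C ?G ?A ?G \<cdot> (smcc.sym C ?A ?G \<odot> idn C ?G) \<cdot> asci C ?A ?G ?G))
      \<cdot> (\<dots>) \<cdot> (c \<odot> mor ?s) = mid C ?A ?A ?G ?G \<cdot> (c \<odot> (?sp \<cdot> mor ?s))"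
      by (simp add: mid_def assoc tensm_merge)
    finally show ?thesis .
  qed
  have "dup C (?A \<otimes> ?G) \<cdot> ?kap = ((q2 C ?A ?G \<odot> q2 C ?A ?G) \<cdot> mid C (bang C ?A) (bang C ?A) (bang C ?G) (bang C ?G) \<cdot> (dup C ?A \<odot> dup C ?G)) \<cdot> (?k \<odot> ?K)"
    by (intro comp_reassoc[OF dup_q2]) auto
  also have "\<dots> = (q2 C ?A ?G \<odot> q2 C ?A ?G) \<cdot> (mid C (bang C ?A) (bang C ?A) (bang C ?G) (bang C ?G)
      \<cdot> ((?k \<odot> ?k) \<odot> (?K \<odot> ?K))) \<cdot> (c \<odot> (?sp \<cdot> mor ?s))"
    using Cons.IH nl cw by (simp add: assoc tensm_merge)
  also have "mid C (bang C ?A) (bang C ?A) (bang C ?G) (bang C ?G) \<cdot> ((?k \<odot> ?k) \<odot> (?K \<odot> ?K))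
    = ((?k \<odot> ?K) \<odot> (?k \<odot> ?K)) \<cdot> mid C ?A ?A ?G ?G"
    using mid_natural[of ?k ?k ?K ?K] by simp
  also have "(q2 C ?A ?G \<odot> q2 C ?A ?G) \<cdot> (\<dots>) \<cdot> (c \<odot> (?sp \<cdot> mor ?s)) = (?kap \<odot> ?kap) \<cdot> mid C ?A ?A ?G ?G \<cdot> (c \<odot> (?sp \<cdot> mor ?s))"
    by (simp add: assoc tensm_merge_comp)
  finally show ?case unfolding str by simp
qed

lemma era_kap:
  assumes "nl \<Gamma>"
  shows "era C (T (W \<Gamma>)) \<cdot> kap \<Gamma> = mor (erase \<Gamma>)"
  using assms
proof (induction \<Gamma>)
  case Nil
  then show ?case by (simp add: era_q1)
next
  case (Cons x \<Gamma>)
  have nl: "\<not> is_Ho x" "nl \<Gamma>" using Cons.prems by auto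
  obtain c w where cw: "commutative_comonoid C (V x) c w" "erv x = ero (V x) w" "era C (V x) \<cdot> co x = w"
    using coalg_var[OF nl(1)] by metis
  note [simp] = comonoid_arr[OF cw(1)] nl
  let ?A = "V x" and ?G = "T (W \<Gamma>)" and ?k = "co x" and ?K = "kap \<Gamma>"
  note e = erase_arr[OF nl(2)]
  have me [simp]: "arr (mor (erase \<Gamma>))" "src (mor (erase \<Gamma>)) = ?G" "trg (mor (erase \<Gamma>)) = \<one>"
    using ar_simps(1-3)[of "erase \<Gamma>"] e by simp_all
  have "era C (?A \<otimes> ?G) \<cdot> q2 C ?A ?G \<cdot> (?k \<odot> ?K) = (lun C \<one> \<cdot> (era C ?A \<odot> era C ?G)) \<cdot> (?k \<odot> ?K)"
    by (intro comp_reassoc[OF era_q2]) auto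
  also have "\<dots> = lun C \<one> \<cdot> (w \<odot> mor (erase \<Gamma>))"
    using Cons.IH nl cw by (simp add: assoc tensm_merge)
  also have "\<dots> = mor ((ero ?A w \<boxtimes> Ids []) \<circ>\<^sub>s (Ids [?A] \<boxtimes> erase \<Gamma>))"
    using e mor_ero_Ids[of w ?A "[]"] by (simp add: mor_Ids_tns assoc tensm_merge del: tns_Id_Nil)
  also have "\<dots> = mor (erase (x # \<Gamma>))"
    using e cw copy_arr[OF cw(1)] tns_factor_left[of "ero ?A w" "erase \<Gamma>"] by simp
  finally show ?case by simp
qed

text \<open>A promotion is \<open>B g\<close> after \<open>kap\<close>: the first commutes with
  \<open>dup\<close> and \<open>era\<close> by naturality, the second by \<open>dup_kap\<close> and
  \<open>era_kap\<close>. Together they meet the premises of \<open>sbI\<close> for a promoted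
  arrow.\<close>

lemma prom_comonoid:
  assumes "nl \<Gamma>" "distinct \<Gamma>" "ar f" "dm f = W \<Gamma>" "cd f = [tyI C \<sigma>]"
  shows "dpv (Stb F \<sigma>) \<circ>\<^sub>s prom \<Gamma> f (tyI C \<sigma>) = (prom \<Gamma> f (tyI C \<sigma>) \<boxtimes> prom \<Gamma> f (tyI C \<sigma>)) \<circ>\<^sub>s str \<Gamma> (\<Gamma> @ \<Gamma>)"
    and "erv (Stb F \<sigma>) \<circ>\<^sub>s prom \<Gamma> f (tyI C \<sigma>) = str \<Gamma> []"
proof -
  let ?A = "tyI C \<sigma>" and ?g = "run C (tyI C \<sigma>) \<cdot> mor f" and ?s = "str \<Gamma> (\<Gamma> @ \<Gamma>)"
  note f [simp] = run_mor[OF assms(3,5)]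
  have v: "valid \<Gamma> (\<Gamma> @ \<Gamma>)" "valid \<Gamma> []" using assms by (auto simp: valid_def)
  note s = str_arr[OF v(1)] str_arr[OF v(2)]
  have ms [simp]: "arr (mor ?s)" "src (mor ?s) = T (W \<Gamma>)" "trg (mor ?s) = T (W \<Gamma> @ W \<Gamma>)"
    using ar_simps(1-3)[of ?s] s by simp_all
  have "dup C ?A \<cdot> B ?g \<cdot> kap \<Gamma> = ((B ?g \<odot> B ?g) \<cdot> dup C (T (W \<Gamma>))) \<cdot> kap \<Gamma>"
    using assms by (intro comp_reassoc) (auto simp: dup_nat)
  also have "\<dots> = ((B ?g \<cdot> kap \<Gamma>) \<odot> (B ?g \<cdot> kap \<Gamma>)) \<cdot> sp (W \<Gamma>) (W \<Gamma>) \<cdot> mor ?s"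
    using assms by (simp add: assoc dup_kap tensm_merge_comp)
  finally have d: "dup C ?A \<cdot> B ?g \<cdot> kap \<Gamma> = \<dots>" .
  show "dpv (Stb F \<sigma>) \<circ>\<^sub>s prom \<Gamma> f ?A = (prom \<Gamma> f ?A \<boxtimes> prom \<Gamma> f ?A) \<circ>\<^sub>s ?s"
  proof (rule arrow_eqI)
    show "mor (dpv (Stb F \<sigma>) \<circ>\<^sub>s prom \<Gamma> f ?A) = mor ((prom \<Gamma> f ?A \<boxtimes> prom \<Gamma> f ?A) \<circ>\<^sub>s ?s)"
      using assms d
      by (simp add: prom_def mor_mk_tns mor_dpo_mk[OF comonoid_bang[OF tyI_obj]] assoc del: str.simps)
  qed (use s in simp_all)
  have "era C ?A \<cdot> B ?g \<cdot> kap \<Gamma> = era C (T (W \<Gamma>)) \<cdot> kap \<Gamma>"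
    using assms by (intro comp_reassoc) (auto simp: era_nat)
  then show "erv (Stb F \<sigma>) \<circ>\<^sub>s prom \<Gamma> f ?A = str \<Gamma> []"
    using assms s by (intro arrow_eqI)
      (simp_all add: prom_def mor_dpo_mk[OF comonoid_bang[OF tyI_obj]] era_kap)
qed

section \<open>Fixpoints\<close>

definition fixs :: "'o \<Rightarrow> 'o list \<times> 'm \<times> 'o list" where
  "fixs A = mk [bang C (hom C (bang C A) A)] (fixp C A \<cdot> run C (bang C (hom C (bang C A) A))) A"

definition mus :: "var list \<Rightarrow> 'o \<Rightarrow> 'o list \<times> 'm \<times> 'o list \<Rightarrow> 'o list \<times> 'm \<times> 'o list" where
  "mus \<Gamma> A f = fixs A \<circ>\<^sub>s prom \<Gamma> (crs (W \<Gamma>) (bang C A) A f) (hom C (bang C A) A)"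

lemma fixs_arr [simp]:
  assumes "A \<in> Obj C"
  shows "ar (fixs A)" "dm (fixs A) = [bang C (hom C (bang C A) A)]" "cd (fixs A) = [A]"
  using assms by (simp_all add: fixs_def)

lemma mus_arr [simp]:
  assumes "nl \<Gamma>" "ar f" "dm f = W \<Gamma> @ [bang C A]" "cd f = [A]"
  shows "ar (mus \<Gamma> A f)"
  using assms ar_body[OF assms(2-4)] by (simp add: mus_def)

lemma mus_proj [simp]: "dm (mus \<Gamma> A f) = W \<Gamma>" "cd (mus \<Gamma> A f) = [A]"
  by (simp_all add: mus_def fixs_def)

lemma mus_cmp:
  assumes k: "cm \<Gamma>' k \<Gamma>" and f: "ar f" "dm f = W \<Gamma> @ [bang C A]" "cd f = [A]"
  shows "mus \<Gamma> A f \<circ>\<^sub>s k = mus \<Gamma>' A (f \<circ>\<^sub>s (k \<boxtimes> Ids [bang C A]))"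
proof -
  have k': "nl \<Gamma>'" "nl \<Gamma>" "ar k" "dm k = W \<Gamma>'" "cd k = W \<Gamma>" using k by (auto simp: cm_def)
  note ar_body[OF f]
  then have "mus \<Gamma> A f \<circ>\<^sub>s k = fixs A \<circ>\<^sub>s (prom \<Gamma> (crs (W \<Gamma>) (bang C A) A f) (hom C (bang C A) A) \<circ>\<^sub>s k)"
    using f k' by (simp add: mus_def cmp_assoc)
  also have "\<dots> = fixs A \<circ>\<^sub>s prom \<Gamma>' (crs (W \<Gamma>) (bang C A) A f \<circ>\<^sub>s k) (hom C (bang C A) A)"
    using f by (subst prom_cmp[OF k]) simp_all
  also have "crs (W \<Gamma>) (bang C A) A f \<circ>\<^sub>s k = crs (W \<Gamma>') (bang C A) A (f \<circ>\<^sub>s (k \<boxtimes> Ids [bang C A]))"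
    using crs_cmp[of f k "bang C A" A] f k' by simp
  finally show ?thesis by (simp add: mus_def)
qed

text \<open>\<open>fixp_eq\<close> duplicates the promoted curried body. Dereliction turns one copy
  back into the curried body, digging turns the other into the promotion of the fixpoint, and
  evaluation cancels the currying.\<close>

lemma mus_unfold:
  assumes "nl \<Gamma>" "distinct \<Gamma>" and f: "ar f" "dm f = W \<Gamma> @ [bang C A]" "cd f = [A]"
  shows "mus \<Gamma> A f = f \<circ>\<^sub>s (J \<Gamma> \<boxtimes> prom \<Gamma> (mus \<Gamma> A f) A) \<circ>\<^sub>s str \<Gamma> (\<Gamma> @ \<Gamma>)"
proof -
  let ?X = "hom C (bang C A) A" and ?s = "str \<Gamma> (\<Gamma> @ \<Gamma>)"
  let ?c = "crs (W \<Gamma>) (bang C A) A f"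
  let ?g = "run C ?X \<cdot> mor ?c" and ?P = "prom \<Gamma> (mus \<Gamma> A f) A"
  have [simp]: "A \<in> Obj C" using ar_body[OF f] by simp
  have c: "ar ?c" "dm ?c = W \<Gamma>" "cd ?c = [?X]" using f by simp_all
  note [simp] = run_mor[OF c(1,3), unfolded c(2)]
  note nl [simp] = assms(1)
  have v: "valid \<Gamma> (\<Gamma> @ \<Gamma>)" using assms by (auto simp: valid_def)
  note s = str_arr[OF v]
  have ms [simp]: "arr (mor ?s)" "src (mor ?s) = T (W \<Gamma>)" "trg (mor ?s) = T (W \<Gamma> @ W \<Gamma>)"
    using ar_simps(1-3)[of ?s] s by simp_all
  let ?h = "B ?g \<cdot> kap \<Gamma>"
  have m: "run C A \<cdot> mor (mus \<Gamma> A f) = fixp C A \<cdot> ?h"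
    by (simp add: mus_def fixs_def prom_def assoc)
  have "dup C ?X \<cdot> B ?g \<cdot> kap \<Gamma> = ((B ?g \<odot> B ?g) \<cdot> dup C (T (W \<Gamma>))) \<cdot> kap \<Gamma>"
    by (intro comp_reassoc) (auto simp: dup_nat)
  also have "\<dots> = (?h \<odot> ?h) \<cdot> sp (W \<Gamma>) (W \<Gamma>) \<cdot> mor ?s"
    using assms by (simp add: assoc dup_kap tensm_merge_comp)
  finally have d: "dup C ?X \<cdot> ?h = (?h \<odot> ?h) \<cdot> sp (W \<Gamma>) (W \<Gamma>) \<cdot> mor ?s" .
  \<comment> \<open>The copy that acts as the function.\<close>
  have e: "eps C ?X \<cdot> ?h = ?g"
  proof -
    have "eps C ?X \<cdot> B ?g \<cdot> kap \<Gamma> = (?g \<cdot> eps C (T (W \<Gamma>))) \<cdot> kap \<Gamma>"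
      by (intro comp_reassoc) (auto simp: eps_nat)
    also have "\<dots> = ?g"
      using kap_coalgebra[OF nl] by (simp add: assoc)
    finally show ?thesis .
  qed
  \<comment> \<open>The copy that acts as the argument: a promotion whose content is again a
    promotion.\<close>
  have b: "dlt C ?X \<cdot> ?h = B ?h \<cdot> kap \<Gamma>"
    using bang_prom[of \<Gamma> ?g] by simp
  have "fixp C A \<cdot> ?h = (eval C (bang C A) A \<cdot> (eps C ?X \<odot> (B (fixp C A) \<cdot> dlt C ?X)) \<cdot> dup C ?X) \<cdot> ?h"
    using fixp_eq[of A] by simp
  also have "\<dots> = eval C (bang C A) A \<cdot> (eps C ?X \<odot> (B (fixp C A) \<cdot> dlt C ?X)) \<cdot> dup C ?X \<cdot> ?h"
    by (simp add: assoc)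
  also have "\<dots> = eval C (bang C A) A \<cdot> ((eps C ?X \<cdot> ?h) \<odot> (B (fixp C A) \<cdot> dlt C ?X \<cdot> ?h)) \<cdot> sp (W \<Gamma>) (W \<Gamma>) \<cdot> mor ?s"
    unfolding d by (simp add: assoc tensm_merge_comp)
  also have "\<dots> = eval C (bang C A) A \<cdot> (?g \<odot> (B (fixp C A \<cdot> ?h) \<cdot> kap \<Gamma>)) \<cdot> sp (W \<Gamma>) (W \<Gamma>) \<cdot> mor ?s"
    unfolding e b by (simp add: bang_comp_comp)
  finally have u: "fixp C A \<cdot> ?h = \<dots>" .
  have "mus \<Gamma> A f = mk (W \<Gamma>) (run C A \<cdot> mor (mus \<Gamma> A f)) A"
    using mk_run[of "mus \<Gamma> A f" A] f by simp
  also have "\<dots> = mk (W \<Gamma>) (eval C (bang C A) A \<cdot> (?g \<odot> (B (run C A \<cdot> mor (mus \<Gamma> A f)) \<cdot> kap \<Gamma>)) \<cdot> sp (W \<Gamma>) (W \<Gamma>) \<cdot> mor ?s) A"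
    unfolding m using u by simp
  also have "\<dots> = mk (W \<Gamma> @ W \<Gamma>) (eval C (bang C A) A \<cdot> (?g \<odot> (B (run C A \<cdot> mor (mus \<Gamma> A f)) \<cdot> kap \<Gamma>)) \<cdot> sp (W \<Gamma>) (W \<Gamma>)) A \<circ>\<^sub>s ?s"
    using s f by (intro arrow_eqI) (simp_all add: m assoc)
  also have "\<dots> = (evs (bang C A) A \<circ>\<^sub>s (?c \<boxtimes> ?P)) \<circ>\<^sub>s ?s"
    using evs_mk[of "W \<Gamma>" "W \<Gamma>" ?g "B (run C A \<cdot> mor (mus \<Gamma> A f)) \<cdot> kap \<Gamma>" "bang C A" A] mk_run[OF c(1,3)]
    by (simp add: m prom_def)
  also have "?c \<boxtimes> ?P = (?c \<boxtimes> Ids [bang C A]) \<circ>\<^sub>s (J \<Gamma> \<boxtimes> ?P)"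
    using c f by (simp add: interchange)
  also have "(evs (bang C A) A \<circ>\<^sub>s (?c \<boxtimes> Ids [bang C A]) \<circ>\<^sub>s (J \<Gamma> \<boxtimes> ?P)) \<circ>\<^sub>s ?s
    = (evs (bang C A) A \<circ>\<^sub>s (?c \<boxtimes> Ids [bang C A])) \<circ>\<^sub>s (J \<Gamma> \<boxtimes> ?P) \<circ>\<^sub>s ?s"
    using c f s by (simp add: cmp_assoc)
  finally show ?thesis unfolding evs_crs[OF f] .
qed

end

section \<open>Substitution for named variables\<close>

primrec fv :: "trm \<Rightarrow> var set" where
  "fv Zero = {}"
| "fv Succ = {}"
| "fv Pred = {}"
| "fv (FV y) = {y}"
| "fv (BV i) = {}"
| "fv (App M Q) = fv M \<union> fv Q"
| "fv (LIf M L R) = fv M \<union> fv L \<union> fv R"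
| "fv (Lam \<sigma> M) = fv M"
| "fv (Mu \<sigma> M) = fv M"

primrec lc :: "nat \<Rightarrow> trm \<Rightarrow> bool" where
  "lc k Zero \<longleftrightarrow> True"
| "lc k Succ \<longleftrightarrow> True"
| "lc k Pred \<longleftrightarrow> True"
| "lc k (FV y) \<longleftrightarrow> True"
| "lc k (BV i) \<longleftrightarrow> i < k"
| "lc k (App M Q) \<longleftrightarrow> lc k M \<and> lc k Q"
| "lc k (LIf M L R) \<longleftrightarrow> lc k M \<and> lc k L \<and> lc k R"
| "lc k (Lam \<sigma> M) \<longleftrightarrow> lc (Suc k) M"
| "lc k (Mu \<sigma> M) \<longleftrightarrow> lc (Suc k) M"

text \<open>Simultaneous substitution; it does not lift and is meant for locally closed \<open>s z\<close>.\<close>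

primrec msub :: "(var \<Rightarrow> trm) \<Rightarrow> trm \<Rightarrow> trm" where
  "msub s Zero = Zero"
| "msub s Succ = Succ"
| "msub s Pred = Pred"
| "msub s (FV y) = s y"
| "msub s (BV i) = BV i"
| "msub s (App M Q) = App (msub s M) (msub s Q)"
| "msub s (LIf M L R) = LIf (msub s M) (msub s L) (msub s R)"
| "msub s (Lam \<sigma> M) = Lam \<sigma> (msub s M)"
| "msub s (Mu \<sigma> M) = Mu \<sigma> (msub s M)"

section \<open>Substitution under named binders\<close>

lemma lift_lc: "lc j M \<Longrightarrow> j \<le> k \<Longrightarrow> lift k M = M"
  by (induction M arbitrary: j k) auto

lemma bind_fresh: "lc j M \<Longrightarrow> j \<le> k \<Longrightarrow> x \<notin> fv M \<Longrightarrow> bind k x M = M"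
  by (induction M arbitrary: j k) auto

lemma lc_bind: "lc k M \<Longrightarrow> lc (Suc k) (bind k x M)"
  by (induction M arbitrary: k) auto

lemma fv_bind: "fv (bind k x M) = fv M - {x}"
  by (induction M arbitrary: k) auto

lemma size_bind [simp]: "size (bind k x M) = size M"
  by (induction M arbitrary: k) auto

lemma fsubst_msub: "lc 0 Q \<Longrightarrow> fsubst x Q M = msub (FV(x := Q)) M"
  by (induction M) (auto simp: lift_lc)

lemma fsubst_FV: "fsubst x (FV y) M = ren (id(x := y)) M"
  by (induction M) auto

lemma ren_msub: "ren r M = msub (\<lambda>z. FV (r z)) M"
  by (induction M) auto

text \<open>Renaming the bound name to a \<open>y\<close> that is fresh for the substituted terms
  rules out capture. Local closedness ensures that \<open>bind\<close> leaves those terms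
  unchanged.\<close>

lemma msub_bind:
  "(\<And>z. z \<in> fv M \<Longrightarrow> z \<noteq> x \<Longrightarrow> y \<notin> fv (s z) \<and> lc 0 (s z))
   \<Longrightarrow> msub s (bind k x M) = bind k y (msub (s(x := FV y)) M)"
  by (induction M arbitrary: k) (auto simp: bind_fresh[of 0])

lemma msub_FV [simp]: "msub FV M = M"
  by (induction M) auto

section \<open>Reduction under a named binder\<close>

lemma bind_eq_conv:
  "bind k x P = Zero \<longleftrightarrow> P = Zero"
  "bind k x P = Succ \<longleftrightarrow> P = Succ"
  "bind k x P = Pred \<longleftrightarrow> P = Pred"
  "bind k x P = App M Q \<longleftrightarrow> (\<exists>M' Q'. P = App M' Q' \<and> M = bind k x M' \<and> Q = bind k x Q')"
  "bind k x P = LIf M L R \<longleftrightarrow> (\<exists>M' L' R'. P = LIf M' L' R' \<and> M = bind k x M' \<and> L = bind k x L' \<and> R = bind k x R')"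
  "bind k x P = Lam \<sigma> M \<longleftrightarrow> (\<exists>M'. P = Lam \<sigma> M' \<and> M = bind (Suc k) x M')"
  "bind k x P = Mu \<sigma> M \<longleftrightarrow> (\<exists>M'. P = Mu \<sigma> M' \<and> M = bind (Suc k) x M')"
  by (cases P; auto)+

lemmas bind_eq_conv' = bind_eq_conv[THEN trans[OF eq_commute]]

lemma bind_eq_num: "bind k x P = num n \<longleftrightarrow> P = num n"
proof (induction n arbitrary: P)
  case 0
  then show ?case by (simp add: bind_eq_conv)
next
  case (Suc n)
  then show ?case by (cases P) (simp_all add: bind_eq_conv)
qed

lemmas bind_eq_num' = bind_eq_num[THEN trans[OF eq_commute]]

lemma lift_bind: "i \<le> k \<Longrightarrow> lift i (bind k x M) = bind (Suc k) x (lift i M)"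
  by (induction M arbitrary: i k) auto

lemma bind_inst: "j \<le> k \<Longrightarrow> bind k x (inst j Q M) = inst j (bind k x Q) (bind (Suc k) x M)"
  by (induction M arbitrary: j k Q) (auto simp: lift_bind)

lemma redex_bind:
  assumes "redex (bind k x P) M"
  shows "\<exists>P'. M = bind k x P' \<and> redex P P'"
  using assms
proof (cases rule: redex.cases)
  case (r_beta \<sigma> \<tau> K Q)
  then obtain K' Q' where "P = App (Lam (\<sigma> \<multimap> \<tau>) K') Q'" "K = bind (Suc k) x K'" "Q = bind k x Q'"
    by (auto simp: bind_eq_conv bind_eq_conv')
  with r_beta show ?thesis
    by (intro exI[of _ "inst 0 Q' K'"]) (auto simp: bind_inst intro: redex.r_beta)
next
  case (r_beta_num K n)
  then obtain K' where "P = App (Lam Iota K') (num n)" "K = bind (Suc k) x K'"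
    by (auto simp: bind_eq_conv bind_eq_conv' bind_eq_num' bind_eq_num)
  with r_beta_num show ?thesis
    by (intro exI[of _ "inst 0 (num n) K'"]) (auto simp: bind_inst intro: redex.r_beta_num)
next
  case (r_mu \<sigma> K)
  then obtain K' where "P = Mu \<sigma> K'" "K = bind (Suc k) x K'"
    by (auto simp: bind_eq_conv)
  with r_mu show ?thesis
    by (intro exI[of _ "inst 0 (Mu \<sigma> K') K'"]) (auto simp: bind_inst intro: redex.r_mu)
next
  case (r_pred n)
  then show ?thesis
    by (intro exI[of _ "num n"])
      (auto simp: bind_eq_conv bind_eq_conv' bind_eq_num' bind_eq_num intro: redex.r_pred)
next
  case (r_if_zero R)
  then obtain L' R' where "P = LIf (num 0) L' R'" "M = bind k x L'"
    by (auto simp: bind_eq_conv bind_eq_conv')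
  then show ?thesis using redex.r_if_zero by blast
next
  case (r_if_suc n L)
  then obtain L' R' where "P = LIf (num (Suc n)) L' R'" "M = bind k x R'"
    by (auto simp: bind_eq_conv bind_eq_conv' bind_eq_num' bind_eq_num)
  then show ?thesis using redex.r_if_suc by blast
qed

text \<open>\<open>bind\<close> changes only variables, so redexes, numerals included, correspond on
  both sides. Reduction below a binder is thereby reflected to the named body, which is the term
  that the rules of interpretation speak about.\<close>

lemma step_bind: "step (bind k x P) M \<Longrightarrow> \<exists>P'. M = bind k x P' \<and> step P P'"
proof (induction "bind k x P" M arbitrary: k P rule: step.induct)
  case (s_redex M')
  then show ?case by (metis redex_bind step.s_redex)
next
  case (s_app1 M M' Q)
  then show ?case by (auto simp: bind_eq_conv') (metis bind.simps(6) step.s_app1)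
next
  case (s_app2 Q Q' M)
  then show ?case by (auto simp: bind_eq_conv') (metis bind.simps(6) step.s_app2)
next
  case (s_if1 M M' L R)
  then show ?case by (auto simp: bind_eq_conv') (metis bind.simps(7) step.s_if1)
next
  case (s_if2 L L' M R)
  then show ?case by (auto simp: bind_eq_conv') (metis bind.simps(7) step.s_if2)
next
  case (s_if3 R R' M L)
  then show ?case by (auto simp: bind_eq_conv') (metis bind.simps(7) step.s_if3)
next
  case (s_lam K K' \<sigma>)
  then show ?case by (auto simp: bind_eq_conv') (metis bind.simps(8) step.s_lam)
next
  case (s_mu K K' \<sigma>)
  then show ?case by (auto simp: bind_eq_conv') (metis bind.simps(9) step.s_mu)
qed

text \<open>A variable with its name erased. Variables with equal \<open>vk\<close> have the same
  kind and type, hence the same object, comonoid and coalgebra in the model.\<close>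

primrec vk :: "var \<Rightarrow> var" where
  "vk (Gnd x) = Gnd 0"
| "vk (Ho f \<sigma> \<tau>) = Ho 0 \<sigma> \<tau>"
| "vk (Stb F \<sigma>) = Stb 0 \<sigma>"

lemma vk_fresh:
  assumes "finite S"
  obtains y where "vk y = vk x" "y \<notin> S"
proof -
  have *: "\<exists>n. c n \<notin> S" if "inj c" for c :: "nat \<Rightarrow> var"
    using ex_new_if_finite[OF infinite_UNIV_nat finite_vimageI[OF assms that]] by auto
  show ?thesis
  proof (cases x)
    case (Gnd z)
    obtain n where "Gnd n \<notin> S" using *[of Gnd] by (auto simp: inj_def)
    with Gnd show ?thesis using that[of "Gnd n"] by simp
  next
    case (Ho f \<sigma> \<tau>)
    obtain n where "Ho n \<sigma> \<tau> \<notin> S" using *[of "\<lambda>n. Ho n \<sigma> \<tau>"] by (auto simp: inj_def)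
    with Ho show ?thesis using that[of "Ho n \<sigma> \<tau>"] by simp
  next
    case (Stb F \<sigma>)
    obtain n where "Stb n \<sigma> \<notin> S" using *[of "\<lambda>n. Stb n \<sigma>"] by (auto simp: inj_def)
    with Stb show ?thesis using that[of "Stb n \<sigma>"] by simp
  qed
qed

lemma vk_eq:
  assumes "vk y = vk x"
  shows "vty y = vty x" "is_Ho y \<longleftrightarrow> is_Ho x" "is_Stb y \<longleftrightarrow> is_Stb x" "is_Gnd y \<longleftrightarrow> is_Gnd x"
  using assms by (cases x; cases y; auto)+

text \<open>\<open>Lam\<close> records only a type. For a variable that is not stable this
  determines the kind, as ground variables have type \<open>Iota\<close> and higher-order ones an
  arrow type.\<close>

lemma vk_eqI: "\<not> is_Stb x \<Longrightarrow> \<not> is_Stb y \<Longrightarrow> vty x = vty y \<Longrightarrow> vk x = vk y"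
  by (cases x; cases y; auto)

section \<open>Syntax-directed interpretation\<close>

context Sl_category
begin

lemma vk_sem:
  assumes "vk y = vk x"
  shows "V y = V x" "dpv y = dpv x" "erv y = erv x" "co y = co x"
  using assms by (cases x; cases y; auto)+

text \<open>Dereliction. The wire of a stable variable carries \<open>!A\<close> while the variable
  as a term has type \<open>A\<close>; for the other kinds the two agree.\<close>

definition der :: "var \<Rightarrow> 'o list \<times> 'm \<times> 'o list" where
  "der x = (if is_Stb x then epss (tyI C (vty x)) else Ids [V x])"

lemma der_arr [simp]: "ar (der x)" "dm (der x) = [V x]" "cd (der x) = [tyI C (vty x)]"
  by (cases x; simp add: der_def)+

lemma vk_der: "vk y = vk x \<Longrightarrow> der y = der x"
  using vk_eq[of y x] vk_sem[of y x] by (simp add: der_def)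

text \<open>
  Unlike \<open>sem\<close> this interpretation has no structural rules: the subterms of an application share
  the copyable variables of \<open>\<Gamma>\<close>, which \<open>str\<close> distributes.
\<close>

inductive isem :: "var list \<Rightarrow> trm \<Rightarrow> ty \<Rightarrow> 'o list \<times> 'm \<times> 'o list \<Rightarrow> bool" where
  j_zero: "valid \<Gamma> [] \<Longrightarrow> isem \<Gamma> Zero Iota (nm 0 \<circ>\<^sub>s str \<Gamma> [])"
| j_succ: "valid \<Gamma> [] \<Longrightarrow> isem \<Gamma> Succ (Iota \<multimap> Iota) (crs [] N N sucs \<circ>\<^sub>s str \<Gamma> [])"
| j_pred: "valid \<Gamma> [] \<Longrightarrow> isem \<Gamma> Pred (Iota \<multimap> Iota) (crs [] N N prds \<circ>\<^sub>s str \<Gamma> [])"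
| j_var: "valid \<Gamma> [x] \<Longrightarrow> isem \<Gamma> (FV x) (vty x) (der x \<circ>\<^sub>s str \<Gamma> [x])"
| j_app: "isem \<Gamma>1 P (\<sigma> \<multimap> \<tau>) f \<Longrightarrow> isem \<Gamma>2 Q \<sigma> g \<Longrightarrow> valid \<Gamma> (\<Gamma>1 @ \<Gamma>2)
    \<Longrightarrow> isem \<Gamma> (App P Q) \<tau> (evs (tyI C \<sigma>) (tyI C \<tau>) \<circ>\<^sub>s (f \<boxtimes> g) \<circ>\<^sub>s str \<Gamma> (\<Gamma>1 @ \<Gamma>2))"
| j_lif: "isem \<Gamma>1 P Iota m \<Longrightarrow> isem \<Gamma>2 L Iota l \<Longrightarrow> isem \<Gamma>2 R Iota r \<Longrightarrow> valid \<Gamma> (\<Gamma>1 @ \<Gamma>2)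
    \<Longrightarrow> isem \<Gamma> (LIf P L R) Iota (cond m l r \<circ>\<^sub>s str \<Gamma> (\<Gamma>1 @ \<Gamma>2))"
| j_lam: "isem (\<Gamma> @ [x]) P \<tau> f \<Longrightarrow> \<not> is_Stb x
    \<Longrightarrow> isem \<Gamma> (lam x P) (vty x \<multimap> \<tau>) (crs (W \<Gamma>) (V x) (tyI C \<tau>) f)"
| j_mu: "isem (\<Gamma> @ [Stb F \<sigma>]) P \<sigma> f \<Longrightarrow> nl \<Gamma>
    \<Longrightarrow> isem \<Gamma> (mu (Stb F \<sigma>) P) \<sigma> (mus \<Gamma> (tyI C \<sigma>) f)"

lemma isem_arr: "isem \<Gamma> M \<sigma> f \<Longrightarrow> ar f \<and> dm f = W \<Gamma> \<and> cd f = [tyI C \<sigma>]"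
proof (induction rule: isem.induct)
  case (j_lam \<Gamma> x P \<tau> f)
  then show ?case by (simp add: varI_vty)
qed (simp_all add: str_arr' del: str.simps)

lemma isem_distinct: "isem \<Gamma> M \<sigma> f \<Longrightarrow> distinct \<Gamma>"
  by (induction rule: isem.induct) (auto simp: valid_distinct)

lemma isem_lc: "isem \<Gamma> M \<sigma> f \<Longrightarrow> lc 0 M"
  by (induction rule: isem.induct) (auto intro: lc_bind)

lemma isem_fv: "isem \<Gamma> M \<sigma> f \<Longrightarrow> fv M \<subseteq> set \<Gamma>"
  by (induction rule: isem.induct) (auto simp: valid_def fv_bind)

lemma valid_in: "valid \<Gamma> ys \<Longrightarrow> is_Ho x \<Longrightarrow> x \<in> set \<Gamma> \<Longrightarrow> x \<in> set ys"
  by (metis One_nat_def count_notin n_not_Suc_n valid_def)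

text \<open>The semantic form of linearity. Together with \<open>isem_fv\<close> it says that the
  higher-order variables of a context are exactly those free in the term, so that the term
  determines how its context splits.\<close>

lemma isem_Ho: "isem \<Gamma> M \<sigma> f \<Longrightarrow> is_Ho x \<Longrightarrow> x \<in> set \<Gamma> \<Longrightarrow> x \<in> fv M"
proof (induction rule: isem.induct)
  case (j_app \<Gamma>1 P \<sigma> \<tau> f \<Gamma>2 Q g \<Gamma>)
  then show ?case using valid_in[of \<Gamma> "\<Gamma>1 @ \<Gamma>2" x] by auto
next
  case (j_lif \<Gamma>1 P m \<Gamma>2 L l R r \<Gamma>)
  then show ?case using valid_in[of \<Gamma> "\<Gamma>1 @ \<Gamma>2" x] by auto
next
  case (j_lam \<Gamma> y P \<tau> f)
  then show ?case using isem_distinct[OF j_lam.hyps(1)] by (auto simp: fv_bind)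
next
  case (j_mu \<Gamma> F \<sigma> P f)
  then show ?case by (auto simp: fv_bind)
qed (use valid_in in fastforce)+

subsection \<open>The substitution theorem\<close>

text \<open>Joins the demands on the arrow \<open>g z\<close> with the typing of the term
  \<open>s z\<close>. All contexts \<open>\<Gamma>\<close> are allowed because the term may land
  where further copyable variables are present, and \<open>cm\<close> is what passing under a
  fixpoint requires.\<close>

definition ssb :: "(var \<Rightarrow> trm) \<Rightarrow> (var \<Rightarrow> var list) \<Rightarrow> (var \<Rightarrow> 'o list \<times> 'm \<times> 'o list) \<Rightarrow> var \<Rightarrow> bool" where
  "ssb s G g z \<longleftrightarrow> sb G g z \<and> lc 0 (s z) \<and> fv (s z) \<subseteq> set (G z)
     \<and> (\<not> is_Ho z \<longrightarrow> cm (G z) (g z) [z])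
     \<and> (\<forall>\<Gamma>. valid \<Gamma> (G z) \<longrightarrow> isem \<Gamma> (s z) (vty z) (der z \<circ>\<^sub>s g z \<circ>\<^sub>s str \<Gamma> (G z)))"

lemma ssb_cong: "s z = s' z \<Longrightarrow> G z = G' z \<Longrightarrow> g z = g' z \<Longrightarrow> ssb s G g z = ssb s' G' g' z"
  by (simp add: ssb_def sb_def)

lemma ssb_sb: "ssb s G g z \<Longrightarrow> sb G g z"
  by (simp add: ssb_def)

lemma ssb_var:
  assumes "vk y = vk x" "s x = FV y" "G x = [y]" "g x = Ids [V x]"
  shows "ssb s G g x"
proof -
  note e = vk_eq[OF assms(1)] vk_sem[OF assms(1)] vk_der[OF assms(1)]
  have "sb G g x"
    using sb_ident[of y] assms(2-4) by (simp add: sb_def e)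
  moreover have "cm (G x) (g x) [x]" if "\<not> is_Ho x"
    using that assms(2-4) cm_Ids[of "[y]"] by (simp add: cm_def e)
  moreover have "isem \<Gamma> (s x) (vty x) (der x \<circ>\<^sub>s g x \<circ>\<^sub>s str \<Gamma> (G x))" if "valid \<Gamma> (G x)" for \<Gamma>
    using j_var[of \<Gamma> y] that assms(2-4) by (simp add: e str_arr' del: str.simps)
  ultimately show ?thesis using assms by (simp add: ssb_def)
qed

text \<open>After a substitution the inputs of a subterm may repeat, whereas a context must be
  distinct. Removing duplicates yields contexts through which the structural arrow factors by
  \<open>str_str2\<close>; a linear variable occurs once in total and is not affected.\<close>

lemma valid_factor:
  assumes "valid \<Gamma> (us @ ws)"
  shows "valid (remdups us) us" "valid (remdups ws) ws" "valid \<Gamma> (remdups us @ remdups ws)"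
proof -
  have *: "count_list us x + count_list ws x = 1" if "x \<in> set us \<or> x \<in> set ws" "is_Ho x" for x
    using assms that by (auto simp: valid_def)
  have pos: "0 < count_list zs x" if "x \<in> set zs" for x and zs :: "var list"
    using that by (metis count_list_0_iff gr0I)
  show "valid (remdups us) us" "valid (remdups ws) ws"
    using * pos by (fastforce simp: valid_def)+
  show "valid \<Gamma> (remdups us @ remdups ws)"
    using assms by (auto simp: valid_def count_list_distinct count_list_0_iff)
      (metis Nat.add_0_right One_nat_def add_is_1 count_list_0_iff)+
qed

text \<open>The part common to abstraction and fixpoint. The bound name is exchanged for a fresh
  \<open>y\<close> of the same kind, and the substitution is extended by \<open>x\<close> to
  \<open>y\<close>, which adds one identity wire on the semantic side.\<close>

lemma msub_binder:
  assumes P: "isem (\<Theta> @ [x]) P \<tau> f"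
    and IH: "\<And>s G g \<Gamma>. \<forall>z \<in> set (\<Theta> @ [x]). ssb s G g z \<Longrightarrow> valid \<Gamma> (cc G (\<Theta> @ [x]))
      \<Longrightarrow> isem \<Gamma> (msub s P) \<tau> (f \<circ>\<^sub>s gs g (\<Theta> @ [x]) \<circ>\<^sub>s str \<Gamma> (cc G (\<Theta> @ [x])))"
    and ssb: "\<forall>z \<in> set \<Theta>. ssb s G g z" and v: "valid \<Gamma> (cc G \<Theta>)"
  obtains y Q where "vk y = vk x" "msub s (bind 0 x P) = bind 0 y Q"
    "isem (\<Gamma> @ [y]) Q \<tau> (f \<circ>\<^sub>s ((gs g \<Theta> \<circ>\<^sub>s str \<Gamma> (cc G \<Theta>)) \<boxtimes> Ids [V x]))"
proof -
  have sb: "\<forall>z \<in> set \<Theta>. sb G g z" using ssb ssb_sb by auto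
  have d: "x \<notin> set \<Theta>" "distinct \<Theta>" using isem_distinct[OF P] by auto
  obtain y where y: "vk y = vk x" "y \<notin> set \<Gamma>" using vk_fresh[of "set \<Gamma>" x] by auto
  let ?s = "s(x := FV y)" and ?G = "G(x := [y])" and ?g = "g(x := Ids [V x])"
  let ?k = "gs g \<Theta> \<circ>\<^sub>s str \<Gamma> (cc G \<Theta>)"
  have G: "cc ?G (\<Theta> @ [x]) = cc G \<Theta> @ [y]" using d by simp
  have ssb': "\<forall>z \<in> set (\<Theta> @ [x]). ssb ?s ?G ?g z"
  proof
    fix z assume "z \<in> set (\<Theta> @ [x])"
    then show "ssb ?s ?G ?g z"
      using d ssb ssb_cong[of ?s z s ?G G ?g g] ssb_var[OF y(1), of ?s ?G ?g]
      by (cases "z = x") auto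
  qed
  then have "\<forall>z \<in> set (\<Theta> @ [x]). sb ?G ?g z" using ssb_sb by blast
  moreover have "gs ?g \<Theta> = gs g \<Theta>" using d(1) by (induction \<Theta>) auto
  ultimately have gs: "gs ?g (\<Theta> @ [x]) = gs g \<Theta> \<boxtimes> Ids [V x]"
    using gs_append[of \<Theta> "[x]" ?G ?g] by simp
  have vy: "valid [y] [y]" by (simp add: valid_def)
  have vG: "valid (\<Gamma> @ [y]) (cc G \<Theta> @ [y])"
    using v y vy by (intro valid_append_split) auto
  have str: "str (\<Gamma> @ [y]) (cc G \<Theta> @ [y]) = str \<Gamma> (cc G \<Theta>) \<boxtimes> Ids [V x]"
    using str_split[OF v vy] y str_self[of "[y]"] vk_sem[OF y(1)] by (simp del: str.simps)
  note f = isem_arr[OF P] and g = gs_arr[OF sb]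
  have "isem (\<Gamma> @ [y]) (msub ?s P) \<tau> (f \<circ>\<^sub>s gs ?g (\<Theta> @ [x]) \<circ>\<^sub>s str (\<Gamma> @ [y]) (cc ?G (\<Theta> @ [x])))"
    by (rule IH[OF ssb']) (unfold G, rule vG)
  also have "f \<circ>\<^sub>s gs ?g (\<Theta> @ [x]) \<circ>\<^sub>s str (\<Gamma> @ [y]) (cc ?G (\<Theta> @ [x])) = f \<circ>\<^sub>s (?k \<boxtimes> Ids [V x])"
    unfolding gs G str using g v by (simp add: interchange)
  finally have "isem (\<Gamma> @ [y]) (msub ?s P) \<tau> (f \<circ>\<^sub>s (?k \<boxtimes> Ids [V x]))" .
  moreover have "msub s (bind 0 x P) = bind 0 y (msub ?s P)"
  proof (rule msub_bind)
    fix z assume "z \<in> fv P" "z \<noteq> x"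
    then have "z \<in> set \<Theta>" using isem_fv[OF P] by auto
    then show "y \<notin> fv (s z) \<and> lc 0 (s z)"
      using ssb v y by (fastforce simp: ssb_def valid_def)
  qed
  ultimately show thesis using that y(1) by blast
qed

text \<open>At each node \<open>subst_str\<close> moves the substitution past the structural arrow,
  and \<open>valid_factor\<close> provides the contexts of the subterms. Below binders the
  naturality of currying and of promotion does the rest.\<close>

lemma isem_msub:
  "isem \<Theta> M \<tau> h \<Longrightarrow> \<forall>z \<in> set \<Theta>. ssb s G g z \<Longrightarrow> valid \<Gamma> (cc G \<Theta>)
   \<Longrightarrow> isem \<Gamma> (msub s M) \<tau> (h \<circ>\<^sub>s gs g \<Theta> \<circ>\<^sub>s str \<Gamma> (cc G \<Theta>))"
proof (induction arbitrary: s G g \<Gamma> rule: isem.induct)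
  \<comment> \<open>The coherence law in the form used at every node that begins with a structural
    arrow.\<close>
  have K: "(k \<circ>\<^sub>s str \<Theta> zs) \<circ>\<^sub>s gs g \<Theta> \<circ>\<^sub>s str \<Gamma> (cc G \<Theta>) = k \<circ>\<^sub>s gs g zs \<circ>\<^sub>s str \<Gamma> (cc G zs) \<and> valid \<Gamma> (cc G zs)"
    if "ar k" "dm k = W zs" "valid \<Theta> zs" "\<forall>z \<in> set \<Theta>. ssb s G g z" "valid \<Gamma> (cc G \<Theta>)" for k zs \<Theta> s G g \<Gamma>
  proof -
    have sb: "\<forall>z \<in> set \<Theta>. sb G g z" using that(4) ssb_sb by blast
    show ?thesis
      using subst_str[OF sb that(3,5)] valid_cc_sb[OF sb that(3), of \<Gamma> "[]"] gs_arr[OF sb] that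
      by (simp add: cmp_assoc del: str.simps)
  qed
  {
    case (j_zero \<Theta>)
    then show ?case using K[of "nm 0" "[]" \<Theta> s G g \<Gamma>] isem.j_zero[of \<Gamma>] by (simp add: str_arr' erase_arr valid_Nil)
  next
    case (j_succ \<Theta>)
    then show ?case using K[of "crs [] N N sucs" "[]" \<Theta> s G g \<Gamma>] isem.j_succ[of \<Gamma>] by (simp add: erase_arr valid_Nil)
  next
    case (j_pred \<Theta>)
    then show ?case using K[of "crs [] N N prds" "[]" \<Theta> s G g \<Gamma>] isem.j_pred[of \<Gamma>] by (simp add: erase_arr valid_Nil)
  next
    case (j_var \<Theta> x)
    then have x: "ssb s G g x" by (auto simp: valid_def)
    have *: "(der x \<circ>\<^sub>s str \<Theta> [x]) \<circ>\<^sub>s gs g \<Theta> \<circ>\<^sub>s str \<Gamma> (cc G \<Theta>) = der x \<circ>\<^sub>s gs g [x] \<circ>\<^sub>s str \<Gamma> (cc G [x])"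
      "valid \<Gamma> (cc G [x])"
      using K[of "der x" "[x]" \<Theta> s G g \<Gamma>] j_var by (simp_all del: str.simps gs.simps)
    show ?case unfolding * using *(2) x sb_arr[OF ssb_sb[OF x]] by (simp add: ssb_def)
  next
    case (j_app \<Theta>1 P \<sigma> \<tau> f1 \<Theta>2 Q f2 \<Theta>)
    let ?C1 = "cc G \<Theta>1" and ?C2 = "cc G \<Theta>2"
    note a1 = isem_arr[OF j_app.hyps(1)] and a2 = isem_arr[OF j_app.hyps(2)]
    have sub: "\<forall>z \<in> set (\<Theta>1 @ \<Theta>2). ssb s G g z" using j_app by (auto simp: valid_def)
    then have sub1: "\<forall>z \<in> set \<Theta>1. sb G g z" and sub2: "\<forall>z \<in> set \<Theta>2. sb G g z"
      and sub12: "\<forall>z \<in> set (\<Theta>1 @ \<Theta>2). sb G g z" by (auto intro: ssb_sb)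
    note g1 = gs_arr[OF sub1] and g2 = gs_arr[OF sub2]
    let ?e = "evs (tyI C \<sigma>) (tyI C \<tau>)"
    have *: "((?e \<circ>\<^sub>s (f1 \<boxtimes> f2)) \<circ>\<^sub>s str \<Theta> (\<Theta>1 @ \<Theta>2)) \<circ>\<^sub>s gs g \<Theta> \<circ>\<^sub>s str \<Gamma> (cc G \<Theta>)
      = (?e \<circ>\<^sub>s (f1 \<boxtimes> f2)) \<circ>\<^sub>s gs g (\<Theta>1 @ \<Theta>2) \<circ>\<^sub>s str \<Gamma> (cc G (\<Theta>1 @ \<Theta>2))" and v: "valid \<Gamma> (?C1 @ ?C2)"
      using K[of "?e \<circ>\<^sub>s (f1 \<boxtimes> f2)" "\<Theta>1 @ \<Theta>2" \<Theta> s G g \<Gamma>] j_app a1 a2 by simp_all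
    note vf = valid_factor[OF v]
    let ?h1 = "f1 \<circ>\<^sub>s gs g \<Theta>1 \<circ>\<^sub>s str (remdups ?C1) ?C1" and ?h2 = "f2 \<circ>\<^sub>s gs g \<Theta>2 \<circ>\<^sub>s str (remdups ?C2) ?C2"
    have "isem (remdups ?C1) (msub s P) (\<sigma> \<multimap> \<tau>) ?h1" "isem (remdups ?C2) (msub s Q) \<sigma> ?h2"
      using j_app.IH sub vf by auto
    from isem.j_app[OF this vf(3)]
    have "isem \<Gamma> (App (msub s P) (msub s Q)) \<tau> (?e \<circ>\<^sub>s (?h1 \<boxtimes> ?h2) \<circ>\<^sub>s str \<Gamma> (remdups ?C1 @ remdups ?C2))" .
    also have "(?h1 \<boxtimes> ?h2) \<circ>\<^sub>s str \<Gamma> (remdups ?C1 @ remdups ?C2)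
      = (f1 \<boxtimes> f2) \<circ>\<^sub>s (gs g \<Theta>1 \<boxtimes> gs g \<Theta>2) \<circ>\<^sub>s (str (remdups ?C1) ?C1 \<boxtimes> str (remdups ?C2) ?C2) \<circ>\<^sub>s str \<Gamma> (remdups ?C1 @ remdups ?C2)"
      using a1 a2 g1 g2 vf by (simp flip: cmp_assoc add: interchange)
    also have "\<dots> = (f1 \<boxtimes> f2) \<circ>\<^sub>s gs g (\<Theta>1 @ \<Theta>2) \<circ>\<^sub>s str \<Gamma> (?C1 @ ?C2)"
      using str_str2[OF vf] gs_append[OF sub12] by simp
    finally show ?case
      using * a1 a2 g1 g2 v gs_append[OF sub12] by (simp add: cmp_assoc j_app.hyps)
  next
    case (j_lif \<Theta>1 P m \<Theta>2 L l R r \<Theta>)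
    let ?C1 = "cc G \<Theta>1" and ?C2 = "cc G \<Theta>2"
    note a1 = isem_arr[OF j_lif.hyps(1)] and a2 = isem_arr[OF j_lif.hyps(2)] and a3 = isem_arr[OF j_lif.hyps(3)]
    have sub: "\<forall>z \<in> set (\<Theta>1 @ \<Theta>2). ssb s G g z" using j_lif by (auto simp: valid_def)
    then have sub1: "\<forall>z \<in> set \<Theta>1. sb G g z" and sub2: "\<forall>z \<in> set \<Theta>2. sb G g z"
      and sub12: "\<forall>z \<in> set (\<Theta>1 @ \<Theta>2). sb G g z" by (auto intro: ssb_sb)
    note g1 = gs_arr[OF sub1] and g2 = gs_arr[OF sub2]
    have *: "(cond m l r \<circ>\<^sub>s str \<Theta> (\<Theta>1 @ \<Theta>2)) \<circ>\<^sub>s gs g \<Theta> \<circ>\<^sub>s str \<Gamma> (cc G \<Theta>)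
      = cond m l r \<circ>\<^sub>s gs g (\<Theta>1 @ \<Theta>2) \<circ>\<^sub>s str \<Gamma> (cc G (\<Theta>1 @ \<Theta>2))" and v: "valid \<Gamma> (?C1 @ ?C2)"
      using K[of "cond m l r" "\<Theta>1 @ \<Theta>2" \<Theta> s G g \<Gamma>] j_lif a1 a2 a3 by simp_all
    note vf = valid_factor[OF v]
    let ?k1 = "gs g \<Theta>1 \<circ>\<^sub>s str (remdups ?C1) ?C1" and ?k2 = "gs g \<Theta>2 \<circ>\<^sub>s str (remdups ?C2) ?C2"
    have "isem (remdups ?C1) (msub s P) Iota (m \<circ>\<^sub>s ?k1)" "isem (remdups ?C2) (msub s L) Iota (l \<circ>\<^sub>s ?k2)"
      "isem (remdups ?C2) (msub s R) Iota (r \<circ>\<^sub>s ?k2)"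
      using j_lif.IH sub vf by auto
    from isem.j_lif[OF this vf(3)]
    have "isem \<Gamma> (LIf (msub s P) (msub s L) (msub s R)) Iota
      (cond (m \<circ>\<^sub>s ?k1) (l \<circ>\<^sub>s ?k2) (r \<circ>\<^sub>s ?k2) \<circ>\<^sub>s str \<Gamma> (remdups ?C1 @ remdups ?C2))" .
    also have "cond (m \<circ>\<^sub>s ?k1) (l \<circ>\<^sub>s ?k2) (r \<circ>\<^sub>s ?k2) = cond m l r \<circ>\<^sub>s (?k1 \<boxtimes> ?k2)"
      using a1 a2 a3 g1 g2 vf by (intro cond_cmp) simp_all
    also have "?k1 \<boxtimes> ?k2 = gs g (\<Theta>1 @ \<Theta>2) \<circ>\<^sub>s (str (remdups ?C1) ?C1 \<boxtimes> str (remdups ?C2) ?C2)"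
      using g1 g2 vf gs_append[OF sub12] by (simp add: interchange)
    also have "(cond m l r \<circ>\<^sub>s \<dots>) \<circ>\<^sub>s str \<Gamma> (remdups ?C1 @ remdups ?C2)
      = cond m l r \<circ>\<^sub>s gs g (\<Theta>1 @ \<Theta>2) \<circ>\<^sub>s (str (remdups ?C1) ?C1 \<boxtimes> str (remdups ?C2) ?C2) \<circ>\<^sub>s str \<Gamma> (remdups ?C1 @ remdups ?C2)"
      using a1 a2 a3 g1 g2 vf gs_append[OF sub12] by (simp add: cmp_assoc)
    also have "\<dots> = cond m l r \<circ>\<^sub>s gs g (\<Theta>1 @ \<Theta>2) \<circ>\<^sub>s str \<Gamma> (?C1 @ ?C2)"
      using str_str2[OF vf] by simp
    finally show ?case using * by simp
  next
    case (j_lam \<Theta> x P \<tau> f)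
    let ?k = "gs g \<Theta> \<circ>\<^sub>s str \<Gamma> (cc G \<Theta>)"
    obtain y Q where y: "vk y = vk x" "msub s (bind 0 x P) = bind 0 y Q"
      "isem (\<Gamma> @ [y]) Q \<tau> (f \<circ>\<^sub>s (?k \<boxtimes> Ids [V x]))"
      using msub_binder[OF j_lam.hyps(1) j_lam.IH j_lam.prems] by blast
    have "\<forall>z \<in> set \<Theta>. sb G g z" using j_lam.prems ssb_sb by auto
    note g = gs_arr[OF this]
    have k: "ar ?k" "dm ?k = W \<Gamma>" "cd ?k = W \<Theta>" using g j_lam.prems by simp_all
    have "isem \<Gamma> (lam y Q) (vty y \<multimap> \<tau>) (crs (W \<Gamma>) (V y) (tyI C \<tau>) (f \<circ>\<^sub>s (?k \<boxtimes> Ids [V x])))"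
      using y(3) by (rule isem.j_lam) (simp add: vk_eq(3)[OF y(1)] j_lam.hyps(2))
    moreover have "crs (W \<Gamma>) (V y) (tyI C \<tau>) (f \<circ>\<^sub>s (?k \<boxtimes> Ids [V x])) = crs (W \<Theta>) (V x) (tyI C \<tau>) f \<circ>\<^sub>s ?k"
      using crs_cmp[of f ?k "V x" "tyI C \<tau>"] isem_arr[OF j_lam.hyps(1)] k vk_sem[OF y(1)] by simp
    ultimately show ?case using vk_eq[OF y(1)] y(2) by simp
  next
    case (j_mu \<Theta> F \<sigma> P f)
    let ?k = "gs g \<Theta> \<circ>\<^sub>s str \<Gamma> (cc G \<Theta>)" and ?A = "tyI C \<sigma>"
    obtain y Q where y: "vk y = vk (Stb F \<sigma>)" "msub s (bind 0 (Stb F \<sigma>) P) = bind 0 y Q"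
      "isem (\<Gamma> @ [y]) Q \<sigma> (f \<circ>\<^sub>s (?k \<boxtimes> Ids [V (Stb F \<sigma>)]))"
      using msub_binder[OF j_mu.hyps(1) j_mu.IH j_mu.prems] by blast
    then obtain F' where F': "y = Stb F' \<sigma>" by (cases y) auto
    have sb: "\<forall>z \<in> set \<Theta>. sb G g z" using j_mu.prems ssb_sb by auto
    \<comment> \<open>The context of a fixpoint has no linear variables, and by \<open>sb\<close>
      neither do the inputs substituted for them.\<close>
    have nlC: "nl (cc G \<Theta>)" using sb j_mu.hyps(2) by (auto simp: sb_def)
    then have nl: "nl \<Gamma>" using valid_in[OF j_mu.prems(2)] by blast
    have "\<forall>z \<in> set \<Theta>. cm (G z) (g z) [z]" using j_mu.prems(1) j_mu.hyps(2) by (auto simp: ssb_def)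
    then have "cm (cc G \<Theta>) (gs g \<Theta>) \<Theta>"
    proof (induction \<Theta>)
      case Nil
      then show ?case using cm_Ids[of "[]"] by simp
    next
      case (Cons z \<Theta>)
      then show ?case using cm_tns[of "G z" "g z" "[z]" "cc G \<Theta>" "gs g \<Theta>" \<Theta>] by simp
    qed
    \<comment> \<open>The substitution as a whole is a coalgebra morphism and can therefore enter
      the promotion by \<open>mus_cmp\<close>.\<close>
    then have k: "cm \<Gamma> ?k \<Theta>"
      by (rule cm_cmp[OF cm_str[OF nl j_mu.prems(2)]])
    have "isem \<Gamma> (mu y Q) \<sigma> (mus \<Gamma> ?A (f \<circ>\<^sub>s (?k \<boxtimes> Ids [V (Stb F \<sigma>)])))"
      using y(3) nl unfolding F' by (rule isem.j_mu)
    moreover have "mus \<Gamma> ?A (f \<circ>\<^sub>s (?k \<boxtimes> Ids [V (Stb F \<sigma>)])) = mus \<Theta> ?A f \<circ>\<^sub>s ?k"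
      using mus_cmp[OF k, of f ?A] isem_arr[OF j_mu.hyps(1)] by simp
    ultimately show ?case using F' y(2) by simp
  }
qed

text \<open>The renaming need not be injective and \<open>\<Gamma>\<close> may contain further
  copyable variables, so contraction, weakening and exchange are all instances.\<close>

lemma isem_ren:
  assumes "isem \<Theta> M \<tau> h" "\<And>z. z \<in> set \<Theta> \<Longrightarrow> vk (r z) = vk z" "valid \<Gamma> (map r \<Theta>)"
  shows "isem \<Gamma> (ren r M) \<tau> (h \<circ>\<^sub>s str \<Gamma> (map r \<Theta>))"
proof -
  have W: "W (map r \<Theta>) = W \<Theta>" using assms(2) by (auto intro: vk_sem(1))
  have "cc (\<lambda>z. [r z]) \<Theta> = map r \<Theta>" by (induction \<Theta>) auto
  then have "isem \<Gamma> (msub (\<lambda>z. FV (r z)) M) \<tau> (h \<circ>\<^sub>s J \<Theta> \<circ>\<^sub>s str \<Gamma> (map r \<Theta>))"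
    using isem_msub[OF assms(1), of "\<lambda>z. FV (r z)" "\<lambda>z. [r z]" "\<lambda>z. Ids [V z]" \<Gamma>] assms(2,3)
    by (auto simp: gs_ident intro: ssb_var)
  moreover have "J \<Theta> \<circ>\<^sub>s str \<Gamma> (map r \<Theta>) = str \<Gamma> (map r \<Theta>)"
    using assms(3) W by simp
  ultimately show ?thesis by (simp add: ren_msub)
qed

lemma isem_weaken:
  assumes "isem \<Theta> M \<tau> h" "valid \<Gamma> \<Theta>"
  shows "isem \<Gamma> M \<tau> (h \<circ>\<^sub>s str \<Gamma> \<Theta>)"
  using isem_ren[OF assms(1), of id \<Gamma>] assms(2) by (simp add: ren_msub)

lemma isem_subst:
  assumes P: "isem (\<Gamma>1 @ [x]) P \<tau> h" and Q: "ssb (\<lambda>_. Q) (\<lambda>_. \<Delta>) (\<lambda>_. q) x" and v: "valid \<Gamma> (\<Gamma>1 @ \<Delta>)"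
  shows "isem \<Gamma> (fsubst x Q P) \<tau> (h \<circ>\<^sub>s (J \<Gamma>1 \<boxtimes> q) \<circ>\<^sub>s str \<Gamma> (\<Gamma>1 @ \<Delta>))"
proof -
  let ?s = "FV(x := Q)" and ?G = "(\<lambda>z. [z])(x := \<Delta>)" and ?g = "(\<lambda>z. Ids [V z])(x := q)"
  have x: "x \<notin> set \<Gamma>1" using isem_distinct[OF P] by simp
  have ssb: "ssb ?s ?G ?g z" for z
  proof (cases "z = x")
    case True
    then show ?thesis using Q ssb_cong[of ?s x "\<lambda>_. Q" ?G "\<lambda>_. \<Delta>" ?g "\<lambda>_. q"] by simp
  next
    case False
    then show ?thesis using ssb_var[of z z ?s ?G ?g] by simp
  qed
  have "cc ?G \<Gamma>1 = \<Gamma>1" using x by (induction \<Gamma>1) auto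
  then have G: "cc ?G (\<Gamma>1 @ [x]) = \<Gamma>1 @ \<Delta>" by simp
  have "gs ?g \<Gamma>1 = J \<Gamma>1" using x by (induction \<Gamma>1) auto
  moreover have "ar q" using Q by (simp add: ssb_def sb_def)
  ultimately have g: "gs ?g (\<Gamma>1 @ [x]) = J \<Gamma>1 \<boxtimes> q"
    using gs_append[of \<Gamma>1 "[x]" ?G ?g] ssb_sb[OF ssb] by simp
  have "lc 0 Q" using Q by (simp add: ssb_def)
  moreover have "isem \<Gamma> (msub ?s P) \<tau> (h \<circ>\<^sub>s gs ?g (\<Gamma>1 @ [x]) \<circ>\<^sub>s str \<Gamma> (cc ?G (\<Gamma>1 @ [x])))"
    by (rule isem_msub[OF P]) (use ssb in blast, unfold G, rule v)
  ultimately show ?thesis unfolding G g by (simp add: fsubst_msub)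
qed

subsection \<open>Uniqueness\<close>

inductive_cases isem_FV: "isem \<Gamma> (FV x) \<sigma> f"
inductive_cases isem_Zero: "isem \<Gamma> Zero \<sigma> f"
inductive_cases isem_Succ: "isem \<Gamma> Succ \<sigma> f"
inductive_cases isem_Pred: "isem \<Gamma> Pred \<sigma> f"
inductive_cases isem_BV: "isem \<Gamma> (BV i) \<sigma> f"
inductive_cases isem_App: "isem \<Gamma> (App P Q) \<sigma> f"
inductive_cases isem_LIf: "isem \<Gamma> (LIf P L R) \<sigma> f"
inductive_cases isem_Lam: "isem \<Gamma> (Lam \<rho> K) \<sigma> f"
inductive_cases isem_Mu: "isem \<Gamma> (Mu \<rho> K) \<sigma> f"

text \<open>Weakening each subterm to this canonical context makes the splittings in \<open>isem\<close> deterministic.\<close>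

definition rs :: "var list \<Rightarrow> trm \<Rightarrow> var list" where
  "rs \<Gamma> M = filter (\<lambda>x. is_Ho x \<longrightarrow> x \<in> fv M) \<Gamma>"

lemma valid_rs:
  assumes "isem \<Gamma>1 P \<sigma> f" "set \<Gamma>1 \<subseteq> set \<Gamma>" "distinct \<Gamma>"
  shows "valid (rs \<Gamma> P) \<Gamma>1"
  using assms isem_distinct[OF assms(1)] isem_fv[OF assms(1)] isem_Ho[OF assms(1)]
  by (auto simp: valid_def rs_def count_list_distinct)

text \<open>A linear variable of \<open>\<Gamma>\<close> belongs to exactly one of
  \<open>\<Gamma>1\<close> and \<open>\<Gamma>2\<close>, hence is free in exactly one of
  \<open>P\<close> and \<open>Q\<close>.\<close>

lemma valid_rs2:
  assumes "isem \<Gamma>1 P \<sigma> f" "isem \<Gamma>2 Q \<tau> g" "valid \<Gamma> (\<Gamma>1 @ \<Gamma>2)"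
  shows "valid \<Gamma> (rs \<Gamma> P @ rs \<Gamma> Q)"
proof -
  have "count_list (rs \<Gamma> P) x + count_list (rs \<Gamma> Q) x = 1" if "x \<in> set \<Gamma>" "is_Ho x" for x
  proof -
    have "x \<in> fv P \<longleftrightarrow> x \<in> set \<Gamma>1" "x \<in> fv Q \<longleftrightarrow> x \<in> set \<Gamma>2"
      using isem_fv[OF assms(1)] isem_Ho[OF assms(1) that(2)] isem_fv[OF assms(2)] isem_Ho[OF assms(2) that(2)]
      by auto
    then have "x \<in> set (rs \<Gamma> P) \<longleftrightarrow> x \<in> set \<Gamma>1" "x \<in> set (rs \<Gamma> Q) \<longleftrightarrow> x \<in> set \<Gamma>2"
      using that by (auto simp: rs_def)
    moreover have "count_list \<Gamma>1 x + count_list \<Gamma>2 x = 1" using assms(3) that by (simp add: valid_def)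
    ultimately show ?thesis
      using isem_distinct[OF assms(1)] isem_distinct[OF assms(2)] assms(3)
      by (simp add: count_list_distinct rs_def valid_distinct split: if_splits)
  qed
  then show ?thesis using assms(3) by (auto simp: valid_def rs_def)
qed

lemma isem_App_rs:
  assumes "isem \<Gamma> (App P Q) \<tau> h"
  obtains \<sigma> f g where "isem (rs \<Gamma> P) P (\<sigma> \<multimap> \<tau>) f" "isem (rs \<Gamma> Q) Q \<sigma> g"
    "h = evs (tyI C \<sigma>) (tyI C \<tau>) \<circ>\<^sub>s (f \<boxtimes> g) \<circ>\<^sub>s str \<Gamma> (rs \<Gamma> P @ rs \<Gamma> Q)"
proof -
  from assms obtain \<Gamma>1 \<Gamma>2 \<sigma> f g where fg: "isem \<Gamma>1 P (\<sigma> \<multimap> \<tau>) f" "isem \<Gamma>2 Q \<sigma> g" "valid \<Gamma> (\<Gamma>1 @ \<Gamma>2)"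
    and h: "h = evs (tyI C \<sigma>) (tyI C \<tau>) \<circ>\<^sub>s (f \<boxtimes> g) \<circ>\<^sub>s str \<Gamma> (\<Gamma>1 @ \<Gamma>2)"
    by (rule isem_App) blast
  have v1: "valid (rs \<Gamma> P) \<Gamma>1" and v2: "valid (rs \<Gamma> Q) \<Gamma>2"
    using valid_rs[OF fg(1)] valid_rs[OF fg(2)] fg(3) by (auto simp: valid_def)
  note v = valid_rs2[OF fg]
  note a = isem_arr[OF fg(1)] isem_arr[OF fg(2)]
  have "(f \<boxtimes> g) \<circ>\<^sub>s str \<Gamma> (\<Gamma>1 @ \<Gamma>2) = (f \<boxtimes> g) \<circ>\<^sub>s (str (rs \<Gamma> P) \<Gamma>1 \<boxtimes> str (rs \<Gamma> Q) \<Gamma>2) \<circ>\<^sub>s str \<Gamma> (rs \<Gamma> P @ rs \<Gamma> Q)"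
    using str_str2[OF v1 v2 v] by simp
  also have "\<dots> = ((f \<circ>\<^sub>s str (rs \<Gamma> P) \<Gamma>1) \<boxtimes> (g \<circ>\<^sub>s str (rs \<Gamma> Q) \<Gamma>2)) \<circ>\<^sub>s str \<Gamma> (rs \<Gamma> P @ rs \<Gamma> Q)"
    using a v v1 v2 by (simp flip: cmp_assoc add: interchange)
  finally show ?thesis
    using that[OF isem_weaken[OF fg(1) v1] isem_weaken[OF fg(2) v2]] h by simp
qed

text \<open>The context \<open>rs \<Gamma> L\<close> serves for both branches: they were interpreted
  in one common context, from which either of them can be weakened.\<close>

lemma isem_LIf_rs:
  assumes "isem \<Gamma> (LIf P L R) \<tau> h"
  obtains m l r where "\<tau> = Iota" "isem (rs \<Gamma> P) P Iota m" "isem (rs \<Gamma> L) L Iota l" "isem (rs \<Gamma> L) R Iota r"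
    "h = cond m l r \<circ>\<^sub>s str \<Gamma> (rs \<Gamma> P @ rs \<Gamma> L)"
proof -
  from assms obtain \<Gamma>1 \<Gamma>2 m l r where m: "\<tau> = Iota" "isem \<Gamma>1 P Iota m" "isem \<Gamma>2 L Iota l" "isem \<Gamma>2 R Iota r"
    "valid \<Gamma> (\<Gamma>1 @ \<Gamma>2)" and h: "h = cond m l r \<circ>\<^sub>s str \<Gamma> (\<Gamma>1 @ \<Gamma>2)"
    by (rule isem_LIf) blast
  have v1: "valid (rs \<Gamma> P) \<Gamma>1" and v2: "valid (rs \<Gamma> L) \<Gamma>2"
    using valid_rs[OF m(2)] valid_rs[OF m(3)] m(5) by (auto simp: valid_def)
  note v = valid_rs2[OF m(2,3,5)]
  note a = isem_arr[OF m(2)] isem_arr[OF m(3)] isem_arr[OF m(4)]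
  have "cond m l r \<circ>\<^sub>s str \<Gamma> (\<Gamma>1 @ \<Gamma>2) = cond m l r \<circ>\<^sub>s (str (rs \<Gamma> P) \<Gamma>1 \<boxtimes> str (rs \<Gamma> L) \<Gamma>2) \<circ>\<^sub>s str \<Gamma> (rs \<Gamma> P @ rs \<Gamma> L)"
    using str_str2[OF v1 v2 v] by simp
  also have "\<dots> = (cond m l r \<circ>\<^sub>s (str (rs \<Gamma> P) \<Gamma>1 \<boxtimes> str (rs \<Gamma> L) \<Gamma>2)) \<circ>\<^sub>s str \<Gamma> (rs \<Gamma> P @ rs \<Gamma> L)"
    using a v v1 v2 by (simp add: cmp_assoc)
  also have "cond m l r \<circ>\<^sub>s (str (rs \<Gamma> P) \<Gamma>1 \<boxtimes> str (rs \<Gamma> L) \<Gamma>2)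
    = cond (m \<circ>\<^sub>s str (rs \<Gamma> P) \<Gamma>1) (l \<circ>\<^sub>s str (rs \<Gamma> L) \<Gamma>2) (r \<circ>\<^sub>s str (rs \<Gamma> L) \<Gamma>2)"
    using a v1 v2 by (intro cond_cmp[symmetric]) simp_all
  finally show ?thesis
    using that[OF m(1) isem_weaken[OF m(2) v1] isem_weaken[OF m(3) v2] isem_weaken[OF m(4) v2]] h by simp
qed

lemma fsubst_self: "fsubst y (FV y) M = M"
  by (induction M) auto

text \<open>Two named bodies of one binder differ by the renaming of \<open>x\<close> to
  \<open>y\<close>. Its structural arrow is an identity because both variables have the same kind,
  so the arrow is unchanged.\<close>

lemma isem_bind:
  assumes x: "isem (\<Gamma> @ [x]) P \<tau> f" and y: "isem (\<Gamma> @ [y]) Q \<tau>' g"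
    and eq: "bind 0 x P = bind 0 y Q" "vk x = vk y"
  shows "isem (\<Gamma> @ [y]) Q \<tau> f"
proof -
  have "Q = inst 0 (FV y) (bind 0 y Q)" by (simp add: inst_bind fsubst_self)
  also have "\<dots> = fsubst x (FV y) P" by (simp add: inst_bind flip: eq(1))
  finally have Q: "Q = ren (id(x := y)) P" by (simp add: fsubst_FV)
  have x': "x \<notin> set \<Gamma>" using isem_distinct[OF x] by simp
  then have m: "map (id(x := y)) (\<Gamma> @ [x]) = \<Gamma> @ [y]" by simp
  note d = isem_distinct[OF y]
  have "isem (\<Gamma> @ [y]) (ren (id(x := y)) P) \<tau> (f \<circ>\<^sub>s str (\<Gamma> @ [y]) (map (id(x := y)) (\<Gamma> @ [x])))"
    by (rule isem_ren[OF x]) (use eq(2) in simp, unfold m, rule valid_self[OF d])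
  then show ?thesis
    unfolding m Q using str_self[OF d] isem_arr[OF x] vk_sem(1)[OF eq(2)] by simp
qed

text \<open>By induction on the size, since two derivations may open a binder with different names
  and then have different subterms. The type is part of the claim because the argument types of an
  application must agree before its arrows can be compared.\<close>

lemma isem_unique: "isem \<Gamma> M \<sigma> f \<Longrightarrow> isem \<Gamma> M \<sigma>' f' \<Longrightarrow> \<sigma> = \<sigma>' \<and> f = f'"
proof (induction "size M" arbitrary: \<Gamma> M \<sigma> f \<sigma>' f' rule: less_induct)
  case less
  show ?case
  proof (cases M)
    case Zero
    then show ?thesis using less.prems by (auto elim!: isem_Zero)
  next
    case Succ
    then show ?thesis using less.prems by (auto elim!: isem_Succ)
  next
    case Pred
    then show ?thesis using less.prems by (auto elim!: isem_Pred)
  next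
    case (FV x)
    then show ?thesis using less.prems by (auto elim!: isem_FV)
  next
    case (BV i)
    then show ?thesis using less.prems by (auto elim!: isem_BV)
  next
    case (App P Q)
    have sz: "size P < size M" "size Q < size M" using App by simp_all
    obtain \<rho> f1 f2 where 1: "isem (rs \<Gamma> P) P (\<rho> \<multimap> \<sigma>) f1" "isem (rs \<Gamma> Q) Q \<rho> f2"
      "f = evs (tyI C \<rho>) (tyI C \<sigma>) \<circ>\<^sub>s (f1 \<boxtimes> f2) \<circ>\<^sub>s str \<Gamma> (rs \<Gamma> P @ rs \<Gamma> Q)"
      using less.prems(1)[unfolded App] by (rule isem_App_rs)
    obtain \<rho>' f1' f2' where 2: "isem (rs \<Gamma> P) P (\<rho>' \<multimap> \<sigma>') f1'" "isem (rs \<Gamma> Q) Q \<rho>' f2'"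
      "f' = evs (tyI C \<rho>') (tyI C \<sigma>') \<circ>\<^sub>s (f1' \<boxtimes> f2') \<circ>\<^sub>s str \<Gamma> (rs \<Gamma> P @ rs \<Gamma> Q)"
      using less.prems(2)[unfolded App] by (rule isem_App_rs)
    show ?thesis
      using less.hyps[OF sz(1) 1(1) 2(1)] less.hyps[OF sz(2) 1(2) 2(2)] 1(3) 2(3) by simp
  next
    case (LIf P L R)
    have sz: "size P < size M" "size L < size M" "size R < size M" using LIf by simp_all
    obtain m l r where 1: "\<sigma> = Iota" "isem (rs \<Gamma> P) P Iota m" "isem (rs \<Gamma> L) L Iota l" "isem (rs \<Gamma> L) R Iota r"
      "f = cond m l r \<circ>\<^sub>s str \<Gamma> (rs \<Gamma> P @ rs \<Gamma> L)"
      using less.prems(1)[unfolded LIf] by (rule isem_LIf_rs)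
    obtain m' l' r' where 2: "\<sigma>' = Iota" "isem (rs \<Gamma> P) P Iota m'" "isem (rs \<Gamma> L) L Iota l'" "isem (rs \<Gamma> L) R Iota r'"
      "f' = cond m' l' r' \<circ>\<^sub>s str \<Gamma> (rs \<Gamma> P @ rs \<Gamma> L)"
      using less.prems(2)[unfolded LIf] by (rule isem_LIf_rs)
    show ?thesis
      using less.hyps[OF sz(1) 1(2) 2(2)] less.hyps[OF sz(2) 1(3) 2(3)] less.hyps[OF sz(3) 1(4) 2(4)] 1 2 by simp
  next
    case (Lam \<rho> K)
    obtain x P \<tau> g where 1: "isem (\<Gamma> @ [x]) P \<tau> g" "\<not> is_Stb x" "\<rho> = vty x" "K = bind 0 x P"
      "\<sigma> = vty x \<multimap> \<tau>" "f = crs (W \<Gamma>) (V x) (tyI C \<tau>) g"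
      using less.prems(1)[unfolded Lam] by (rule isem_Lam) blast
    obtain y Q \<tau>' g' where 2: "isem (\<Gamma> @ [y]) Q \<tau>' g'" "\<not> is_Stb y" "\<rho> = vty y" "K = bind 0 y Q"
      "\<sigma>' = vty y \<multimap> \<tau>'" "f' = crs (W \<Gamma>) (V y) (tyI C \<tau>') g'"
      using less.prems(2)[unfolded Lam] by (rule isem_Lam) blast
    have vk: "vk x = vk y" using 1 2 by (intro vk_eqI) auto
    \<comment> \<open>The first derivation is moved to the bound name of the second, so that both
      speak about \<open>Q\<close>.\<close>
    have "isem (\<Gamma> @ [y]) Q \<tau> g" using isem_bind[OF 1(1) 2(1) _ vk] 1(4) 2(4) by simp
    moreover have "size Q < size M" using Lam 2(4) by simp
    ultimately have "\<tau> = \<tau>' \<and> g = g'" using less.hyps 2(1) by blast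
    then show ?thesis using 1 2 vk_sem(1)[OF vk] by simp
  next
    case (Mu \<rho> K)
    obtain F P g where 1: "isem (\<Gamma> @ [Stb F \<rho>]) P \<rho> g" "K = bind 0 (Stb F \<rho>) P"
      "\<sigma> = \<rho>" "f = mus \<Gamma> (tyI C \<rho>) g"
      using less.prems(1)[unfolded Mu] by (rule isem_Mu) blast
    obtain F' Q g' where 2: "isem (\<Gamma> @ [Stb F' \<rho>]) Q \<rho> g'" "K = bind 0 (Stb F' \<rho>) Q"
      "\<sigma>' = \<rho>" "f' = mus \<Gamma> (tyI C \<rho>) g'"
      using less.prems(2)[unfolded Mu] by (rule isem_Mu) blast
    have "isem (\<Gamma> @ [Stb F' \<rho>]) Q \<rho> g" using isem_bind[OF 1(1) 2(1)] 1(2) 2(2) by simp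
    moreover have "size Q < size M" using Mu 2(2) by simp
    ultimately have "g = g'" using less.hyps 2(1) by blast
    then show ?thesis using 1 2 by simp
  qed
qed

subsection \<open>Invariance under reduction\<close>

text \<open>A constant \<open>u\<close> applied to a numeral, with the contexts of both discarded.
  It covers \<open>Succ\<close>, which builds numerals, as well as the reduction of
  \<open>Pred\<close>.\<close>

lemma evs_numeral:
  assumes v: "valid \<Gamma>1 []" "valid \<Gamma>2 []" "valid \<Gamma> (\<Gamma>1 @ \<Gamma>2)"
    and u: "ar u" "dm u = [N]" "cd u = [N]" "u \<circ>\<^sub>s nm n = nm k"
  shows "evs N N \<circ>\<^sub>s ((crs [] N N u \<circ>\<^sub>s str \<Gamma>1 []) \<boxtimes> (nm n \<circ>\<^sub>s str \<Gamma>2 [])) \<circ>\<^sub>s str \<Gamma> (\<Gamma>1 @ \<Gamma>2) = nm k \<circ>\<^sub>s str \<Gamma> []"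
proof -
  let ?c = "crs [] N N u"
  have c: "ar ?c" using u by simp
  have v': "valid \<Gamma> []" using valid_trans2[OF v] by simp
  have "((?c \<circ>\<^sub>s str \<Gamma>1 []) \<boxtimes> (nm n \<circ>\<^sub>s str \<Gamma>2 [])) \<circ>\<^sub>s str \<Gamma> (\<Gamma>1 @ \<Gamma>2)
    = (?c \<boxtimes> nm n) \<circ>\<^sub>s (str \<Gamma>1 [] \<boxtimes> str \<Gamma>2 []) \<circ>\<^sub>s str \<Gamma> (\<Gamma>1 @ \<Gamma>2)"
    using c v str_arr[OF v(1)] str_arr[OF v(2)] by (simp flip: cmp_assoc add: interchange)
  also have "(str \<Gamma>1 [] \<boxtimes> str \<Gamma>2 []) \<circ>\<^sub>s str \<Gamma> (\<Gamma>1 @ \<Gamma>2) = str \<Gamma> []"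
    using str_str2[OF v] by simp
  also have "?c \<boxtimes> nm n = (?c \<boxtimes> Ids [N]) \<circ>\<^sub>s nm n"
    using c tns_factor_left[of ?c "nm n"] by simp
  finally have "evs N N \<circ>\<^sub>s ((?c \<circ>\<^sub>s str \<Gamma>1 []) \<boxtimes> (nm n \<circ>\<^sub>s str \<Gamma>2 [])) \<circ>\<^sub>s str \<Gamma> (\<Gamma>1 @ \<Gamma>2)
    = ((evs N N \<circ>\<^sub>s (?c \<boxtimes> Ids [N])) \<circ>\<^sub>s nm n) \<circ>\<^sub>s str \<Gamma> []"
    using c str_arr[OF v'] by (simp add: cmp_assoc)
  also have "evs N N \<circ>\<^sub>s (?c \<boxtimes> Ids [N]) = u"
    using u by (intro evs_crs) simp_all
  finally show ?thesis using u by simp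
qed

lemma cond_numeral:
  assumes v: "valid \<Gamma>1 []" "valid \<Gamma> (\<Gamma>1 @ \<Gamma>2)" and \<Gamma>2: "distinct \<Gamma>2"
    and l: "ar l" "dm l = W \<Gamma>2" "cd l = [N]" and r: "ar r" "dm r = W \<Gamma>2" "cd r = [N]"
  shows "cond (nm k \<circ>\<^sub>s str \<Gamma>1 []) l r \<circ>\<^sub>s str \<Gamma> (\<Gamma>1 @ \<Gamma>2) = (if k = 0 then l else r) \<circ>\<^sub>s str \<Gamma> \<Gamma>2"
proof -
  note s = str_arr[OF v(1)]
  have "cond (nm k \<circ>\<^sub>s str \<Gamma>1 []) l r = cond (nm k) l r \<circ>\<^sub>s (str \<Gamma>1 [] \<boxtimes> J \<Gamma>2)"
    using cond_cmp[of "nm k" l r "str \<Gamma>1 []" "J \<Gamma>2"] l r s by simp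
  also have "cond (nm k) l r = (if k = 0 then l else r)"
    using cond_nm l r by (cases k) auto
  finally have "cond (nm k \<circ>\<^sub>s str \<Gamma>1 []) l r \<circ>\<^sub>s str \<Gamma> (\<Gamma>1 @ \<Gamma>2)
    = (if k = 0 then l else r) \<circ>\<^sub>s (str \<Gamma>1 [] \<boxtimes> J \<Gamma>2) \<circ>\<^sub>s str \<Gamma> (\<Gamma>1 @ \<Gamma>2)"
    using l r s v by (simp add: cmp_assoc)
  also have "(str \<Gamma>1 [] \<boxtimes> J \<Gamma>2) \<circ>\<^sub>s str \<Gamma> (\<Gamma>1 @ \<Gamma>2) = str \<Gamma> \<Gamma>2"
    using str_str2[OF v(1) valid_self[OF \<Gamma>2] v(2)] \<Gamma>2 by (simp add: str_self)
  finally show ?thesis .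
qed

lemma isem_numI: "valid \<Gamma> [] \<Longrightarrow> isem \<Gamma> (num n) Iota (nm n \<circ>\<^sub>s str \<Gamma> [])"
proof (induction n arbitrary: \<Gamma>)
  case 0
  then show ?case using j_zero by simp
next
  case (Suc n)
  have v: "valid [] ([] :: var list)" "valid \<Gamma> ([] @ [])" using Suc.prems by (simp_all add: valid_def)
  show ?case
    using j_app[OF j_succ[OF v(1)] Suc.IH[OF v(1)] v(2)] evs_numeral[OF v(1) v(1) v(2), of sucs n "Suc n"]
    by (simp add: sucs_nm)
qed

text \<open>A numeral has no free variables, so its context has no linear ones; uniqueness then
  identifies any interpretation with the one of \<open>isem_numI\<close>.\<close>

lemma isem_numD: "isem \<Gamma> (num n) \<sigma> f \<Longrightarrow> \<sigma> = Iota \<and> valid \<Gamma> [] \<and> f = nm n \<circ>\<^sub>s str \<Gamma> []"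
proof -
  assume f: "isem \<Gamma> (num n) \<sigma> f"
  have "fv (num n) = {}" by (induction n) auto
  then have "valid \<Gamma> []" using isem_Ho[OF f] isem_distinct[OF f] by (auto simp: valid_Nil)
  then show ?thesis using isem_unique[OF f isem_numI] by blast
qed

text \<open>Every contraction that substitutes is an instance of \<open>isem_subst\<close>. What
  differs is why the substituted arrow qualifies: the variable is linear, the argument is a numeral,
  or it is a promoted fixpoint.\<close>

lemma isem_redex: "redex M M' \<Longrightarrow> isem \<Gamma> M \<sigma> f \<Longrightarrow> isem \<Gamma> M' \<sigma> f"
proof (induction rule: redex.induct)
  have if_num: "isem \<Gamma> (if n = 0 then L else R) \<sigma> f" if M: "isem \<Gamma> (LIf (num n) L R) \<sigma> f" for n L R
  proof -
    obtain \<Gamma>1 \<Gamma>2 m l r where m: "\<sigma> = Iota" "isem \<Gamma>1 (num n) Iota m" "isem \<Gamma>2 L Iota l" "isem \<Gamma>2 R Iota r"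
      "valid \<Gamma> (\<Gamma>1 @ \<Gamma>2)" and f: "f = cond m l r \<circ>\<^sub>s str \<Gamma> (\<Gamma>1 @ \<Gamma>2)"
      using M by (rule isem_LIf) blast
    have n: "valid \<Gamma>1 []" "m = nm n \<circ>\<^sub>s str \<Gamma>1 []" using isem_numD[OF m(2)] by auto
    have d2: "distinct \<Gamma>2" using isem_distinct[OF m(3)] .
    \<comment> \<open>The numeral uses no linear variable, so the context of the branches alone
      accounts for all those of \<open>\<Gamma>\<close>.\<close>
    have v: "valid \<Gamma> \<Gamma>2" using valid_trans2[OF n(1) valid_self[OF d2] m(5)] by simp
    have "f = (if n = 0 then l else r) \<circ>\<^sub>s str \<Gamma> \<Gamma>2"
      unfolding f n(2) using isem_arr[OF m(3)] isem_arr[OF m(4)]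
      by (intro cond_numeral[OF n(1) m(5) d2]) simp_all
    then show ?thesis using isem_weaken[OF m(3) v] isem_weaken[OF m(4) v] m(1) by simp
  qed
  {
  case (r_beta \<rho> \<rho>' K Q)
  then obtain \<Gamma>1 \<Gamma>2 \<upsilon> h g where fg: "isem \<Gamma>1 (Lam (\<rho> \<multimap> \<rho>') K) (\<upsilon> \<multimap> \<sigma>) h" "isem \<Gamma>2 Q \<upsilon> g" "valid \<Gamma> (\<Gamma>1 @ \<Gamma>2)"
    and f: "f = evs (tyI C \<upsilon>) (tyI C \<sigma>) \<circ>\<^sub>s (h \<boxtimes> g) \<circ>\<^sub>s str \<Gamma> (\<Gamma>1 @ \<Gamma>2)"
    by (auto elim: isem_App)
  from fg(1) obtain x P k where x: "isem (\<Gamma>1 @ [x]) P \<sigma> k" "\<not> is_Stb x" "\<rho> \<multimap> \<rho>' = vty x" "K = bind 0 x P"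
    "\<upsilon> = vty x" "h = crs (W \<Gamma>1) (V x) (tyI C \<sigma>) k"
    by (auto elim!: isem_Lam)
  have ho: "is_Ho x" using x(2,3) by (cases x) auto
  have V: "tyI C \<upsilon> = V x" using x(2,5) by (simp add: varI_vty)
  note g = isem_arr[OF fg(2)] and k = isem_arr[OF x(1)]
  \<comment> \<open>A linear variable imposes neither the copying nor the coalgebra condition, so an
    arbitrary argument is allowed.\<close>
  have "ssb (\<lambda>_. Q) (\<lambda>_. \<Gamma>2) (\<lambda>_. g) x"
    using ho g V isem_lc[OF fg(2)] isem_fv[OF fg(2)] isem_weaken[OF fg(2)] x(2,5)
    by (auto simp: ssb_def sb_def der_def)
  from isem_subst[OF x(1) this fg(3)]
  have "isem \<Gamma> (inst 0 Q K) \<sigma> (k \<circ>\<^sub>s (J \<Gamma>1 \<boxtimes> g) \<circ>\<^sub>s str \<Gamma> (\<Gamma>1 @ \<Gamma>2))"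
    by (simp add: x(4) inst_bind)
  also have "k \<circ>\<^sub>s (J \<Gamma>1 \<boxtimes> g) \<circ>\<^sub>s str \<Gamma> (\<Gamma>1 @ \<Gamma>2)
    = (evs (V x) (tyI C \<sigma>) \<circ>\<^sub>s (h \<boxtimes> Ids [V x])) \<circ>\<^sub>s (J \<Gamma>1 \<boxtimes> g) \<circ>\<^sub>s str \<Gamma> (\<Gamma>1 @ \<Gamma>2)"
    using k by (simp add: x(6) evs_crs)
  also have "\<dots> = f"
    using g k fg(3) V tns_factor_left[of h g] by (simp add: f x(6) cmp_assoc)
  finally show ?case .
next
  case (r_beta_num K n)
  then obtain \<Gamma>1 \<Gamma>2 \<upsilon> h g where fg: "isem \<Gamma>1 (Lam Iota K) (\<upsilon> \<multimap> \<sigma>) h" "isem \<Gamma>2 (num n) \<upsilon> g" "valid \<Gamma> (\<Gamma>1 @ \<Gamma>2)"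
    and f: "f = evs (tyI C \<upsilon>) (tyI C \<sigma>) \<circ>\<^sub>s (h \<boxtimes> g) \<circ>\<^sub>s str \<Gamma> (\<Gamma>1 @ \<Gamma>2)"
    by (auto elim: isem_App)
  from fg(1) obtain x P k where x: "isem (\<Gamma>1 @ [x]) P \<sigma> k" "\<not> is_Stb x" "Iota = vty x" "K = bind 0 x P"
    "\<upsilon> = vty x" "h = crs (W \<Gamma>1) (V x) (tyI C \<sigma>) k"
    by (auto elim!: isem_Lam)
  then obtain z where z: "x = Gnd z" by (cases x) auto
  have n: "valid \<Gamma>2 []" "g = nm n \<circ>\<^sub>s str \<Gamma>2 []" using isem_numD[OF fg(2)] by auto
  note k = isem_arr[OF x(1)]
  have "sb (\<lambda>_. []) (\<lambda>_. nm n) (Gnd z)"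
    using nm_comonoid[of z n] str_self[of "[]"] by (intro sbI) simp_all
  moreover have "Ids [N] \<circ>\<^sub>s nm n \<circ>\<^sub>s str \<Delta> [] = nm n \<circ>\<^sub>s str \<Delta> []" if "valid \<Delta> []" for \<Delta>
    using str_arr[OF that] by simp
  moreover have "lc 0 (num n)" "fv (num n) = {}" by (induction n) auto
  ultimately have "ssb (\<lambda>_. num n) (\<lambda>_. []) (\<lambda>_. nm n) x"
    using cm_nm[of n z] isem_numI[of _ n] by (simp add: ssb_def der_def z del: str.simps)
  moreover have d1: "valid \<Gamma>1 \<Gamma>1" using isem_distinct[OF x(1)] by (intro valid_self) simp
  then have v: "valid \<Gamma> (\<Gamma>1 @ [])" using valid_trans2[OF _ n(1) fg(3)] by blast
  ultimately have "isem \<Gamma> (inst 0 (num n) K) \<sigma> (k \<circ>\<^sub>s (J \<Gamma>1 \<boxtimes> nm n) \<circ>\<^sub>s str \<Gamma> (\<Gamma>1 @ []))"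
    using isem_subst[OF x(1), of "num n" "[]" "nm n" \<Gamma>] by (simp add: x(4) inst_bind)
  \<comment> \<open>The closed numeral is substituted with no inputs, while in the redex it was
    interpreted over \<open>\<Gamma>2\<close>; discarding \<open>\<Gamma>2\<close> explicitly
    reconciles the two.\<close>
  also have "str \<Gamma> (\<Gamma>1 @ []) = (J \<Gamma>1 \<boxtimes> str \<Gamma>2 []) \<circ>\<^sub>s str \<Gamma> (\<Gamma>1 @ \<Gamma>2)"
    using str_str2[OF d1 n(1) fg(3)] isem_distinct[OF x(1)] by (simp add: str_self)
  also have "(J \<Gamma>1 \<boxtimes> nm n) \<circ>\<^sub>s (J \<Gamma>1 \<boxtimes> str \<Gamma>2 []) \<circ>\<^sub>s str \<Gamma> (\<Gamma>1 @ \<Gamma>2) = (J \<Gamma>1 \<boxtimes> g) \<circ>\<^sub>s str \<Gamma> (\<Gamma>1 @ \<Gamma>2)"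
    using fg(3) str_arr[OF n(1)] by (simp flip: cmp_assoc add: interchange n(2))
  also have "k \<circ>\<^sub>s (J \<Gamma>1 \<boxtimes> g) \<circ>\<^sub>s str \<Gamma> (\<Gamma>1 @ \<Gamma>2)
    = (evs N (tyI C \<sigma>) \<circ>\<^sub>s (h \<boxtimes> Ids [N])) \<circ>\<^sub>s (J \<Gamma>1 \<boxtimes> g) \<circ>\<^sub>s str \<Gamma> (\<Gamma>1 @ \<Gamma>2)"
    using k by (simp add: x(6) z evs_crs)
  also have "\<dots> = f"
    using isem_arr[OF fg(2)] k fg(3) tns_factor_left[of h g] by (simp add: f x(5,6) z cmp_assoc)
  finally show ?case .
next
  case (r_mu \<rho> K)
  then obtain F P h where P: "isem (\<Gamma> @ [Stb F \<rho>]) P \<rho> h" "nl \<Gamma>" "K = bind 0 (Stb F \<rho>) P" "\<sigma> = \<rho>"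
    and f: "f = mus \<Gamma> (tyI C \<rho>) h"
    by (auto elim!: isem_Mu)
  let ?A = "tyI C \<rho>"
  have M: "isem \<Gamma> (Mu \<rho> K) \<rho> f" using r_mu P(4) by simp
  have d: "distinct \<Gamma>" using isem_distinct[OF M] .
  note h = isem_arr[OF P(1)] and fa = isem_arr[OF M]
  have v: "valid \<Gamma> (\<Gamma> @ \<Gamma>)" using d P(2) by (auto simp: valid_def)
  \<comment> \<open>The promoted fixpoint takes all of \<open>\<Gamma>\<close> as input. This
    context has no linear variables, so body and substituted fixpoint can share it.\<close>
  have "sb (\<lambda>_. \<Gamma>) (\<lambda>_. prom \<Gamma> f ?A) (Stb F \<rho>)"
    using prom_comonoid[OF P(2) d, of f \<rho> F] fa P(2) d by (intro sbI) simp_all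
  moreover have "isem \<Delta> (Mu \<rho> K) \<rho> (epss ?A \<circ>\<^sub>s prom \<Gamma> f ?A \<circ>\<^sub>s str \<Delta> \<Gamma>)" if "valid \<Delta> \<Gamma>" for \<Delta>
  proof -
    have "epss ?A \<circ>\<^sub>s prom \<Gamma> f ?A \<circ>\<^sub>s str \<Delta> \<Gamma> = (epss ?A \<circ>\<^sub>s prom \<Gamma> f ?A) \<circ>\<^sub>s str \<Delta> \<Gamma>"
      using fa P(2) that by (simp add: cmp_assoc)
    also have "epss ?A \<circ>\<^sub>s prom \<Gamma> f ?A = f" using fa P(2) by (intro epss_prom) simp_all
    finally show ?thesis using isem_weaken[OF M that] by simp
  qed
  ultimately have "ssb (\<lambda>_. Mu \<rho> K) (\<lambda>_. \<Gamma>) (\<lambda>_. prom \<Gamma> f ?A) (Stb F \<rho>)"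
    using cm_prom[OF P(2), of f \<rho> F] fa isem_lc[OF M] isem_fv[OF M] by (simp add: ssb_def der_def)
  from isem_subst[OF P(1) this v]
  have "isem \<Gamma> (inst 0 (Mu \<rho> K) K) \<rho> (h \<circ>\<^sub>s (J \<Gamma> \<boxtimes> prom \<Gamma> f ?A) \<circ>\<^sub>s str \<Gamma> (\<Gamma> @ \<Gamma>))"
    by (simp add: P(3) inst_bind)
  also have "h \<circ>\<^sub>s (J \<Gamma> \<boxtimes> prom \<Gamma> f ?A) \<circ>\<^sub>s str \<Gamma> (\<Gamma> @ \<Gamma>) = f"
    unfolding f using mus_unfold[OF P(2) d, of h ?A] h by simp
  finally show ?case using P(4) by simp
next
  case (r_pred n)
  then obtain \<Gamma>1 \<Gamma>2 \<upsilon> h g where fg: "isem \<Gamma>1 Pred (\<upsilon> \<multimap> \<sigma>) h" "isem \<Gamma>2 (num (Suc n)) \<upsilon> g" "valid \<Gamma> (\<Gamma>1 @ \<Gamma>2)"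
    and f: "f = evs (tyI C \<upsilon>) (tyI C \<sigma>) \<circ>\<^sub>s (h \<boxtimes> g) \<circ>\<^sub>s str \<Gamma> (\<Gamma>1 @ \<Gamma>2)"
    by (auto elim: isem_App)
  have h: "\<upsilon> = Iota" "\<sigma> = Iota" "valid \<Gamma>1 []" "h = crs [] N N prds \<circ>\<^sub>s str \<Gamma>1 []"
    using fg(1) by (auto elim: isem_Pred)
  have g: "valid \<Gamma>2 []" "g = nm (Suc n) \<circ>\<^sub>s str \<Gamma>2 []" using isem_numD[OF fg(2)] by auto
  have "f = nm n \<circ>\<^sub>s str \<Gamma> []"
    unfolding f using evs_numeral[OF h(3) g(1) fg(3), of prds "Suc n" n] h g by (simp add: prds_nm)
  moreover have "valid \<Gamma> []" using valid_trans2[OF h(3) g(1) fg(3)] by simp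
  ultimately show ?case using isem_numI h(2) by simp
next
  case (r_if_zero L R)
  then show ?case using if_num[of 0 L R] by simp
next
  case (r_if_suc n L R)
  then show ?case using if_num[of "Suc n" L R] by simp
  }
qed

text \<open>The arrow is kept along with the typing, so this is subject reduction and soundness at
  once. Congruence is immediate because each rule builds its arrow from those of the subterms; below
  binders \<open>step_bind\<close> returns to the named body.\<close>

lemma isem_step: "isem \<Gamma> M \<sigma> f \<Longrightarrow> step M M' \<Longrightarrow> isem \<Gamma> M' \<sigma> f"
proof (induction arbitrary: M' rule: isem.induct)
  case (j_app \<Gamma>1 P \<sigma> \<tau> f \<Gamma>2 Q g \<Gamma>)
  from j_app.prems show ?case
  proof cases
    case s_redex
    then show ?thesis using isem_redex isem.j_app[OF j_app.hyps] by blast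
  qed (use j_app isem.j_app in auto)
next
  case (j_lif \<Gamma>1 P m \<Gamma>2 L l R r \<Gamma>)
  from j_lif.prems show ?case
  proof cases
    case s_redex
    then show ?thesis using isem_redex isem.j_lif[OF j_lif.hyps] by blast
  qed (use j_lif isem.j_lif in auto)
next
  case (j_lam \<Gamma> x P \<tau> f)
  from j_lam.prems show ?case
  proof cases
    case s_redex
    then show ?thesis using isem_redex isem.j_lam[OF j_lam.hyps] by blast
  next
    case (s_lam K)
    then show ?thesis using step_bind j_lam isem.j_lam by blast
  qed
next
  case (j_mu \<Gamma> F \<sigma> P f)
  from j_mu.prems show ?case
  proof cases
    case s_redex
    then show ?thesis using isem_redex isem.j_mu[OF j_mu.hyps] by simp
  next
    case (s_mu K)
    then obtain P' where "K = bind 0 (Stb F \<sigma>) P'" "step P P'" using step_bind by blast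
    then show ?thesis using s_mu j_mu isem.j_mu[of \<Gamma> F \<sigma> P' f] by simp
  qed
qed (auto elim: step.cases redex.cases)

lemma isem_steps: "step\<^sup>*\<^sup>* M M' \<Longrightarrow> isem \<Gamma> M \<sigma> f \<Longrightarrow> isem \<Gamma> M' \<sigma> f"
  by (induction rule: rtranclp_induct) (auto intro: isem_step)

subsection \<open>Comparison with the interpretation of derivations\<close>

lemma mor_J_under: "ar g \<Longrightarrow> mor (J \<Gamma> \<boxtimes> g) = under C (W \<Gamma>) (mor g)"
  by (simp add: mor_Ids_under)

lemma mk_cmp_under:
  assumes "arr f" "src f = T (W \<Gamma> @ cd g)" "trg f = A" "ar g"
  shows "mk (W \<Gamma> @ cd g) f A \<circ>\<^sub>s (J \<Gamma> \<boxtimes> g) = mk (W \<Gamma> @ dm g) (f \<cdot> under C (W \<Gamma>) (mor g)) A"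
  using assms mor_J_under[OF assms(4), of \<Gamma>] mk_cmp[of "J \<Gamma> \<boxtimes> g" "W \<Gamma> @ cd g" f A] by simp

lemma crs_mk:
  assumes "okl As" "A \<in> Obj C" "D \<in> Obj C" "arr f" "src f = T (As @ [A])" "trg f = D"
  shows "crs As A D (mk (As @ [A]) f D) = mk As (cur C (T As) A D (f \<cdot> snoc C As A)) (hom C A D)"
proof -
  have "run C D \<cdot> (runi C D \<cdot> f) \<cdot> snoc C As A = f \<cdot> snoc C As A"
    using assms by (simp add: assoc)
  then show ?thesis by (simp add: crs_def)
qed

lemma isem_weaken_last:
  assumes f: "isem \<Gamma> M \<tau> (mk (W \<Gamma>) f (tyI C \<tau>))" "arr f" "src f = T (W \<Gamma>)" "trg f = tyI C \<tau>"
    and x: "x \<notin> set \<Gamma>" "\<not> is_Ho x"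
  shows "isem (\<Gamma> @ [x]) M \<tau> (mk (W \<Gamma> @ [V x]) (f \<cdot> under C (W \<Gamma>) (mor (erv x))) (tyI C \<tau>))"
proof -
  have d: "distinct (\<Gamma> @ [x])" using isem_distinct[OF f(1)] x by simp
  have "isem (\<Gamma> @ [x]) M \<tau> (mk (W \<Gamma> @ cd (erv x)) f (tyI C \<tau>) \<circ>\<^sub>s (J \<Gamma> \<boxtimes> erv x))"
    using isem_weaken[OF f(1) valid_weaken[OF d x(2)]] str_weaken[OF d x(2)] x by simp
  also have "mk (W \<Gamma> @ cd (erv x)) f (tyI C \<tau>) \<circ>\<^sub>s (J \<Gamma> \<boxtimes> erv x)
    = mk (W \<Gamma> @ dm (erv x)) (f \<cdot> under C (W \<Gamma>) (mor (erv x))) (tyI C \<tau>)"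
    using f x by (intro mk_cmp_under) simp_all
  finally show ?thesis using x by simp
qed

text \<open>Merging two variables is a renaming that is not injective, and its structural arrow
  copies the last wire.\<close>

lemma isem_contract_last:
  assumes f: "isem (\<Gamma> @ [x1, x2]) M \<tau> (mk (W \<Gamma> @ [V x, V x]) f (tyI C \<tau>))"
      "arr f" "src f = T (W \<Gamma> @ [V x, V x])" "trg f = tyI C \<tau>"
    and x: "x \<notin> set \<Gamma>" "\<not> is_Ho x" "vk x = vk x1" "vk x = vk x2"
  shows "isem (\<Gamma> @ [x]) (merge x1 x2 x M) \<tau> (mk (W \<Gamma> @ [V x]) (f \<cdot> under C (W \<Gamma>) (mor (dpv x))) (tyI C \<tau>))"
proof -
  let ?r = "id(x1 := x, x2 := x)"
  have d0: "distinct (\<Gamma> @ [x1, x2])" using isem_distinct[OF f(1)] .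
  then have d: "distinct (\<Gamma> @ [x])" using x by simp
  have m: "map ?r (\<Gamma> @ [x1, x2]) = \<Gamma> @ [x, x]" using d0 by simp
  have "isem (\<Gamma> @ [x]) (ren ?r M) \<tau>
    (mk (W \<Gamma> @ [V x, V x]) f (tyI C \<tau>) \<circ>\<^sub>s str (\<Gamma> @ [x]) (map ?r (\<Gamma> @ [x1, x2])))"
    by (rule isem_ren[OF f(1)]) (use x in simp, unfold m, rule valid_contract[OF d x(2)])
  also have "mk (W \<Gamma> @ [V x, V x]) f (tyI C \<tau>) \<circ>\<^sub>s str (\<Gamma> @ [x]) (map ?r (\<Gamma> @ [x1, x2]))
    = mk (W \<Gamma> @ cd (dpv x)) f (tyI C \<tau>) \<circ>\<^sub>s (J \<Gamma> \<boxtimes> dpv x)"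
    unfolding m using str_contract[OF d x(2)] x by simp
  also have "\<dots> = mk (W \<Gamma> @ dm (dpv x)) (f \<cdot> under C (W \<Gamma>) (mor (dpv x))) (tyI C \<tau>)"
    using f x by (intro mk_cmp_under) simp_all
  finally show ?thesis unfolding dm_dp[OF x(2)] .
qed

text \<open>Logical rules have disjoint contexts, for which the structural arrow of
  \<open>isem\<close> is an identity. Structural rules become instances of renaming, whose
  structural arrows are those of the model under the preceding wires.\<close>

lemma sem_isem: "sem C \<Gamma> M \<sigma> f \<Longrightarrow> isem \<Gamma> M \<sigma> (mk (W \<Gamma>) f (tyI C \<sigma>))"
proof (induction rule: sem.induct)
  have d: "distinct \<Gamma>" if "sem C \<Gamma> M \<sigma> f" for \<Gamma> M \<sigma> f
    using typing_distinct[OF sem_typing[OF that]] .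
  have a: "arr f" "src f = T (W \<Gamma>)" "trg f = tyI C \<sigma>" if "sem C \<Gamma> M \<sigma> f" for \<Gamma> M \<sigma> f
    using sem_hom[OF that] by (auto simp: Hom_iff basisI_def)
  {
    case i_zero
    have "valid ([] :: var list) []" by (simp add: valid_def)
    from j_zero[OF this] show ?case by (simp add: nm_def)
  next
    case i_succ
    have "valid ([] :: var list) []" by (simp add: valid_def)
    from j_succ[OF this] show ?case
      by (simp add: sucs_def crs_mk[of "[]", simplified] assoc)
  next
    case i_pred
    have "valid ([] :: var list) []" by (simp add: valid_def)
    from j_pred[OF this] show ?case
      by (simp add: prds_def crs_mk[of "[]", simplified] assoc)
  next
    case (i_lif \<Gamma> M m \<Delta> L l R r)
    note m = a[OF i_lif.hyps(1)] and l = a[OF i_lif.hyps(2)] and r = a[OF i_lif.hyps(3)]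
    have dd: "distinct (\<Gamma> @ \<Delta>)" using d[OF i_lif.hyps(1)] d[OF i_lif.hyps(2)] i_lif.hyps by simp
    have "isem (\<Gamma> @ \<Delta>) (LIf M L R) Iota
      (cond (mk (W \<Gamma>) m N) (mk (W \<Delta>) l N) (mk (W \<Delta>) r N) \<circ>\<^sub>s str (\<Gamma> @ \<Delta>) (\<Gamma> @ \<Delta>))"
      using i_lif.IH dd by (intro j_lif valid_self) simp_all
    then show ?case
      using m l r str_self[OF dd] by (simp add: cond_def)
  next
    case (i_exch \<Gamma> x y \<Delta> M \<tau> f)
    let ?g = "sgs [V y] [V x] \<boxtimes> J \<Delta>"
    have dd: "distinct (\<Gamma> @ y # x # \<Delta>)" using d[OF i_exch.hyps] by auto
    have "valid (\<Gamma> @ y # x # \<Delta>) (\<Gamma> @ x # y # \<Delta>)"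
      by (rule valid_perm[OF _ valid_self[OF dd]]) simp
    from isem_weaken[OF i_exch.IH this] str_exchange[OF dd]
    have "isem (\<Gamma> @ y # x # \<Delta>) M \<tau> (mk (W \<Gamma> @ cd ?g) f (tyI C \<tau>) \<circ>\<^sub>s (J \<Gamma> \<boxtimes> ?g))" by simp
    also have "mk (W \<Gamma> @ cd ?g) f (tyI C \<tau>) \<circ>\<^sub>s (J \<Gamma> \<boxtimes> ?g) = mk (W \<Gamma> @ dm ?g) (f \<cdot> under C (W \<Gamma>) (mor ?g)) (tyI C \<tau>)"
      using a[OF i_exch.hyps] by (intro mk_cmp_under) simp_all
    finally show ?case by (simp add: sgs_single_Ids basisI_def)
  next
    case (i_gvar x)
    have v: "valid [Gnd x] [Gnd x]" by (simp add: valid_def)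
    from j_var[OF v] show ?case using str_self[of "[Gnd x]"] by (simp add: der_def del: str.simps flip: Ids_single)
  next
    case (i_gweak \<Gamma> M \<tau> f x)
    from isem_weaken_last[OF i_gweak.IH a[OF i_gweak.hyps(1)] i_gweak.hyps(2)] show ?case by simp
  next
    case (i_gcontr \<Gamma> x1 x2 M \<tau> f x)
    have "isem (\<Gamma> @ [Gnd x1, Gnd x2]) M \<tau> (mk (W \<Gamma> @ [V (Gnd x), V (Gnd x)]) f (tyI C \<tau>))"
      "src f = T (W \<Gamma> @ [V (Gnd x), V (Gnd x)])"
      using i_gcontr.IH a[OF i_gcontr.hyps(1)] by simp_all
    from isem_contract_last[OF this(1) a(1)[OF i_gcontr.hyps(1)] this(2) a(3)[OF i_gcontr.hyps(1)] i_gcontr.hyps(2)]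
    show ?case by (simp only: dpv.simps dpo_proj map_append list.map varI.simps vk.simps var.disc simp_thms)
  next
    case (i_hvar f \<sigma> \<tau>)
    have v: "valid [Ho f \<sigma> \<tau>] [Ho f \<sigma> \<tau>]" by (simp add: valid_def)
    from j_var[OF v] show ?case using str_self[of "[Ho f \<sigma> \<tau>]"] by (simp add: der_def del: str.simps flip: Ids_single)
  next
    case (i_app \<Gamma> M \<sigma> \<tau> f \<Delta> Q g)
    note f = a[OF i_app.hyps(1)] and g = a[OF i_app.hyps(2)]
    have dd: "distinct (\<Gamma> @ \<Delta>)" using d[OF i_app.hyps(1)] d[OF i_app.hyps(2)] i_app.hyps by simp
    have "isem (\<Gamma> @ \<Delta>) (App M Q) \<tau> (evs (tyI C \<sigma>) (tyI C \<tau>)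
      \<circ>\<^sub>s (mk (W \<Gamma>) f (hom C (tyI C \<sigma>) (tyI C \<tau>)) \<boxtimes> mk (W \<Delta>) g (tyI C \<sigma>)) \<circ>\<^sub>s str (\<Gamma> @ \<Delta>) (\<Gamma> @ \<Delta>))"
      using i_app.IH dd by (intro j_app valid_self) simp_all
    then show ?case
      using f g str_self[OF dd] evs_mk[of "W \<Gamma>" "W \<Delta>" f g "tyI C \<sigma>" "tyI C \<tau>"] by simp
  next
    case (i_lam \<Gamma> x M \<tau> f)
    from j_lam[OF i_lam.IH i_lam.hyps(2)] show ?case
      using a[OF i_lam.hyps(1)] i_lam.hyps(2) crs_mk[of "W \<Gamma>" "V x" "tyI C \<tau>" f]
      by (simp add: basisI_def varI_vty)
  next
    case (i_svar F \<sigma>)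
    have v: "valid [Stb F \<sigma>] [Stb F \<sigma>]" by (simp add: valid_def)
    from j_var[OF v] show ?case using str_self[of "[Stb F \<sigma>]"] by (simp add: der_def epss_def del: str.simps)
  next
    case (i_sweak \<Gamma> M \<tau> f F \<sigma>)
    from isem_weaken_last[OF i_sweak.IH a[OF i_sweak.hyps(1)] i_sweak.hyps(2)] show ?case by simp
  next
    case (i_scontr \<Gamma> F1 \<sigma> F2 M \<tau> f F)
    have "isem (\<Gamma> @ [Stb F1 \<sigma>, Stb F2 \<sigma>]) M \<tau> (mk (W \<Gamma> @ [V (Stb F \<sigma>), V (Stb F \<sigma>)]) f (tyI C \<tau>))"
      "src f = T (W \<Gamma> @ [V (Stb F \<sigma>), V (Stb F \<sigma>)])"
      using i_scontr.IH a[OF i_scontr.hyps(1)] by simp_all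
    from isem_contract_last[OF this(1) a(1)[OF i_scontr.hyps(1)] this(2) a(3)[OF i_scontr.hyps(1)] i_scontr.hyps(2)]
    show ?case by (simp only: dpv.simps dpo_proj map_append list.map varI.simps vk.simps var.disc simp_thms)
  next
    case (i_mu \<Gamma> \<Delta> F \<sigma> M f)
    let ?A = "tyI C \<sigma>" and ?G = "\<Gamma> @ \<Delta>"
    let ?X = "hom C (bang C ?A) ?A"
    let ?c = "cur C (T (W ?G)) (bang C ?A) ?A (f \<cdot> snoc C (W ?G) (bang C ?A))"
    note f = a[OF i_mu.hyps(1)]
    have nl: "nl ?G" using i_mu.hyps by (auto simp: list_all_iff is_Gnd_def is_Stb_def)
    have "isem (?G @ [Stb F \<sigma>]) M \<sigma> (mk (W ?G @ [bang C ?A]) f ?A)" using i_mu.IH by simp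
    from j_mu[OF this nl] have "isem ?G (mu (Stb F \<sigma>) M) \<sigma> (mus ?G ?A (mk (W ?G @ [bang C ?A]) f ?A))" .
    also have "crs (W ?G) (bang C ?A) ?A (mk (W ?G @ [bang C ?A]) f ?A) = mk (W ?G) ?c ?X"
      using f by (intro crs_mk) simp_all
    then have "mus ?G ?A (mk (W ?G @ [bang C ?A]) f ?A) = fixs ?A \<circ>\<^sub>s prom ?G (mk (W ?G) ?c ?X) ?X"
      by (simp add: mus_def)
    also have "\<dots> = mk (W ?G) (fixp C ?A \<cdot> B ?c \<cdot> kap ?G) ?A"
      using f nl by (intro arrow_eqI) (simp_all add: fixs_def prom_def assoc)
    \<comment> \<open>Unfolding \<open>kap\<close> restores the iterated \<open>q\<close> and the
      tensor of coalgebra structures in the rule for fixpoints.\<close>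
    finally show ?case by (simp add: kap_def basisI_def)
  }
qed

theorem sem_conv:
  assumes "M =\<^sub>S\<^sub>l M'" "sem C \<Gamma> M \<sigma> f" "sem C \<Gamma> M' \<sigma> f'"
  shows "f = f'"
proof -
  obtain P where P: "step\<^sup>*\<^sup>* M P" "step\<^sup>*\<^sup>* M' P" using conv_joinable[OF assms(1)] by blast
  have "mk (W \<Gamma>) f (tyI C \<sigma>) = mk (W \<Gamma>) f' (tyI C \<sigma>)"
    using isem_steps[OF P(1) sem_isem[OF assms(2)]] isem_steps[OF P(2) sem_isem[OF assms(3)]] isem_unique by blast
  \<comment> \<open>\<open>mk\<close> only adds a trailing unit, which is cancelled by the inverse
    of \<open>runi\<close>.\<close>
  then have "runi C (tyI C \<sigma>) \<cdot> f = runi C (tyI C \<sigma>) \<cdot> f'" by (simp add: mk_def)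
  then show ?thesis
    by (rule iso_cancel_left[of "run C (tyI C \<sigma>)" "runi C (tyI C \<sigma>)" "tyI C \<sigma>", rotated -1])
      (use sem_hom[OF assms(2)] sem_hom[OF assms(3)] in \<open>simp_all add: Hom_iff\<close>)
qed

end

theorem theorem2:
  fixes C :: "('o, 'm) slcat"
  assumes "Sl_category C"
    and "\<Gamma> \<turnstile> M : \<sigma>" and "\<Gamma> \<turnstile> M' : \<sigma>"
    and "M =\<^sub>S\<^sub>l M'"
    and "sem C \<Gamma> M \<sigma> f" and "sem C \<Gamma> M' \<sigma> f'"
  shows "f = f'"
  by (rule Sl_category.sem_conv[OF assms(1,4,5,6)])

end
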